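(* Let $X,Y$ be rearrangement-invariant Banach function spaces on $\mathbb{T}$ such that $X\subset Y$, $Y$ has nontrivial Boyd indices and $Y$ has the Fatou property. Let $a\in X'$. Then the Toeplitz operator $T_a:f\mapsto P(af)$ is bounded from $H[X]$ to $H[Y]$ if and only if $a\in M(X,Y)$, and then $$\|a\|_{M(X,Y)}\le \|T_a\|_{H[X]\to H[Y]}\le \|P\|_{Y\to Y}\,\|a\|_{M(X,Y)}.$$
   Context: $\mathbb{T}$ is the unit circle with normalized Lebesgue measure $m$; $L^0$ is the space of a.e. finite measurable complex functions on $\mathbb{T}$ (modulo a.e. equality). A Banach function space (B.f.s.) is a complex Banach space $X\subset L^0$ such that (a) $f\in X$, $g\in L^0$, $|g|\le|f|$ a.e. imply $g\in X$, $\|g\|_X\le\|f\|_X$; (b) $L^\infty\subset X$; (c) $f_n,f\in X$, $0\le f_n\uparrow f$ a.e. imply $\|f\|_X=\sup_n\|f_n\|_X$. $X$ is rearrangement-invariant (r.i.) if whenever $f\in X$ and $g\in L^0$ are equimeasurable (i.e. $m\{|f|>\lambda\}=m\{|g|>\lambda\}$ for all $\lambda\ge0$), then $g\in X$ and $\|f\|_X=\|g\|_X$; every r.i. B.f.s. satisfies $X\subset L^1$. $X$ has the Fatou property if $f_n\in X$, $f\in L^0$, $0\le f_n\uparrow f$ a.e. and $\sup_n\|f_n\|_X<\infty$ imply $f\in X$ and $\|f\|_X=\sup_n\|f_n\|_X$. The Köthe dual $X'$ is the space of $g\in L^0$ with $\|g\|_{X'}=\sup\{\int_{\mathbb{T}}|fg|\,dm:\|f\|_X\le1\}<\infty$.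 Boyd indices: for $s>0$ let $(D_sf)(e^{i\theta})=f(e^{i\theta s})$ if $\theta s\in[0,2\pi)$ and $0$ otherwise ($\theta\in[0,2\pi)$); $\alpha_X=\lim_{s\to0}\frac{\log\|D_{1/s}\|_{X\to X}}{\log s}$, $\beta_X=\lim_{s\to\infty}\frac{\log\|D_{1/s}\|_{X\to X}}{\log s}$. They are nontrivial if $\alpha_X,\beta_X\in(0,1)$. $M(X,Y)=\{f\in L^0: fg\in Y\text{ for all }g\in X\}$ with $\|f\|_{M(X,Y)}=\sup_{\|g\|_X\le1}\|fg\|_Y$. $\langle f,g\rangle=\int_{\mathbb{T}}f\overline{g}\,dm$, $\chi_n(t)=t^n$ for $n\in\mathbb{Z}$, $\widehat f(n)=\langle f,\chi_n\rangle$. $H[X]=\{f\in X:\widehat f(n)=0\text{ for all }n<0\}$ with the norm of $X$. $P$ is the Riesz projection, $Pf=\frac12(f+i\tilde f+\widehat f(0))$ for $f\in L^1$, where $\tilde f$ is the conjugate function of $f$ (for $f\in L^p$, $p>1$, $P$ maps $\sum_{n\in\mathbb{Z}}\widehat f(n)t^n$ to $\sum_{n\ge0}\widehat f(n)t^n$); $P$ is bounded on an r.i. space iff its Boyd indices are nontrivial. If $a\in X'$ then $af\in L^1$ for each $f\in H[X]$, so $T_af=P(af)$ is well defined. *)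

theory Defs
  imports "HOL-Analysis.Analysis"
begin

text \<open>
  Elements of \<open>L\<^sup>0\<close> are represented by Borel functions on the circle; every class of
  Lebesgue measurable functions modulo a.e. equality has such a representative. A space
  \<open>X \<subset> L\<^sup>0\<close> is the set of all representatives of its elements together with a real-valued norm,
  whose values outside the set are never used. Closure of the set and invariance of the norm under
  a.e. equality follow from the ideal property.
\<close>

definition circle_measure :: "complex measure" where
  "circle_measure =
     distr (uniform_measure lborel {0..<2*pi}) (restrict_space borel (sphere 0 1)) cis"

lemma space_circle_measure [simp]: "space circle_measure = sphere 0 1"
  by (simp add: circle_measure_def space_restrict_space)

lemma emeasure_circle_measure: "emeasure circle_measure (sphere 0 1) = 1"
proof -
  have "cis \<in> borel_measurable borel"
    by (intro borel_measurable_continuous_onI continuous_intros)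
  then have "cis \<in> uniform_measure lborel {0..<2*pi} \<rightarrow>\<^sub>M restrict_space borel (sphere 0 1)"
    by (intro measurable_restrict_space2) auto
  then show ?thesis
    unfolding circle_measure_def
    by (subst emeasure_distr)
       (auto simp: space_restrict_space sets_restrict_space_iff vimage_def divide_eq_1_ennreal)
qed

abbreviation L0 :: "(complex \<Rightarrow> complex) set" where
  "L0 \<equiv> borel_measurable circle_measure"


section \<open>Banach function spaces\<close>

text \<open>A real function \<open>f\<close> is the increasing limit a.e. of the nonnegative functions \<open>F n\<close>.\<close>
definition nonneg_increasing_to :: "(nat \<Rightarrow> complex \<Rightarrow> real) \<Rightarrow> (complex \<Rightarrow> real) \<Rightarrow> bool" where
  "nonneg_increasing_to F f \<longleftrightarrow>
     (AE z in circle_measure.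
        (\<forall>n. 0 \<le> F n z) \<and> incseq (\<lambda>n. F n z) \<and> (\<lambda>n. F n z) \<longlonglongrightarrow> f z)"

locale banach_function_space =
  fixes X :: "(complex \<Rightarrow> complex) set" and N :: "(complex \<Rightarrow> complex) \<Rightarrow> real"
  assumes subset_L0: "X \<subseteq> L0"
    and add_closed: "\<lbrakk>f \<in> X; g \<in> X\<rbrakk> \<Longrightarrow> (\<lambda>z. f z + g z) \<in> X"
    and scale_closed: "f \<in> X \<Longrightarrow> (\<lambda>z. c * f z) \<in> X"
    and norm_nonneg: "f \<in> X \<Longrightarrow> 0 \<le> N f"
    and norm_eq_0_iff: "f \<in> X \<Longrightarrow> N f = 0 \<longleftrightarrow> (AE z in circle_measure. f z = 0)"
    and norm_triangle: "\<lbrakk>f \<in> X; g \<in> X\<rbrakk> \<Longrightarrow> N (\<lambda>z. f z + g z) \<le> N f + N g"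
    and norm_scale: "f \<in> X \<Longrightarrow> N (\<lambda>z. c * f z) = cmod c * N f"
    and complete: "\<lbrakk>\<And>n. F n \<in> X;
        \<And>e. e > 0 \<Longrightarrow> \<exists>M. \<forall>i\<ge>M. \<forall>j\<ge>M. N (\<lambda>z. F i z - F j z) < e\<rbrakk>
      \<Longrightarrow> \<exists>f\<in>X. (\<lambda>n. N (\<lambda>z. F n z - f z)) \<longlonglongrightarrow> 0"
    and ideal: "\<lbrakk>f \<in> X; g \<in> L0; AE z in circle_measure. cmod (g z) \<le> cmod (f z)\<rbrakk>
      \<Longrightarrow> g \<in> X \<and> N g \<le> N f"
    and Linfty_subset: "\<lbrakk>f \<in> L0; AE z in circle_measure. cmod (f z) \<le> C\<rbrakk> \<Longrightarrow> f \<in> X"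
    and order_continuity: "\<lbrakk>\<And>n. (\<lambda>z. complex_of_real (F n z)) \<in> X;
        (\<lambda>z. complex_of_real (h z)) \<in> X; nonneg_increasing_to F h\<rbrakk>
      \<Longrightarrow> N (\<lambda>z. complex_of_real (h z)) = (SUP n. N (\<lambda>z. complex_of_real (F n z)))"

definition equimeasurable :: "(complex \<Rightarrow> complex) \<Rightarrow> (complex \<Rightarrow> complex) \<Rightarrow> bool" where
  "equimeasurable f g \<longleftrightarrow>
     (\<forall>l\<ge>0. measure circle_measure {z \<in> space circle_measure. cmod (f z) > l}
          = measure circle_measure {z \<in> space circle_measure. cmod (g z) > l})"

locale ri_space = banach_function_space +
  assumes rearrangement_invariant:
    "\<lbrakk>f \<in> X; g \<in> L0; equimeasurable f g\<rbrakk> \<Longrightarrow> g \<in> X \<and> N f = N g"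

definition fatou_property ::
  "(complex \<Rightarrow> complex) set \<Rightarrow> ((complex \<Rightarrow> complex) \<Rightarrow> real) \<Rightarrow> bool" where
  "fatou_property X N \<longleftrightarrow>
     (\<forall>F h. (\<forall>n. (\<lambda>z. complex_of_real (F n z)) \<in> X) \<longrightarrow>
        (\<lambda>z. complex_of_real (h z)) \<in> L0 \<longrightarrow> nonneg_increasing_to F h \<longrightarrow>
        bdd_above (range (\<lambda>n. N (\<lambda>z. complex_of_real (F n z)))) \<longrightarrow>
        (\<lambda>z. complex_of_real (h z)) \<in> X \<and>
        N (\<lambda>z. complex_of_real (h z)) = (SUP n. N (\<lambda>z. complex_of_real (F n z))))"

definition kothe_dual ::
  "(complex \<Rightarrow> complex) set \<Rightarrow> ((complex \<Rightarrow> complex) \<Rightarrow> real) \<Rightarrow> (complex \<Rightarrow> complex) set" where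
  "kothe_dual X N =
     {g \<in> L0. (SUP f\<in>{f \<in> X. N f \<le> 1}.
                 \<integral>\<^sup>+ z. ennreal (cmod (f z * g z)) \<partial>circle_measure) < \<infinity>}"

definition multipliers ::
  "(complex \<Rightarrow> complex) set \<Rightarrow> (complex \<Rightarrow> complex) set \<Rightarrow> (complex \<Rightarrow> complex) set" where
  "multipliers X Y = {f \<in> L0. \<forall>g\<in>X. (\<lambda>z. f z * g z) \<in> Y}"

text \<open>Only meaningful for elements of \<open>multipliers X Y\<close>.\<close>
definition multiplier_norm ::
  "(complex \<Rightarrow> complex) set \<Rightarrow> ((complex \<Rightarrow> complex) \<Rightarrow> real) \<Rightarrow>
   ((complex \<Rightarrow> complex) \<Rightarrow> real) \<Rightarrow> (complex \<Rightarrow> complex) \<Rightarrow> ennreal" where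
  "multiplier_norm X NX NY f = (SUP g\<in>{g \<in> X. NX g \<le> 1}. ennreal (NY (\<lambda>z. f z * g z)))"


section \<open>Operators and Boyd indices\<close>

definition bounded_operator ::
  "(complex \<Rightarrow> complex) set \<Rightarrow> ((complex \<Rightarrow> complex) \<Rightarrow> real) \<Rightarrow>
   (complex \<Rightarrow> complex) set \<Rightarrow> ((complex \<Rightarrow> complex) \<Rightarrow> real) \<Rightarrow>
   ((complex \<Rightarrow> complex) \<Rightarrow> complex \<Rightarrow> complex) \<Rightarrow> bool" where
  "bounded_operator X NX Y NY T \<longleftrightarrow>
     (\<forall>f\<in>X. T f \<in> Y) \<and> (\<exists>C. \<forall>f\<in>X. NY (T f) \<le> C * NX f)"

definition op_norm ::
  "(complex \<Rightarrow> complex) set \<Rightarrow> ((complex \<Rightarrow> complex) \<Rightarrow> real) \<Rightarrow>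
   (complex \<Rightarrow> complex) set \<Rightarrow> ((complex \<Rightarrow> complex) \<Rightarrow> real) \<Rightarrow>
   ((complex \<Rightarrow> complex) \<Rightarrow> complex \<Rightarrow> complex) \<Rightarrow> ennreal" where
  "op_norm X NX Y NY T =
     (SUP f\<in>{f \<in> X. NX f \<le> 1}. if T f \<in> Y then ennreal (NY (T f)) else \<infinity>)"

definition dilation :: "real \<Rightarrow> (complex \<Rightarrow> complex) \<Rightarrow> complex \<Rightarrow> complex" where
  "dilation s f z = (if Arg2pi z * s \<in> {0..<2*pi} then f (cis (Arg2pi z * s)) else 0)"

text \<open>
  The dilations are bounded on every r.i. space, so that \<open>enn2real\<close> does not lose anything below.
\<close>
definition boyd_quotient ::
  "(complex \<Rightarrow> complex) set \<Rightarrow> ((complex \<Rightarrow> complex) \<Rightarrow> real) \<Rightarrow> real \<Rightarrow> real" where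
  "boyd_quotient X N s = ln (enn2real (op_norm X N X N (dilation (1 / s)))) / ln s"

definition has_lower_boyd_index ::
  "(complex \<Rightarrow> complex) set \<Rightarrow> ((complex \<Rightarrow> complex) \<Rightarrow> real) \<Rightarrow> real \<Rightarrow> bool" where
  "has_lower_boyd_index X N \<alpha> \<longleftrightarrow> (boyd_quotient X N \<longlongrightarrow> \<alpha>) (at_right 0)"

definition has_upper_boyd_index ::
  "(complex \<Rightarrow> complex) set \<Rightarrow> ((complex \<Rightarrow> complex) \<Rightarrow> real) \<Rightarrow> real \<Rightarrow> bool" where
  "has_upper_boyd_index X N \<beta> \<longleftrightarrow> (boyd_quotient X N \<longlongrightarrow> \<beta>) at_top"

definition nontrivial_boyd_indices ::
  "(complex \<Rightarrow> complex) set \<Rightarrow> ((complex \<Rightarrow> complex) \<Rightarrow> real) \<Rightarrow> bool" where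
  "nontrivial_boyd_indices X N \<longleftrightarrow>
     (\<exists>\<alpha>\<in>{0<..<1}. \<exists>\<beta>\<in>{0<..<1}. has_lower_boyd_index X N \<alpha> \<and> has_upper_boyd_index X N \<beta>)"


section \<open>Hardy spaces, Riesz projection and Toeplitz operators\<close>

definition pairing :: "(complex \<Rightarrow> complex) \<Rightarrow> (complex \<Rightarrow> complex) \<Rightarrow> complex" where
  "pairing f g = (\<integral>z. f z * cnj (g z) \<partial>circle_measure)"

definition fourier_coeff :: "(complex \<Rightarrow> complex) \<Rightarrow> int \<Rightarrow> complex" where
  "fourier_coeff f n = pairing f (\<lambda>t. t powi n)"

text \<open>
  The Hardy space \<open>H[X]\<close> is this set with the norm of \<open>X\<close>; the integrals defining the Fourier
  coefficients converge since every r.i. space is contained in \<open>L\<^sup>1\<close>.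
\<close>
definition hardy :: "(complex \<Rightarrow> complex) set \<Rightarrow> (complex \<Rightarrow> complex) set" where
  "hardy X = {f \<in> X. \<forall>n<0. fourier_coeff f n = 0}"

text \<open>
  The conjugate function is the radial limit of the conjugate Poisson integral. For
  \<open>w = e\<^sup>i\<^sup>t\<close> and \<open>z = e\<^sup>i\<^sup>\<theta>\<close> the kernel below is
  \<open>2 r sin (\<theta> - t) / (1 - 2 r cos (\<theta> - t) + r\<^sup>2)\<close>. For integrable \<open>f\<close> the limit exists at almost
  every point of the circle; elsewhere \<^const>\<open>Lim\<close> has a fixed unspecified value.
\<close>
definition conjugate_function :: "(complex \<Rightarrow> complex) \<Rightarrow> complex \<Rightarrow> complex" where
  "conjugate_function f z =
     Lim (at_left (1::real)) (\<lambda>r. \<integral>w. f w *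
       complex_of_real (Im ((w + complex_of_real r * z) / (w - complex_of_real r * z)))
       \<partial>circle_measure)"

definition riesz_projection :: "(complex \<Rightarrow> complex) \<Rightarrow> complex \<Rightarrow> complex" where
  "riesz_projection f z = (f z + \<i> * conjugate_function f z + fourier_coeff f 0) / 2"

definition toeplitz :: "(complex \<Rightarrow> complex) \<Rightarrow> (complex \<Rightarrow> complex) \<Rightarrow> complex \<Rightarrow> complex" where
  "toeplitz a f = riesz_projection (\<lambda>z. a z * f z)"

end

theory Submission
  imports Defs "HOL-Complex_Analysis.Complex_Analysis"
begin

text \<open>
  Everything about \<open>P\<close> is read off the Herglotz transform \<open>F(\<zeta>) = \<integral> f(w) (w + \<zeta>)/(w - \<zeta>) dm(w)\<close>, whose
  radial boundary values are \<open>f + i f\<^sup>~\<close>. For \<open>f \<ge> 0\<close> it maps the disc to the right half plane, so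
  the mean value property of \<open>2F/(F + l)\<close>, of \<open>cos F\<close> and of \<open>F\<^sup>1\<^sup>/\<^sup>2\<close> gives respectively the weak type
  (1,1) inequality, an exponential estimate for bounded \<open>f\<close>, and, together with the Hardy-Littlewood
  maximal inequality, the existence of the radial limits.

  Cutting \<open>f\<close> at the levels \<open>f\<^sup>*(2\<^sup>j t)\<close> turns the first two estimates into a bound of the rearrangement
  of \<open>f + i f\<^sup>~\<close> by a series of dyadic dilations of \<open>f\<^sup>*\<close>, which converges in \<open>Y\<close> because the Boyd
  indices are nontrivial. Hence \<open>P\<close> is bounded on \<open>Y\<close>, and the upper estimate for \<open>T\<^sub>a\<close> follows.

  For the lower estimate let \<open>h\<close> be an outer function with \<open>|h| = |f|\<close>, where \<open>f\<close> is bounded and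
  bounded away from \<open>0\<close>. Then \<open>\<chi>\<^sub>n h\<close> lies in \<open>H[X]\<close> with the norm of \<open>f\<close>, and \<open>\<chi>\<^sub>-\<^sub>n T\<^sub>a(\<chi>\<^sub>n h)\<close> tends to
  \<open>a h\<close> in measure. The Fatou property of \<open>Y\<close> bounds the norm of \<open>a h\<close>, that is of \<open>a f\<close>, and
  then extends the bound from such \<open>f\<close> to all of \<open>X\<close>.
\<close>

section \<open>Integration on the circle\<close>

text \<open>\<open>conjugate_function\<close> is a pointwise limit that exists only almost
  everywhere, so it is not estimated directly. All estimates are made on circles of radius below
  \<open>1\<close>, where the transforms are holomorphic and the mean value property is exact.
  Bounds of distribution functions survive the passage to the boundary, being lower semicontinuous
  under a.e. convergence; hence the work with distribution functions and rearrangements instead of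
  an interpolation between L^p spaces.

  The levels \<open>f\<^sup>*(2\<^sup>j t)\<close> balance two rates: the layer below the level
  number \<open>j\<close> has support of measure at most \<open>2^(j+1) t\<close>, and testing it at
  a height proportional to \<open>j + 1\<close> gains a factor \<open>4^(j+1)\<close>. The linear
  cost of the heights disappears by Abel summation.

  The lower estimate must have the factor \<open>1\<close>, while the bounds for \<open>P\<close>
  are crude. Its weak type constant therefore serves only to prove convergence of the shifted
  functions; the norm bound itself comes from \<open>T\<^sub>a\<close>, and multiplication by
  unimodular functions and the Fatou property lose nothing. Crude constants show that the operator
  norms are finite, after which homogeneity yields the inequalities with the exact norms.\<close>

lemma sets_circle_measure [measurable_cong]:
  "sets circle_measure = sets (restrict_space borel (sphere 0 1))"
  by (simp add: circle_measure_def)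

lemma emeasure_circle_UNIV: "emeasure circle_measure (space circle_measure) = 1"
  by (simp add: emeasure_circle_measure)

interpretation circle: finite_measure circle_measure
  by (rule finite_measureI) (simp add: emeasure_circle_measure)

lemma measure_circle_space [simp]: "measure circle_measure (sphere 0 1) = 1"
  by (simp add: measure_def emeasure_circle_measure)

lemma measure_circle_le_1: "measure circle_measure A \<le> 1"
  using circle.bounded_measure[of A] by simp

lemma measurable_cis [measurable]: "cis \<in> borel \<rightarrow>\<^sub>M circle_measure"
proof -
  have "cis \<in> borel_measurable borel"
    by (intro borel_measurable_continuous_onI continuous_intros)
  then have "cis \<in> borel \<rightarrow>\<^sub>M restrict_space borel (sphere 0 1)"
    by (intro measurable_restrict_space2) auto
  then show ?thesis
    using measurable_cong_sets[OF refl sets_circle_measure] by auto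
qed

lemma continuous_imp_measurable_circle:
  fixes f :: "complex \<Rightarrow> 'b::topological_space"
  assumes "continuous_on (sphere 0 1) f"
  shows "f \<in> borel_measurable circle_measure"
  using borel_measurable_continuous_on_restrict[OF assms]
    measurable_cong_sets[OF sets_circle_measure refl] by auto

lemma measurable_ident_circle [measurable]: "(\<lambda>z. z) \<in> borel_measurable circle_measure"
  by (rule continuous_imp_measurable_circle) (intro continuous_intros)

lemma borel_imp_measurable_circle:
  "f \<in> borel_measurable borel \<Longrightarrow> f \<in> borel_measurable circle_measure"
  using measurable_compose[OF measurable_ident_circle] by auto

lemma open_Int_sphere_sets: "open U \<Longrightarrow> sphere 0 1 \<inter> U \<in> sets circle_measure"
  by (auto simp: sets_circle_measure sets_restrict_space)

lemma closed_Int_sphere_sets: "closed U \<Longrightarrow> sphere 0 1 \<inter> U \<in> sets circle_measure"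
  by (auto simp: sets_circle_measure sets_restrict_space)

lemma nn_integral_circle:
  assumes [measurable]: "f \<in> borel_measurable circle_measure"
  shows "(\<integral>\<^sup>+z. f z \<partial>circle_measure)
    = (\<integral>\<^sup>+t. f (cis t) * indicator {0..<2*pi} t \<partial>lborel) / ennreal (2*pi)"
proof -
  have "measurable (uniform_measure lborel {0..<2*pi}) (restrict_space borel (sphere 0 1))
      = borel \<rightarrow>\<^sub>M circle_measure"
    by (rule measurable_cong_sets) (simp_all add: sets_circle_measure)
  then have m: "cis \<in> uniform_measure lborel {0..<2*pi} \<rightarrow>\<^sub>M restrict_space borel (sphere 0 1)"
    using measurable_cis by blast
  have f: "f \<in> borel_measurable (restrict_space borel (sphere 0 1))"
    using assms measurable_cong_sets[OF sets_circle_measure refl] by auto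
  show ?thesis
    unfolding circle_measure_def
    by (subst nn_integral_distr[OF m]) (use f in \<open>auto simp: nn_integral_uniform_measure\<close>)
qed

lemma emeasure_circle:
  assumes [measurable]: "Measurable.pred circle_measure P"
  shows "emeasure circle_measure {z \<in> space circle_measure. P z}
    = emeasure lborel {t \<in> {0..<2*pi}. P (cis t)} / ennreal (2*pi)"
proof -
  have "emeasure circle_measure {z \<in> space circle_measure. P z}
      = (\<integral>\<^sup>+z. indicator {z \<in> space circle_measure. P z} z \<partial>circle_measure)"
    by (rule nn_integral_indicator[symmetric]) measurable
  also have "\<dots> = (\<integral>\<^sup>+t. indicator {z \<in> space circle_measure. P z} (cis t) * indicator {0..<2*pi} t \<partial>lborel)
      / ennreal (2*pi)"
    by (subst nn_integral_circle) auto
  also have "(\<integral>\<^sup>+t. indicator {z \<in> space circle_measure. P z} (cis t) * indicator {0..<2*pi} t \<partial>lborel)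
      = (\<integral>\<^sup>+t. indicator {t \<in> {0..<2*pi}. P (cis t)} t \<partial>lborel)"
    by (rule nn_integral_cong) (auto simp: indicator_def)
  also have "\<dots> = emeasure lborel {t \<in> {0..<2*pi}. P (cis t)}"
    by (rule nn_integral_indicator) measurable
  finally show ?thesis .
qed

lemma integral_circle:
  fixes f :: "complex \<Rightarrow> 'b::{banach,second_countable_topology}"
  assumes [measurable]: "f \<in> borel_measurable circle_measure"
  shows "(\<integral>z. f z \<partial>circle_measure)
    = (\<integral>t. indicator {0..<2*pi} t *\<^sub>R f (cis t) \<partial>lborel) /\<^sub>R (2*pi)"
proof -
  have "measurable (uniform_measure lborel {0..<2*pi}) (restrict_space borel (sphere 0 1))
      = borel \<rightarrow>\<^sub>M circle_measure"
    by (rule measurable_cong_sets) (simp_all add: sets_circle_measure)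
  then have m: "cis \<in> uniform_measure lborel {0..<2*pi} \<rightarrow>\<^sub>M restrict_space borel (sphere 0 1)"
    using measurable_cis by blast
  have f: "f \<in> borel_measurable (restrict_space borel (sphere 0 1))"
    using assms measurable_cong_sets[OF sets_circle_measure refl] by auto
  have c: "ennreal (1 / (2*pi)) = 1 / ennreal (2*pi)"
    by (subst divide_ennreal[symmetric]) auto
  have "indicator {0..<2*pi} t / emeasure lborel {0..<2*pi} = ennreal (indicator {0..<2*pi} t / (2*pi))" for t
    using c by (cases "t \<in> {0..<2*pi}") auto
  then have eq: "uniform_measure lborel {0..<2*pi} = density lborel (\<lambda>t. ennreal (indicator {0..<2*pi} t / (2*pi)))"
    by (simp add: uniform_measure_def)
  have "(\<integral>z. f z \<partial>circle_measure) = (\<integral>t. f (cis t) \<partial>uniform_measure lborel {0..<2*pi})"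
    unfolding circle_measure_def by (rule integral_distr[OF m f])
  also have "\<dots> = (\<integral>t. (indicator {0..<2*pi} t / (2*pi)) *\<^sub>R f (cis t) \<partial>lborel)"
    unfolding eq by (rule integral_density)
      (use measurable_compose[OF measurable_cis assms]
        in \<open>auto intro!: borel_measurable_divide borel_measurable_indicator AE_I2\<close>)
  also have "\<dots> = (\<integral>t. (1 / (2*pi)) *\<^sub>R (indicator {0..<2*pi} t *\<^sub>R f (cis t)) \<partial>lborel)"
    by (rule Bochner_Integration.integral_cong) simp_all
  also have "\<dots> = (1 / (2*pi)) *\<^sub>R (\<integral>t. indicator {0..<2*pi} t *\<^sub>R f (cis t) \<partial>lborel)"
    by (rule integral_scaleR_right)
  finally show ?thesis unfolding inverse_eq_divide .
qed

text \<open>Contour integrals are gauge integrals over the closed interval. The half-open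
  parametrisation of the circle differs from it by the null set of the endpoint
  \<open>2*pi\<close>.\<close>

lemma integral_circle_has_integral:
  fixes f :: "complex \<Rightarrow> complex"
  assumes f: "continuous_on (sphere 0 1) f" and I: "((\<lambda>t. f (cis t)) has_integral I) {0..2*pi}"
  shows "(\<integral>z. f z \<partial>circle_measure) = I / (2*pi)"
proof -
  have c: "continuous_on {0..2*pi} (\<lambda>t. f (cis t))"
    by (rule continuous_on_compose2[OF f]) (auto intro!: continuous_intros)
  have s: "set_integrable lborel {0..2*pi} (\<lambda>t. f (cis t))"
    using c borel_integrable_atLeastAtMost'[OF c] by (simp add: set_integrable_def)
  have "(\<integral>t. indicator {0..<2*pi} t *\<^sub>R f (cis t) \<partial>lborel) = (LINT t:{0..2*pi}|lborel. f (cis t))"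
    unfolding set_lebesgue_integral_def
  proof (rule integral_cong_AE)
    show "AE t in lborel. indicator {0..<2*pi} t *\<^sub>R f (cis t) = indicat_real {0..2*pi} t *\<^sub>R f (cis t)"
      using AE_lborel_singleton[of "2*pi"] by eventually_elim (auto simp: indicator_def)
    show "(\<lambda>t. indicat_real {0..2*pi} t *\<^sub>R f (cis t)) \<in> borel_measurable lborel"
      using s by (simp add: set_integrable_def)
    have [measurable]: "f \<in> borel_measurable circle_measure"
      by (rule continuous_imp_measurable_circle[OF f])
    show "(\<lambda>t. indicat_real {0..<2*pi} t *\<^sub>R f (cis t)) \<in> borel_measurable lborel"
      by measurable
  qed
  also have "\<dots> = I"
    using set_borel_integral_eq_integral(2)[OF s] I by (simp add: integral_unique)
  finally show ?thesis
    using integral_circle[OF continuous_imp_measurable_circle[OF f]]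
    by (simp add: scaleR_conv_of_real field_simps)
qed

lemma integrable_circle_bounded:
  fixes f :: "complex \<Rightarrow> 'b::{banach,second_countable_topology}"
  assumes "f \<in> borel_measurable circle_measure" "\<And>z. z \<in> sphere 0 1 \<Longrightarrow> norm (f z) \<le> B"
  shows "integrable circle_measure f"
  by (rule circle.integrable_const_bound[where B = B]) (use assms in auto)

lemma integrable_circle_continuous:
  fixes f :: "complex \<Rightarrow> 'b::{banach,second_countable_topology}"
  assumes "continuous_on (sphere 0 1) f"
  shows "integrable circle_measure f"
proof -
  have "compact (f ` sphere 0 1)"
    by (rule compact_continuous_image[OF assms]) simp
  then obtain B where "\<forall>z\<in>sphere 0 1. norm (f z) \<le> B"
    by (metis bounded_iff compact_imp_bounded image_eqI)
  then show ?thesis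
    by (intro integrable_circle_bounded[where B = B] continuous_imp_measurable_circle assms) auto
qed

text \<open>Along \<open>cis\<close> one has \<open>dw = \<i> * w * dt\<close>, which turns Cauchy's
  kernel \<open>1 / (w - \<zeta>)\<close> into \<open>w / (w - \<zeta>)\<close> with respect to
  normalized arc length.\<close>

lemma cauchy_circle:
  assumes G: "G holomorphic_on S" "open S" "cball 0 1 \<subseteq> S" and \<zeta>: "cmod \<zeta> < 1"
  shows "(\<integral>w. G w * (w / (w - \<zeta>)) \<partial>circle_measure) = G \<zeta>"
proof -
  have "((\<lambda>u. G u/(u-\<zeta>)) has_contour_integral (2 * of_real pi * \<i> * G \<zeta>)) (circlepath 0 1)"
    by (rule Cauchy_integral_circlepath_simple) (use G holomorphic_on_subset \<zeta> in auto)
  then have "((\<lambda>t. G (cis t) / (cis t - \<zeta>) * \<i> * cis t) has_integral (2 * of_real pi * \<i> * G \<zeta>)) {0..2*pi}"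
    unfolding circlepath_def by (subst (asm) has_contour_integral_part_circlepath_iff) auto
  then have "((\<lambda>t. (G (cis t) / (cis t - \<zeta>) * \<i> * cis t) / \<i>) has_integral (2 * of_real pi * \<i> * G \<zeta>) / \<i>) {0..2*pi}"
    by (rule has_integral_divide)
  then have "((\<lambda>t. G (cis t) * (cis t / (cis t - \<zeta>))) has_integral (2 * of_real pi * G \<zeta>)) {0..2*pi}"
    by (simp add: field_simps)
  moreover have "continuous_on (sphere 0 1) G"
    using G by (meson continuous_on_subset holomorphic_on_imp_continuous_on order_trans sphere_cball)
  then have "continuous_on (sphere 0 1) (\<lambda>w. G w * (w / (w - \<zeta>)))"
    using \<zeta> by (auto intro!: continuous_intros)
  ultimately have "(\<integral>w. G w * (w / (w - \<zeta>)) \<partial>circle_measure) = 2 * of_real pi * G \<zeta> / (2*pi)"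
    by (intro integral_circle_has_integral)
  then show ?thesis by simp
qed

lemma mean_value_circle:
  assumes "G holomorphic_on S" "open S" "cball 0 1 \<subseteq> S"
  shows "(\<integral>w. G w \<partial>circle_measure) = G 0"
proof -
  have "(\<integral>w. G w \<partial>circle_measure) = (\<integral>w. G w * (w / (w - 0)) \<partial>circle_measure)"
    by (rule Bochner_Integration.integral_cong) auto
  also have "\<dots> = G 0"
    by (rule cauchy_circle[OF assms]) auto
  finally show ?thesis .
qed

section \<open>The Poisson kernel and its reproducing property\<close>

text \<open>Given as the real part of the Herglotz kernel, so that it produces the real part of a
  Herglotz transform of a real function; \<open>poisson_kernel_eq\<close> is the usual
  quotient.\<close>

definition poisson_kernel :: "complex \<Rightarrow> complex \<Rightarrow> real" where
  "poisson_kernel \<zeta> w = Re ((w + \<zeta>) / (w - \<zeta>))"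

lemma poisson_kernel_eq:
  assumes "cmod w = 1" "cmod \<zeta> < 1"
  shows "poisson_kernel \<zeta> w = (1 - (cmod \<zeta>)\<^sup>2) / (cmod (w - \<zeta>))\<^sup>2"
proof -
  have "(Re w)\<^sup>2 + (Im w)\<^sup>2 = 1" using assms by (simp add: cmod_def)
  moreover have "Re ((w + \<zeta>) * cnj (w - \<zeta>)) = ((Re w)\<^sup>2 + (Im w)\<^sup>2) - ((Re \<zeta>)\<^sup>2 + (Im \<zeta>)\<^sup>2)"
    by (simp add: power2_eq_square algebra_simps)
  ultimately show ?thesis
    by (simp add: poisson_kernel_def Re_divide cmod_power2) (simp add: power2_eq_square algebra_simps)
qed

lemma poisson_kernel_nonneg:
  "cmod w = 1 \<Longrightarrow> cmod \<zeta> < 1 \<Longrightarrow> 0 \<le> poisson_kernel \<zeta> w"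
  by (subst poisson_kernel_eq) (auto simp: abs_square_le_1)

lemma continuous_on_poisson_kernel:
  "cmod \<zeta> < 1 \<Longrightarrow> continuous_on (sphere 0 1) (poisson_kernel \<zeta>)"
  unfolding poisson_kernel_def by (intro continuous_intros) auto

text \<open>As a function of \<open>w\<close> this can vanish only at the reflection of
  \<open>\<zeta>\<close> in the circle, which lies outside the closed disc.\<close>

lemma reflected_kernel_nonzero:
  assumes "cmod \<zeta> < 1" "cmod w \<le> 1"
  shows "1 - cnj \<zeta> * w \<noteq> 0"
proof
  assume "1 - cnj \<zeta> * w = 0"
  then have "cmod \<zeta> * cmod w = 1" by (metis complex_mod_cnj eq_iff_diff_eq_0 norm_mult norm_one)
  moreover have "cmod \<zeta> * cmod w \<le> cmod \<zeta> * 1" using assms(2) by (intro mult_left_mono) auto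
  ultimately show False using assms(1) by simp
qed

text \<open>On the circle the Poisson kernel is the sum of the Cauchy kernel and of a boundary function
  that extends holomorphically to the disc and vanishes at the origin.\<close>
lemma poisson_formula:
  assumes G: "G holomorphic_on S" "open S" "cball 0 1 \<subseteq> S" and \<zeta>: "cmod \<zeta> < 1"
  shows "(\<integral>w. G w * of_real (poisson_kernel \<zeta> w) \<partial>circle_measure) = G \<zeta>"
proof -
  \<comment> \<open>The pole that is removed lies outside the closed disc, so an open neighbourhood
    of the closed disc remains.\<close>
  define S' where "S' = S \<inter> {w. 1 - cnj \<zeta> * w \<noteq> 0}"
  note nz = reflected_kernel_nonzero[OF \<zeta>]
  have S': "open S'" "cball 0 1 \<subseteq> S'"
    using G nz by (auto simp: S'_def intro!: open_Int open_Collect_neq continuous_intros)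
  have contG: "continuous_on (sphere 0 1) G"
    using G by (meson continuous_on_subset holomorphic_on_imp_continuous_on order_trans sphere_cball)
  have hol: "(\<lambda>w. G w * (cnj \<zeta> * w / (1 - cnj \<zeta> * w))) holomorphic_on S'"
    using G(1) by (auto simp: S'_def intro!: holomorphic_intros elim: holomorphic_on_subset)
  have int: "integrable circle_measure (\<lambda>w. G w * (w / (w - \<zeta>)))"
    "integrable circle_measure (\<lambda>w. G w * (cnj \<zeta> * w / (1 - cnj \<zeta> * w)))"
    using \<zeta> nz by (auto intro!: integrable_circle_continuous continuous_intros contG)
  have "(\<integral>w. G w * of_real (poisson_kernel \<zeta> w) \<partial>circle_measure)
    = (\<integral>w. G w * (w / (w - \<zeta>)) + G w * (cnj \<zeta> * w / (1 - cnj \<zeta> * w)) \<partial>circle_measure)"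
  proof (rule Bochner_Integration.integral_cong)
    fix w assume "w \<in> space circle_measure"
    then have w: "cmod w = 1" by simp
    then have ww: "w * cnj w = 1" by (simp add: complex_mult_cnj cmod_def complex_eq_iff)
    have n1: "w \<noteq> \<zeta>" "w \<noteq> 0" using w \<zeta> by auto
    have n2: "1 - cnj \<zeta> * w \<noteq> 0" using nz w by simp
    have e1: "(w + \<zeta>) / (w - \<zeta>) = 2 * (w / (w - \<zeta>)) - 1" using n1 by (simp add: field_simps)
    have e2: "cnj (w / (w - \<zeta>)) = 1 / (1 - cnj \<zeta> * w)"
    proof -
      have "cnj w = 1 / w" using ww n1 by (simp add: field_simps)
      then show ?thesis using n1 n2 by (simp add: field_simps)
    qed
    have "of_real (poisson_kernel \<zeta> w) = ((w + \<zeta>) / (w - \<zeta>) + cnj ((w + \<zeta>) / (w - \<zeta>))) / 2"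
      unfolding poisson_kernel_def complex_add_cnj by simp
    also have "\<dots> = w / (w - \<zeta>) + (1 / (1 - cnj \<zeta> * w) - 1)"
      unfolding e1 complex_cnj_diff complex_cnj_mult e2[unfolded complex_cnj_divide complex_cnj_diff]
      using e2 by (simp add: field_simps)
    also have "1 / (1 - cnj \<zeta> * w) - 1 = cnj \<zeta> * w / (1 - cnj \<zeta> * w)"
      using n2 by (simp add: field_simps)
    finally have "of_real (poisson_kernel \<zeta> w) = w / (w - \<zeta>) + cnj \<zeta> * w / (1 - cnj \<zeta> * w)"
      using n2 by (simp add: field_simps)
    then show "G w * of_real (poisson_kernel \<zeta> w) = G w * (w / (w - \<zeta>)) + G w * (cnj \<zeta> * w / (1 - cnj \<zeta> * w))"
      by (simp add: algebra_simps)
  qed simp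
  also have "\<dots> = (\<integral>w. G w * (w / (w - \<zeta>)) \<partial>circle_measure)
      + (\<integral>w. G w * (cnj \<zeta> * w / (1 - cnj \<zeta> * w)) \<partial>circle_measure)"
    by (rule Bochner_Integration.integral_add) (use int in auto)
  also have "\<dots> = G \<zeta> + 0"
    using cauchy_circle[OF G \<zeta>] mean_value_circle[OF hol S'] by simp
  finally show ?thesis by simp
qed

lemma integral_poisson_kernel:
  assumes "cmod \<zeta> < 1"
  shows "(\<integral>w. poisson_kernel \<zeta> w \<partial>circle_measure) = 1"
proof -
  have "complex_of_real (\<integral>w. poisson_kernel \<zeta> w \<partial>circle_measure) = 1"
    using poisson_formula[of "\<lambda>_. 1" UNIV \<zeta>] assms by simp
  then show ?thesis by simp
qed

section \<open>The maximal function on the circle\<close>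

lemma (in sigma_finite_measure) nn_integral_layer_cake:
  fixes u :: "'a \<Rightarrow> real"
  assumes [measurable]: "u \<in> borel_measurable M"
  shows "(\<integral>\<^sup>+x. ennreal (u x) \<partial>M)
    = (\<integral>\<^sup>+s. emeasure M {x \<in> space M. s < u x} * indicator {0..} s \<partial>lborel)"
proof -
  interpret pair_sigma_finite lborel M ..
  have "(\<integral>\<^sup>+x. ennreal (u x) \<partial>M) = (\<integral>\<^sup>+x. (\<integral>\<^sup>+s. (if 0 \<le> s \<and> s < u x then 1 else 0) \<partial>lborel) \<partial>M)"
  proof (rule nn_integral_cong)
    fix x
    have "(\<integral>\<^sup>+s. (if 0 \<le> s \<and> s < u x then 1 else 0) \<partial>lborel) = (\<integral>\<^sup>+s. indicator {0..<u x} s \<partial>lborel)"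
      by (rule nn_integral_cong) (simp add: indicator_def)
    also have "\<dots> = ennreal (u x)"
      by (cases "0 \<le> u x") (auto simp: ennreal_neg)
    finally show "ennreal (u x) = (\<integral>\<^sup>+s. (if 0 \<le> s \<and> s < u x then 1 else 0) \<partial>lborel)" by simp
  qed
  also have "\<dots> = (\<integral>\<^sup>+s. (\<integral>\<^sup>+x. (if 0 \<le> s \<and> s < u x then 1 else 0) \<partial>M) \<partial>lborel)"
    by (rule Fubini') measurable
  also have "\<dots> = (\<integral>\<^sup>+s. emeasure M {x \<in> space M. s < u x} * indicator {0..} s \<partial>lborel)"
  proof (rule nn_integral_cong)
    fix s :: real
    have "(\<integral>\<^sup>+x. (if 0 \<le> s \<and> s < u x then 1 else 0) \<partial>M)
        = (\<integral>\<^sup>+x. indicator {x \<in> space M. s < u x} x * indicator {0..} s \<partial>M)"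
      by (rule nn_integral_cong) (auto simp: indicator_def)
    also have "\<dots> = emeasure M {x \<in> space M. s < u x} * indicator {0..} s"
      by (subst nn_integral_multc) auto
    finally show "(\<integral>\<^sup>+x. (if 0 \<le> s \<and> s < u x then 1 else 0) \<partial>M)
        = emeasure M {x \<in> space M. s < u x} * indicator {0..} s" .
  qed
  finally show ?thesis .
qed

lemma emeasure_lborel_shift:
  fixes A :: "real set"
  assumes "A \<in> sets borel"
  shows "emeasure lborel ((\<lambda>x. c + x) -` A) = emeasure lborel A"
proof -
  have "emeasure lborel A = emeasure (distr lborel borel ((+) c)) A"
    by (simp add: lborel_distr_plus)
  also have "\<dots> = emeasure lborel ((\<lambda>x. c + x) -` A)"
    using assms by (subst emeasure_distr) auto
  finally show ?thesis ..
qed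

text \<open>This is the rotation invariance of the circle measure: the piece \<open>{0..<a}\<close>
  is carried to the end of the period by adding \<open>2*pi - a\<close>, the rest is moved down by
  \<open>a\<close>.\<close>

lemma emeasure_periodic_shift:
  fixes Q :: "real \<Rightarrow> bool"
  assumes [measurable]: "Measurable.pred borel Q" and per: "\<And>t. Q (t + 2*pi) = Q t"
    and a: "0 \<le> a" "a < 2*pi"
  shows "emeasure lborel {t \<in> {0..<2*pi}. Q (t - a)} = emeasure lborel {t \<in> {0..<2*pi}. Q t}"
proof -
  have 1: "emeasure lborel {t \<in> {0..<a}. Q (t - a)} = emeasure lborel {t \<in> {2*pi-a..<2*pi}. Q t}"
  proof -
    have q: "Q (2*pi - a + t) = Q (t - a)" for t
      using per[of "t - a"] by (simp add: algebra_simps)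
    have "{t \<in> {0..<a}. Q (t - a)} = (\<lambda>x. (2*pi - a) + x) -` {t \<in> {2*pi-a..<2*pi}. Q t}"
      by (auto simp: q)
    then show ?thesis by (simp only:) (rule emeasure_lborel_shift, measurable)
  qed
  have 2: "emeasure lborel {t \<in> {a..<2*pi}. Q (t - a)} = emeasure lborel {t \<in> {0..<2*pi-a}. Q t}"
  proof -
    have "{t \<in> {a..<2*pi}. Q (t - a)} = (\<lambda>x. (- a) + x) -` {t \<in> {0..<2*pi-a}. Q t}"
      by auto
    then show ?thesis by (simp only:) (rule emeasure_lborel_shift, measurable)
  qed
  have m: "{t \<in> {0..<a}. Q (t - a)} \<in> sets lborel" "{t \<in> {a..<2*pi}. Q (t - a)} \<in> sets lborel"
    by measurable
  have dj: "{t \<in> {0..<a}. Q (t - a)} \<inter> {t \<in> {a..<2*pi}. Q (t - a)} = {}" by auto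
  have "{t \<in> {0..<2*pi}. Q (t - a)} = {t \<in> {0..<a}. Q (t - a)} \<union> {t \<in> {a..<2*pi}. Q (t - a)}"
    using a by auto
  then have "emeasure lborel {t \<in> {0..<2*pi}. Q (t - a)}
    = emeasure lborel {t \<in> {0..<a}. Q (t - a)} + emeasure lborel {t \<in> {a..<2*pi}. Q (t - a)}"
    using plus_emeasure[OF m dj] by argo
  also have "\<dots> = emeasure lborel {t \<in> {0..<2*pi-a}. Q t} + emeasure lborel {t \<in> {2*pi-a..<2*pi}. Q t}"
    unfolding 1 2 by (rule add.commute)
  also have "\<dots> = emeasure lborel ({t \<in> {0..<2*pi-a}. Q t} \<union> {t \<in> {2*pi-a..<2*pi}. Q t})"
    by (rule plus_emeasure) auto
  also have "{t \<in> {0..<2*pi-a}. Q t} \<union> {t \<in> {2*pi-a..<2*pi}. Q t} = {t \<in> {0..<2*pi}. Q t}"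
    using a by auto
  finally show ?thesis .
qed

section \<open>Lengths of arcs and the doubling property\<close>

lemma cmod_1_minus_cis: "cmod (1 - cis t) = 2 * \<bar>sin (t / 2)\<bar>"
proof -
  have "(cmod (1 - cis t))\<^sup>2 = (1 - cos t)\<^sup>2 + (sin t)\<^sup>2"
    by (simp add: cmod_power2)
  also have "\<dots> = 2 - 2 * cos t"
    using sin_cos_squared_add[of t] by (simp add: power2_eq_square algebra_simps)
  also have "\<dots> = (2 * \<bar>sin (t / 2)\<bar>)\<^sup>2"
    using cos_double_sin[of "t / 2"] by (simp add: power_mult_distrib)
  finally show ?thesis
    by (rule power2_eq_imp_eq) auto
qed

text \<open>On \<open>{0..2}\<close> the cubic Taylor error \<open>x^3 / 6\<close> is at most
  \<open>2 * x / 3\<close>. The interval reaches to \<open>2\<close> so that \<open>pi < 4\<close>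
  is enough to cover half angles up to \<open>pi / 2\<close>.\<close>

lemma sin_ge_third: "0 \<le> x \<Longrightarrow> x \<le> 2 \<Longrightarrow> x / 3 \<le> sin x" for x :: real
proof -
  assume x: "0 \<le> x" "x \<le> 2"
  have "(\<Sum>m<3. sin_coeff m * x ^ m) = x"
    by (simp add: sin_coeff_def lessThan_nat_numeral)
  then have "\<bar>sin x - x\<bar> \<le> inverse (fact 3) * x ^ 3"
    using Maclaurin_sin_bound[of x 3] x by simp
  also have "inverse (fact 3) * x ^ 3 = x ^ 3 / 6"
    by (simp add: fact_numeral field_simps)
  finally have "\<bar>sin x - x\<bar> \<le> x ^ 3 / 6" .
  moreover have "x ^ 3 / 6 \<le> 2 * x / 3"
  proof -
    have "x * x \<le> 2 * 2" using x by (intro mult_mono) auto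
    then have "x * (x * x) \<le> x * 4" using x by (intro mult_left_mono) auto
    then show ?thesis by (simp add: power3_eq_cube)
  qed
  ultimately show ?thesis by linarith
qed

text \<open>For angles \<open>t\<close> up to \<open>pi\<close> the chord
  \<open>2 * sin (t/2)\<close> lies between \<open>t / 3\<close> and \<open>t\<close>. Hence the arc
  stretches at most \<open>3 * \<delta>\<close> to each side of \<open>1\<close>; the lower bound
  counts one side only and is capped by the full circle.\<close>

lemma measure_circle_ball_1:
  assumes "\<delta> > 0"
  shows "measure circle_measure (sphere 0 1 \<inter> ball 1 \<delta>) \<le> 6 * \<delta> / (2*pi)"
    and "min \<delta> (2*pi) / (2*pi) \<le> measure circle_measure (sphere 0 1 \<inter> ball 1 \<delta>)"
proof -
  have eq: "emeasure circle_measure (sphere 0 1 \<inter> ball 1 \<delta>)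
    = emeasure lborel {t \<in> {0..<2*pi}. cmod (1 - cis t) < \<delta>} / ennreal (2*pi)"
  proof -
    have "sphere 0 1 \<inter> ball 1 \<delta> = {z \<in> space circle_measure. cmod (1 - z) < \<delta>}"
      by (auto simp: dist_norm)
    then show ?thesis by (simp only:) (rule emeasure_circle, measurable)
  qed
  have "{t \<in> {0..<2*pi}. cmod (1 - cis t) < \<delta>} \<subseteq> {0..<3*\<delta>} \<union> {2*pi-3*\<delta><..<2*pi}"
  proof
    fix t assume t: "t \<in> {t \<in> {0..<2*pi}. cmod (1 - cis t) < \<delta>}"
    show "t \<in> {0..<3*\<delta>} \<union> {2*pi-3*\<delta><..<2*pi}"
    proof (cases "t \<le> pi")
      case True
      then have "t/2 \<le> 2" using pi_less_4 by linarith
      then have "(t/2)/3 \<le> sin (t/2)" using t by (intro sin_ge_third) auto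
      then show ?thesis using t by (auto simp: cmod_1_minus_cis)
    next
      case False
      then have "pi - t/2 \<le> 2" "0 \<le> pi - t/2" using pi_less_4 t by auto
      then have "(pi - t/2)/3 \<le> sin (pi - t/2)" by (intro sin_ge_third) auto
      then show ?thesis using t by (auto simp: cmod_1_minus_cis)
    qed
  qed
  then have "emeasure lborel {t \<in> {0..<2*pi}. cmod (1 - cis t) < \<delta>}
      \<le> emeasure lborel ({0..<3*\<delta>} \<union> {2*pi-3*\<delta><..<2*pi})"
    by (rule emeasure_mono) auto
  also have "\<dots> \<le> emeasure lborel {0..<3*\<delta>} + emeasure lborel {2*pi-3*\<delta><..<2*pi}"
    by (rule emeasure_subadditive) auto
  also have "\<dots> = ennreal (6 * \<delta>)"
    using assms by (simp add: ennreal_plus[symmetric] del: ennreal_plus)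
  finally have "emeasure circle_measure (sphere 0 1 \<inter> ball 1 \<delta>) \<le> ennreal (6 * \<delta>) / ennreal (2*pi)"
    unfolding eq by (rule divide_right_mono_ennreal)
  then show "measure circle_measure (sphere 0 1 \<inter> ball 1 \<delta>) \<le> 6 * \<delta> / (2*pi)"
    using assms by (simp add: divide_ennreal circle.emeasure_eq_measure)
  have "{0..<min \<delta> (2*pi)} \<subseteq> {t \<in> {0..<2*pi}. cmod (1 - cis t) < \<delta>}"
  proof
    fix t assume t: "t \<in> {0..<min \<delta> (2*pi)}"
    have "\<bar>sin (t / 2)\<bar> \<le> \<bar>t / 2\<bar>" by (rule abs_sin_x_le_abs_x)
    then show "t \<in> {t \<in> {0..<2*pi}. cmod (1 - cis t) < \<delta>}"
      using t by (auto simp: cmod_1_minus_cis)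
  qed
  then have "emeasure lborel {0..<min \<delta> (2*pi)} \<le> emeasure lborel {t \<in> {0..<2*pi}. cmod (1 - cis t) < \<delta>}"
    by (rule emeasure_mono) measurable
  then have "ennreal (min \<delta> (2*pi)) / ennreal (2*pi) \<le> emeasure circle_measure (sphere 0 1 \<inter> ball 1 \<delta>)"
    unfolding eq using assms by (intro divide_right_mono_ennreal) auto
  then show "min \<delta> (2*pi) / (2*pi) \<le> measure circle_measure (sphere 0 1 \<inter> ball 1 \<delta>)"
    using assms by (simp add: divide_ennreal circle.emeasure_eq_measure)
qed

lemma measure_circle_ball_rotate:
  assumes "cmod z = 1"
  shows "measure circle_measure (sphere 0 1 \<inter> ball z \<delta>) = measure circle_measure (sphere 0 1 \<inter> ball 1 \<delta>)"
proof -
  define a where "a = Arg2pi z"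
  have a: "0 \<le> a" "a < 2*pi" "z = cis a"
    using Arg2pi[of z] assms by (auto simp: a_def cis_conv_exp is_Arg_def)
  have eq: "emeasure circle_measure (sphere 0 1 \<inter> ball w \<delta>)
    = emeasure lborel {t \<in> {0..<2*pi}. cmod (w - cis t) < \<delta>} / ennreal (2*pi)" for w
  proof -
    have "sphere 0 1 \<inter> ball w \<delta> = {z \<in> space circle_measure. cmod (w - z) < \<delta>}"
      by (auto simp: dist_norm)
    then show ?thesis by (simp only:) (rule emeasure_circle, measurable)
  qed
  have "cmod (z - cis t) = cmod (1 - cis (t - a))" for t
  proof -
    have "z - cis t = cis a * (1 - cis (t - a))"
      by (simp add: a(3) right_diff_distrib cis_mult)
    then show ?thesis by (simp add: norm_mult)
  qed
  then have "emeasure lborel {t \<in> {0..<2*pi}. cmod (z - cis t) < \<delta>}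
    = emeasure lborel {t \<in> {0..<2*pi}. cmod (1 - cis (t - a)) < \<delta>}"
    by simp
  also have "\<dots> = emeasure lborel {t \<in> {0..<2*pi}. cmod (1 - cis t) < \<delta>}"
    by (rule emeasure_periodic_shift[where Q = "\<lambda>t. cmod (1 - cis t) < \<delta>"])
      (use a in \<open>auto simp: cis_mult[symmetric]\<close>)
  finally show ?thesis by (simp add: measure_def eq)
qed

text \<open>The dilation factor \<open>5\<close> is that of the Vitali covering lemma. Comparing the
  upper and lower bounds for arcs at \<open>1\<close> gives \<open>6 * 5 = 30\<close>; beyond
  \<open>2*pi\<close> the smaller arc is already the whole circle.\<close>

lemma measure_circle_ball_doubling:
  assumes "cmod z = 1" "\<delta> > 0"
  shows "measure circle_measure (sphere 0 1 \<inter> ball z (5 * \<delta>)) \<le> 30 * measure circle_measure (sphere 0 1 \<inter> ball z \<delta>)"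
proof -
  have 1: "measure circle_measure (sphere 0 1 \<inter> ball 1 (5 * \<delta>)) \<le> 30 * \<delta> / (2*pi)"
    using measure_circle_ball_1(1)[of "5 * \<delta>"] assms by simp
  have 2: "min \<delta> (2*pi) / (2*pi) \<le> measure circle_measure (sphere 0 1 \<inter> ball 1 \<delta>)"
    using measure_circle_ball_1(2)[of \<delta>] assms by simp
  have 3: "measure circle_measure (sphere 0 1 \<inter> ball 1 (5 * \<delta>)) \<le> 1" by (rule measure_circle_le_1)
  have "measure circle_measure (sphere 0 1 \<inter> ball 1 (5 * \<delta>)) \<le> 30 * measure circle_measure (sphere 0 1 \<inter> ball 1 \<delta>)"
  proof (cases "\<delta> \<le> 2*pi")
    case True
    then show ?thesis using 1 2 by simp
  next
    case False
    then show ?thesis using 2 3 by simp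
  qed
  then show ?thesis by (simp only: measure_circle_ball_rotate[OF assms(1)])
qed

text \<open>\<open>K\<close> is a compact part of the set where the Hardy-Littlewood maximal function of \<open>v\<close> exceeds \<open>l\<close>.\<close>
lemma maximal_weak_type:
  fixes v :: "complex \<Rightarrow> real"
  assumes v: "integrable circle_measure v" "\<And>z. 0 \<le> v z"
    and K: "compact K" "K \<subseteq> sphere 0 1"
    and ex: "\<And>z. z \<in> K \<Longrightarrow> \<exists>\<delta>>0. l * measure circle_measure (sphere 0 1 \<inter> ball z \<delta>)
        < (\<integral>w. indicator (ball z \<delta>) w * v w \<partial>circle_measure)"
    and l: "l > 0"
  shows "l * measure circle_measure K \<le> 30 * (\<integral>w. v w \<partial>circle_measure)"
proof -
  obtain d where d: "\<And>z. z \<in> K \<Longrightarrow> d z > 0 \<and> l * measure circle_measure (sphere 0 1 \<inter> ball z (d z))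
        < (\<integral>w. indicator (ball z (d z)) w * v w \<partial>circle_measure)"
    using ex by metis
  have "K \<subseteq> (\<Union>z\<in>K. ball z (d z))" using d by force
  \<comment> \<open>A finite subcover bounds the radii, as the covering lemma requires, and keeps
    all sums finite.\<close>
  then obtain F where F: "F \<subseteq> K" "finite F" "K \<subseteq> (\<Union>z\<in>F. ball z (d z))"
    using compactE_image[OF K(1), of K "\<lambda>z. ball z (d z)"] by auto
  have bnd: "0 < d i \<and> d i \<le> Max (d ` F)" if "i \<in> F" for i using d F that by auto
  obtain C where "countable C" and C: "C \<subseteq> F" "pairwise (\<lambda>i j. disjnt (ball i (d i)) (ball j (d j))) C"
     "K \<subseteq> (\<Union>i\<in>C. ball i (5 * d i))"
    by (rule Vitali_covering_lemma_balls[OF F(3) bnd])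
  have fC: "finite C" using C F finite_subset by blast
  have ms: "sphere 0 1 \<inter> ball z r \<in> sets circle_measure" for z r
    by (rule open_Int_sphere_sets) simp
  have bm: "(\<lambda>w. indicator (ball z r) w :: real) \<in> borel_measurable circle_measure" for z r
    by (rule borel_imp_measurable_circle) (rule borel_measurable_indicator, simp)
  have int: "integrable circle_measure (\<lambda>w. indicator (ball z r) w * v w)" for z r
    by (rule Bochner_Integration.integrable_bound[OF v(1)])
       (use bm v in \<open>auto simp: indicator_def\<close>)
  have "measure circle_measure K \<le> measure circle_measure (\<Union>i\<in>C. sphere 0 1 \<inter> ball i (5 * d i))"
    by (rule circle.finite_measure_mono) (use C K in \<open>auto intro!: open_Int_sphere_sets\<close>)
  also have "\<dots> \<le> (\<Sum>i\<in>C. measure circle_measure (sphere 0 1 \<inter> ball i (5 * d i)))"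
    by (rule circle.finite_measure_subadditive_finite) (use fC ms in auto)
  also have "\<dots> \<le> (\<Sum>i\<in>C. 30 * measure circle_measure (sphere 0 1 \<inter> ball i (d i)))"
  proof (rule sum_mono)
    fix i assume "i \<in> C"
    then have "i \<in> K" using C F by auto
    then show "measure circle_measure (sphere 0 1 \<inter> ball i (5 * d i)) \<le> 30 * measure circle_measure (sphere 0 1 \<inter> ball i (d i))"
      using d K by (intro measure_circle_ball_doubling) auto
  qed
  finally have "l * measure circle_measure K \<le> l * (\<Sum>i\<in>C. 30 * measure circle_measure (sphere 0 1 \<inter> ball i (d i)))"
    using l by (intro mult_left_mono) auto
  also have "\<dots> = 30 * (\<Sum>i\<in>C. l * measure circle_measure (sphere 0 1 \<inter> ball i (d i)))"
    by (simp add: sum_distrib_left mult_ac)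
  also have "\<dots> \<le> 30 * (\<Sum>i\<in>C. (\<integral>w. indicator (ball i (d i)) w * v w \<partial>circle_measure))"
    using C F d by (intro mult_left_mono sum_mono) (auto intro!: less_imp_le)
  also have "(\<Sum>i\<in>C. (\<integral>w. indicator (ball i (d i)) w * v w \<partial>circle_measure))
      = (\<integral>w. (\<Sum>i\<in>C. indicator (ball i (d i)) w * v w) \<partial>circle_measure)"
    by (rule Bochner_Integration.integral_sum[symmetric]) (rule int)
  also have "30 * \<dots> \<le> 30 * (\<integral>w. v w \<partial>circle_measure)"
  proof (intro mult_left_mono integral_mono Bochner_Integration.integrable_sum int v(1))
    fix w
    have "disjoint_family_on (\<lambda>i. ball i (d i)) C"
      using C(2) by (auto simp: disjoint_family_on_def pairwise_def disjnt_def)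
    then have "(\<Sum>i\<in>C. indicator (ball i (d i)) w) = (indicator (\<Union>i\<in>C. ball i (d i)) w :: real)"
      using fC by (simp add: indicator_UN_disjoint)
    then have "(\<Sum>i\<in>C. indicator (ball i (d i)) w) \<le> (1::real)"
      by (simp add: indicator_def)
    then have "(\<Sum>i\<in>C. indicator (ball i (d i)) w) * v w \<le> 1 * v w"
      using v(2) by (intro mult_right_mono) auto
    then show "(\<Sum>i\<in>C. indicator (ball i (d i)) w * v w) \<le> v w"
      by (simp add: sum_distrib_right)
  qed auto
  finally show ?thesis .
qed

text \<open>The superlevel sets of the Poisson kernel are arcs centred at \<open>z\<close>.\<close>
lemma poisson_le_maximal:
  fixes v :: "complex \<Rightarrow> real"
  assumes v: "integrable circle_measure v" "\<And>w. 0 \<le> v w"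
    and z: "cmod z = 1" and \<rho>: "0 \<le> \<rho>" "\<rho> < 1"
    and max: "\<And>\<delta>. \<delta> > 0 \<Longrightarrow> (\<integral>w. indicator (ball z \<delta>) w * v w \<partial>circle_measure)
        \<le> l * measure circle_measure (sphere 0 1 \<inter> ball z \<delta>)"
    and l: "l \<ge> 0"
  shows "(\<integral>w. v w * poisson_kernel (of_real \<rho> * z) w \<partial>circle_measure) \<le> l"
proof -
  define P where "P = poisson_kernel (of_real \<rho> * z)"
  have c\<rho>: "cmod (of_real \<rho> * z) < 1" using z \<rho> by (simp add: norm_mult)
  have [measurable]: "P \<in> borel_measurable circle_measure" "v \<in> borel_measurable circle_measure"
    using v continuous_imp_measurable_circle[OF continuous_on_poisson_kernel[OF c\<rho>]] by (auto simp: P_def)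
  have Peq: "P w = (1 - \<rho>\<^sup>2) / ((1 - \<rho>)\<^sup>2 + \<rho> * (cmod (z - w))\<^sup>2)" if "cmod w = 1" for w
  proof -
    have a: "(Re w)\<^sup>2 + (Im w)\<^sup>2 = 1" "(Re z)\<^sup>2 + (Im z)\<^sup>2 = 1"
      using that z by (simp_all add: cmod_def)
    have "(cmod (w - of_real \<rho> * z))\<^sup>2 = (Re w)\<^sup>2 + (Im w)\<^sup>2 + \<rho>\<^sup>2 * ((Re z)\<^sup>2 + (Im z)\<^sup>2) - 2 * \<rho> * (Re w * Re z + Im w * Im z)"
      unfolding cmod_power2 by (simp add: power2_eq_square algebra_simps)
    also have "\<dots> = (1 - \<rho>)\<^sup>2 + \<rho> * ((Re w)\<^sup>2 + (Im w)\<^sup>2 + ((Re z)\<^sup>2 + (Im z)\<^sup>2) - 2 * (Re w * Re z + Im w * Im z))"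
      unfolding a by (simp add: power2_eq_square algebra_simps)
    also have "(Re w)\<^sup>2 + (Im w)\<^sup>2 + ((Re z)\<^sup>2 + (Im z)\<^sup>2) - 2 * (Re w * Re z + Im w * Im z) = (cmod (z - w))\<^sup>2"
      unfolding cmod_power2 by (simp add: power2_eq_square algebra_simps)
    finally show ?thesis
      unfolding P_def poisson_kernel_eq[OF that c\<rho>] using \<rho> z by (simp add: norm_mult)
  qed
  have level: "(\<exists>\<delta>>0. {w \<in> space circle_measure. s < P w} = sphere 0 1 \<inter> ball z \<delta>)
      \<or> {w \<in> space circle_measure. s < P w} = {}" if s: "0 < s" for s
  proof (cases "{w \<in> space circle_measure. s < P w} = {}")
    case False
    define D where "D w = (1 - \<rho>)\<^sup>2 + \<rho> * (cmod (z - w))\<^sup>2" for w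
    have Dpos: "D w > 0" for w using \<rho> by (auto simp: D_def intro!: add_pos_nonneg)
    have iff: "s < P w \<longleftrightarrow> \<rho> * (cmod (z - w))\<^sup>2 < (1 - \<rho>\<^sup>2) / s - (1 - \<rho>)\<^sup>2" if "cmod w = 1" for w
    proof -
      have "s < P w \<longleftrightarrow> s * D w < 1 - \<rho>\<^sup>2"
        unfolding Peq[OF that] D_def[symmetric] using Dpos[of w] by (simp add: pos_less_divide_eq)
      also have "\<dots> \<longleftrightarrow> D w < (1 - \<rho>\<^sup>2) / s" using s by (simp add: pos_less_divide_eq mult.commute)
      finally show ?thesis by (simp add: D_def) linarith
    qed
    define c where "c = (1 - \<rho>\<^sup>2) / s - (1 - \<rho>)\<^sup>2"
    obtain w0 where w0: "cmod w0 = 1" "s < P w0" using False by auto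
    then have "\<rho> * (cmod (z - w0))\<^sup>2 < c" using iff c_def by auto
    moreover have "0 \<le> \<rho> * (cmod (z - w0))\<^sup>2" using \<rho> by simp
    ultimately have c: "c > 0" by linarith
    show ?thesis
    proof (cases "\<rho> = 0")
      case True
      \<comment> \<open>For \<open>\<rho> = 0\<close> the kernel is constant, so a nonempty
        superlevel set is the whole circle; the radius \<open>3\<close> exceeds its
        diameter.\<close>
      have "{w \<in> space circle_measure. s < P w} = sphere 0 1 \<inter> ball z 3"
      proof -
        have "dist z w < 3" if "cmod w = 1" for w
          using norm_triangle_ineq4[of z w] that z by (simp add: dist_norm)
        then show ?thesis using iff True c by (auto simp: c_def)
      qed
      then show ?thesis by (intro disjI1 exI[of _ 3]) auto
    next
      case False
      then have r0: "\<rho> > 0" using \<rho> by simp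
      have "{w \<in> space circle_measure. s < P w} = sphere 0 1 \<inter> ball z (sqrt (c / \<rho>))"
      proof -
        have "\<rho> * (cmod (z - w))\<^sup>2 < c \<longleftrightarrow> cmod (z - w) < sqrt (c / \<rho>)" for w
        proof -
          have "\<rho> * (cmod (z - w))\<^sup>2 < c \<longleftrightarrow> (cmod (z - w))\<^sup>2 < c / \<rho>"
            using r0 by (simp add: pos_less_divide_eq mult.commute)
          also have "\<dots> \<longleftrightarrow> sqrt ((cmod (z - w))\<^sup>2) < sqrt (c / \<rho>)"
            by (simp only: real_sqrt_less_iff)
          finally show ?thesis by simp
        qed
        then show ?thesis using iff by (auto simp: c_def dist_norm)
      qed
      then show ?thesis using c r0 by (intro disjI1 exI[of _ "sqrt (c / \<rho>)"]) auto
    qed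
  qed auto
  \<comment> \<open>On every arc centred at \<open>z\<close>, hence on every superlevel set of the
    kernel, the measure with density \<open>v\<close> is at most \<open>l\<close> times the circle
    measure. Integrating over the levels compares the two integrals of the kernel, and with respect
    to the circle measure that integral is \<open>1\<close>.\<close>
  define N where "N = density circle_measure (\<lambda>w. ennreal (v w))"
  have iv: "integrable circle_measure (\<lambda>w. indicator A w * v w)" if "A \<in> sets circle_measure" for A
    by (rule Bochner_Integration.integrable_bound[OF v(1)]) (use that v in \<open>auto simp: indicator_def\<close>)
  have NA: "emeasure N A = ennreal (\<integral>w. indicator A w * v w \<partial>circle_measure)" if "A \<in> sets circle_measure" for A
  proof -
    have "emeasure N A = (\<integral>\<^sup>+w. ennreal (v w) * indicator A w \<partial>circle_measure)"
      unfolding N_def using that by (subst emeasure_density) auto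
    also have "\<dots> = (\<integral>\<^sup>+w. ennreal (indicator A w * v w) \<partial>circle_measure)"
      by (rule nn_integral_cong) (simp add: indicator_def)
    also have "\<dots> = ennreal (\<integral>w. indicator A w * v w \<partial>circle_measure)"
      by (rule nn_integral_eq_integral) (use iv that v in auto)
    finally show ?thesis .
  qed
  have finN: "finite_measure N"
  proof (rule finite_measureI)
    show "emeasure N (space N) \<noteq> \<infinity>"
      using NA[OF sets.top] by (simp add: N_def)
  qed
  then interpret N: finite_measure N .
  have NP: "emeasure N {w \<in> space circle_measure. s < P w}
      \<le> ennreal l * emeasure circle_measure {w \<in> space circle_measure. s < P w}" if s: "0 < s" for s
    using level[OF s]
  proof
    assume "\<exists>\<delta>>0. {w \<in> space circle_measure. s < P w} = sphere 0 1 \<inter> ball z \<delta>"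
    then obtain \<delta> where \<delta>: "\<delta> > 0" "{w \<in> space circle_measure. s < P w} = sphere 0 1 \<inter> ball z \<delta>" by blast
    have "(\<integral>w. indicator (sphere 0 1 \<inter> ball z \<delta>) w * v w \<partial>circle_measure) = (\<integral>w. indicator (ball z \<delta>) w * v w \<partial>circle_measure)"
      by (rule Bochner_Integration.integral_cong) (auto simp: indicator_def)
    then have "emeasure N (sphere 0 1 \<inter> ball z \<delta>) \<le> ennreal (l * measure circle_measure (sphere 0 1 \<inter> ball z \<delta>))"
      using max[OF \<delta>(1)] NA[OF open_Int_sphere_sets[of "ball z \<delta>"]] by (simp add: ennreal_leI)
    then show ?thesis using l by (simp only: \<delta>(2) circle.emeasure_eq_measure ennreal_mult')
  next
    assume "{w \<in> space circle_measure. s < P w} = {}"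
    then show ?thesis by (simp only: emeasure_empty mult_zero_right)
  qed
  have [measurable]: "P \<in> borel_measurable N" by (simp add: N_def)
  have "(\<integral>\<^sup>+w. ennreal (P w) \<partial>N) = (\<integral>\<^sup>+s. emeasure N {x \<in> space N. s < P x} * indicator {0..} s \<partial>lborel)"
    by (rule N.nn_integral_layer_cake) measurable
  also have "\<dots> \<le> (\<integral>\<^sup>+s. ennreal l * (emeasure circle_measure {x \<in> space circle_measure. s < P x} * indicator {0..} s) \<partial>lborel)"
  proof (rule nn_integral_mono_AE)
    show "AE s in lborel. emeasure N {x \<in> space N. s < P x} * indicator {0..} s
        \<le> ennreal l * (emeasure circle_measure {x \<in> space circle_measure. s < P x} * indicator {0..} s)"
      using AE_lborel_singleton[of "0::real"]
    proof eventually_elim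
      case (elim s)
      show ?case
      proof (cases "s > 0")
        case True
        then show ?thesis using NP[OF True] by (simp add: N_def)
      qed (use elim in \<open>auto simp: indicator_def\<close>)
    qed
  qed
  also have "\<dots> = ennreal l * (\<integral>\<^sup>+s. emeasure circle_measure {x \<in> space circle_measure. s < P x} * indicator {0..} s \<partial>lborel)"
    by (rule nn_integral_cmult) measurable
  also have "\<dots> = ennreal l * (\<integral>\<^sup>+w. ennreal (P w) \<partial>circle_measure)"
    by (subst circle.nn_integral_layer_cake[of P]) auto
  also have "(\<integral>\<^sup>+w. ennreal (P w) \<partial>circle_measure) = ennreal (\<integral>w. P w \<partial>circle_measure)"
    unfolding P_def
    by (rule nn_integral_eq_integral)
       (use poisson_kernel_nonneg c\<rho> continuous_on_poisson_kernel in \<open>auto intro!: integrable_circle_continuous AE_I2\<close>)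
  also have "(\<integral>w. P w \<partial>circle_measure) = 1"
    unfolding P_def by (rule integral_poisson_kernel[OF c\<rho>])
  finally have *: "(\<integral>\<^sup>+w. ennreal (P w) \<partial>N) \<le> ennreal l" by simp
  have "(\<integral>\<^sup>+w. ennreal (P w) \<partial>N) = (\<integral>\<^sup>+w. ennreal (v w) * ennreal (P w) \<partial>circle_measure)"
    unfolding N_def by (rule nn_integral_density) measurable
  also have "\<dots> = (\<integral>\<^sup>+w. ennreal (v w * P w) \<partial>circle_measure)"
    using v by (intro nn_integral_cong) (simp add: ennreal_mult')
  finally have **: "(\<integral>\<^sup>+w. ennreal (v w * P w) \<partial>circle_measure) \<le> ennreal l" using * by simp
  have "0 \<le> P w" if "cmod w = 1" for w
    using poisson_kernel_nonneg[OF that c\<rho>] by (simp add: P_def)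
  then have "(\<integral>w. v w * P w \<partial>circle_measure) = enn2real (\<integral>\<^sup>+w. ennreal (v w * P w) \<partial>circle_measure)"
    by (intro integral_eq_nn_integral) (use v in \<open>auto intro!: AE_I2 mult_nonneg_nonneg\<close>)
  also have "\<dots> \<le> l"
    using ** l by (metis enn2real_leI)
  finally show ?thesis by (simp add: P_def)
qed

section \<open>Herglotz transforms\<close>

definition herglotz :: "(complex \<Rightarrow> complex) \<Rightarrow> complex \<Rightarrow> complex" where
  "herglotz f \<zeta> = (\<integral>w. f w * ((w + \<zeta>) / (w - \<zeta>)) \<partial>circle_measure)"

lemma herglotz_kernel_bound:
  assumes "cmod w = 1" "cmod \<zeta> < 1"
  shows "cmod ((w + \<zeta>) / (w - \<zeta>)) \<le> 2 / (1 - cmod \<zeta>)"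
proof -
  have "cmod (w + \<zeta>) \<le> 2" using norm_triangle_ineq[of w \<zeta>] assms by simp
  moreover have "1 - cmod \<zeta> \<le> cmod (w - \<zeta>)" using norm_triangle_ineq2[of w \<zeta>] assms by simp
  ultimately show ?thesis
    using assms by (simp add: norm_divide frac_le)
qed

lemma continuous_on_herglotz_kernel:
  "cmod \<zeta> < 1 \<Longrightarrow> continuous_on (sphere 0 1) (\<lambda>w. (w + \<zeta>) / (w - \<zeta>))"
  by (intro continuous_intros) auto

lemma integrable_mult_bounded:
  fixes f k :: "complex \<Rightarrow> complex"
  assumes "integrable circle_measure f" "k \<in> borel_measurable circle_measure"
    "\<And>w. cmod w = 1 \<Longrightarrow> cmod (k w) \<le> B"
  shows "integrable circle_measure (\<lambda>w. f w * k w)"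
proof (rule Bochner_Integration.integrable_bound)
  show "integrable circle_measure (\<lambda>w. B * cmod (f w))"
    using assms by auto
  show "AE w in circle_measure. norm (f w * k w) \<le> norm (B * cmod (f w))"
  proof (rule AE_I2)
    fix w assume "w \<in> space circle_measure"
    then have k: "cmod (k w) \<le> B" using assms by auto
    then have "0 \<le> B" using norm_ge_zero order_trans by blast
    then show "norm (f w * k w) \<le> norm (B * cmod (f w))"
      using mult_left_mono[OF k, of "cmod (f w)"] by (simp add: norm_mult mult.commute)
  qed
qed (use assms in measurable)

lemma integrable_herglotz:
  assumes "integrable circle_measure f" "cmod \<zeta> < 1"
  shows "integrable circle_measure (\<lambda>w. f w * ((w + \<zeta>) / (w - \<zeta>)))"
  by (rule integrable_mult_bounded[OF assms(1) continuous_imp_measurable_circle])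
     (use continuous_on_herglotz_kernel herglotz_kernel_bound assms in auto)

lemma herglotz_add:
  "integrable circle_measure f \<Longrightarrow> integrable circle_measure g \<Longrightarrow> cmod \<zeta> < 1 \<Longrightarrow>
    herglotz (\<lambda>w. f w + g w) \<zeta> = herglotz f \<zeta> + herglotz g \<zeta>"
  unfolding herglotz_def distrib_right
  by (intro Bochner_Integration.integral_add integrable_herglotz)

lemma herglotz_diff:
  "integrable circle_measure f \<Longrightarrow> integrable circle_measure g \<Longrightarrow> cmod \<zeta> < 1 \<Longrightarrow>
    herglotz (\<lambda>w. f w - g w) \<zeta> = herglotz f \<zeta> - herglotz g \<zeta>"
  unfolding herglotz_def left_diff_distrib
  by (intro Bochner_Integration.integral_diff integrable_herglotz)

lemma herglotz_cmult: "herglotz (\<lambda>w. c * f w) \<zeta> = c * herglotz f \<zeta>"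
  unfolding herglotz_def mult.assoc by (rule integral_mult_right_zero)

lemma herglotz_0: "herglotz f 0 = (\<integral>w. f w \<partial>circle_measure)"
  unfolding herglotz_def by (rule Bochner_Integration.integral_cong) auto

text \<open>The kernel is \<open>1\<close> plus twice the geometric series in
  \<open>\<zeta> / w\<close> without its constant term. It is dominated by a convergent series
  uniformly in \<open>w\<close>, so integration term by term gives a power series in
  \<open>\<zeta>\<close>.\<close>

lemma herglotz_holomorphic:
  assumes f: "integrable circle_measure f"
  shows "herglotz f holomorphic_on ball 0 1"
proof (rule power_series_holomorphic)
  fix \<zeta> :: complex assume "\<zeta> \<in> ball 0 1"
  then have \<zeta>: "cmod \<zeta> < 1" by simp
  define c where "c n w = 2 * (1 / w) ^ n - (if n = 0 then 1 else 0)" for n and w :: complex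
  have cm: "c n \<in> borel_measurable circle_measure" for n
    unfolding c_def by (rule continuous_imp_measurable_circle) (auto intro!: continuous_intros)
  have cb: "cmod (c n w) \<le> 3" if "cmod w = 1" for n w
    using norm_triangle_ineq4[of "2 * (1 / w) ^ n" "if n = 0 then 1 else 0"] that
    by (auto simp: c_def norm_mult norm_power norm_divide split: if_splits)
  define t where "t n w = f w * (c n w * \<zeta> ^ n)" for n w
  have it: "integrable circle_measure (t n)" for n
    unfolding t_def
  proof (rule integrable_mult_bounded[OF f])
    show "(\<lambda>w. c n w * \<zeta> ^ n) \<in> borel_measurable circle_measure" using cm by measurable
    show "cmod (c n w * \<zeta> ^ n) \<le> 3 * cmod \<zeta> ^ n" if "cmod w = 1" for w
      using cb[OF that, of n] by (simp add: norm_mult norm_power mult_right_mono)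
  qed
  have tb: "norm (t n w) \<le> 3 * cmod (f w) * cmod \<zeta> ^ n" if "cmod w = 1" for n w
  proof -
    have "cmod (f w) * (cmod (c n w) * cmod \<zeta> ^ n) \<le> cmod (f w) * (3 * cmod \<zeta> ^ n)"
      using cb[OF that, of n] by (intro mult_left_mono mult_right_mono) auto
    then show ?thesis by (simp add: t_def norm_mult norm_power mult_ac)
  qed
  have sg: "summable (\<lambda>n. C * cmod \<zeta> ^ n)" for C
    using \<zeta> by (intro summable_mult summable_geometric) auto
  have sums: "(\<lambda>n. t n w) sums (f w * ((w + \<zeta>) / (w - \<zeta>)))" if w: "cmod w = 1" for w
  proof -
    have w0: "w \<noteq> 0" "w \<noteq> \<zeta>" using w \<zeta> by auto
    have "(\<lambda>n. (\<zeta> / w) ^ n) sums (1 / (1 - \<zeta> / w))"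
      using w \<zeta> by (intro geometric_sums) (simp add: norm_divide)
    then have "(\<lambda>n. 2 * (\<zeta> / w) ^ n - (if n = 0 then 1 else 0)) sums (2 * (1 / (1 - \<zeta> / w)) - 1)"
      by (intro sums_diff sums_mult sums_single[of 0 "\<lambda>_. 1"])
    also have "2 * (1 / (1 - \<zeta> / w)) - 1 = (w + \<zeta>) / (w - \<zeta>)"
      using w0 by (simp add: field_simps)
    finally have "(\<lambda>n. f w * (2 * (\<zeta> / w) ^ n - (if n = 0 then 1 else 0))) sums (f w * ((w + \<zeta>) / (w - \<zeta>)))"
      by (rule sums_mult)
    moreover have "2 * (\<zeta> / w) ^ n - (if n = 0 then 1 else 0) = c n w * \<zeta> ^ n" for n
      by (simp add: c_def power_divide)
    ultimately show ?thesis by (simp add: t_def)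
  qed
  have "(\<lambda>n. \<integral>w. t n w \<partial>circle_measure) sums (\<integral>w. (\<Sum>n. t n w) \<partial>circle_measure)"
  proof (rule sums_integral[OF it])
    show "AE w in circle_measure. summable (\<lambda>n. norm (t n w))"
      by (rule AE_I2, rule summable_comparison_test'[OF sg, of _ _ "3 * cmod (f _)"]) (use tb in auto)
    show "summable (\<lambda>n. \<integral>w. norm (t n w) \<partial>circle_measure)"
    proof (rule summable_comparison_test'[OF sg])
      fix n
      have "(\<integral>w. norm (t n w) \<partial>circle_measure) \<le> (\<integral>w. 3 * cmod (f w) * cmod \<zeta> ^ n \<partial>circle_measure)"
        by (rule integral_mono) (use it f tb in auto)
      also have "\<dots> = (\<integral>w. 3 * cmod (f w) \<partial>circle_measure) * cmod \<zeta> ^ n"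
        by (rule integral_mult_left_zero)
      finally show "norm (\<integral>w. norm (t n w) \<partial>circle_measure) \<le> (\<integral>w. 3 * cmod (f w) \<partial>circle_measure) * cmod \<zeta> ^ n"
        by simp
    qed
  qed
  also have "(\<integral>w. (\<Sum>n. t n w) \<partial>circle_measure) = herglotz f \<zeta>"
    unfolding herglotz_def by (rule Bochner_Integration.integral_cong) (use sums in \<open>auto simp: sums_iff\<close>)
  also have "(\<lambda>n. \<integral>w. t n w \<partial>circle_measure)
      = (\<lambda>n. (\<integral>w. f w * (2 * (1 / w) ^ n - (if n = 0 then 1 else 0)) \<partial>circle_measure) * (\<zeta> - 0) ^ n)"
    by (simp add: t_def c_def mult.assoc[symmetric])
  finally show "(\<lambda>n. (\<integral>w. f w * (2 * (1 / w) ^ n - (if n = 0 then 1 else 0)) \<partial>circle_measure) * (\<zeta> - 0) ^ n)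
      sums herglotz f \<zeta>" .
qed

lemma Re_herglotz:
  assumes "integrable circle_measure g" "cmod \<zeta> < 1"
  shows "Re (herglotz (\<lambda>w. complex_of_real (g w)) \<zeta>) = (\<integral>w. g w * poisson_kernel \<zeta> w \<partial>circle_measure)"
proof -
  have "Re (herglotz (\<lambda>w. complex_of_real (g w)) \<zeta>)
    = (\<integral>w. Re (complex_of_real (g w) * ((w + \<zeta>) / (w - \<zeta>))) \<partial>circle_measure)"
    unfolding herglotz_def
    by (rule integral_Re[symmetric]) (use assms integrable_herglotz[of "\<lambda>w. complex_of_real (g w)"] in auto)
  moreover have "Re (complex_of_real (g w) * ((w + \<zeta>) / (w - \<zeta>))) = g w * poisson_kernel \<zeta> w" for w
    unfolding poisson_kernel_def by (metis Re_complex_of_real Im_complex_of_real mult_zero_left diff_zero times_complex.sel(1))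
  ultimately show ?thesis by simp
qed

lemma integrable_poisson:
  assumes "integrable circle_measure (g :: complex \<Rightarrow> real)" "cmod \<zeta> < 1"
  shows "integrable circle_measure (\<lambda>w. g w * poisson_kernel \<zeta> w)"
proof -
  have "integrable circle_measure (\<lambda>w. Re (complex_of_real (g w) * ((w + \<zeta>) / (w - \<zeta>))))"
    by (rule integrable_Re) (use assms integrable_herglotz[of "\<lambda>w. complex_of_real (g w)"] in auto)
  moreover have "Re (complex_of_real (g w) * ((w + \<zeta>) / (w - \<zeta>))) = g w * poisson_kernel \<zeta> w" for w
    unfolding poisson_kernel_def by (metis Re_complex_of_real Im_complex_of_real mult_zero_left diff_zero times_complex.sel(1))
  ultimately show ?thesis by simp
qed

text \<open>The Poisson kernel is nonnegative with integral \<open>1\<close>, so the real part of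
  the transform is a weighted mean of \<open>g\<close>.\<close>

lemma Re_herglotz_ge:
  assumes "integrable circle_measure g" "cmod \<zeta> < 1" "\<And>w. cmod w = 1 \<Longrightarrow> m \<le> g w"
  shows "m \<le> Re (herglotz (\<lambda>w. complex_of_real (g w)) \<zeta>)"
proof -
  have P: "integrable circle_measure (poisson_kernel \<zeta>)"
    by (rule integrable_circle_continuous[OF continuous_on_poisson_kernel[OF assms(2)]])
  have "m = (\<integral>w. m * poisson_kernel \<zeta> w \<partial>circle_measure)"
    using integral_poisson_kernel[OF assms(2)] by simp
  also have "\<dots> \<le> (\<integral>w. g w * poisson_kernel \<zeta> w \<partial>circle_measure)"
    by (rule integral_mono) (use P integrable_poisson assms poisson_kernel_nonneg in \<open>auto intro!: mult_right_mono\<close>)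
  finally show ?thesis using Re_herglotz assms by simp
qed

lemma Re_herglotz_bounds:
  assumes "integrable circle_measure g" "cmod \<zeta> < 1" "\<And>w. cmod w = 1 \<Longrightarrow> m \<le> g w \<and> g w \<le> B"
  shows "m \<le> Re (herglotz (\<lambda>w. complex_of_real (g w)) \<zeta>)"
    and "Re (herglotz (\<lambda>w. complex_of_real (g w)) \<zeta>) \<le> B"
proof -
  show "m \<le> Re (herglotz (\<lambda>w. complex_of_real (g w)) \<zeta>)"
    by (rule Re_herglotz_ge) (use assms in auto)
  have P: "integrable circle_measure (poisson_kernel \<zeta>)"
    by (rule integrable_circle_continuous[OF continuous_on_poisson_kernel[OF assms(2)]])
  have "(\<integral>w. g w * poisson_kernel \<zeta> w \<partial>circle_measure) \<le> (\<integral>w. B * poisson_kernel \<zeta> w \<partial>circle_measure)"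
    by (rule integral_mono) (use P integrable_poisson assms poisson_kernel_nonneg in \<open>auto intro!: mult_right_mono\<close>)
  also have "\<dots> = B" using integral_poisson_kernel[OF assms(2)] by simp
  finally show "Re (herglotz (\<lambda>w. complex_of_real (g w)) \<zeta>) \<le> B"
    using Re_herglotz assms by simp
qed

section \<open>Distribution and maximal estimates on circles of radius below 1\<close>

lemma mean_value_radius:
  assumes F: "F holomorphic_on ball 0 1" and r: "0 \<le> r" "r < 1"
  shows "(\<integral>w. F (of_real r * w) \<partial>circle_measure) = F 0"
proof -
  define S where "S = (\<lambda>w. complex_of_real r * w) -` ball 0 1"
  have "(\<lambda>w. F (of_real r * w)) holomorphic_on S"
    unfolding S_def by (rule holomorphic_on_compose_gen[OF _ F, unfolded o_def]) (auto intro!: holomorphic_intros)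
  moreover have "open S"
    unfolding S_def by (rule open_vimage) (auto intro!: continuous_intros)
  moreover have "cball 0 1 \<subseteq> S"
  proof
    fix w :: complex assume "w \<in> cball 0 1"
    then have "r * cmod w \<le> r * 1" using r by (intro mult_left_mono) auto
    then show "w \<in> S" using r by (simp add: S_def norm_mult)
  qed
  ultimately have "(\<integral>w. F (of_real r * w) \<partial>circle_measure) = F (of_real r * 0)"
    by (rule mean_value_circle)
  then show ?thesis by simp
qed

lemma cmod_radius_less: "cmod w = 1 \<Longrightarrow> 0 \<le> r \<Longrightarrow> r < 1 \<Longrightarrow> cmod (complex_of_real r * w) < 1"
  by (simp add: norm_mult)

lemma continuous_on_radius:
  assumes F: "continuous_on (ball 0 1) F" and r: "0 \<le> r" "r < 1"
  shows "continuous_on (sphere 0 1) (\<lambda>w. F (complex_of_real r * w))"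
  by (rule continuous_on_compose2[OF F]) (use r in \<open>auto intro!: continuous_intros simp: norm_mult\<close>)

text \<open>Kolmogorov's weak type estimate: \<open>Re (2F/(F+l)) \<ge> 1\<close> exactly where \<open>|F| \<ge> l\<close>.\<close>
lemma weak_type_right_half_plane:
  assumes F: "F holomorphic_on ball 0 1" and Re: "\<And>\<zeta>. cmod \<zeta> < 1 \<Longrightarrow> 0 \<le> Re (F \<zeta>)"
    and r: "0 \<le> r" "r < 1" and l: "l > 0"
  shows "measure circle_measure {z \<in> space circle_measure. l \<le> cmod (F (of_real r * z))} \<le> 2 * cmod (F 0) / l"
proof -
  define \<phi> where "\<phi> \<zeta> = 2 * F \<zeta> / (F \<zeta> + of_real l)" for \<zeta>
  have nz: "F \<zeta> + of_real l \<noteq> 0" "l \<le> cmod (F \<zeta> + of_real l)" if "cmod \<zeta> < 1" for \<zeta>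
  proof -
    have "l \<le> Re (F \<zeta> + of_real l)" using Re[OF that] by simp
    also have "\<dots> \<le> cmod (F \<zeta> + of_real l)" by (rule complex_Re_le_cmod)
    finally show "l \<le> cmod (F \<zeta> + of_real l)" .
    then show "F \<zeta> + of_real l \<noteq> 0" using l by auto
  qed
  have hol: "\<phi> holomorphic_on ball 0 1"
    unfolding \<phi>_def by (intro holomorphic_intros F) (use nz in auto)
  have Re\<phi>: "Re (\<phi> \<zeta>) = 2 * ((cmod (F \<zeta>))\<^sup>2 + l * Re (F \<zeta>)) / (cmod (F \<zeta> + of_real l))\<^sup>2" if "cmod \<zeta> < 1" for \<zeta>
    unfolding \<phi>_def by (simp add: Re_divide cmod_power2) (simp add: power2_eq_square algebra_simps)
  have pos: "0 \<le> Re (\<phi> \<zeta>)" if "cmod \<zeta> < 1" for \<zeta>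
    using Re[OF that] l by (simp add: Re\<phi>[OF that])
  have one: "1 \<le> Re (\<phi> \<zeta>)" if "cmod \<zeta> < 1" "l \<le> cmod (F \<zeta>)" for \<zeta>
  proof -
    have "l\<^sup>2 \<le> (cmod (F \<zeta>))\<^sup>2" using that l by (intro power_mono) auto
    moreover have "(cmod (F \<zeta> + of_real l))\<^sup>2 = (cmod (F \<zeta>))\<^sup>2 + 2 * l * Re (F \<zeta>) + l\<^sup>2"
      unfolding cmod_power2 by (simp add: power2_eq_square algebra_simps)
    moreover have "0 < (cmod (F \<zeta> + of_real l))\<^sup>2" using nz(1)[OF that(1)] by simp
    ultimately show ?thesis
      unfolding Re\<phi>[OF that(1)] by (simp add: pos_le_divide_eq)
  qed
  have cont: "continuous_on (sphere 0 1) (\<lambda>z. \<phi> (of_real r * z))"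
    by (rule continuous_on_radius[OF holomorphic_on_imp_continuous_on[OF hol] r])
  have contF: "continuous_on (sphere 0 1) (\<lambda>z. F (of_real r * z))"
    by (rule continuous_on_radius[OF holomorphic_on_imp_continuous_on[OF F] r])
  have [measurable]: "(\<lambda>z. F (of_real r * z)) \<in> borel_measurable circle_measure"
    by (rule continuous_imp_measurable_circle[OF contF])
  have int: "integrable circle_measure (\<lambda>z. Re (\<phi> (of_real r * z)))"
    using integrable_circle_continuous[OF cont] by simp
  have lt: "cmod (complex_of_real r * z) < 1" if "cmod z = 1" for z
    using r that by (simp add: norm_mult)
  have "measure circle_measure {z \<in> space circle_measure. l \<le> cmod (F (of_real r * z))}
    = (\<integral>z. indicator {z \<in> space circle_measure. l \<le> cmod (F (of_real r * z))} z \<partial>circle_measure)"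
    by (auto intro!: arg_cong[where f = "measure circle_measure"])
  also have "\<dots> \<le> (\<integral>z. Re (\<phi> (of_real r * z)) \<partial>circle_measure)"
  proof (rule integral_mono)
    show "integrable circle_measure (indicat_real {z \<in> space circle_measure. l \<le> cmod (F (complex_of_real r * z))})"
      by (rule integrable_real_indicator) (measurable, simp add: circle.emeasure_eq_measure)
  qed (use int one pos lt in \<open>auto simp: indicator_def\<close>)
  also have "\<dots> = Re (\<integral>z. \<phi> (of_real r * z) \<partial>circle_measure)"
    by (rule integral_Re) (rule integrable_circle_continuous[OF cont])
  also have "\<dots> = Re (\<phi> 0)" by (simp only: mean_value_radius[OF hol r])
  also have "\<dots> \<le> cmod (\<phi> 0)" by (rule complex_Re_le_cmod)
  also have "\<dots> = 2 * cmod (F 0) / cmod (F 0 + of_real l)"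
    by (simp add: \<phi>_def norm_divide norm_mult)
  also have "\<dots> \<le> 2 * cmod (F 0) / l"
    using nz[of 0] l by (intro divide_left_mono) auto
  finally show ?thesis .
qed

lemma cos_ge: "1 - x\<^sup>2 / 2 \<le> cos x" for x :: real
proof -
  have "\<bar>sin (x/2)\<bar> \<le> \<bar>x/2\<bar>" by (rule abs_sin_x_le_abs_x)
  then have "(sin (x/2))\<^sup>2 \<le> (x/2)\<^sup>2" by (simp only: abs_le_square_iff)
  then show ?thesis using cos_double_sin[of "x/2"] by (simp add: power_divide)
qed

text \<open>The mean value property of \<open>cos F\<close>, whose real part is \<open>cos (Re F) cosh (Im F)\<close>.\<close>
lemma cosh_estimate:
  assumes F: "F holomorphic_on ball 0 1" and Re: "\<And>\<zeta>. cmod \<zeta> < 1 \<Longrightarrow> 0 \<le> Re (F \<zeta>) \<and> Re (F \<zeta>) \<le> 1"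
    and F0: "Im (F 0) = 0" and r: "0 \<le> r" "r < 1" and l: "l \<ge> 0" "cosh l > 1"
  shows "measure circle_measure {z \<in> space circle_measure. l \<le> \<bar>Im (F (of_real r * z))\<bar>}
    \<le> Re (F 0) / (cosh l - 1)"
proof -
  define A B where "A z = Re (F (of_real r * z))" and "B z = Im (F (of_real r * z))" for z
  have contF: "continuous_on (sphere 0 1) (\<lambda>z. F (of_real r * z))"
    by (rule continuous_on_radius[OF holomorphic_on_imp_continuous_on[OF F] r])
  have cA: "continuous_on (sphere 0 1) A" and cB: "continuous_on (sphere 0 1) B"
    unfolding A_def B_def by (intro continuous_intros contF)+
  have [measurable]: "B \<in> borel_measurable circle_measure"
    by (rule continuous_imp_measurable_circle[OF cB])
  have cch: "continuous_on (sphere 0 1) (\<lambda>z. cosh (B z))"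
    unfolding cosh_field_def by (intro continuous_intros cB) auto
  have A: "0 \<le> A z" "A z \<le> 1" if "cmod z = 1" for z
    using Re[OF cmod_radius_less[OF that r]] by (auto simp: A_def)
  have [measurable]: "(\<lambda>z. cosh (B z)) \<in> borel_measurable circle_measure"
    by (rule continuous_imp_measurable_circle[OF cch])
  have hol: "(\<lambda>\<zeta>. cos (F \<zeta>)) holomorphic_on ball 0 1" by (intro holomorphic_intros F)
  have Recos: "Re (cos (F (of_real r * z))) = cos (A z) * cosh (B z)" for z
    by (simp add: Re_cos A_def B_def cosh_field_def)
  have "(\<integral>z. cos (A z) * cosh (B z) \<partial>circle_measure) = Re (\<integral>z. cos (F (of_real r * z)) \<partial>circle_measure)"
    unfolding Recos[symmetric]
    by (rule integral_Re) (auto intro!: integrable_circle_continuous continuous_intros contF)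
  also have "\<dots> = Re (cos (F 0))"
    using mean_value_radius[OF hol r] by simp
  also have "\<dots> \<le> 1"
    using F0 by (simp add: Re_cos)
  finally have 1: "(\<integral>z. cos (A z) * cosh (B z) \<partial>circle_measure) \<le> 1" .
  have ReF: "(\<integral>z. A z \<partial>circle_measure) = Re (F 0)"
    unfolding A_def using mean_value_radius[OF F r]
    by (subst integral_Re) (auto intro!: integrable_circle_continuous contF)
  \<comment> \<open>As \<open>A z\<close> lies in \<open>{0..1}\<close>, \<open>cos (A z)\<close> is
    at least \<open>1 - A z / 2\<close>, hence at least \<open>1/2\<close>. Splitting off
    \<open>cos A\<close> before bounding keeps the estimate proportional to the mean of
    \<open>A\<close>, that is to \<open>Re (F 0)\<close>; bounding \<open>cos A\<close> by a
    constant at once would lose this.\<close>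
  have pt: "(cosh (B z) - 1) / 2 \<le> cos (A z) * cosh (B z) - (1 - A z / 2)" if "cmod z = 1" for z
  proof -
    have "(A z)\<^sup>2 \<le> A z * 1" unfolding power2_eq_square using A[OF that] by (intro mult_left_mono) auto
    then have c: "1 - A z / 2 \<le> cos (A z)" using cos_ge[of "A z"] by linarith
    have "1/2 \<le> cos (A z)" using c A[OF that] by linarith
    moreover have "1 \<le> cosh (B z)" by (rule cosh_real_ge_1)
    ultimately have "1/2 * (cosh (B z) - 1) \<le> cos (A z) * (cosh (B z) - 1)"
      by (intro mult_right_mono) auto
    then show ?thesis using c by (simp add: algebra_simps)
  qed
  have i1: "integrable circle_measure (\<lambda>z. (cosh (B z) - 1) / 2)"
    and i2: "integrable circle_measure (\<lambda>z. cos (A z) * cosh (B z))"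
    and i3: "integrable circle_measure (\<lambda>z. 1 - A z / 2)"
    and i4: "integrable circle_measure (\<lambda>z. A z)"
    by (auto intro!: integrable_circle_continuous continuous_intros cA cch)
  have "(\<integral>z. (cosh (B z) - 1) / 2 \<partial>circle_measure)
    \<le> (\<integral>z. cos (A z) * cosh (B z) - (1 - A z / 2) \<partial>circle_measure)"
    by (rule integral_mono) (use i1 i2 i3 pt in auto)
  also have "\<dots> = (\<integral>z. cos (A z) * cosh (B z) \<partial>circle_measure) - (\<integral>z. 1 - A z / 2 \<partial>circle_measure)"
    by (rule Bochner_Integration.integral_diff[OF i2 i3])
  also have "(\<integral>z. 1 - A z / 2 \<partial>circle_measure) = 1 - Re (F 0) / 2"
    using i4 ReF by (subst Bochner_Integration.integral_diff) auto
  finally have "(\<integral>z. (cosh (B z) - 1) / 2 \<partial>circle_measure) \<le> Re (F 0) / 2" using 1 by linarith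
  then have 2: "(\<integral>z. cosh (B z) - 1 \<partial>circle_measure) \<le> Re (F 0)" by simp
  have i5: "integrable circle_measure (\<lambda>z. cosh (B z) - 1)"
    by (auto intro!: integrable_circle_continuous continuous_intros cch)
  have "measure circle_measure {z \<in> space circle_measure. l \<le> \<bar>B z\<bar>}
    \<le> measure circle_measure {z \<in> space circle_measure. cosh l - 1 \<le> cosh (B z) - 1}"
  proof (rule circle.finite_measure_mono)
    show "{z \<in> space circle_measure. cosh l - 1 \<le> cosh (B z) - 1} \<in> sets circle_measure"
      by measurable
    show "{z \<in> space circle_measure. l \<le> \<bar>B z\<bar>} \<subseteq> {z \<in> space circle_measure. cosh l - 1 \<le> cosh (B z) - 1}"
    proof safe
      fix z assume "l \<le> \<bar>B z\<bar>"
      then have "cosh l \<le> cosh \<bar>B z\<bar>" using l by (intro cosh_real_nonneg_le_iff[THEN iffD2]) auto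
      then show "cosh l - 1 \<le> cosh (B z) - 1" by (simp add: cosh_real_abs)
    qed
  qed
  also have "\<dots> \<le> (\<integral>z. cosh (B z) - 1 \<partial>circle_measure) / (cosh l - 1)"
    by (rule integral_Markov_inequality_measure[where A = "{}", simplified])
       (use i5 l cosh_real_ge_1 in auto)
  also have "\<dots> \<le> Re (F 0) / (cosh l - 1)"
    using 2 l by (intro divide_right_mono) auto
  finally show ?thesis by (simp add: B_def)
qed

text \<open>The maximal function of the square root of \<open>F\<close>, which is in \<open>H\<^sup>1\<close>.\<close>
lemma maximal_right_half_plane:
  assumes F: "F holomorphic_on ball 0 1" and Re: "\<And>\<zeta>. cmod \<zeta> < 1 \<Longrightarrow> 0 < Re (F \<zeta>)"
    and l: "l > 0"
  obtains E where "E \<in> sets circle_measure" "measure circle_measure E \<le> 120 * sqrt (cmod (F 0) / l)"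
    "\<And>z r. cmod z = 1 \<Longrightarrow> z \<notin> E \<Longrightarrow> 0 \<le> r \<Longrightarrow> r < 1 \<Longrightarrow> cmod (F (of_real r * z)) \<le> l"
proof -
  define G where "G \<zeta> = csqrt (F \<zeta>)" for \<zeta>
  have slit: "F \<zeta> \<notin> \<real>\<^sub>\<le>\<^sub>0" if "cmod \<zeta> < 1" for \<zeta>
    using Re[OF that] by (auto simp: complex_nonpos_Reals_iff)
  have G: "G holomorphic_on ball 0 1"
    unfolding G_def by (intro holomorphic_intros F) (use slit in auto)
  have contG: "continuous_on (ball 0 1) G" by (rule holomorphic_on_imp_continuous_on[OF G])
  have GG: "(G \<zeta>)\<^sup>2 = F \<zeta>" for \<zeta> by (simp add: G_def)
  have normG: "(cmod (G \<zeta>))\<^sup>2 = cmod (F \<zeta>)" for \<zeta> by (simp add: GG norm_power[symmetric])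
  \<comment> \<open>Square roots of points of the right half plane lie in the sector of half angle
    \<open>pi / 4\<close>. There the modulus is controlled by the real part, whose mean over a
    circle is known exactly.\<close>
  have ReG: "cmod (G \<zeta>) \<le> 2 * Re (G \<zeta>)" if "cmod \<zeta> < 1" for \<zeta>
  proof -
    have "(Re (G \<zeta>))\<^sup>2 - (Im (G \<zeta>))\<^sup>2 = Re (F \<zeta>)"
      by (simp add: GG[symmetric] power2_eq_square)
    then have "(Im (G \<zeta>))\<^sup>2 \<le> (Re (G \<zeta>))\<^sup>2" using Re[OF that] by linarith
    then have "\<bar>Im (G \<zeta>)\<bar> \<le> \<bar>Re (G \<zeta>)\<bar>" by (simp only: abs_le_square_iff)
    moreover have "0 \<le> Re (G \<zeta>)" unfolding G_def using csqrt_principal by (metis less_eq_real_def)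
    ultimately show ?thesis using cmod_le[of "G \<zeta>"] by linarith
  qed
  \<comment> \<open>These are the points whose radius meets \<open>sqrt l \<le> |G|\<close> before
    \<open>R\<close>. Stopping at \<open>R < 1\<close> makes the set a projection of a compact set,
    hence compact, as \<open>maximal_weak_type\<close> demands.\<close>
  define K where "K R = {z \<in> sphere 0 1. \<exists>\<rho>\<in>{0..R}. sqrt l \<le> cmod (G (of_real \<rho> * z))}" for R :: real
  have compK: "compact (K R)" if R: "0 \<le> R" "R < 1" for R
  proof -
    define T where "T = (sphere 0 1 \<times> {0..R}) \<inter> (\<lambda>p. cmod (G (of_real (snd p) * fst p))) -` {sqrt l..}"
    have lt: "cmod (complex_of_real (snd p) * fst p) < 1" if "p \<in> sphere 0 1 \<times> {0..R}" for p
      using that R by (auto simp: norm_mult)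
    have "continuous_on (sphere 0 1 \<times> {0..R}) (\<lambda>p. cmod (G (of_real (snd p) * fst p)))"
      by (intro continuous_intros continuous_on_compose2[OF contG]) (use lt in auto)
    then have "closed T"
      unfolding T_def by (rule continuous_closed_preimage) (auto intro: closed_Times)
    moreover have "compact (sphere (0::complex) 1 \<times> {0..R})" by (intro compact_Times) auto
    ultimately have "compact ((sphere 0 1 \<times> {0..R}) \<inter> T)" by (intro compact_Int_closed)
    then have "compact T" by (simp add: T_def)
    then have "compact (fst ` T)" by (intro compact_continuous_image continuous_intros)
    also have "fst ` T = K R" by (force simp: T_def K_def)
    finally show ?thesis .
  qed
  have Kmeas: "K R \<in> sets circle_measure" if "0 \<le> R" "R < 1" for R
  proof -
    have "sphere 0 1 \<inter> K R \<in> sets circle_measure"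
      by (rule closed_Int_sphere_sets) (use compK that compact_imp_closed in blast)
    moreover have "sphere 0 1 \<inter> K R = K R" by (auto simp: K_def)
    ultimately show ?thesis by simp
  qed
  have bound: "measure circle_measure (K R) \<le> 120 * sqrt (cmod (F 0) / l)" if R: "0 \<le> R" "R < 1" for R
  proof -
    \<comment> \<open>Rescaled from the intermediate radius \<open>R'\<close>, the function
      \<open>G\<close> is holomorphic across the closed unit disc, so the Poisson formula reproduces
      its values at radii up to \<open>R\<close> from those at radius \<open>R'\<close>.\<close>
    define R' where "R' = (1 + R) / 2"
    have R': "0 < R'" "R' < 1" "R < R'" using R by (auto simp: R'_def)
    define v where "v w = cmod (G (of_real R' * w))" for w
    have contv: "continuous_on (sphere 0 1) (\<lambda>w. G (of_real R' * w))"
      by (rule continuous_on_radius[OF contG]) (use R' in auto)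
    have iv: "integrable circle_measure v"
      unfolding v_def by (intro integrable_circle_continuous continuous_intros contv)
    have "(\<integral>w. v w \<partial>circle_measure) \<le> (\<integral>w. 2 * Re (G (of_real R' * w)) \<partial>circle_measure)"
    proof (rule integral_mono[OF iv])
      show "integrable circle_measure (\<lambda>w. 2 * Re (G (of_real R' * w)))"
        by (intro integrable_circle_continuous continuous_intros contv)
      show "v w \<le> 2 * Re (G (of_real R' * w))" if "w \<in> space circle_measure" for w
        unfolding v_def using that R' by (intro ReG) (auto simp: norm_mult)
    qed
    also have "\<dots> = 2 * Re (\<integral>w. G (of_real R' * w) \<partial>circle_measure)"
      using integral_Re[OF integrable_circle_continuous[OF contv]] by simp
    also have "\<dots> = 2 * Re (G 0)" using mean_value_radius[OF G] R' by simp
    also have "\<dots> \<le> 2 * sqrt (cmod (F 0))"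
      using complex_Re_le_cmod[of "G 0"] normG[of 0] real_le_rsqrt by (auto simp flip: normG)
    finally have v1: "(\<integral>w. v w \<partial>circle_measure) \<le> 2 * sqrt (cmod (F 0))" .
    define S where "S = (\<lambda>w. complex_of_real R' * w) -` ball 0 1"
    have "(\<lambda>w. G (of_real R' * w)) holomorphic_on S"
      unfolding S_def by (rule holomorphic_on_compose_gen[OF _ G, unfolded o_def]) (auto intro!: holomorphic_intros)
    moreover have "open S"
      unfolding S_def by (rule open_vimage) (auto intro!: continuous_intros)
    moreover have "cball 0 1 \<subseteq> S"
    proof
      fix w :: complex assume "w \<in> cball 0 1"
      then have "R' * cmod w \<le> R' * 1" using R' by (intro mult_left_mono) auto
      then have "R' * cmod w < 1" using R' by linarith
      then show "w \<in> S" using R' by (simp add: S_def norm_mult)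
    qed
    ultimately have pf: "(\<integral>w. G (of_real R' * w) * of_real (poisson_kernel \<zeta> w) \<partial>circle_measure) = G (of_real R' * \<zeta>)"
      if "cmod \<zeta> < 1" for \<zeta>
      using poisson_formula[of "\<lambda>w. G (of_real R' * w)" S \<zeta>] that by blast
    \<comment> \<open>Halving the level makes the contradiction strict: if all averages of
      \<open>v\<close> over arcs at \<open>z\<close> were at most \<open>sqrt l / 2\<close>, so
      would be \<open>|G|\<close> at the chosen point of the radius. With the mean of
      \<open>v\<close> at most \<open>2 * sqrt (cmod (F 0))\<close> this produces
      \<open>2 * 30 * 2 = 120\<close>.\<close>
    have "(sqrt l / 2) * measure circle_measure (K R) \<le> 30 * (\<integral>w. v w \<partial>circle_measure)"
    proof (rule maximal_weak_type[OF iv])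
      show "0 \<le> v w" for w by (simp add: v_def)
      show "compact (K R)" by (rule compK[OF R])
      show "K R \<subseteq> sphere 0 1" by (auto simp: K_def)
      show "sqrt l / 2 > 0" using l by simp
      fix z assume z: "z \<in> K R"
      show "\<exists>\<delta>>0. sqrt l / 2 * measure circle_measure (sphere 0 1 \<inter> ball z \<delta>)
        < (\<integral>w. indicator (ball z \<delta>) w * v w \<partial>circle_measure)"
      proof (rule ccontr)
        assume "\<not> ?thesis"
        then have nb: "(\<integral>w. indicator (ball z \<delta>) w * v w \<partial>circle_measure)
            \<le> sqrt l / 2 * measure circle_measure (sphere 0 1 \<inter> ball z \<delta>)" if "\<delta> > 0" for \<delta>
          using that by (meson not_less)
        obtain \<rho> where \<rho>: "0 \<le> \<rho>" "\<rho> \<le> R" "sqrt l \<le> cmod (G (of_real \<rho> * z))" and z1: "cmod z = 1"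
          using z by (auto simp: K_def)
        define s where "s = \<rho> / R'"
        have s: "0 \<le> s" "s < 1" using \<rho> R' by (auto simp: s_def)
        have sz: "cmod (of_real s * z) < 1" using s z1 by (simp add: norm_mult)
        have "sqrt l \<le> cmod (G (of_real R' * (of_real s * z)))"
          using \<rho> R' by (simp add: s_def)
        also have "\<dots> = cmod (\<integral>w. G (of_real R' * w) * of_real (poisson_kernel (of_real s * z) w) \<partial>circle_measure)"
          by (simp only: pf[OF sz])
        also have "\<dots> \<le> (\<integral>w. cmod (G (of_real R' * w) * of_real (poisson_kernel (of_real s * z) w)) \<partial>circle_measure)"
          by (rule integral_norm_bound)
        also have "\<dots> = (\<integral>w. v w * poisson_kernel (of_real s * z) w \<partial>circle_measure)"
          by (rule Bochner_Integration.integral_cong)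
             (use poisson_kernel_nonneg[OF _ sz] in \<open>auto simp: v_def norm_mult\<close>)
        also have "\<dots> \<le> sqrt l / 2"
          by (rule poisson_le_maximal[OF iv _ z1 s nb]) (use l in \<open>auto simp: v_def\<close>)
        finally show False using l by simp
      qed
    qed
    then have "(sqrt l / 2) * measure circle_measure (K R) \<le> 60 * sqrt (cmod (F 0))" using v1 by linarith
    then show ?thesis using l by (simp add: real_sqrt_divide field_simps)
  qed
  define E where "E = (\<Union>n. K (1 - 1 / Suc n))"
  have R01: "0 \<le> 1 - 1 / real (Suc n)" "1 - 1 / real (Suc n) < 1" for n by auto
  have inc: "incseq (\<lambda>n. K (1 - 1 / Suc n))"
  proof (rule incseq_SucI)
    fix n
    have "1 - 1 / real (Suc n) \<le> 1 - 1 / real (Suc (Suc n))"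
      by (simp add: frac_le)
    then show "K (1 - 1 / Suc n) \<le> K (1 - 1 / Suc (Suc n))"
      unfolding K_def by fastforce
  qed
  show ?thesis
  proof (rule that[of E])
    show "E \<in> sets circle_measure" unfolding E_def using Kmeas[OF R01] by (intro sets.countable_UN) auto
    have "(\<lambda>n. measure circle_measure (K (1 - 1 / Suc n))) \<longlonglongrightarrow> measure circle_measure E"
      unfolding E_def by (rule circle.finite_Lim_measure_incseq) (use Kmeas[OF R01] inc in auto)
    then show "measure circle_measure E \<le> 120 * sqrt (cmod (F 0) / l)"
      by (rule LIMSEQ_le_const2) (use bound[OF R01] in blast)
    fix z r assume z: "cmod z = 1" "z \<notin> E" and r: "0 \<le> r" "r < (1::real)"
    show "cmod (F (of_real r * z)) \<le> l"
    proof (rule ccontr)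
      assume "\<not> ?thesis"
      then have "l \<le> (cmod (G (of_real r * z)))\<^sup>2" by (simp add: normG)
      then have 1: "sqrt l \<le> cmod (G (of_real r * z))" by (simp add: real_le_lsqrt real_sqrt_le_iff' real_le_rsqrt sqrt_le_D)
      obtain n where n: "1 / real (Suc n) < 1 - r" using r reals_Archimedean[of "1 - r"]
        by (auto simp: inverse_eq_divide)
      then have "z \<in> K (1 - 1 / Suc n)" using z r 1 by (auto simp: K_def)
      then show False using z by (auto simp: E_def)
    qed
  qed
qed

text \<open>Positive and negative part of \<open>g\<close> are treated separately, each shifted by
  \<open>e\<close>. The shift makes the real part strictly positive, as \<open>csqrt\<close> needs
  for holomorphy, and cancels in the difference. Each part has mean at most \<open>2 * e\<close> and
  is tested at \<open>l / 2\<close>, so it contributes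
  \<open>120 * 2 * sqrt (e / l)\<close>.\<close>

lemma maximal_herglotz:
  fixes g :: "complex \<Rightarrow> real"
  assumes g: "integrable circle_measure g" "(\<integral>w. \<bar>g w\<bar> \<partial>circle_measure) \<le> e" and e: "e > 0" and l: "l > 0"
  obtains E where "E \<in> sets circle_measure" "measure circle_measure E \<le> 480 * sqrt (e / l)"
    "\<And>z r. cmod z = 1 \<Longrightarrow> z \<notin> E \<Longrightarrow> 0 \<le> r \<Longrightarrow> r < 1 \<Longrightarrow>
        cmod (herglotz (\<lambda>w. complex_of_real (g w)) (of_real r * z)) \<le> l"
proof -
  have half: thesis_half if u: "integrable circle_measure u" "\<And>w. 0 \<le> u w" "\<And>w. u w \<le> \<bar>g w\<bar>"
    and thesis_half: "\<And>E. E \<in> sets circle_measure \<Longrightarrow> measure circle_measure E \<le> 240 * sqrt (e / l) \<Longrightarrow>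
      (\<And>z r. cmod z = 1 \<Longrightarrow> z \<notin> E \<Longrightarrow> 0 \<le> r \<Longrightarrow> r < 1 \<Longrightarrow>
        cmod (herglotz (\<lambda>w. complex_of_real (u w + e)) (of_real r * z)) \<le> l / 2) \<Longrightarrow> thesis_half"
    for u :: "complex \<Rightarrow> real" and thesis_half
  proof -
    define F where "F = herglotz (\<lambda>w. complex_of_real (u w + e))"
    have iu: "integrable circle_measure (\<lambda>w. u w + e)" using u by simp
    have hol: "F holomorphic_on ball 0 1" unfolding F_def
      by (rule herglotz_holomorphic) (simp only: complex_of_real_integrable_eq iu)
    have pos: "0 < Re (F \<zeta>)" if "cmod \<zeta> < 1" for \<zeta>
    proof -
      have "e \<le> Re (F \<zeta>)" unfolding F_def by (rule Re_herglotz_ge[OF iu that]) (use u in auto)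
      then show ?thesis using e by simp
    qed
    have "F 0 = of_real (\<integral>w. u w + e \<partial>circle_measure)"
      unfolding F_def herglotz_0 by (rule integral_complex_of_real)
    moreover have "(\<integral>w. u w + e \<partial>circle_measure) = (\<integral>w. u w \<partial>circle_measure) + e"
      using u by simp
    moreover have "(\<integral>w. u w \<partial>circle_measure) \<le> (\<integral>w. \<bar>g w\<bar> \<partial>circle_measure)"
      by (rule integral_mono) (use u g in auto)
    moreover have "0 \<le> (\<integral>w. u w \<partial>circle_measure)" using u by simp
    ultimately have F0: "cmod (F 0) \<le> 2 * e" using g e by (simp del: of_real_add)
    obtain E where E: "E \<in> sets circle_measure" "measure circle_measure E \<le> 120 * sqrt (cmod (F 0) / (l/2))"
      "\<And>z r. cmod z = 1 \<Longrightarrow> z \<notin> E \<Longrightarrow> 0 \<le> r \<Longrightarrow> r < 1 \<Longrightarrow> cmod (F (of_real r * z)) \<le> l / 2"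
      using maximal_right_half_plane[OF hol pos, of "l/2"] l by auto
    have "sqrt (cmod (F 0) / (l/2)) \<le> sqrt (4 * (e / l))"
      using F0 l by (intro real_sqrt_le_mono) (simp add: field_simps)
    also have "\<dots> = 2 * sqrt (e / l)" by (simp only: real_sqrt_mult real_sqrt_four)
    finally show ?thesis using that(4)[OF E(1)] E(2,3) unfolding F_def by simp
  qed
  have ig: "integrable circle_measure (\<lambda>w. max (g w) 0)" "integrable circle_measure (\<lambda>w. max (- g w) 0)"
    using g by auto
  obtain E1 where E1: "E1 \<in> sets circle_measure" "measure circle_measure E1 \<le> 240 * sqrt (e / l)"
      "\<And>z r. cmod z = 1 \<Longrightarrow> z \<notin> E1 \<Longrightarrow> 0 \<le> r \<Longrightarrow> r < 1 \<Longrightarrow>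
        cmod (herglotz (\<lambda>w. complex_of_real (max (g w) 0 + e)) (of_real r * z)) \<le> l / 2"
    by (rule half[OF ig(1)]) auto
  obtain E2 where E2: "E2 \<in> sets circle_measure" "measure circle_measure E2 \<le> 240 * sqrt (e / l)"
      "\<And>z r. cmod z = 1 \<Longrightarrow> z \<notin> E2 \<Longrightarrow> 0 \<le> r \<Longrightarrow> r < 1 \<Longrightarrow>
        cmod (herglotz (\<lambda>w. complex_of_real (max (- g w) 0 + e)) (of_real r * z)) \<le> l / 2"
    by (rule half[OF ig(2)]) auto
  show ?thesis
  proof (rule that[of "E1 \<union> E2"])
    show "E1 \<union> E2 \<in> sets circle_measure" using E1 E2 by auto
    show "measure circle_measure (E1 \<union> E2) \<le> 480 * sqrt (e / l)"
      using measure_Un_le[OF E1(1) E2(1)] E1 E2 by linarith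
    fix z r assume z: "cmod z = 1" "z \<notin> E1 \<union> E2" and r: "0 \<le> r" "r < (1::real)"
    have "(\<lambda>w. complex_of_real (g w))
      = (\<lambda>w. complex_of_real (max (g w) 0 + e) - complex_of_real (max (- g w) 0 + e))"
      by (auto simp: fun_eq_iff max_def)
    then have "herglotz (\<lambda>w. complex_of_real (g w)) (of_real r * z)
      = herglotz (\<lambda>w. complex_of_real (max (g w) 0 + e)) (of_real r * z)
        - herglotz (\<lambda>w. complex_of_real (max (- g w) 0 + e)) (of_real r * z)"
      by (simp only:) (rule herglotz_diff, use ig cmod_radius_less[OF z(1) r] in auto)
    then show "cmod (herglotz (\<lambda>w. complex_of_real (g w)) (of_real r * z)) \<le> l"
      using norm_triangle_ineq4 E1(3)[of z r] E2(3)[of z r] z r by (smt (verit) Un_iff field_sum_of_halves)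
  qed
qed

section \<open>Density of trigonometric polynomials\<close>

definition L1_approximable :: "(complex \<Rightarrow> real) \<Rightarrow> bool" where
  "L1_approximable g \<longleftrightarrow> integrable circle_measure g \<and>
    (\<forall>e>0. \<exists>h. continuous_on (sphere 0 1) h \<and> (\<integral>w. \<bar>g w - h w\<bar> \<partial>circle_measure) < e)"

lemma L1_approximable_limit:
  assumes g: "integrable circle_measure g"
    and ap: "\<And>e. e > 0 \<Longrightarrow> \<exists>g'. L1_approximable g' \<and> (\<integral>w. \<bar>g w - g' w\<bar> \<partial>circle_measure) < e"
  shows "L1_approximable g"
  unfolding L1_approximable_def
proof (intro conjI allI impI g)
  fix e :: real assume "e > 0"
  then obtain g' where g': "L1_approximable g'" "(\<integral>w. \<bar>g w - g' w\<bar> \<partial>circle_measure) < e/2"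
    using ap[of "e/2"] by auto
  then obtain h where h: "continuous_on (sphere 0 1) h" "(\<integral>w. \<bar>g' w - h w\<bar> \<partial>circle_measure) < e/2"
    using \<open>e > 0\<close> unfolding L1_approximable_def by (meson half_gt_zero)
  have i: "integrable circle_measure g'" "integrable circle_measure h"
    using g' h integrable_circle_continuous by (auto simp: L1_approximable_def)
  have "(\<integral>w. \<bar>g w - h w\<bar> \<partial>circle_measure) \<le> (\<integral>w. \<bar>g w - g' w\<bar> + \<bar>g' w - h w\<bar> \<partial>circle_measure)"
    by (rule integral_mono) (use g i in auto)
  also have "\<dots> = (\<integral>w. \<bar>g w - g' w\<bar> \<partial>circle_measure) + (\<integral>w. \<bar>g' w - h w\<bar> \<partial>circle_measure)"
    by (rule Bochner_Integration.integral_add) (use g i in auto)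
  finally have "(\<integral>w. \<bar>g w - h w\<bar> \<partial>circle_measure) < e" using g'(2) h(2) by linarith
  then show "\<exists>h. continuous_on (sphere 0 1) h \<and> (\<integral>w. \<bar>g w - h w\<bar> \<partial>circle_measure) < e"
    using h by blast
qed

lemma L1_approximable_sequence:
  assumes g: "integrable circle_measure g" and s: "\<And>n. L1_approximable (s n)"
    and w: "integrable circle_measure w" "\<And>n z. z \<in> sphere 0 1 \<Longrightarrow> \<bar>s n z\<bar> \<le> w z"
    and lim: "\<And>z. z \<in> sphere 0 1 \<Longrightarrow> (\<lambda>n. s n z) \<longlonglongrightarrow> g z"
  shows "L1_approximable g"
proof (rule L1_approximable_limit[OF g])
  have i: "integrable circle_measure (s n)" for n using s by (simp add: L1_approximable_def)
  have "(\<lambda>n. \<integral>z. \<bar>g z - s n z\<bar> \<partial>circle_measure) \<longlonglongrightarrow> (\<integral>z. 0 \<partial>circle_measure)"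
  proof (rule integral_dominated_convergence[where w = "\<lambda>z. \<bar>g z\<bar> + w z"])
    show "AE z in circle_measure. (\<lambda>n. \<bar>g z - s n z\<bar>) \<longlonglongrightarrow> 0"
    proof (rule AE_I2)
      fix z assume "z \<in> space circle_measure"
      then have "(\<lambda>n. \<bar>g z - s n z\<bar>) \<longlonglongrightarrow> \<bar>g z - g z\<bar>" by (intro tendsto_intros lim) simp
      then show "(\<lambda>n. \<bar>g z - s n z\<bar>) \<longlonglongrightarrow> 0" by simp
    qed
    show "AE z in circle_measure. norm \<bar>g z - s n z\<bar> \<le> \<bar>g z\<bar> + w z" for n
    proof (rule AE_I2)
      fix z assume "z \<in> space circle_measure"
      then have "\<bar>s n z\<bar> \<le> w z" using w(2) by simp
      then show "norm \<bar>g z - s n z\<bar> \<le> \<bar>g z\<bar> + w z"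
        using abs_triangle_ineq4[of "g z" "s n z"] by simp
    qed
  qed (use g i w in auto)
  then have lim0: "(\<lambda>n. \<integral>z. \<bar>g z - s n z\<bar> \<partial>circle_measure) \<longlonglongrightarrow> 0" by simp
  fix e :: real assume "e > 0"
  then have "eventually (\<lambda>n. (\<integral>z. \<bar>g z - s n z\<bar> \<partial>circle_measure) < e) sequentially"
    using lim0 by (rule order_tendstoD(2)[rotated])
  then obtain N where "(\<integral>z. \<bar>g z - s N z\<bar> \<partial>circle_measure) < e"
    using eventually_happens by (auto simp: eventually_sequentially)
  then show "\<exists>g'. L1_approximable g' \<and> (\<integral>w. \<bar>g w - g' w\<bar> \<partial>circle_measure) < e"
    using s by blast
qed

lemma L1_approximable_add:
  assumes f: "L1_approximable f" and g: "L1_approximable g"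
  shows "L1_approximable (\<lambda>z. f z + g z)"
  unfolding L1_approximable_def
proof (intro conjI allI impI)
  have i: "integrable circle_measure f" "integrable circle_measure g"
    using f g by (auto simp: L1_approximable_def)
  show "integrable circle_measure (\<lambda>z. f z + g z)" using i by simp
  fix e :: real assume "e > 0"
  then have "e/2 > 0" by simp
  then obtain h k where h: "continuous_on (sphere 0 1) h" "(\<integral>w. \<bar>f w - h w\<bar> \<partial>circle_measure) < e/2"
    and k: "continuous_on (sphere 0 1) k" "(\<integral>w. \<bar>g w - k w\<bar> \<partial>circle_measure) < e/2"
    using f g unfolding L1_approximable_def by meson
  have j: "integrable circle_measure h" "integrable circle_measure k"
    using h k integrable_circle_continuous by auto
  have "(\<integral>w. \<bar>(f w + g w) - (h w + k w)\<bar> \<partial>circle_measure)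
      \<le> (\<integral>w. \<bar>f w - h w\<bar> + \<bar>g w - k w\<bar> \<partial>circle_measure)"
    by (rule integral_mono) (use i j in auto)
  also have "\<dots> = (\<integral>w. \<bar>f w - h w\<bar> \<partial>circle_measure) + (\<integral>w. \<bar>g w - k w\<bar> \<partial>circle_measure)"
    by (rule Bochner_Integration.integral_add) (use i j in auto)
  finally have "(\<integral>w. \<bar>(f w + g w) - (h w + k w)\<bar> \<partial>circle_measure) < e"
    using h k by linarith
  moreover have "continuous_on (sphere 0 1) (\<lambda>w. h w + k w)" using h k by (intro continuous_intros)
  ultimately show "\<exists>h. continuous_on (sphere 0 1) h \<and> (\<integral>w. \<bar>f w + g w - h w\<bar> \<partial>circle_measure) < e"
    by (intro exI[of _ "\<lambda>w. h w + k w"]) blast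
qed

lemma L1_approximable_cmult:
  assumes f: "L1_approximable f"
  shows "L1_approximable (\<lambda>z. c * f z)"
proof (cases "c = 0")
  case True
  then show ?thesis by (auto simp: L1_approximable_def intro!: exI[of _ "\<lambda>_. 0"])
next
  case False
  show ?thesis
    unfolding L1_approximable_def
  proof (intro conjI allI impI)
    have i: "integrable circle_measure f" using f by (auto simp: L1_approximable_def)
    show "integrable circle_measure (\<lambda>z. c * f z)" using i by simp
    fix e :: real assume "e > 0"
    then have "e/\<bar>c\<bar> > 0" using False by simp
    then obtain h where h: "continuous_on (sphere 0 1) h" "(\<integral>w. \<bar>f w - h w\<bar> \<partial>circle_measure) < e/\<bar>c\<bar>"
      using f unfolding L1_approximable_def by meson
    have "(\<integral>w. \<bar>c * f w - c * h w\<bar> \<partial>circle_measure) = \<bar>c\<bar> * (\<integral>w. \<bar>f w - h w\<bar> \<partial>circle_measure)"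
      by (simp add: abs_mult right_diff_distrib[symmetric])
    also have "\<dots> < e" using h(2) False by (simp add: pos_less_divide_eq mult.commute)
    finally show "\<exists>h. continuous_on (sphere 0 1) h \<and> (\<integral>w. \<bar>c * f w - h w\<bar> \<partial>circle_measure) < e"
      using h(1) by (intro exI[of _ "\<lambda>w. c * h w"]) (auto intro!: continuous_intros)
  qed
qed

text \<open>Closed sets form an intersection-stable generator of the Borel sets. The indicator of a
  closed set is the limit of tent functions of the distance, and approximability passes to
  complements and to countable disjoint unions.\<close>

lemma L1_approximable_indicator:
  assumes "A \<in> sets borel"
  shows "L1_approximable (indicator A)"
proof -
  have A: "A \<in> sigma_sets UNIV (Collect closed)"
    using assms by (simp add: borel_eq_closed)
  have im: "integrable circle_measure (indicat_real B)" if "B \<in> sets borel" for B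
    by (rule integrable_circle_bounded[where B = 1])
       (use that in \<open>auto intro!: borel_imp_measurable_circle borel_measurable_indicator simp: indicator_def\<close>)
  have cont: "L1_approximable h" if "continuous_on (sphere 0 1) h" for h
    using that integrable_circle_continuous[OF that]
    by (auto simp: L1_approximable_def intro!: exI[of _ h])
  have one: "L1_approximable (\<lambda>_. 1)" by (rule cont) simp
  have bor: "B \<in> sets borel" if "B \<in> sigma_sets UNIV (Collect closed)" for B :: "complex set"
    using that by (simp add: borel_eq_closed)
  have st: "Int_stable (Collect closed :: complex set set)" by (auto simp: Int_stable_def)
  have sub: "(Collect closed :: complex set set) \<subseteq> Pow UNIV" by auto
  show ?thesis using st sub A
  proof (induction rule: sigma_sets_induct_disjoint)
    case (basic C)
    show ?case
    \<comment> \<open>\<open>infdist\<close> to the empty set is \<open>0\<close> by convention, so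
      the tents below would be constantly \<open>1\<close> there.\<close>
    proof (cases "C = {}")
      case True
      then show ?thesis using cont[of "\<lambda>_. 0"] by simp
    next
      case False
      define s where "s n z = max 0 (1 - real n * infdist z C)" for n z
      show ?thesis
      proof (rule L1_approximable_sequence[where s = s and w = "\<lambda>_. 1"])
        show "integrable circle_measure (indicat_real C)" using basic by (intro im) auto
        show "L1_approximable (s n)" for n
          unfolding s_def by (intro cont continuous_intros continuous_on_infdist)
        show "\<bar>s n z\<bar> \<le> 1" for n z by (simp add: s_def infdist_nonneg)
        show "(\<lambda>n. s n z) \<longlonglongrightarrow> indicat_real C z" for z
        proof (cases "z \<in> C")
          case True
          then show ?thesis by (simp add: s_def)
        next
          case z: False
          then have pos: "infdist z C > 0"
            using basic False by (metis infdist_pos_not_in_closed mem_Collect_eq)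
          have "eventually (\<lambda>n. s n z = 0) sequentially"
          proof -
            obtain N where N: "1 < real N * infdist z C" using pos reals_Archimedean3 by metis
            have "s n z = 0" if "n \<ge> N" for n
            proof -
              have "real N * infdist z C \<le> real n * infdist z C"
                using that pos by (intro mult_right_mono) auto
              then show ?thesis using N by (simp add: s_def)
            qed
            then show ?thesis using eventually_sequentially by blast
          qed
          then show ?thesis using z by (simp add: tendsto_eventually)
        qed
      qed auto
    qed
  next
    case empty
    then show ?case using cont[of "\<lambda>_. 0"] by simp
  next
    case (compl A)
    have "L1_approximable (\<lambda>z. 1 + (- 1) * indicator A z)"
      by (intro L1_approximable_add L1_approximable_cmult compl one)
    also have "(\<lambda>z. 1 + (- 1) * indicator A z) = indicat_real (UNIV - A)"
      by (auto simp: indicator_def)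
    finally show ?case .
  next
    case (union A)
    have dj: "disjoint_family_on A S" for S using union(1) by (auto simp: disjoint_family_on_def)
    show ?case
    proof (rule L1_approximable_sequence[where s = "\<lambda>n z. (\<Sum>i<n. indicator (A i) z)" and w = "\<lambda>_. 1"])
      show "integrable circle_measure (indicat_real (\<Union> (range A)))"
        using union(2) bor by (intro im sets.countable_UN) auto
      show "L1_approximable (\<lambda>z. \<Sum>i<n. indicator (A i) z)" for n
      proof (induction n)
        case 0
        then show ?case using cont[of "\<lambda>_. 0"] by simp
      next
        case (Suc n)
        then show ?case using L1_approximable_add[OF Suc union(3)[of n]] by simp
      qed
      have eq: "(\<Sum>i<n. indicator (A i) z) = indicat_real (\<Union>i<n. A i) z" for n z
        by (rule indicator_UN_disjoint[symmetric]) (use dj in auto)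
      show "\<bar>\<Sum>i<n. indicator (A i) z\<bar> \<le> (1::real)" for n z
        by (simp only: eq) (simp add: indicator_def)
      show "(\<lambda>n. \<Sum>i<n. indicator (A i) z) \<longlonglongrightarrow> indicat_real (\<Union> (range A)) z" for z
      proof (cases "z \<in> \<Union> (range A)")
        case True
        then obtain k where k: "z \<in> A k" by auto
        have "eventually (\<lambda>n. indicat_real (\<Union>i<n. A i) z = 1) sequentially"
          using eventually_gt_at_top[of k] by (rule eventually_mono) (use k in \<open>auto simp: indicator_def\<close>)
        then show ?thesis using True unfolding eq by (simp add: tendsto_eventually)
      next
        case False
        then show ?thesis by (simp add: indicator_def)
      qed
    qed auto
  qed
qed

lemma integrable_imp_L1_approximable:
  fixes g :: "complex \<Rightarrow> real"
  assumes "integrable circle_measure g"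
  shows "L1_approximable g"
  using assms
proof (induction g rule: integrable_induct)
  case (base A c)
  obtain B where B: "B \<in> sets borel" "A = sphere 0 1 \<inter> B"
    using base(1) by (auto simp: sets_circle_measure sets_restrict_space)
  have 1: "L1_approximable (\<lambda>z. c * indicator B z)"
    by (intro L1_approximable_cmult L1_approximable_indicator B)
  show ?case
  proof (rule L1_approximable_limit)
    show "integrable circle_measure (\<lambda>x. indicat_real A x *\<^sub>R c)"
      using base by simp
    have "(\<integral>w. \<bar>indicat_real A w *\<^sub>R c - c * indicator B w\<bar> \<partial>circle_measure) = (\<integral>w. 0 \<partial>circle_measure)"
      by (rule Bochner_Integration.integral_cong) (auto simp: B indicator_def)
    then show "\<exists>g'. L1_approximable g' \<and> (\<integral>w. \<bar>indicat_real A w *\<^sub>R c - g' w\<bar> \<partial>circle_measure) < e"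
      if "e > 0" for e
      using that 1 by (intro exI[of _ "\<lambda>z. c * indicator B z"]) simp
  qed
next
  case (add f g)
  then show ?case by (intro L1_approximable_add)
next
  case (lim f s)
  show ?case
    by (rule L1_approximable_sequence[where s = s and w = "\<lambda>z. 2 * \<bar>f z\<bar>"])
       (use lim in auto)
qed

lemma cnj_eq_inverse: "cmod z = 1 \<Longrightarrow> cnj z = inverse z"
  by (metis complex_inverse complex_cnj_cnj complex_div_cnj complex_mod_cnj complex_mod_mult_cnj inverse_eq_divide inverse_unique mult.commute norm_one of_real_1 complex_norm_square power_one)

text \<open>Functions instead of coefficient lists, so that radial limits and projections are
  followed along sums. A product of two of them agrees with a third one on the circle only, because
  \<open>powi\<close> is not additive in the exponent at \<open>0\<close>.\<close>

inductive trig_poly :: "(complex \<Rightarrow> complex) \<Rightarrow> bool" where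
  monomial: "trig_poly (\<lambda>z. c * z powi k)"
| add: "trig_poly p \<Longrightarrow> trig_poly q \<Longrightarrow> trig_poly (\<lambda>z. p z + q z)"

lemma continuous_on_trig_poly: "trig_poly p \<Longrightarrow> continuous_on (sphere 0 1) p"
  by (induction rule: trig_poly.induct) (auto intro!: continuous_intros)

lemma trig_poly_mult_monomial:
  "trig_poly q \<Longrightarrow> \<exists>s. trig_poly s \<and> (\<forall>z\<in>sphere 0 1. s z = c * z powi k * q z)"
proof (induction rule: trig_poly.induct)
  case (monomial d l)
  show ?case
  proof (intro exI conjI ballI)
    show "trig_poly (\<lambda>z. (c * d) * z powi (k + l))" by (rule trig_poly.monomial)
    fix z :: complex assume "z \<in> sphere 0 1"
    then have "z \<noteq> 0" by auto
    then show "c * d * z powi (k + l) = c * z powi k * (d * z powi l)"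
      by (simp add: power_int_add)
  qed
next
  case (add p q)
  then obtain s t where "trig_poly s" "\<forall>z\<in>sphere 0 1. s z = c * z powi k * p z"
    "trig_poly t" "\<forall>z\<in>sphere 0 1. t z = c * z powi k * q z" by blast
  then show ?case
    by (intro exI[of _ "\<lambda>z. s z + t z"]) (auto intro: trig_poly.add simp: ring_distribs)
qed

lemma trig_poly_mult:
  assumes "trig_poly p" "trig_poly q"
  shows "\<exists>s. trig_poly s \<and> (\<forall>z\<in>sphere 0 1. s z = p z * q z)"
  using assms
proof (induction rule: trig_poly.induct)
  case (monomial c k)
  then show ?case using trig_poly_mult_monomial by blast
next
  case (add p p')
  then obtain s t where "trig_poly s" "\<forall>z\<in>sphere 0 1. s z = p z * q z"
    "trig_poly t" "\<forall>z\<in>sphere 0 1. t z = p' z * q z" by blast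
  then show ?case
    by (intro exI[of _ "\<lambda>z. s z + t z"]) (auto intro: trig_poly.add simp: ring_distribs)
qed

definition real_trig_poly :: "(complex \<Rightarrow> real) \<Rightarrow> bool" where
  "real_trig_poly f \<longleftrightarrow> (\<exists>p. trig_poly p \<and> (\<forall>z\<in>sphere 0 1. complex_of_real (f z) = p z))"

text \<open>Stone-Weierstrass for the real-valued trigonometric polynomials. \<open>Re\<close> and
  \<open>Im\<close> are among them, as combinations of \<open>z\<close> and its inverse, and
  separate the points of the circle.\<close>

lemma trig_poly_dense_continuous:
  assumes "continuous_on (sphere 0 1) f" "0 < e"
  shows "\<exists>g. real_trig_poly g \<and> (\<forall>z\<in>sphere 0 1. \<bar>f z - g z\<bar> < e)"
proof (rule Stone_Weierstrass_HOL[where P = real_trig_poly])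
  show "compact (sphere (0::complex) 1)" by simp
  show "real_trig_poly (\<lambda>x. c)" for c
    unfolding real_trig_poly_def
  proof (intro exI conjI ballI)
    show "trig_poly (\<lambda>z. of_real c * z powi 0)" by (rule trig_poly.monomial)
  qed simp
  show "continuous_on (sphere 0 1) f" if "real_trig_poly f" for f
  proof -
    obtain p where p: "trig_poly p" "\<forall>z\<in>sphere 0 1. complex_of_real (f z) = p z"
      using \<open>real_trig_poly f\<close> by (auto simp: real_trig_poly_def)
    have "continuous_on (sphere 0 1) (\<lambda>z. Re (p z))"
      by (intro continuous_intros continuous_on_trig_poly p)
    then show ?thesis
      by (rule continuous_on_eq) (use p(2) in \<open>metis Re_complex_of_real\<close>)
  qed
  show "real_trig_poly (\<lambda>x. f x + g x)" if "real_trig_poly f \<and> real_trig_poly g" for f g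
  proof -
    from that obtain p q where "trig_poly p" "\<forall>z\<in>sphere 0 1. complex_of_real (f z) = p z"
      "trig_poly q" "\<forall>z\<in>sphere 0 1. complex_of_real (g z) = q z" by (auto simp: real_trig_poly_def)
    then show ?thesis unfolding real_trig_poly_def
      by (intro exI[of _ "\<lambda>z. p z + q z"]) (auto intro: trig_poly.add)
  qed
  show "real_trig_poly (\<lambda>x. f x * g x)" if "real_trig_poly f \<and> real_trig_poly g" for f g
  proof -
    from that obtain p q where pq: "trig_poly p" "\<forall>z\<in>sphere 0 1. complex_of_real (f z) = p z"
      "trig_poly q" "\<forall>z\<in>sphere 0 1. complex_of_real (g z) = q z" by (auto simp: real_trig_poly_def)
    obtain s where "trig_poly s" "\<forall>z\<in>sphere 0 1. s z = p z * q z"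
      using trig_poly_mult[OF pq(1,3)] by blast
    then show ?thesis unfolding real_trig_poly_def using pq by (intro exI[of _ s]) auto
  qed
  show "\<exists>f. real_trig_poly f \<and> f x \<noteq> f y" if "x \<in> sphere 0 1 \<and> y \<in> sphere 0 1 \<and> x \<noteq> y" for x y :: complex
  proof -
    have inv: "z powi (-1) = cnj z" if "z \<in> sphere 0 1" for z :: complex
      using that by (simp add: cnj_eq_inverse power_int_minus)
    have "real_trig_poly Re"
      unfolding real_trig_poly_def
    proof (intro exI conjI ballI)
      show "trig_poly (\<lambda>z. (1/2) * z powi 1 + (1/2) * z powi (-1))" by (intro trig_poly.intros)
      show "complex_of_real (Re z) = (1/2) * z powi 1 + (1/2) * z powi (-1)" if "z \<in> sphere 0 1" for z
        unfolding inv[OF that] by (simp add: complex_eq_iff)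
    qed
    moreover have "real_trig_poly Im"
      unfolding real_trig_poly_def
    proof (intro exI conjI ballI)
      show "trig_poly (\<lambda>z. (- \<i>/2) * z powi 1 + (\<i>/2) * z powi (-1))" by (intro trig_poly.intros)
      show "complex_of_real (Im z) = (- \<i>/2) * z powi 1 + (\<i>/2) * z powi (-1)" if "z \<in> sphere 0 1" for z
        unfolding inv[OF that] by (simp add: complex_eq_iff)
    qed
    ultimately show ?thesis using that complex_eq_iff by metis
  qed
qed (use assms in auto)

lemma trig_poly_dense:
  fixes g :: "complex \<Rightarrow> real"
  assumes g: "integrable circle_measure g" and e: "e > 0"
  obtains q where "real_trig_poly q" "integrable circle_measure q"
    "(\<integral>w. \<bar>g w - q w\<bar> \<partial>circle_measure) < e"
proof -
  obtain h where h: "continuous_on (sphere 0 1) h" "(\<integral>w. \<bar>g w - h w\<bar> \<partial>circle_measure) < e/2"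
    using integrable_imp_L1_approximable[OF g] e unfolding L1_approximable_def
    by (meson half_gt_zero)
  obtain q where q: "real_trig_poly q" "\<forall>z\<in>sphere 0 1. \<bar>h z - q z\<bar> < e/2"
    using trig_poly_dense_continuous[OF h(1), of "e/2"] e by auto
  obtain p where p: "trig_poly p" "\<forall>z\<in>sphere 0 1. complex_of_real (q z) = p z"
    using q by (auto simp: real_trig_poly_def)
  have "continuous_on (sphere 0 1) (\<lambda>z. Re (p z))"
    by (intro continuous_intros continuous_on_trig_poly p)
  then have "continuous_on (sphere 0 1) q"
    by (rule continuous_on_eq) (use p(2) in \<open>metis Re_complex_of_real\<close>)
  then have i: "integrable circle_measure q" "integrable circle_measure h"
    using h integrable_circle_continuous by auto
  have "(\<integral>w. \<bar>g w - q w\<bar> \<partial>circle_measure) \<le> (\<integral>w. \<bar>g w - h w\<bar> + e/2 \<partial>circle_measure)"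
  proof (rule integral_mono)
    fix w assume "w \<in> space circle_measure"
    then have "\<bar>h w - q w\<bar> < e/2" using q by simp
    then show "\<bar>g w - q w\<bar> \<le> \<bar>g w - h w\<bar> + e/2" by linarith
  qed (use g i in auto)
  also have "\<dots> = (\<integral>w. \<bar>g w - h w\<bar> \<partial>circle_measure) + e/2"
    using g i by simp
  finally show ?thesis using that[OF q(1) i(1)] h(2) by linarith
qed

section \<open>Herglotz transforms and Poisson integrals of trigonometric polynomials\<close>

text \<open>The kernel is twice the Cauchy kernel minus \<open>1\<close>. The mean
  \<open>0 ^ m\<close> of \<open>w ^ m\<close> is \<open>1\<close> for \<open>m = 0\<close> and
  \<open>0\<close> otherwise.\<close>

lemma herglotz_monomial_nonneg:
  assumes "cmod \<zeta> < 1"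
  shows "herglotz (\<lambda>w. w ^ m) \<zeta> = 2 * \<zeta> ^ m - 0 ^ m"
proof -
  have "herglotz (\<lambda>w. w ^ m) \<zeta> = (\<integral>w. 2 * (w ^ m * (w / (w - \<zeta>))) - w ^ m \<partial>circle_measure)"
    unfolding herglotz_def
  proof (rule Bochner_Integration.integral_cong)
    fix w assume "w \<in> space circle_measure"
    then have "w \<noteq> \<zeta>" using assms by auto
    then have "(w + \<zeta>) / (w - \<zeta>) = 2 * (w / (w - \<zeta>)) - 1" by (simp add: field_simps)
    then show "w ^ m * ((w + \<zeta>) / (w - \<zeta>)) = 2 * (w ^ m * (w / (w - \<zeta>))) - w ^ m"
      by (simp add: right_diff_distrib)
  qed simp
  also have "\<dots> = 2 * (\<integral>w. w ^ m * (w / (w - \<zeta>)) \<partial>circle_measure) - (\<integral>w. w ^ m \<partial>circle_measure)"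
    unfolding integral_mult_right_zero[symmetric]
    by (rule Bochner_Integration.integral_diff)
       (use assms in \<open>auto intro!: integrable_circle_continuous continuous_intros\<close>)
  also have "(\<integral>w. w ^ m * (w / (w - \<zeta>)) \<partial>circle_measure) = \<zeta> ^ m"
    by (rule cauchy_circle[where S = UNIV]) (use assms in \<open>auto intro!: holomorphic_intros\<close>)
  also have "(\<integral>w. w ^ m \<partial>circle_measure) = 0 ^ m"
    by (rule mean_value_circle[where S = UNIV]) (auto intro!: holomorphic_intros)
  finally show ?thesis .
qed

text \<open>After conjugation the integrand is the boundary function of a holomorphic function
  vanishing at the origin. The Herglotz transform thus kills negative frequencies.\<close>

lemma herglotz_monomial_neg:
  assumes \<zeta>: "cmod \<zeta> < 1" and m: "m > 0"
  shows "herglotz (\<lambda>w. inverse w ^ m) \<zeta> = 0"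
proof -
  note nz = reflected_kernel_nonzero[OF \<zeta>]
  define S where "S = {w. 1 - cnj \<zeta> * w \<noteq> 0}"
  have "cnj (herglotz (\<lambda>w. inverse w ^ m) \<zeta>) = (\<integral>w. cnj (inverse w ^ m * ((w + \<zeta>) / (w - \<zeta>))) \<partial>circle_measure)"
    unfolding herglotz_def by (rule Bochner_Integration.integral_cnj[symmetric])
  also have "\<dots> = (\<integral>w. w ^ m * ((1 + cnj \<zeta> * w) / (1 - cnj \<zeta> * w)) \<partial>circle_measure)"
  proof (rule Bochner_Integration.integral_cong)
    fix w assume "w \<in> space circle_measure"
    then have w: "cmod w = 1" by simp
    then have n: "w \<noteq> 0" by auto
    have c: "cnj w = 1 / w" using cnj_eq_inverse[OF w] by (simp add: inverse_eq_divide)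
    have "cnj ((w + \<zeta>) / (w - \<zeta>)) = (1 / w + cnj \<zeta>) / (1 / w - cnj \<zeta>)"
      by (simp add: c)
    also have "\<dots> = (w * (1 / w + cnj \<zeta>)) / (w * (1 / w - cnj \<zeta>))"
      using n by (intro mult_divide_mult_cancel_left[symmetric])
    also have "\<dots> = (1 + cnj \<zeta> * w) / (1 - cnj \<zeta> * w)"
      using n by (simp add: ring_distribs mult.commute)
    finally have "cnj ((w + \<zeta>) / (w - \<zeta>)) = (1 + cnj \<zeta> * w) / (1 - cnj \<zeta> * w)" .
    moreover have "cnj (inverse w ^ m) = w ^ m" using c n by simp
    ultimately show "cnj (inverse w ^ m * ((w + \<zeta>) / (w - \<zeta>))) = w ^ m * ((1 + cnj \<zeta> * w) / (1 - cnj \<zeta> * w))"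
      by (simp only: complex_cnj_mult)
  qed simp
  also have "\<dots> = 0 ^ m * ((1 + cnj \<zeta> * 0) / (1 - cnj \<zeta> * 0))"
    by (rule mean_value_circle[where S = S])
       (use nz in \<open>auto simp: S_def intro!: holomorphic_intros open_Collect_neq continuous_intros\<close>)
  also have "\<dots> = 0" using m by (simp add: zero_power)
  finally show ?thesis by simp
qed

lemma poisson_monomial_nonneg:
  assumes "cmod \<zeta> < 1"
  shows "(\<integral>w. w ^ m * of_real (poisson_kernel \<zeta> w) \<partial>circle_measure) = \<zeta> ^ m"
  by (rule poisson_formula[where S = UNIV]) (use assms in \<open>auto intro!: holomorphic_intros\<close>)

lemma poisson_monomial_neg:
  assumes "cmod \<zeta> < 1"
  shows "(\<integral>w. inverse w ^ m * of_real (poisson_kernel \<zeta> w) \<partial>circle_measure) = cnj \<zeta> ^ m"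
proof -
  have "(\<integral>w. inverse w ^ m * of_real (poisson_kernel \<zeta> w) \<partial>circle_measure)
    = (\<integral>w. cnj (w ^ m * of_real (poisson_kernel \<zeta> w)) \<partial>circle_measure)"
    by (rule Bochner_Integration.integral_cong) (auto simp: cnj_eq_inverse)
  also have "\<dots> = cnj (\<zeta> ^ m)"
    using poisson_monomial_nonneg[OF assms] by (subst Bochner_Integration.integral_cnj) auto
  finally show ?thesis by simp
qed

lemma filterlim_radius: "((\<lambda>r. complex_of_real r * z) \<longlongrightarrow> z) (at_left 1)"
proof -
  have "((\<lambda>r. complex_of_real r * z) \<longlongrightarrow> complex_of_real 1 * z) (at_left 1)"
    by (intro tendsto_intros)
  then show ?thesis by simp
qed

lemma eventually_at_left_1: "eventually (\<lambda>r. 0 \<le> r \<and> r < (1::real)) (at_left 1)"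
  using eventually_at_left_real[of 0 1] by (auto elim: eventually_mono)

text \<open>The limit \<open>L\<close> stays unidentified here; if \<open>p\<close> is real on the
  circle, its real part is read off the limit of the Poisson integral.\<close>

lemma trig_poly_radial_limits:
  assumes "trig_poly p" "cmod z = 1"
  shows "(\<exists>L. ((\<lambda>r. herglotz p (of_real r * z)) \<longlongrightarrow> L) (at_left 1)) \<and>
    ((\<lambda>r. \<integral>w. p w * of_real (poisson_kernel (of_real r * z) w) \<partial>circle_measure) \<longlongrightarrow> p z) (at_left 1)"
  using assms(1)
proof (induction rule: trig_poly.induct)
  case (monomial c k)
  note z = assms(2)
  have lt: "cmod (complex_of_real r * z) < 1" if "0 \<le> r \<and> r < 1" for r
    using cmod_radius_less[OF z] that by auto
  show ?case
  proof (cases "k \<ge> 0")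
    case True
    define m where "m = nat k"
    have k: "w powi k = w ^ m" for w :: complex using True by (simp add: m_def power_int_def)
    have "((\<lambda>r. c * (2 * (of_real r * z) ^ m - 0 ^ m)) \<longlongrightarrow> c * (2 * z ^ m - 0 ^ m)) (at_left 1)"
      by (intro tendsto_intros filterlim_radius)
    moreover have "eventually (\<lambda>r. herglotz (\<lambda>z. c * z powi k) (of_real r * z) = c * (2 * (of_real r * z) ^ m - 0 ^ m)) (at_left 1)"
      using eventually_at_left_1 by eventually_elim (simp only: k herglotz_cmult herglotz_monomial_nonneg lt)
    ultimately have 1: "((\<lambda>r. herglotz (\<lambda>z. c * z powi k) (of_real r * z)) \<longlongrightarrow> c * (2 * z ^ m - 0 ^ m)) (at_left 1)"
      by (simp add: tendsto_cong)
    have "((\<lambda>r. c * (of_real r * z) ^ m) \<longlongrightarrow> c * z ^ m) (at_left 1)"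
      by (intro tendsto_intros filterlim_radius)
    moreover have "eventually (\<lambda>r. (\<integral>w. c * w powi k * of_real (poisson_kernel (of_real r * z) w) \<partial>circle_measure) = c * (of_real r * z) ^ m) (at_left 1)"
      using eventually_at_left_1
      by eventually_elim (simp only: k mult.assoc integral_mult_right_zero poisson_monomial_nonneg lt)
    ultimately have "((\<lambda>r. \<integral>w. c * w powi k * of_real (poisson_kernel (of_real r * z) w) \<partial>circle_measure) \<longlongrightarrow> c * z powi k) (at_left 1)"
      by (simp add: tendsto_cong k)
    then show ?thesis using 1 by blast
  next
    case False
    define m where "m = nat (- k)"
    have m: "m > 0" using False by (simp add: m_def)
    have k: "w powi k = inverse w ^ m" for w :: complex using False by (simp add: m_def power_int_def)
    have "eventually (\<lambda>r. herglotz (\<lambda>z. c * z powi k) (of_real r * z) = 0) (at_left 1)"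
      using eventually_at_left_1
      by eventually_elim (simp only: k herglotz_cmult herglotz_monomial_neg[OF _ m] lt mult_zero_right)
    then have 1: "((\<lambda>r. herglotz (\<lambda>z. c * z powi k) (of_real r * z)) \<longlongrightarrow> 0) (at_left 1)"
      by (simp add: tendsto_eventually)
    have "((\<lambda>r. c * cnj (of_real r * z) ^ m) \<longlongrightarrow> c * cnj z ^ m) (at_left 1)"
      by (intro tendsto_intros filterlim_radius)
    moreover have "eventually (\<lambda>r. (\<integral>w. c * w powi k * of_real (poisson_kernel (of_real r * z) w) \<partial>circle_measure) = c * cnj (of_real r * z) ^ m) (at_left 1)"
      using eventually_at_left_1
      by eventually_elim (simp only: k mult.assoc integral_mult_right_zero poisson_monomial_neg lt)
    ultimately have "((\<lambda>r. \<integral>w. c * w powi k * of_real (poisson_kernel (of_real r * z) w) \<partial>circle_measure) \<longlongrightarrow> c * z powi k) (at_left 1)"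
      by (simp add: tendsto_cong k cnj_eq_inverse[OF z])
    then show ?thesis using 1 by blast
  qed
next
  case (add p q)
  note z = assms(2)
  have lt: "cmod (complex_of_real r * z) < 1" if "0 \<le> r \<and> r < 1" for r
    using cmod_radius_less[OF z] that by auto
  have i: "integrable circle_measure p" "integrable circle_measure q"
    using add continuous_on_trig_poly integrable_circle_continuous by auto
  from add obtain L K where L: "((\<lambda>r. herglotz p (of_real r * z)) \<longlongrightarrow> L) (at_left 1)"
    "((\<lambda>r. herglotz q (of_real r * z)) \<longlongrightarrow> K) (at_left 1)" by blast
  have "eventually (\<lambda>r. herglotz (\<lambda>w. p w + q w) (of_real r * z) = herglotz p (of_real r * z) + herglotz q (of_real r * z)) (at_left 1)"
    using eventually_at_left_1 by eventually_elim (use i lt in \<open>auto intro!: herglotz_add\<close>)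
  then have 1: "((\<lambda>r. herglotz (\<lambda>w. p w + q w) (of_real r * z)) \<longlongrightarrow> L + K) (at_left 1)"
    using tendsto_add[OF L] by (simp add: tendsto_cong)
  have pk: "integrable circle_measure (\<lambda>w. f w * complex_of_real (poisson_kernel \<zeta> w))"
    if "trig_poly f" "cmod \<zeta> < 1" for f \<zeta>
    using that by (intro integrable_circle_continuous continuous_intros continuous_on_trig_poly continuous_on_poisson_kernel)
  have "eventually (\<lambda>r. (\<integral>w. (p w + q w) * of_real (poisson_kernel (of_real r * z) w) \<partial>circle_measure)
      = (\<integral>w. p w * of_real (poisson_kernel (of_real r * z) w) \<partial>circle_measure)
        + (\<integral>w. q w * of_real (poisson_kernel (of_real r * z) w) \<partial>circle_measure)) (at_left 1)"
    using eventually_at_left_1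
    by eventually_elim (unfold distrib_right, intro Bochner_Integration.integral_add pk lt add)
  then have "((\<lambda>r. \<integral>w. (p w + q w) * of_real (poisson_kernel (of_real r * z) w) \<partial>circle_measure) \<longlongrightarrow> p z + q z) (at_left 1)"
    using tendsto_add[OF conjunct2[OF add.IH(1)] conjunct2[OF add.IH(2)]] by (simp add: tendsto_cong)
  then show ?case using 1 by blast
qed

lemma real_trig_poly_radial_limit:
  assumes q: "real_trig_poly q" "integrable circle_measure q" and z: "cmod z = 1"
  obtains L where "((\<lambda>r. herglotz (\<lambda>w. complex_of_real (q w)) (of_real r * z)) \<longlongrightarrow> L) (at_left 1)"
    "Re L = q z"
proof -
  obtain p where p: "trig_poly p" "\<forall>z\<in>sphere 0 1. complex_of_real (q z) = p z"
    using q by (auto simp: real_trig_poly_def)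
  have H: "herglotz (\<lambda>w. complex_of_real (q w)) = herglotz p"
    unfolding herglotz_def fun_eq_iff
    by (intro allI Bochner_Integration.integral_cong) (use p in auto)
  obtain L where L: "((\<lambda>r. herglotz p (of_real r * z)) \<longlongrightarrow> L) (at_left 1)"
    using trig_poly_radial_limits[OF p(1) z] by blast
  have "((\<lambda>r. Re (\<integral>w. p w * of_real (poisson_kernel (of_real r * z) w) \<partial>circle_measure)) \<longlongrightarrow> Re (p z)) (at_left 1)"
    using trig_poly_radial_limits[OF p(1) z] by (intro tendsto_intros) auto
  moreover have "eventually (\<lambda>r. Re (\<integral>w. p w * of_real (poisson_kernel (of_real r * z) w) \<partial>circle_measure)
      = Re (herglotz p (of_real r * z))) (at_left 1)"
    using eventually_at_left_1
  proof eventually_elim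
    case (elim r)
    have lt: "cmod (complex_of_real r * z) < 1" using elim cmod_radius_less[OF z] by auto
    have "(\<integral>w. p w * of_real (poisson_kernel (of_real r * z) w) \<partial>circle_measure)
      = (\<integral>w. complex_of_real (q w * poisson_kernel (of_real r * z) w) \<partial>circle_measure)"
      by (rule Bochner_Integration.integral_cong) (use p in auto)
    also have "\<dots> = of_real (\<integral>w. q w * poisson_kernel (of_real r * z) w \<partial>circle_measure)"
      by (rule integral_complex_of_real)
    finally show ?case using Re_herglotz[OF q(2) lt] by (simp add: H)
  qed
  ultimately have "((\<lambda>r. Re (herglotz p (of_real r * z))) \<longlongrightarrow> Re (p z)) (at_left 1)"
    by (simp add: tendsto_cong)
  moreover have "((\<lambda>r. Re (herglotz p (of_real r * z))) \<longlongrightarrow> Re L) (at_left 1)"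
    by (intro tendsto_intros L)
  ultimately have "Re L = Re (p z)"
    using tendsto_unique trivial_limit_at_left_real by blast
  also have "\<dots> = q z" using p z by (metis Re_complex_of_real mem_sphere_0)
  finally show ?thesis using that L H by simp
qed

section \<open>Radial limits and the conjugate function\<close>

text \<open>An exchange of limits: near the limit point any two approximants are close to
  \<open>h\<close>, hence to each other, so their limits form a Cauchy sequence.\<close>

lemma limit_exists_if_approximated:
  fixes h :: "real \<Rightarrow> complex"
  assumes F: "F \<noteq> bot"
    and ap: "\<And>n. \<exists>q. (q \<longlongrightarrow> L n) F \<and> eventually (\<lambda>r. cmod (h r - q r) \<le> e n) F"
    and e: "e \<longlonglongrightarrow> 0"
  shows "\<exists>M. (h \<longlongrightarrow> M) F \<and> L \<longlonglongrightarrow> M"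
proof -
  have d: "cmod (L n - L m) \<le> e n + e m" for n m
  proof -
    obtain q q' where q: "(q \<longlongrightarrow> L n) F" "eventually (\<lambda>r. cmod (h r - q r) \<le> e n) F"
      "(q' \<longlongrightarrow> L m) F" "eventually (\<lambda>r. cmod (h r - q' r) \<le> e m) F"
      using ap[of n] ap[of m] by blast
    have "((\<lambda>r. cmod (q r - q' r)) \<longlongrightarrow> cmod (L n - L m)) F" by (intro tendsto_intros q)
    moreover have "eventually (\<lambda>r. cmod (q r - q' r) \<le> e n + e m) F"
      using q(2,4)
    proof eventually_elim
      case (elim r)
      have "q r - q' r = (h r - q' r) - (h r - q r)" by simp
      then show ?case using norm_triangle_ineq4[of "h r - q' r" "h r - q r"] elim by simp
    qed
    ultimately show ?thesis using F by (rule tendsto_upperbound)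
  qed
  have "Cauchy L"
  proof (rule metric_CauchyI)
    fix \<epsilon> :: real assume "\<epsilon> > 0"
    then have "eventually (\<lambda>n. e n < \<epsilon> / 2) sequentially"
      using e by (intro order_tendstoD(2)) auto
    then obtain N where N: "\<And>n. n \<ge> N \<Longrightarrow> e n < \<epsilon> / 2" by (auto simp: eventually_sequentially)
    show "\<exists>M. \<forall>m\<ge>M. \<forall>n\<ge>M. dist (L m) (L n) < \<epsilon>"
    proof (intro exI[of _ N] allI impI)
      fix m n assume "m \<ge> N" "n \<ge> N"
      then show "dist (L m) (L n) < \<epsilon>" using N[of m] N[of n] d[of m n] by (simp add: dist_norm)
    qed
  qed
  then obtain M where M: "L \<longlonglongrightarrow> M" using Cauchy_convergent convergent_def by blast
  have "(h \<longlongrightarrow> M) F"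
  proof (rule tendstoI)
    fix \<epsilon> :: real assume "\<epsilon> > 0"
    then have e3: "0 < \<epsilon> / 3" by simp
    have "eventually (\<lambda>n. e n < \<epsilon> / 3) sequentially" "eventually (\<lambda>n. dist (L n) M < \<epsilon> / 3) sequentially"
      using order_tendstoD(2)[OF e e3] tendstoD[OF M e3] by blast+
    then have "eventually (\<lambda>n. e n < \<epsilon> / 3 \<and> dist (L n) M < \<epsilon> / 3) sequentially"
      by (rule eventually_conj)
    then obtain n where n: "e n < \<epsilon> / 3" "dist (L n) M < \<epsilon> / 3"
      by (auto simp: eventually_sequentially)
    obtain q where q: "(q \<longlongrightarrow> L n) F" "eventually (\<lambda>r. cmod (h r - q r) \<le> e n) F" using ap by blast
    have "eventually (\<lambda>r. dist (q r) (L n) < \<epsilon> / 3) F" using q \<open>\<epsilon> > 0\<close> by (intro tendstoD) auto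
    with q(2) show "eventually (\<lambda>r. dist (h r) M < \<epsilon>) F"
    proof eventually_elim
      case (elim r)
      have "dist (h r) M \<le> dist (h r) (q r) + dist (q r) (L n) + dist (L n) M"
        by (smt (verit) dist_triangle)
      then show ?case using elim n by (simp add: dist_norm)
    qed
  qed
  then show ?thesis using M by blast
qed

lemma herglotz_radial_limit_real:
  fixes g :: "complex \<Rightarrow> real"
  assumes g: "integrable circle_measure g"
  shows "AE z in circle_measure. \<exists>L. ((\<lambda>r. herglotz (\<lambda>w. complex_of_real (g w)) (of_real r * z)) \<longlongrightarrow> L) (at_left 1)
    \<and> Re L = g z"
proof -
  \<comment> \<open>The mean error \<open>(1/16)^n\<close> is tested at the level
    \<open>(1/4)^n\<close>: the maximal estimate then leaves an exceptional set of measure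
    \<open>480 * (1/2)^n\<close>, and Markov's inequality one of measure \<open>(1/4)^n\<close>.
    Both are summable, as Borel-Cantelli requires.\<close>
  have "\<forall>n. \<exists>q. real_trig_poly q \<and> integrable circle_measure q \<and> (\<integral>w. \<bar>g w - q w\<bar> \<partial>circle_measure) < (1/16)^n"
    using trig_poly_dense[OF g, of "(1/16)^n" for n] by (metis zero_less_divide_1_iff zero_less_numeral zero_less_power)
  then obtain q where q: "\<And>n. real_trig_poly (q n)" "\<And>n. integrable circle_measure (q n)"
    "\<And>n. (\<integral>w. \<bar>g w - q n w\<bar> \<partial>circle_measure) < (1/16)^n"
    by metis
  have "\<forall>n. \<exists>E. E \<in> sets circle_measure \<and> measure circle_measure E \<le> 480 * (1/2)^n \<and>
    (\<forall>z r. cmod z = 1 \<longrightarrow> z \<notin> E \<longrightarrow> 0 \<le> r \<longrightarrow> r < 1 \<longrightarrow>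
        cmod (herglotz (\<lambda>w. complex_of_real (g w - q n w)) (of_real r * z)) \<le> (1/4)^n)"
  proof
    fix n
    have "integrable circle_measure (\<lambda>w. g w - q n w)" using g q by simp
    then obtain E where E: "E \<in> sets circle_measure" "measure circle_measure E \<le> 480 * sqrt ((1/16)^n / (1/4)^n)"
      "\<And>z r. cmod z = 1 \<Longrightarrow> z \<notin> E \<Longrightarrow> 0 \<le> r \<Longrightarrow> r < 1 \<Longrightarrow>
        cmod (herglotz (\<lambda>w. complex_of_real (g w - q n w)) (of_real r * z)) \<le> (1/4)^n"
      by (rule maximal_herglotz[of _ "(1/16)^n" "(1/4)^n"]) (use q(3)[of n] in auto)
    have "(1/16)^n / (1/4)^n = ((1/2::real)^n)\<^sup>2"
      by (simp add: power_divide[symmetric] power_mult_distrib[symmetric] power2_eq_square)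
    then have "sqrt ((1/16)^n / (1/4)^n) = (1/2::real)^n" by simp
    then show "\<exists>E. E \<in> sets circle_measure \<and> measure circle_measure E \<le> 480 * (1/2)^n \<and>
    (\<forall>z r. cmod z = 1 \<longrightarrow> z \<notin> E \<longrightarrow> 0 \<le> r \<longrightarrow> r < 1 \<longrightarrow>
        cmod (herglotz (\<lambda>w. complex_of_real (g w - q n w)) (of_real r * z)) \<le> (1/4)^n)"
      using E by (intro exI[of _ E]) simp
  qed
  then obtain E where E: "\<And>n. E n \<in> sets circle_measure" "\<And>n. measure circle_measure (E n) \<le> 480 * (1/2)^n"
    "\<And>n z r. cmod z = 1 \<Longrightarrow> z \<notin> E n \<Longrightarrow> 0 \<le> r \<Longrightarrow> r < 1 \<Longrightarrow>
        cmod (herglotz (\<lambda>w. complex_of_real (g w - q n w)) (of_real r * z)) \<le> (1/4)^n"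
    by metis
  \<comment> \<open>At a point lying in only finitely many \<open>A n\<close> the values
    \<open>q n z\<close> tend to \<open>g z\<close>; this identifies the real part of the radial
    limit.\<close>
  define A where "A n = {z \<in> space circle_measure. (1/4)^n \<le> \<bar>g z - q n z\<bar>}" for n
  have [measurable]: "g \<in> borel_measurable circle_measure" "q n \<in> borel_measurable circle_measure" for n
    using g q by auto
  have A: "A n \<in> sets circle_measure" for n unfolding A_def by measurable
  have mA: "measure circle_measure (A n) \<le> (1/4)^n" for n
  proof -
    have "measure circle_measure (A n) \<le> (\<integral>w. \<bar>g w - q n w\<bar> \<partial>circle_measure) / (1/4)^n"
      unfolding A_def
      by (rule integral_Markov_inequality_measure[where A = "{}", simplified]) (use g q in auto)
    also have "\<dots> \<le> (1/16)^n / (1/4)^n" using q(3)[of n] by (intro divide_right_mono) auto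
    also have "\<dots> = (1/4)^n" by (simp add: power_divide[symmetric])
    finally show ?thesis .
  qed
  have s2: "summable (\<lambda>n. 480 * (1/2::real)^n)" and s4: "summable (\<lambda>n. (1/4::real)^n)"
    by (auto intro!: summable_mult summable_geometric)
  have "AE z in circle_measure. eventually (\<lambda>n. z \<in> space circle_measure - E n) sequentially"
    by (rule borel_cantelli_AE1[OF E(1)])
       (use E(2) in \<open>auto simp: circle.emeasure_eq_measure intro!: summable_comparison_test'[OF s2]\<close>)
  moreover have "AE z in circle_measure. eventually (\<lambda>n. z \<in> space circle_measure - A n) sequentially"
    by (rule borel_cantelli_AE1[OF A])
       (use mA in \<open>auto simp: circle.emeasure_eq_measure intro!: summable_comparison_test'[OF s4]\<close>)
  ultimately show ?thesis
    using AE_space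
  proof eventually_elim
    case (elim z)
    then have z: "cmod z = 1" by simp
    have "eventually (\<lambda>n. z \<in> space circle_measure - E n \<and> z \<in> space circle_measure - A n) sequentially"
      using elim(1,2) by (rule eventually_conj)
    then obtain N where N: "\<And>n. n \<ge> N \<Longrightarrow> z \<notin> E n \<and> z \<notin> A n" by (auto simp: eventually_sequentially)
    define h where "h r = herglotz (\<lambda>w. complex_of_real (g w)) (of_real r * z)" for r
    define Q where "Q n r = herglotz (\<lambda>w. complex_of_real (q (n + N) w)) (of_real r * z)" for n r
    have "\<exists>L. (Q n \<longlongrightarrow> L) (at_left 1) \<and> Re L = q (n + N) z" for n
      using real_trig_poly_radial_limit[OF q(1,2) z, of "n + N"] unfolding Q_def by blast
    then obtain L where L: "\<And>n. (Q n \<longlongrightarrow> L n) (at_left 1)" "\<And>n. Re (L n) = q (n + N) z" by metis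
    have close: "eventually (\<lambda>r. cmod (h r - Q n r) \<le> (1/4)^(n + N)) (at_left 1)" for n
      using eventually_at_left_1
    proof eventually_elim
      case (elim r)
      have "herglotz (\<lambda>w. complex_of_real (g w - q (n + N) w)) (of_real r * z)
        = herglotz (\<lambda>w. complex_of_real (g w) - complex_of_real (q (n + N) w)) (of_real r * z)"
        by simp
      also have "\<dots> = h r - Q n r"
        unfolding h_def Q_def by (rule herglotz_diff) (use g q cmod_radius_less[OF z] elim in auto)
      finally show ?case using E(3)[OF z, of "n + N" r] N[of "n + N"] elim by simp
    qed
    have lim0: "(\<lambda>n. (1/4::real)^(n + N)) \<longlonglongrightarrow> 0"
      by (rule LIMSEQ_ignore_initial_segment) (rule LIMSEQ_power_zero, simp)
    obtain M where M: "(h \<longlongrightarrow> M) (at_left 1)" "L \<longlonglongrightarrow> M"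
      using limit_exists_if_approximated[of "at_left 1" L h "\<lambda>n. (1/4)^(n + N)"] L(1) close lim0
        trivial_limit_at_left_real by blast
    have "(\<lambda>n. Re (L n)) \<longlonglongrightarrow> Re M" by (intro tendsto_intros M)
    then have 1: "(\<lambda>n. q (n + N) z) \<longlonglongrightarrow> Re M" by (simp add: L)
    have "(\<lambda>n. g z - q (n + N) z) \<longlonglongrightarrow> 0"
    proof (rule Lim_null_comparison[OF _ lim0])
      show "eventually (\<lambda>n. norm (g z - q (n + N) z) \<le> (1/4)^(n + N)) sequentially"
      proof (rule always_eventually, rule allI)
        fix n
        have "z \<notin> A (n + N)" using N by simp
        then show "norm (g z - q (n + N) z) \<le> (1/4)^(n + N)" using z by (auto simp: A_def)
      qed
    qed
    then have "(\<lambda>n. g z - (g z - q (n + N) z)) \<longlonglongrightarrow> g z - 0" by (intro tendsto_intros)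
    then have "(\<lambda>n. q (n + N) z) \<longlonglongrightarrow> g z" by simp
    then have "Re M = g z" using 1 LIMSEQ_unique by blast
    then show ?case using M(1) unfolding h_def by blast
  qed
qed

section \<open>The conjugate Poisson integral and its boundary values\<close>

text \<open>The integral under the limit in \<open>conjugate_function\<close>, at a point of the
  disc. It is complex linear in \<open>f\<close> and is the imaginary part of the Herglotz transform
  only for real \<open>f\<close>; hence the separate treatment of \<open>Re\<close> and
  \<open>Im\<close> below.\<close>

definition conjugate_poisson :: "(complex \<Rightarrow> complex) \<Rightarrow> complex \<Rightarrow> complex" where
  "conjugate_poisson f \<zeta> = (\<integral>w. f w * complex_of_real (Im ((w + \<zeta>) / (w - \<zeta>))) \<partial>circle_measure)"

lemma conjugate_function_eq:
  "conjugate_function f z = Lim (at_left 1) (\<lambda>r. conjugate_poisson f (of_real r * z))"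
  by (simp add: conjugate_function_def conjugate_poisson_def)

lemma conjugate_poisson_of_real:
  assumes "integrable circle_measure g" "cmod \<zeta> < 1"
  shows "conjugate_poisson (\<lambda>w. complex_of_real (g w)) \<zeta>
    = of_real (Im (herglotz (\<lambda>w. complex_of_real (g w)) \<zeta>))"
proof -
  have "Im (herglotz (\<lambda>w. complex_of_real (g w)) \<zeta>)
    = (\<integral>w. Im (complex_of_real (g w) * ((w + \<zeta>) / (w - \<zeta>))) \<partial>circle_measure)"
    unfolding herglotz_def
    by (rule integral_Im[symmetric]) (use assms integrable_herglotz[of "\<lambda>w. complex_of_real (g w)"] in auto)
  moreover have "Im (complex_of_real (g w) * ((w + \<zeta>) / (w - \<zeta>))) = g w * Im ((w + \<zeta>) / (w - \<zeta>))" for w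
    by (metis Re_complex_of_real Im_complex_of_real mult_zero_left add_0_right times_complex.sel(2))
  moreover have "conjugate_poisson (\<lambda>w. complex_of_real (g w)) \<zeta>
    = (\<integral>w. complex_of_real (g w * Im ((w + \<zeta>) / (w - \<zeta>))) \<partial>circle_measure)"
    unfolding conjugate_poisson_def by (simp only: of_real_mult)
  ultimately show ?thesis by (simp only: integral_complex_of_real)
qed

lemma integrable_conjugate_poisson:
  assumes "integrable circle_measure f" "cmod \<zeta> < 1"
  shows "integrable circle_measure (\<lambda>w. f w * complex_of_real (Im ((w + \<zeta>) / (w - \<zeta>))))"
proof (rule integrable_mult_bounded[OF assms(1)])
  show "(\<lambda>w. complex_of_real (Im ((w + \<zeta>) / (w - \<zeta>)))) \<in> borel_measurable circle_measure"
    by (intro continuous_imp_measurable_circle continuous_intros continuous_on_herglotz_kernel)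
       (use assms in auto)
  show "cmod (complex_of_real (Im ((w + \<zeta>) / (w - \<zeta>)))) \<le> 2 / (1 - cmod \<zeta>)" if "cmod w = 1" for w
    using abs_Im_le_cmod[of "(w + \<zeta>) / (w - \<zeta>)"] herglotz_kernel_bound[OF that assms(2)]
    unfolding norm_of_real by linarith
qed

lemma conjugate_poisson_herglotz_parts:
  assumes f: "integrable circle_measure f" and \<zeta>: "cmod \<zeta> < 1"
  shows "conjugate_poisson f \<zeta>
      = of_real (Im (herglotz (\<lambda>w. complex_of_real (Re (f w))) \<zeta>))
        + \<i> * of_real (Im (herglotz (\<lambda>w. complex_of_real (Im (f w))) \<zeta>))"
    and "herglotz f \<zeta> = herglotz (\<lambda>w. complex_of_real (Re (f w))) \<zeta>
        + \<i> * herglotz (\<lambda>w. complex_of_real (Im (f w))) \<zeta>"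
proof -
  have i: "integrable circle_measure (\<lambda>w. Re (f w))" "integrable circle_measure (\<lambda>w. Im (f w))"
    using f by auto
  have ci: "integrable circle_measure (\<lambda>w. complex_of_real (Re (f w)))"
    "integrable circle_measure (\<lambda>w. complex_of_real (Im (f w)))"
    "integrable circle_measure (\<lambda>w. \<i> * complex_of_real (Im (f w)))"
    using i by auto
  have feq: "f = (\<lambda>w. complex_of_real (Re (f w)) + \<i> * complex_of_real (Im (f w)))"
    by (simp add: fun_eq_iff complex_eq_iff)
  show "herglotz f \<zeta> = herglotz (\<lambda>w. complex_of_real (Re (f w))) \<zeta>
        + \<i> * herglotz (\<lambda>w. complex_of_real (Im (f w))) \<zeta>"
    by (subst feq) (simp only: herglotz_add[OF ci(1) ci(3) \<zeta>] herglotz_cmult)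
  have "conjugate_poisson f \<zeta> = conjugate_poisson (\<lambda>w. complex_of_real (Re (f w))) \<zeta>
      + \<i> * conjugate_poisson (\<lambda>w. complex_of_real (Im (f w))) \<zeta>"
  proof -
    have "conjugate_poisson f \<zeta> = conjugate_poisson (\<lambda>w. complex_of_real (Re (f w)) + \<i> * complex_of_real (Im (f w))) \<zeta>"
      using feq by simp
    also have "\<dots> = (\<integral>w. complex_of_real (Re (f w)) * complex_of_real (Im ((w + \<zeta>) / (w - \<zeta>)))
        + \<i> * complex_of_real (Im (f w)) * complex_of_real (Im ((w + \<zeta>) / (w - \<zeta>))) \<partial>circle_measure)"
      unfolding conjugate_poisson_def distrib_right ..
    also have "\<dots> = conjugate_poisson (\<lambda>w. complex_of_real (Re (f w))) \<zeta>
      + conjugate_poisson (\<lambda>w. \<i> * complex_of_real (Im (f w))) \<zeta>"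
      unfolding conjugate_poisson_def
      by (rule Bochner_Integration.integral_add) (rule integrable_conjugate_poisson[OF ci(1) \<zeta>],
          rule integrable_conjugate_poisson[OF ci(3) \<zeta>])
    also have "conjugate_poisson (\<lambda>w. \<i> * complex_of_real (Im (f w))) \<zeta>
        = \<i> * conjugate_poisson (\<lambda>w. complex_of_real (Im (f w))) \<zeta>"
      unfolding conjugate_poisson_def mult.assoc by (rule integral_mult_right_zero)
    finally show ?thesis .
  qed
  then show "conjugate_poisson f \<zeta>
      = of_real (Im (herglotz (\<lambda>w. complex_of_real (Re (f w))) \<zeta>))
        + \<i> * of_real (Im (herglotz (\<lambda>w. complex_of_real (Im (f w))) \<zeta>))"
    by (simp only: conjugate_poisson_of_real[OF i(1) \<zeta>] conjugate_poisson_of_real[OF i(2) \<zeta>])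
qed

text \<open>The limits for the real and the imaginary part of \<open>f\<close> combine linearly. In
  particular the \<open>Lim\<close> in \<open>conjugate_function\<close> is a genuine limit almost
  everywhere, so the values of the Riesz projection can be read off the disc.\<close>

theorem herglotz_radial_limit:
  assumes f: "integrable circle_measure f"
  shows "AE z in circle_measure. ((\<lambda>r. herglotz f (of_real r * z)) \<longlongrightarrow> f z + \<i> * conjugate_function f z) (at_left 1)"
proof -
  have i: "integrable circle_measure (\<lambda>w. Re (f w))" "integrable circle_measure (\<lambda>w. Im (f w))"
    using f by auto
  show ?thesis
    using herglotz_radial_limit_real[OF i(1)] herglotz_radial_limit_real[OF i(2)] AE_space
  proof eventually_elim
    case (elim z)
    then have z: "cmod z = 1" by simp
    obtain L K where L: "((\<lambda>r. herglotz (\<lambda>w. complex_of_real (Re (f w))) (of_real r * z)) \<longlongrightarrow> L) (at_left 1)" "Re L = Re (f z)"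
      and K: "((\<lambda>r. herglotz (\<lambda>w. complex_of_real (Im (f w))) (of_real r * z)) \<longlongrightarrow> K) (at_left 1)" "Re K = Im (f z)"
      using elim by blast
    have ev: "eventually (\<lambda>r. cmod (complex_of_real r * z) < 1) (at_left 1)"
      using eventually_at_left_1 by eventually_elim (use cmod_radius_less[OF z] in auto)
    have "((\<lambda>r. of_real (Im (herglotz (\<lambda>w. complex_of_real (Re (f w))) (of_real r * z)))
        + \<i> * of_real (Im (herglotz (\<lambda>w. complex_of_real (Im (f w))) (of_real r * z)))) \<longlongrightarrow> of_real (Im L) + \<i> * of_real (Im K)) (at_left 1)"
      by (intro tendsto_intros L K)
    moreover have "eventually (\<lambda>r. conjugate_poisson f (of_real r * z) = of_real (Im (herglotz (\<lambda>w. complex_of_real (Re (f w))) (of_real r * z)))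
        + \<i> * of_real (Im (herglotz (\<lambda>w. complex_of_real (Im (f w))) (of_real r * z)))) (at_left 1)"
      using ev by eventually_elim (rule conjugate_poisson_herglotz_parts(1)[OF f])
    ultimately have "((\<lambda>r. conjugate_poisson f (of_real r * z)) \<longlongrightarrow> of_real (Im L) + \<i> * of_real (Im K)) (at_left 1)"
      by (simp add: tendsto_cong)
    then have c: "conjugate_function f z = of_real (Im L) + \<i> * of_real (Im K)"
      unfolding conjugate_function_eq by (intro tendsto_Lim trivial_limit_at_left_real)
    have "((\<lambda>r. herglotz (\<lambda>w. complex_of_real (Re (f w))) (of_real r * z)
        + \<i> * herglotz (\<lambda>w. complex_of_real (Im (f w))) (of_real r * z)) \<longlongrightarrow> L + \<i> * K) (at_left 1)"
      by (intro tendsto_intros L K)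
    moreover have "eventually (\<lambda>r. herglotz f (of_real r * z) = herglotz (\<lambda>w. complex_of_real (Re (f w))) (of_real r * z)
        + \<i> * herglotz (\<lambda>w. complex_of_real (Im (f w))) (of_real r * z)) (at_left 1)"
      using ev by eventually_elim (rule conjugate_poisson_herglotz_parts(2)[OF f])
    ultimately have "((\<lambda>r. herglotz f (of_real r * z)) \<longlongrightarrow> L + \<i> * K) (at_left 1)"
      by (simp add: tendsto_cong)
    moreover have "L + \<i> * K = f z + \<i> * conjugate_function f z"
      using L(2) K(2) by (simp add: c complex_eq_iff)
    ultimately show ?case by simp
  qed
qed

lemma continuous_on_herglotz:
  "integrable circle_measure f \<Longrightarrow> continuous_on (ball 0 1) (herglotz f)"
  by (intro holomorphic_on_imp_continuous_on herglotz_holomorphic)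

lemma continuous_on_conjugate_poisson:
  assumes f: "integrable circle_measure f"
  shows "continuous_on (ball 0 1) (conjugate_poisson f)"
proof -
  have "continuous_on (ball 0 1) (\<lambda>\<zeta>. of_real (Im (herglotz (\<lambda>w. complex_of_real (Re (f w))) \<zeta>))
        + \<i> * of_real (Im (herglotz (\<lambda>w. complex_of_real (Im (f w))) \<zeta>)))"
    using f by (intro continuous_intros continuous_on_herglotz) auto
  then show ?thesis
    by (rule continuous_on_eq) (use conjugate_poisson_herglotz_parts(1)[OF f] in auto)
qed

text \<open>\<open>Lim\<close> is the same unspecified value wherever the limit does not exist, so it is measurable
  because the set of convergence is.\<close>
lemma Lim_nonexistent:
  fixes h :: "'b \<Rightarrow> 'a::t2_space"
  assumes "\<nexists>l. (h \<longlongrightarrow> l) F"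
  shows "Lim F h = (THE l. False)"
proof -
  have "(\<lambda>l. (h \<longlongrightarrow> l) F) = (\<lambda>l. False)" using assms by auto
  then show ?thesis unfolding t2_space_class.Lim_def by (rule arg_cong)
qed

text \<open>The Cauchy criterion with countable outer quantifiers and a non-strict inequality: if
  \<open>h\<close> depends continuously on a point of the circle, the inner condition defines a
  closed set, so the set of convergence is a Borel set.\<close>

lemma cauchy_at_left_1_iff:
  fixes h :: "real \<Rightarrow> complex"
  shows "(\<exists>l. (h \<longlongrightarrow> l) (at_left 1)) \<longleftrightarrow>
    (\<forall>k. \<exists>m. \<forall>r s. 1 - 1 / Suc m < r \<and> r < 1 \<and> 1 - 1 / Suc m < s \<and> s < 1 \<longrightarrow> dist (h r) (h s) \<le> 1 / Suc k)"
    (is "_ = ?R")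
proof
  assume "\<exists>l. (h \<longlongrightarrow> l) (at_left 1)"
  then obtain l where l: "(h \<longlongrightarrow> l) (at_left 1)" by blast
  show ?R
  proof
    fix k
    have "eventually (\<lambda>r. dist (h r) l < 1 / Suc k / 2) (at_left 1)"
      using l by (rule tendstoD) simp
    then obtain b where b: "b < 1" "\<And>r. b < r \<Longrightarrow> r < 1 \<Longrightarrow> dist (h r) l < 1 / Suc k / 2"
      unfolding eventually_at_left_field by blast
    obtain m where m: "1 / real (Suc m) < 1 - b"
      using b reals_Archimedean[of "1 - b"] by (auto simp: inverse_eq_divide)
    have "dist (h r) (h s) \<le> 1 / Suc k" if "1 - 1 / Suc m < r" "r < 1" "1 - 1 / Suc m < s" "s < 1" for r s
    proof -
      have "b < r" "b < s" using that m by linarith+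
      then have "dist (h r) l < 1 / Suc k / 2" "dist (h s) l < 1 / Suc k / 2"
        using that b(2) by blast+
      then show ?thesis using dist_triangle2[of "h r" "h s" l] by linarith
    qed
    then show "\<exists>m. \<forall>r s. 1 - 1 / Suc m < r \<and> r < 1 \<and> 1 - 1 / Suc m < s \<and> s < 1 \<longrightarrow> dist (h r) (h s) \<le> 1 / Suc k"
      by blast
  qed
next
  assume R: ?R
  \<comment> \<open>The factor \<open>2\<close> puts \<open>s n\<close> strictly inside the window
    belonging to every \<open>m \<le> n\<close>.\<close>
  define s where "s n = 1 - 1 / (2 * real (Suc n))" for n
  have s1: "s n < 1" for n by (simp add: s_def)
  have sm: "1 - 1 / Suc m < s n" if "m \<le> n" for m n
  proof -
    have "1 / (2 * real (Suc n)) < 1 / real (Suc m)"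
      using that by (intro divide_strict_left_mono) auto
    then show ?thesis by (simp add: s_def)
  qed
  have "\<forall>k. \<exists>m. \<forall>r t. 1 - 1 / Suc m < r \<and> r < 1 \<and> 1 - 1 / Suc m < t \<and> t < 1 \<longrightarrow> dist (h r) (h t) \<le> 1 / Suc k"
    by (rule R)
  then obtain m where m: "\<And>k r t. 1 - 1 / Suc (m k) < r \<Longrightarrow> r < 1 \<Longrightarrow> 1 - 1 / Suc (m k) < t \<Longrightarrow> t < 1 \<Longrightarrow> dist (h r) (h t) \<le> 1 / Suc k"
    by metis
  have sk: "\<exists>k. 1 / real (Suc k) < e" if "e > 0" for e :: real
    using that reals_Archimedean[of e] by (auto simp: inverse_eq_divide)
  have "Cauchy (\<lambda>n. h (s n))"
  proof (rule metric_CauchyI)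
    fix e :: real assume "e > 0"
    then obtain k where k: "1 / real (Suc k) < e" using sk by blast
    have "dist (h (s i)) (h (s j)) < e" if "i \<ge> m k" "j \<ge> m k" for i j
      using m[OF sm[OF that(1)] s1 sm[OF that(2)] s1] k by linarith
    then show "\<exists>M. \<forall>i\<ge>M. \<forall>j\<ge>M. dist (h (s i)) (h (s j)) < e" by blast
  qed
  then obtain l where l: "(\<lambda>n. h (s n)) \<longlonglongrightarrow> l" using Cauchy_convergent convergent_def by blast
  have "(h \<longlongrightarrow> l) (at_left 1)"
  proof (rule tendstoI)
    fix e :: real assume "e > 0"
    then obtain k where k: "1 / real (Suc k) < e" using sk by blast
    have "dist (h r) l \<le> 1 / Suc k" if r: "1 - 1 / Suc (m k) < r" "r < 1" for r
    proof -
      have "(\<lambda>n. dist (h r) (h (s n))) \<longlonglongrightarrow> dist (h r) l" by (intro tendsto_intros l)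
      moreover have "dist (h r) (h (s n)) \<le> 1 / Suc k" if "n \<ge> m k" for n
        using m[OF r sm[OF that] s1] .
      ultimately show ?thesis by (intro LIMSEQ_le_const2) blast+
    qed
    then show "eventually (\<lambda>r. dist (h r) l < e) (at_left 1)"
      unfolding eventually_at_left_field using k
      by (intro exI[of _ "1 - 1 / Suc (m k)"]) (auto intro: le_less_trans)
  qed
  then show "\<exists>l. (h \<longlongrightarrow> l) (at_left 1)" by blast
qed

lemma measurable_conjugate_function:
  assumes f: "integrable circle_measure f"
  shows "conjugate_function f \<in> borel_measurable circle_measure"
proof -
  define c where "c r z = conjugate_poisson f (of_real r * z)" for r and z :: complex
  note cont = continuous_on_conjugate_poisson[OF f]
  have cz: "continuous_on (sphere 0 1) (c r)" if "0 \<le> r" "r < 1" for r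
    unfolding c_def by (rule continuous_on_radius[OF cont that])
  define B where "B k m = {z \<in> space circle_measure. \<forall>r s. 1 - 1 / Suc m < r \<and> r < 1 \<and> 1 - 1 / Suc m < s \<and> s < 1
    \<longrightarrow> dist (c r z) (c s z) \<le> 1 / Suc k}" for k m :: nat
  have B: "B k m \<in> sets circle_measure" for k m
  proof -
    have rs0: "0 \<le> r" if "1 - 1 / real (Suc m) < r" for r
    proof -
      have "1 / real (Suc m) \<le> 1" by simp
      then show ?thesis using that by linarith
    qed
    have cl: "closedin (top_of_set (sphere 0 1)) {z \<in> sphere 0 1. dist (c r z) (c s z) \<le> 1 / Suc k}"
      if "1 - 1 / Suc m < r" "r < 1" "1 - 1 / Suc m < s" "s < 1" for r s
    proof -
      have "continuous_on (sphere 0 1) (\<lambda>z. dist (c r z) (c s z))"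
        using that by (intro continuous_intros cz rs0) auto
      then have "closed (sphere 0 1 \<inter> (\<lambda>z. dist (c r z) (c s z)) -` {..1 / Suc k})"
        by (rule continuous_closed_preimage) auto
      also have "sphere 0 1 \<inter> (\<lambda>z. dist (c r z) (c s z)) -` {..1 / Suc k}
          = {z \<in> sphere 0 1. dist (c r z) (c s z) \<le> 1 / Suc k}" by auto
      finally show ?thesis by (auto intro: closed_subset)
    qed
    have "closed {z \<in> sphere 0 1. dist (c r z) (c s z) \<le> 1 / Suc k}"
      if "1 - 1 / Suc m < r" "r < 1" "1 - 1 / Suc m < s" "s < 1" for r s
      using closedin_closed_trans[OF cl[OF that]] by simp
    \<comment> \<open>The intersection runs over uncountably many pairs of radii, so measurability
      has to come from closedness.\<close>
    then have "closed (\<Inter>p\<in>{(r, s). 1 - 1 / Suc m < r \<and> r < 1 \<and> 1 - 1 / Suc m < s \<and> s < 1}.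
        {z \<in> sphere 0 1. dist (c (fst p) z) (c (snd p) z) \<le> 1 / Suc k})"
      by (intro closed_INT) auto
    then have "sphere 0 1 \<inter> (\<Inter>p\<in>{(r, s). 1 - 1 / Suc m < r \<and> r < 1 \<and> 1 - 1 / Suc m < s \<and> s < 1}.
        {z \<in> sphere 0 1. dist (c (fst p) z) (c (snd p) z) \<le> 1 / Suc k}) \<in> sets circle_measure"
      by (rule closed_Int_sphere_sets)
    also have "sphere 0 1 \<inter> (\<Inter>p\<in>{(r, s). 1 - 1 / Suc m < r \<and> r < 1 \<and> 1 - 1 / Suc m < s \<and> s < 1}.
        {z \<in> sphere 0 1. dist (c (fst p) z) (c (snd p) z) \<le> 1 / Suc k}) = B k m"
      by (auto simp: B_def)
    finally show ?thesis .
  qed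
  define C where "C = (\<Inter>k. \<Union>m. B k m)"
  have C: "C \<in> sets circle_measure" unfolding C_def by (intro sets.countable_INT sets.countable_UN) (use B in auto)
  have Ciff: "z \<in> C \<longleftrightarrow> (\<exists>l. ((\<lambda>r. c r z) \<longlongrightarrow> l) (at_left 1))" if "cmod z = 1" for z
    unfolding cauchy_at_left_1_iff C_def B_def using that by auto
  define s where "s n = 1 - 1 / (real (Suc n))" for n
  have s01: "0 \<le> s n" "s n < 1" for n by (auto simp: s_def)
  have sl: "filterlim s (at_left 1) sequentially"
    unfolding filterlim_at
  proof
    show "eventually (\<lambda>n. s n \<in> {..<1} \<and> s n \<noteq> 1) sequentially"
      using s01 by (auto intro!: always_eventually) (metis less_irrefl)
    have "(\<lambda>n. 1 - 1 / real (Suc n)) \<longlonglongrightarrow> 1 - 0"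
      by (intro tendsto_intros LIMSEQ_Suc lim_1_over_n)
    then show "s \<longlonglongrightarrow> 1" unfolding s_def by simp
  qed
  have cm: "c (s n) \<in> borel_measurable circle_measure" for n
    by (rule continuous_imp_measurable_circle[OF cz[OF s01]])
  define u where "u n z = (if z \<in> C then c (s n) z else (THE l. False))" for n z
  have um: "u n \<in> borel_measurable circle_measure" for n
    unfolding u_def by (rule measurable_If_set) (use cm sets.Int[OF C sets.top] in auto)
  show ?thesis
  proof (rule borel_measurable_LIMSEQ_metric[OF um])
    fix z assume "z \<in> space circle_measure"
    then have z: "cmod z = 1" by simp
    show "(\<lambda>n. u n z) \<longlonglongrightarrow> conjugate_function f z"
    proof (cases "z \<in> C")
      case True
      then obtain l where l: "((\<lambda>r. c r z) \<longlongrightarrow> l) (at_left 1)" using Ciff[OF z] by blast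
      then have "conjugate_function f z = l"
        unfolding conjugate_function_eq c_def by (intro tendsto_Lim trivial_limit_at_left_real)
      then show ?thesis using filterlim_compose[OF l sl] True by (simp add: u_def)
    next
      case False
      then have "conjugate_function f z = (THE l. False)"
        unfolding conjugate_function_eq using Ciff[OF z] Lim_nonexistent unfolding c_def by blast
      then show ?thesis using False by (simp add: u_def)
    qed
  qed
qed

lemma fourier_coeff_0: "fourier_coeff f 0 = (\<integral>w. f w \<partial>circle_measure)"
  by (simp add: fourier_coeff_def pairing_def)

lemma riesz_projection_radial_limit:
  assumes f: "integrable circle_measure f"
  shows "AE z in circle_measure. ((\<lambda>r. (herglotz f (of_real r * z) + fourier_coeff f 0) / 2) \<longlongrightarrow> riesz_projection f z) (at_left 1)"
  using herglotz_radial_limit[OF f]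
  by eventually_elim (auto simp: riesz_projection_def intro!: tendsto_intros)

lemma measurable_riesz_projection:
  assumes f: "integrable circle_measure f"
  shows "riesz_projection f \<in> borel_measurable circle_measure"
proof -
  have [measurable]: "conjugate_function f \<in> borel_measurable circle_measure" "f \<in> borel_measurable circle_measure"
    using measurable_conjugate_function[OF f] f by auto
  show ?thesis unfolding riesz_projection_def by measurable
qed

section \<open>Decreasing rearrangements\<close>

definition distr_fun :: "(complex \<Rightarrow> complex) \<Rightarrow> real \<Rightarrow> real" where
  "distr_fun f l = measure circle_measure {z \<in> space circle_measure. l < cmod (f z)}"

text \<open>For unbounded \<open>f\<close> the infimum at \<open>t \<le> 0\<close> would be over the
  empty set; the value \<open>0\<close> there keeps the function real and nonnegative.\<close>

definition rearr :: "(complex \<Rightarrow> complex) \<Rightarrow> real \<Rightarrow> real" where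
  "rearr f t = (if t \<le> 0 then 0 else Inf {l. 0 \<le> l \<and> distr_fun f l \<le> t})"

lemma distr_fun_bounds: "0 \<le> distr_fun f l" "distr_fun f l \<le> 1"
  by (auto simp: distr_fun_def measure_circle_le_1)

lemma sets_superlevel [simp]:
  assumes [measurable]: "f \<in> L0"
  shows "{z. cmod z = 1 \<and> l < cmod (f z)} \<in> sets circle_measure"
proof -
  have "{z \<in> space circle_measure. l < cmod (f z)} \<in> sets circle_measure" by measurable
  then show ?thesis by simp
qed

lemma distr_fun_antimono: "f \<in> L0 \<Longrightarrow> l \<le> l' \<Longrightarrow> distr_fun f l' \<le> distr_fun f l"
  unfolding distr_fun_def by (rule circle.finite_measure_mono) auto

lemma distr_fun_mono_AE:
  assumes "g \<in> L0" "AE z in circle_measure. cmod (f z) \<le> cmod (g z)"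
  shows "distr_fun f l \<le> distr_fun g l"
  unfolding distr_fun_def
  by (rule circle.finite_measure_mono_AE) (use assms in auto)

lemma distr_fun_ev_le:
  assumes f: "f \<in> L0" and t: "t > 0"
  shows "\<exists>l\<ge>0. distr_fun f l \<le> t"
proof -
  have "(\<lambda>n. distr_fun f (real n)) \<longlonglongrightarrow> measure circle_measure (\<Inter>n. {z \<in> space circle_measure. real n < cmod (f z)})"
    unfolding distr_fun_def
    by (rule circle.finite_Lim_measure_decseq) (use f in \<open>auto simp: decseq_def\<close>)
  also have "(\<Inter>n. {z \<in> space circle_measure. real n < cmod (f z)}) = {}"
    using reals_Archimedean2 by (auto, metis less_asym)
  finally have "(\<lambda>n. distr_fun f (real n)) \<longlonglongrightarrow> 0" by simp
  then have "eventually (\<lambda>n. distr_fun f (real n) < t) sequentially" using t by (intro order_tendstoD(2))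
  then obtain n where "distr_fun f (real n) < t" by (auto simp: eventually_sequentially)
  then show ?thesis by (intro exI[of _ "real n"]) auto
qed

lemma distr_fun_right_continuous:
  assumes f: "f \<in> L0" and le: "\<And>l. l > a \<Longrightarrow> distr_fun f l \<le> t"
  shows "distr_fun f a \<le> t"
proof -
  have "(\<lambda>n. distr_fun f (a + 1 / real (Suc n))) \<longlonglongrightarrow> measure circle_measure (\<Union>n. {z \<in> space circle_measure. a + 1 / real (Suc n) < cmod (f z)})"
    unfolding distr_fun_def
  proof (rule circle.finite_Lim_measure_incseq)
    show "incseq (\<lambda>n. {z \<in> space circle_measure. a + 1 / real (Suc n) < cmod (f z)})"
    proof (rule incseq_SucI, safe)
      fix n z assume "a + 1 / real (Suc n) < cmod (f z)"
      moreover have "1 / real (Suc (Suc n)) \<le> 1 / real (Suc n)" by (rule divide_left_mono) auto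
      ultimately show "a + 1 / real (Suc (Suc n)) < cmod (f z)" by linarith
    qed
  qed (use f in auto)
  also have "(\<Union>n. {z \<in> space circle_measure. a + 1 / real (Suc n) < cmod (f z)}) = {z \<in> space circle_measure. a < cmod (f z)}"
  proof safe
    fix z n assume "a + 1 / real (Suc n) < cmod (f z)"
    moreover have "0 < 1 / real (Suc n)" by simp
    ultimately show "a < cmod (f z)" by linarith
  next
    fix z assume z: "z \<in> space circle_measure" "a < cmod (f z)"
    then obtain n where "inverse (real (Suc n)) < cmod (f z) - a" using reals_Archimedean[of "cmod (f z) - a"] by auto
    then show "z \<in> (\<Union>n. {z \<in> space circle_measure. a + 1 / real (Suc n) < cmod (f z)})"
      using z by (auto simp: inverse_eq_divide intro!: exI[of _ n])
  qed
  finally have "(\<lambda>n. distr_fun f (a + 1 / real (Suc n))) \<longlonglongrightarrow> distr_fun f a" by (simp only: distr_fun_def)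
  then show ?thesis
    by (rule LIMSEQ_le_const2) (use le in auto)
qed

text \<open>The distribution function is continuous from the right, so the infimum is attained and
  both inequalities can be non-strict.\<close>

lemma rearr_le_iff:
  assumes f: "f \<in> L0" and t: "t > 0" and l: "l \<ge> 0"
  shows "rearr f t \<le> l \<longleftrightarrow> distr_fun f l \<le> t"
proof
  have bdd: "bdd_below {l. 0 \<le> l \<and> distr_fun f l \<le> t}" by (rule bdd_belowI[of _ 0]) auto
  have ne: "{l. 0 \<le> l \<and> distr_fun f l \<le> t} \<noteq> {}" using distr_fun_ev_le[OF f t] by auto
  have R: "rearr f t = Inf {l. 0 \<le> l \<and> distr_fun f l \<le> t}" using t by (simp add: rearr_def)
  show "distr_fun f l \<le> t \<Longrightarrow> rearr f t \<le> l"
    unfolding R by (rule cInf_lower) (use l bdd in auto)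
  assume le: "rearr f t \<le> l"
  show "distr_fun f l \<le> t"
  proof (rule distr_fun_right_continuous[OF f])
    fix l' assume "l' > l"
    then have "Inf {l. 0 \<le> l \<and> distr_fun f l \<le> t} < l'" using le R by simp
    then obtain x where "x \<in> {l. 0 \<le> l \<and> distr_fun f l \<le> t}" "x < l'"
      using cInf_lessD[OF ne] by blast
    then show "distr_fun f l' \<le> t" using distr_fun_antimono[OF f, of x l'] by auto
  qed
qed

lemma rearr_nonneg: "f \<in> L0 \<Longrightarrow> 0 \<le> rearr f t"
proof (cases "t \<le> 0")
  case False
  assume f: "f \<in> L0"
  have "{l. 0 \<le> l \<and> distr_fun f l \<le> t} \<noteq> {}" using distr_fun_ev_le[OF f, of t] False by auto
  then show ?thesis using False by (auto simp: rearr_def intro!: cInf_greatest)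
qed (simp add: rearr_def)

lemma rearr_less_iff:
  "f \<in> L0 \<Longrightarrow> l \<ge> 0 \<Longrightarrow> t > 0 \<Longrightarrow> l < rearr f t \<longleftrightarrow> t < distr_fun f l"
  using rearr_le_iff[of f t l] by linarith

lemma distr_fun_rearr: "f \<in> L0 \<Longrightarrow> t > 0 \<Longrightarrow> distr_fun f (rearr f t) \<le> t"
  using rearr_le_iff[of f t "rearr f t"] rearr_nonneg by auto

lemma rearr_antimono:
  assumes "f \<in> L0" "0 < s" "s \<le> t"
  shows "rearr f t \<le> rearr f s"
  using distr_fun_rearr[of f s] assms rearr_nonneg[OF assms(1)] by (subst rearr_le_iff) auto

lemma rearr_eq_0: "f \<in> L0 \<Longrightarrow> t \<ge> 1 \<Longrightarrow> rearr f t = 0"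
  using rearr_le_iff[of f t 0] rearr_nonneg[of f t] distr_fun_bounds(2)[of f 0] by auto

text \<open>Normalized to be uniformly distributed on \<open>{0..<1}\<close>, so that it carries
  rearrangements, which are functions of a measure in \<open>{0..1}\<close>, back to the
  circle.\<close>

definition circle_angle :: "complex \<Rightarrow> real" where
  "circle_angle z = Arg2pi z / (2 * pi)"

lemma circle_angle_bounds: "0 \<le> circle_angle z" "circle_angle z < 1"
  using Arg2pi_ge_0[of z] Arg2pi_lt_2pi[of z] by (auto simp: circle_angle_def)

text \<open>\<open>Arg2pi\<close> is continuous off the nonnegative real axis, which meets the
  circle only in \<open>1\<close>.\<close>

lemma measurable_circle_angle [measurable]: "circle_angle \<in> borel_measurable circle_measure"
proof -
  have "Arg2pi \<in> borel_measurable circle_measure"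
    unfolding borel_measurable_iff_less
  proof
    fix a
    have cont: "continuous_on (sphere 0 1 - {1}) Arg2pi"
    proof (rule continuous_at_imp_continuous_on, rule ballI, rule continuous_at_Arg2pi)
      fix z :: complex assume "z \<in> sphere 0 1 - {1}"
      then show "z \<notin> \<real>\<^sub>\<ge>\<^sub>0" by (auto simp: complex_nonneg_Reals_iff cmod_def complex_eq_iff power2_eq_1_iff)
    qed
    have "openin (top_of_set (sphere 0 1 - {1})) ((sphere 0 1 - {1}) \<inter> Arg2pi -` {..<a})"
      by (rule continuous_openin_preimage_gen[OF cont]) simp
    then obtain T where T: "open T" "(sphere 0 1 - {1}) \<inter> Arg2pi -` {..<a} = (sphere 0 1 - {1}) \<inter> T"
      by (auto simp: openin_open)
    show "{w \<in> space circle_measure. Arg2pi w < a} \<in> sets circle_measure"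
    proof (cases "a > 0")
      case True
      have A1: "Arg2pi 1 = 0" by (simp add: Arg2pi_eq_0)
      have "{w \<in> space circle_measure. Arg2pi w < a} = (sphere 0 1 \<inter> {1}) \<union> (sphere 0 1 \<inter> (T - {1}))"
      proof -
        have "Arg2pi w < a \<longleftrightarrow> w \<in> T" if "cmod w = 1" "w \<noteq> 1" for w
        proof -
          have "w \<in> sphere 0 1 - {1}" using that by simp
          then show ?thesis using T(2) by blast
        qed
        then show ?thesis using True A1 by (intro set_eqI) (case_tac "x = 1", auto)
      qed
      moreover have "sphere 0 1 \<inter> {1} \<in> sets circle_measure" "sphere 0 1 \<inter> (T - {1}) \<in> sets circle_measure"
        using T(1) by (intro closed_Int_sphere_sets open_Int_sphere_sets open_Diff closed_singleton)+
      ultimately show ?thesis by (simp only: sets.Un)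
    next
      case False
      then have "{w \<in> space circle_measure. Arg2pi w < a} = {}"
        using Arg2pi_ge_0 by (auto simp: not_less) (meson dual_order.strict_trans1 less_le_not_le order_trans)
      then show ?thesis by (simp only: sets.empty_sets)
    qed
  qed
  then show ?thesis unfolding circle_angle_def by measurable
qed

lemma measure_circle_angle_less:
  assumes "0 \<le> m" "m \<le> 1"
  shows "measure circle_measure {z \<in> space circle_measure. circle_angle z < m} = m"
proof -
  have Arg: "Arg2pi (cis t) = t" if "t \<in> {0..<2*pi}" for t
    by (rule Arg2pi_unique[of 1]) (use that in \<open>auto simp: cis_conv_exp\<close>)
  have "emeasure circle_measure {z \<in> space circle_measure. circle_angle z < m}
    = emeasure lborel {t \<in> {0..<2*pi}. circle_angle (cis t) < m} / ennreal (2*pi)"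
    by (rule emeasure_circle) measurable
  also have "{t \<in> {0..<2*pi}. circle_angle (cis t) < m} = {0..<2*pi*m}"
  proof -
    have "t < 2 * pi" if "t < 2 * pi * m" for t
    proof -
      have "2 * pi * m \<le> 2 * pi * 1" using assms by (intro mult_left_mono) auto
      then show ?thesis using that by linarith
    qed
    then show ?thesis
      using Arg by (auto simp: circle_angle_def pos_divide_less_eq mult.commute)
  qed
  also have "emeasure lborel {0..<2*pi*m} / ennreal (2*pi) = ennreal m"
    using assms by (simp add: divide_ennreal)
  finally show ?thesis using assms by (simp add: measure_def)
qed

lemma AE_circle_angle_pos: "AE z in circle_measure. 0 < circle_angle z"
proof -
  have le: "measure circle_measure {z \<in> space circle_measure. circle_angle z \<le> 0} \<le> m" if "0 < m" "m \<le> 1" for m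
  proof -
    have "measure circle_measure {z \<in> space circle_measure. circle_angle z \<le> 0} \<le> measure circle_measure {z \<in> space circle_measure. circle_angle z < m}"
      by (rule circle.finite_measure_mono) (use that in \<open>auto simp del: space_circle_measure\<close>)
    then show ?thesis using measure_circle_angle_less[of m] that by simp
  qed
  have "measure circle_measure {z \<in> space circle_measure. circle_angle z \<le> 0} \<le> 0"
  proof (rule field_le_epsilon)
    fix e :: real assume "0 < e"
    show "measure circle_measure {z \<in> space circle_measure. circle_angle z \<le> 0} \<le> 0 + e"
    proof (cases "e \<le> 1")
      case True
      then show ?thesis using le[OF \<open>0 < e\<close>] by simp
    next
      case False
      then show ?thesis
        using measure_circle_le_1[of "{z \<in> space circle_measure. circle_angle z \<le> 0}"] by linarith
    qed
  qed
  then have "measure circle_measure {z \<in> space circle_measure. circle_angle z \<le> 0} = 0"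
    by (simp add: measure_le_0_iff)
  then have e: "emeasure circle_measure {z \<in> space circle_measure. circle_angle z \<le> 0} = 0"
    by (simp add: circle.emeasure_eq_measure)
  show ?thesis
  proof (rule AE_I[OF _ e])
    show "{z \<in> space circle_measure. circle_angle z \<le> 0} \<in> sets circle_measure" by measurable
  qed auto
qed

lemma measurable_rearr_angle:
  assumes f: "f \<in> L0" and s: "s > 0"
  shows "(\<lambda>z. rearr f (s * circle_angle z)) \<in> borel_measurable circle_measure"
  unfolding borel_measurable_iff_greater
proof
  fix l
  show "{w \<in> space circle_measure. l < rearr f (s * circle_angle w)} \<in> sets circle_measure"
  proof (cases "l \<ge> 0")
    case True
    have "l < rearr f (s * circle_angle w) \<longleftrightarrow> 0 < s * circle_angle w \<and> s * circle_angle w < distr_fun f l" for w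
    proof (cases "0 < circle_angle w")
      case True
      then show ?thesis using rearr_less_iff[OF f \<open>l \<ge> 0\<close>] s by auto
    next
      case False
      then have "s * circle_angle w \<le> 0" using s circle_angle_bounds(1)[of w] by simp
      then show ?thesis using \<open>l \<ge> 0\<close> by (simp add: rearr_def)
    qed
    then show ?thesis by (simp only:) measurable
  next
    case False
    then have "l < rearr f (s * circle_angle w)" for w using rearr_nonneg[OF f] by (meson less_le_trans not_less)
    then have "{w \<in> space circle_measure. l < rearr f (s * circle_angle w)} = space circle_measure" by auto
    then show ?thesis by (simp only: sets.top)
  qed
qed

text \<open>Off the null set of angle \<open>0\<close>, the value exceeds \<open>l\<close> exactly
  on the arc of angles below \<open>distr_fun f l\<close>, and the measure of that arc is this
  number.\<close>

lemma distr_fun_rearr_angle: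
  assumes f: "f \<in> L0" and l: "l \<ge> 0"
  shows "distr_fun (\<lambda>z. complex_of_real (rearr f (circle_angle z))) l = distr_fun f l"
proof -
  have [measurable]: "(\<lambda>z. rearr f (circle_angle z)) \<in> borel_measurable circle_measure"
    using measurable_rearr_angle[OF f, of 1] by simp
  have "distr_fun (\<lambda>z. complex_of_real (rearr f (circle_angle z))) l
      = measure circle_measure {z \<in> space circle_measure. l < rearr f (circle_angle z)}"
    unfolding distr_fun_def using rearr_nonneg[OF f] by simp
  also have "\<dots> = measure circle_measure {z \<in> space circle_measure. circle_angle z < distr_fun f l}"
  proof (rule circle.finite_measure_eq_AE)
    show "AE z in circle_measure. z \<in> {z \<in> space circle_measure. l < rearr f (circle_angle z)} \<longleftrightarrow>
       z \<in> {z \<in> space circle_measure. circle_angle z < distr_fun f l}"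
      using AE_circle_angle_pos by eventually_elim (use rearr_less_iff[OF f l] in auto)
  qed measurable
  also have "\<dots> = distr_fun f l" by (rule measure_circle_angle_less) (use distr_fun_bounds in auto)
  finally show ?thesis .
qed

lemma equimeasurable_iff: "equimeasurable f g \<longleftrightarrow> (\<forall>l\<ge>0. distr_fun f l = distr_fun g l)"
  by (simp add: equimeasurable_def distr_fun_def)

section \<open>The rearrangement of a Herglotz transform\<close>

lemma herglotz_sum:
  assumes "finite I" "\<And>i. i \<in> I \<Longrightarrow> integrable circle_measure (f i)" "cmod \<zeta> < 1"
  shows "herglotz (\<lambda>w. \<Sum>i\<in>I. f i w) \<zeta> = (\<Sum>i\<in>I. herglotz (f i) \<zeta>)"
  unfolding herglotz_def sum_distrib_right
  by (rule Bochner_Integration.integral_sum) (use integrable_herglotz assms in blast)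

lemma measurable_herglotz_radius:
  assumes "integrable circle_measure f" "0 \<le> r" "r < 1"
  shows "(\<lambda>z. herglotz f (of_real r * z)) \<in> borel_measurable circle_measure"
  by (intro continuous_imp_measurable_circle continuous_on_radius continuous_on_herglotz assms)

text \<open>Divided by the height \<open>h\<close>, the transform has real part in
  \<open>{0..1}\<close> and a value at the origin at most the measure of the support. In
  \<open>1 + y\<close> the \<open>1\<close> pays for the real part and \<open>y\<close> for the
  imaginary part, which \<open>cosh_estimate\<close> controls.\<close>

lemma weak_type_layer:
  fixes g :: "complex \<Rightarrow> real"
  assumes g: "integrable circle_measure g" "\<And>w. 0 \<le> g w" "\<And>w. g w \<le> h"
    and x: "measure circle_measure {w \<in> space circle_measure. g w \<noteq> 0} \<le> x"
    and r: "0 \<le> r" "r < 1" and y: "0 \<le> y" "cosh y > 1"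
  shows "distr_fun (\<lambda>z. herglotz (\<lambda>w. complex_of_real (g w)) (of_real r * z)) ((1 + y) * h) \<le> x / (cosh y - 1)"
proof (cases "h > 0")
  case False
  then have g0: "g w = 0" for w using g(2,3)[of w] by linarith
  have "h = 0" using g(2,3)[of 0] False by simp
  then have "distr_fun (\<lambda>z. herglotz (\<lambda>w. complex_of_real (g w)) (of_real r * z)) ((1 + y) * h) = 0"
    by (simp add: distr_fun_def herglotz_def g0)
  moreover have "0 \<le> x" using x by (meson measure_nonneg order_trans)
  ultimately show ?thesis using y by (simp only:) simp
next
  case True
  define F where "F = herglotz (\<lambda>w. complex_of_real (g w / h))"
  have [measurable]: "g \<in> borel_measurable circle_measure" using g by auto
  have ig: "integrable circle_measure (\<lambda>w. g w / h)" using g by simp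
  have hol: "F holomorphic_on ball 0 1"
    unfolding F_def by (rule herglotz_holomorphic) (simp only: complex_of_real_integrable_eq ig)
  have Re: "0 \<le> Re (F \<zeta>) \<and> Re (F \<zeta>) \<le> 1" if "cmod \<zeta> < 1" for \<zeta>
    unfolding F_def using Re_herglotz_bounds[OF ig that, of 0 1] g True by simp
  have F0: "F 0 = of_real (\<integral>w. g w / h \<partial>circle_measure)"
    unfolding F_def herglotz_0 by (rule integral_complex_of_real)
  have "(\<integral>w. g w / h \<partial>circle_measure) \<le> (\<integral>w. indicator {w \<in> space circle_measure. g w \<noteq> 0} w \<partial>circle_measure)"
  proof (rule integral_mono[OF ig])
    show "integrable circle_measure (indicat_real {w \<in> space circle_measure. g w \<noteq> 0})"
      by (rule integrable_real_indicator) (measurable, simp add: circle.emeasure_eq_measure)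
  qed (use g True in \<open>auto simp: indicator_def\<close>)
  also have "\<dots> = measure circle_measure {w \<in> space circle_measure. g w \<noteq> 0}"
    by (auto intro!: arg_cong[where f = "measure circle_measure"])
  finally have F0x: "Re (F 0) \<le> x" using x F0 by simp
  have eq: "herglotz (\<lambda>w. complex_of_real (g w)) \<zeta> = of_real h * F \<zeta>" for \<zeta>
    unfolding F_def herglotz_cmult[symmetric] using True by simp
  have contF: "continuous_on (sphere 0 1) (\<lambda>z. F (of_real r * z))"
    by (rule continuous_on_radius[OF holomorphic_on_imp_continuous_on[OF hol] r])
  have [measurable]: "(\<lambda>z. F (of_real r * z)) \<in> borel_measurable circle_measure"
    by (rule continuous_imp_measurable_circle[OF contF])
  have "distr_fun (\<lambda>z. herglotz (\<lambda>w. complex_of_real (g w)) (of_real r * z)) ((1 + y) * h)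
    \<le> measure circle_measure {z \<in> space circle_measure. y \<le> \<bar>Im (F (of_real r * z))\<bar>}"
    unfolding distr_fun_def
  proof (rule circle.finite_measure_mono)
    show "{z \<in> space circle_measure. y \<le> \<bar>Im (F (of_real r * z))\<bar>} \<in> sets circle_measure"
      by measurable
    show "{z \<in> space circle_measure. (1 + y) * h < cmod (herglotz (\<lambda>w. complex_of_real (g w)) (of_real r * z))}
      \<subseteq> {z \<in> space circle_measure. y \<le> \<bar>Im (F (of_real r * z))\<bar>}"
    proof
      fix z assume z: "z \<in> {z \<in> space circle_measure. (1 + y) * h < cmod (herglotz (\<lambda>w. complex_of_real (g w)) (of_real r * z))}"
      then have "h * (1 + y) < h * cmod (F (of_real r * z))" using True by (simp add: eq norm_mult mult.commute)
      then have "1 + y < cmod (F (of_real r * z))" using True by simp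
      moreover have "cmod (F (of_real r * z)) \<le> \<bar>Re (F (of_real r * z))\<bar> + \<bar>Im (F (of_real r * z))\<bar>"
        by (rule cmod_le)
      moreover have "\<bar>Re (F (of_real r * z))\<bar> \<le> 1" using Re[OF cmod_radius_less[OF _ r], of z] z by auto
      ultimately show "z \<in> {z \<in> space circle_measure. y \<le> \<bar>Im (F (of_real r * z))\<bar>}" using z by auto
    qed
  qed
  also have "\<dots> \<le> Re (F 0) / (cosh y - 1)"
    by (rule cosh_estimate[OF hol Re _ r y]) (simp_all add: F0)
  also have "\<dots> \<le> x / (cosh y - 1)" using F0x y by (intro divide_right_mono) auto
  finally show ?thesis .
qed

lemma weak_type_herglotz:
  fixes g :: "complex \<Rightarrow> real"
  assumes g: "integrable circle_measure g" "\<And>w. 0 \<le> g w" and r: "0 \<le> r" "r < 1" and l: "l > 0"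
  shows "distr_fun (\<lambda>z. herglotz (\<lambda>w. complex_of_real (g w)) (of_real r * z)) l
    \<le> 2 * (\<integral>w. g w \<partial>circle_measure) / l"
proof -
  define F where "F = herglotz (\<lambda>w. complex_of_real (g w))"
  have ci: "integrable circle_measure (\<lambda>w. complex_of_real (g w))" using g by simp
  have hol: "F holomorphic_on ball 0 1" unfolding F_def by (rule herglotz_holomorphic[OF ci])
  have Re: "0 \<le> Re (F \<zeta>)" if "cmod \<zeta> < 1" for \<zeta>
    unfolding F_def by (rule Re_herglotz_ge[OF g(1) that]) (use g in auto)
  have [measurable]: "(\<lambda>z. F (of_real r * z)) \<in> borel_measurable circle_measure"
    unfolding F_def by (rule measurable_herglotz_radius[OF ci r])
  have "distr_fun (\<lambda>z. F (of_real r * z)) l \<le> measure circle_measure {z \<in> space circle_measure. l \<le> cmod (F (of_real r * z))}"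
    unfolding distr_fun_def by (rule circle.finite_measure_mono) (auto simp del: space_circle_measure)
  also have "\<dots> \<le> 2 * cmod (F 0) / l" by (rule weak_type_right_half_plane[OF hol Re r l])
  also have "F 0 = of_real (\<integral>w. g w \<partial>circle_measure)"
    unfolding F_def herglotz_0 by (rule integral_complex_of_real)
  finally show ?thesis using g by (simp add: F_def)
qed

text \<open>With \<open>exp 1\<close> bounded below by \<open>2\<close>, \<open>exp (5 * m)\<close>
  is at least \<open>32 ^ m\<close>, hence at least \<open>8 * 4 ^ m\<close>; that is why the
  heights are multiples of \<open>5\<close>. The rate \<open>4 ^ m\<close> beats the rate
  \<open>2 ^ m\<close> at which the supports of the layers grow.\<close>

lemma cosh_lower_bound: "m \<ge> 1 \<Longrightarrow> 2 * 4 ^ m \<le> cosh (5 * real m) - 1"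
proof -
  assume m: "m \<ge> 1"
  have "(2::real) \<le> exp 1" using exp_ge_add_one_self[of 1] by simp
  then have "(2::real) ^ (5 * m) \<le> exp 1 ^ (5 * m)" by (rule power_mono) simp
  also have "\<dots> = exp (5 * real m)" by (simp add: exp_of_nat_mult[symmetric])
  finally have e: "32 ^ m \<le> exp (5 * real m)" by (simp add: power_mult)
  have "(8::real) * 4 ^ m \<le> 8 ^ m * 4 ^ m"
    using m self_le_power[of "8::real" m] by (intro mult_right_mono) auto
  also have "\<dots> = 32 ^ m" by (simp add: power_mult_distrib[symmetric])
  finally have "8 * 4 ^ m \<le> exp (5 * real m)" using e by linarith
  moreover have "exp (5 * real m) / 2 \<le> cosh (5 * real m)" by (simp add: cosh_field_def)
  moreover have "(1::real) \<le> 4 ^ m" by simp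
  ultimately show ?thesis by linarith
qed

text \<open>Abel summation: the weights linear in \<open>j\<close>, which come from the heights at
  which the layers are tested, turn into the plain sum of the levels.\<close>

lemma sum_layers_abel:
  fixes s :: "nat \<Rightarrow> real"
  shows "(\<Sum>j<J. (real j + 1) * (s j - s (Suc j))) = (\<Sum>j<J. s j) - real J * s J"
  by (induction J) (auto simp: algebra_simps)

text \<open>The part of \<open>f\<close> above the level \<open>f\<^sup>*(t)\<close> is estimated by the weak type inequality, the
  part below it is cut at the levels \<open>f\<^sup>*(2\<^sup>j t)\<close> and each layer is estimated exponentially.\<close>
lemma rearr_herglotz_le:
  fixes f :: "complex \<Rightarrow> real"
  assumes f: "integrable circle_measure f" "\<And>w. 0 \<le> f w"
    and t: "t > 0" and J: "2 ^ J * t \<ge> 1" and r: "0 \<le> r" "r < 1"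
  defines "R \<equiv> rearr (\<lambda>w. complex_of_real (f w))"
  shows "rearr (\<lambda>z. herglotz (\<lambda>w. complex_of_real (f w)) (of_real r * z)) t
    \<le> 4 / t * (\<integral>w. f w - min (f w) (R t) \<partial>circle_measure) + 6 * (\<Sum>j<J. R (2 ^ j * t))"
proof -
  define s where "s j = R (2 ^ j * t)" for j
  define g where "g j w = min (f w) (s j) - min (f w) (s (Suc j))" for j w
  define f1 where "f1 w = f w - min (f w) (R t)" for w
  have fL: "(\<lambda>w. complex_of_real (f w)) \<in> L0" using f by auto
  have [measurable]: "f \<in> borel_measurable circle_measure" using f by auto
  have s0: "0 \<le> s j" for j unfolding s_def R_def by (rule rearr_nonneg[OF fL])
  \<comment> \<open>\<open>2 ^ J * t\<close> has reached the total mass \<open>1\<close>, so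
    finitely many layers exhaust the part of \<open>f\<close> below \<open>R t\<close>.\<close>
  have sJ: "s J = 0" unfolding s_def R_def using rearr_eq_0[OF fL J] .
  have sdec: "s (Suc j) \<le> s j" for j unfolding s_def R_def by (rule rearr_antimono[OF fL]) (use t in auto)
  have if1: "integrable circle_measure f1" unfolding f1_def using f by simp
  have ig: "integrable circle_measure (g j)" for j unfolding g_def using f by simp
  have f1_0: "0 \<le> f1 w" for w by (simp add: f1_def)
  have g_0: "0 \<le> g j w" and g_h: "g j w \<le> s j - s (Suc j)" for j w
    using sdec[of j] by (auto simp: g_def min_def)
  have gx: "measure circle_measure {w \<in> space circle_measure. g j w \<noteq> 0} \<le> 2 ^ Suc j * t" for j
  proof -
    have "measure circle_measure {w \<in> space circle_measure. g j w \<noteq> 0} \<le> distr_fun (\<lambda>w. complex_of_real (f w)) (s (Suc j))"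
      unfolding distr_fun_def
    proof (rule circle.finite_measure_mono)
      show "{w \<in> space circle_measure. g j w \<noteq> 0} \<subseteq> {z \<in> space circle_measure. s (Suc j) < cmod (complex_of_real (f z))}"
        using sdec[of j] by (auto simp: g_def min_def split: if_splits)
    qed measurable
    also have "\<dots> \<le> 2 ^ Suc j * t" unfolding s_def R_def by (rule distr_fun_rearr[OF fL]) (use t in auto)
    finally show ?thesis .
  qed
  have "f w = f1 w + (\<Sum>j<J. g j w)" for w
  proof -
    have "(\<Sum>j<J. g j w) = min (f w) (s 0) - min (f w) (s J)"
      unfolding g_def by (rule sum_lessThan_telescope')
    then show ?thesis using f(2)[of w] sJ by (simp add: f1_def s_def)
  qed
  then have H: "herglotz (\<lambda>w. complex_of_real (f w)) \<zeta>
      = herglotz (\<lambda>w. complex_of_real (f1 w)) \<zeta> + (\<Sum>j<J. herglotz (\<lambda>w. complex_of_real (g j w)) \<zeta>)"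
    if "cmod \<zeta> < 1" for \<zeta>
  proof -
    have "(\<lambda>w. complex_of_real (f w)) = (\<lambda>w. complex_of_real (f1 w) + (\<Sum>j<J. complex_of_real (g j w)))"
      using \<open>\<And>w. f w = f1 w + (\<Sum>j<J. g j w)\<close> by (metis of_real_add of_real_sum)
    then have "herglotz (\<lambda>w. complex_of_real (f w)) \<zeta> = herglotz (\<lambda>w. complex_of_real (f1 w)) \<zeta>
        + herglotz (\<lambda>w. \<Sum>j<J. complex_of_real (g j w)) \<zeta>"
      by (simp only:) (rule herglotz_add, use if1 ig that in auto)
    then show ?thesis using herglotz_sum[of "{..<J}" "\<lambda>j w. complex_of_real (g j w)" \<zeta>] ig that by simp
  qed
  define x1 where "x1 = (\<integral>w. f1 w \<partial>circle_measure)"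
  have x1: "0 \<le> x1" unfolding x1_def using f1_0 by simp
  \<comment> \<open>The level at which the weak type inequality leaves a set of measure
    \<open>t / 2\<close>.\<close>
  define a where "a = 4 / t * x1"
  \<comment> \<open>The height \<open>y = 5 * Suc j\<close> in \<open>weak_type_layer\<close>. The
    support has measure at most \<open>2 ^ Suc j * t\<close> and the gain is
    \<open>2 * 4 ^ Suc j\<close>, so the exceptional sets have measure at most
    \<open>t / 2 * (1/2) ^ Suc j\<close>, in total less than \<open>t / 2\<close>.\<close>
  define b where "b j = (1 + 5 * real (Suc j)) * (s j - s (Suc j))" for j
  define Hf where "Hf z = herglotz (\<lambda>w. complex_of_real (f w)) (of_real r * z)" for z
  define H1 where "H1 z = herglotz (\<lambda>w. complex_of_real (f1 w)) (of_real r * z)" for z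
  define Hg where "Hg j z = herglotz (\<lambda>w. complex_of_real (g j w)) (of_real r * z)" for j z
  have m1 [measurable]: "H1 \<in> L0" unfolding H1_def using if1 r by (intro measurable_herglotz_radius) auto
  have mg [measurable]: "Hg j \<in> L0" for j unfolding Hg_def using ig r by (intro measurable_herglotz_radius) auto
  have mf: "Hf \<in> L0" unfolding Hf_def using f r by (intro measurable_herglotz_radius) auto
  have d1: "distr_fun H1 a \<le> t / 2"
  proof (cases "x1 = 0")
    case True
    then have "AE w in circle_measure. f1 w = 0"
      unfolding x1_def using integral_nonneg_eq_0_iff_AE[OF if1] f1_0 by simp
    then have "H1 z = (\<integral>w. 0 \<partial>circle_measure)" for z
      unfolding H1_def herglotz_def
    proof (intro integral_cong_AE)
      show "(\<lambda>w. complex_of_real (f1 w) * ((w + of_real r * z) / (w - of_real r * z))) \<in> borel_measurable circle_measure"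
        using if1 by measurable
    qed auto
    then show ?thesis using True t by (simp add: distr_fun_def a_def)
  next
    case False
    then have "a > 0" using x1 t by (simp add: a_def)
    then have "distr_fun H1 a \<le> 2 * x1 / a"
      unfolding H1_def x1_def by (intro weak_type_herglotz[OF if1 f1_0 r])
    also have "\<dots> = t / 2" using False t by (simp add: a_def field_simps)
    finally show ?thesis .
  qed
  have dg: "distr_fun (Hg j) (b j) \<le> t / 2 * (1/2) ^ Suc j" for j
  proof -
    have c: "2 * 4 ^ Suc j \<le> cosh (5 * real (Suc j)) - 1" by (rule cosh_lower_bound) simp
    have p: "(0::real) < 2 * 4 ^ Suc j" by simp
    have "distr_fun (Hg j) (b j) \<le> (2 ^ Suc j * t) / (cosh (5 * real (Suc j)) - 1)"
      unfolding Hg_def b_def by (rule weak_type_layer[OF ig g_0 g_h gx r])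
        (simp, use less_le_trans[OF p c] in linarith)
    also have "\<dots> \<le> (2 ^ Suc j * t) / (2 * 4 ^ Suc j)"
      using t by (intro divide_left_mono mult_pos_pos c p less_le_trans[OF p c]) auto
    also have "\<dots> = t / 2 * (2 / 4) ^ Suc j" unfolding power_divide by simp
    finally show ?thesis by simp
  qed
  have "distr_fun Hf (a + (\<Sum>j<J. b j)) \<le> measure circle_measure
    ({z \<in> space circle_measure. a < cmod (H1 z)} \<union> (\<Union>j<J. {z \<in> space circle_measure. b j < cmod (Hg j z)}))"
    unfolding distr_fun_def
  proof (rule circle.finite_measure_mono)
    show "{z \<in> space circle_measure. a + (\<Sum>j<J. b j) < cmod (Hf z)}
      \<subseteq> {z \<in> space circle_measure. a < cmod (H1 z)} \<union> (\<Union>j<J. {z \<in> space circle_measure. b j < cmod (Hg j z)})"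
    proof
      fix z assume z: "z \<in> {z \<in> space circle_measure. a + (\<Sum>j<J. b j) < cmod (Hf z)}"
      show "z \<in> {z \<in> space circle_measure. a < cmod (H1 z)} \<union> (\<Union>j<J. {z \<in> space circle_measure. b j < cmod (Hg j z)})"
      proof (rule ccontr)
        assume n: "\<not> ?thesis"
        have "Hf z = H1 z + (\<Sum>j<J. Hg j z)"
          unfolding Hf_def H1_def Hg_def by (rule H) (use z cmod_radius_less r in auto)
        then have "cmod (Hf z) \<le> cmod (H1 z) + cmod (\<Sum>j<J. Hg j z)"
          by (simp add: norm_triangle_ineq)
        also have "\<dots> \<le> a + (\<Sum>j<J. b j)"
        proof (rule add_mono)
          show "cmod (H1 z) \<le> a" using n z by auto
          have "cmod (Hg j z) \<le> b j" if "j < J" for j using n z that by force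
          then show "cmod (\<Sum>j<J. Hg j z) \<le> (\<Sum>j<J. b j)" by (intro sum_norm_le) auto
        qed
        finally show False using z by simp
      qed
    qed
  qed measurable
  also have "\<dots> \<le> measure circle_measure {z \<in> space circle_measure. a < cmod (H1 z)}
      + measure circle_measure (\<Union>j<J. {z \<in> space circle_measure. b j < cmod (Hg j z)})"
    by (rule measure_Un_le) measurable
  also have "measure circle_measure (\<Union>j<J. {z \<in> space circle_measure. b j < cmod (Hg j z)})
      \<le> (\<Sum>j<J. distr_fun (Hg j) (b j))"
    unfolding distr_fun_def by (rule circle.finite_measure_subadditive_finite) auto
  also have "\<dots> \<le> (\<Sum>j<J. t / 2 * (1/2) ^ Suc j)" by (rule sum_mono) (rule dg)
  also have "\<dots> = t / 2 * (\<Sum>j<J. (1/2) ^ Suc j)" by (rule sum_distrib_left[symmetric])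
  also have "(\<Sum>j<J. (1/2::real) ^ Suc j) = 1 - (1/2) ^ J"
    by (induction J) (auto simp: field_simps)
  also have "t / 2 * (1 - (1/2) ^ J) \<le> t / 2 * 1" using t by (intro mult_left_mono) auto
  also have "measure circle_measure {z \<in> space circle_measure. a < cmod (H1 z)} \<le> t / 2"
    using d1 by (simp add: distr_fun_def)
  finally have D: "distr_fun Hf (a + (\<Sum>j<J. b j)) \<le> t" by simp
  have b_le: "b j \<le> 6 * ((real j + 1) * (s j - s (Suc j)))" for j
  proof -
    have "b j \<le> (6 * (real j + 1)) * (s j - s (Suc j))"
      unfolding b_def using sdec[of j] by (intro mult_right_mono) auto
    then show ?thesis by (simp only: mult.assoc)
  qed
  have a0: "0 \<le> a" using x1 t by (simp add: a_def)
  have b0: "0 \<le> b j" for j unfolding b_def using sdec[of j] by (intro mult_nonneg_nonneg) auto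
  have "rearr Hf t \<le> a + (\<Sum>j<J. b j)"
    using D by (subst rearr_le_iff[OF mf t]) (auto intro!: add_nonneg_nonneg sum_nonneg a0 b0)
  also have "(\<Sum>j<J. b j) \<le> (\<Sum>j<J. 6 * ((real j + 1) * (s j - s (Suc j))))"
    by (rule sum_mono) (rule b_le)
  also have "\<dots> = 6 * (\<Sum>j<J. s j)"
    unfolding sum_distrib_left[symmetric] sum_layers_abel sJ by simp
  finally show ?thesis by (simp add: Hf_def a_def x1_def f1_def s_def)
qed

text \<open>Almost everywhere \<open>f\<close> is below some level \<open>b k\<close> at
  \<open>(1/2) ^ k * t\<close>. Where it lies between \<open>b k\<close> and
  \<open>b (Suc k)\<close> it is at most \<open>b (Suc k)\<close>, on a set of measure at most
  \<open>(1/2) ^ k * t\<close>. The series is, up to a factor, a dyadic upper sum for the integral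
  of \<open>R\<close> over \<open>{0<..t}\<close>.\<close>

lemma nn_integral_above_rearr:
  fixes f :: "complex \<Rightarrow> real"
  assumes f: "f \<in> borel_measurable circle_measure" "\<And>w. 0 \<le> f w" and t: "t > 0"
  defines "R \<equiv> rearr (\<lambda>w. complex_of_real (f w))"
  shows "(\<integral>\<^sup>+w. ennreal (f w - min (f w) (R t)) \<partial>circle_measure)
    \<le> (\<Sum>k. ennreal (t * ((1/2) ^ k * R ((1/2) ^ Suc k * t))))"
proof -
  note [measurable] = f(1)
  have fL: "(\<lambda>w. complex_of_real (f w)) \<in> L0" by measurable
  define b where "b k = R ((1/2) ^ k * t)" for k
  have b0: "0 \<le> b k" for k unfolding b_def R_def by (rule rearr_nonneg[OF fL])
  have mb: "measure circle_measure {w \<in> space circle_measure. b k < f w} \<le> (1/2) ^ k * t" for k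
  proof -
    have "distr_fun (\<lambda>w. complex_of_real (f w)) (b k) \<le> (1/2) ^ k * t"
      unfolding b_def R_def by (rule distr_fun_rearr[OF fL]) (use t in simp)
    then show ?thesis using f(2) by (simp add: distr_fun_def)
  qed
  have ex: "AE w in circle_measure. \<exists>k. f w \<le> b k"
  proof -
    have "measure circle_measure {w \<in> space circle_measure. \<forall>k. b k < f w} \<le> (1/2) ^ k * t" for k
      by (rule order_trans[OF circle.finite_measure_mono mb[of k]]) (auto simp del: space_circle_measure)
    moreover have "(\<lambda>k. (1/2) ^ k * t) \<longlonglongrightarrow> 0 * t" by (intro tendsto_intros LIMSEQ_power_zero) simp
    ultimately have "measure circle_measure {w \<in> space circle_measure. \<forall>k. b k < f w} \<le> 0 * t"
      by (intro LIMSEQ_le_const) auto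
    then have "measure circle_measure {w \<in> space circle_measure. \<forall>k. b k < f w} = 0"
      by (simp add: measure_le_0_iff)
    then have e: "emeasure circle_measure {w \<in> space circle_measure. \<forall>k. b k < f w} = 0"
      by (simp add: circle.emeasure_eq_measure)
    show ?thesis
    proof (rule AE_I[OF _ e])
      show "{w \<in> space circle_measure. \<forall>k. b k < f w} \<in> sets circle_measure" by measurable
    qed (auto simp: not_le)
  qed
  have "(\<integral>\<^sup>+w. ennreal (f w - min (f w) (R t)) \<partial>circle_measure)
    \<le> (\<integral>\<^sup>+w. (\<Sum>k. ennreal (b (Suc k)) * indicator {w \<in> space circle_measure. b k < f w} w) \<partial>circle_measure)"
  proof (rule nn_integral_mono_AE)
    show "AE w in circle_measure. ennreal (f w - min (f w) (R t))
      \<le> (\<Sum>k. ennreal (b (Suc k)) * indicator {w \<in> space circle_measure. b k < f w} w)"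
      using ex AE_space
    proof eventually_elim
      case (elim w)
      define k where "k = (LEAST k. f w \<le> b k)"
      have k: "f w \<le> b k" unfolding k_def using elim(1) by (rule LeastI_ex)
      show ?case
      proof (cases k)
        case 0
        then show ?thesis using k by (simp add: b_def)
      next
        case (Suc k')
        then have "\<not> f w \<le> b k'" using not_less_Least[of k' "\<lambda>k. f w \<le> b k"] k_def by simp
        then have "ennreal (f w - min (f w) (R t)) \<le> ennreal (b (Suc k')) * indicator {w \<in> space circle_measure. b k' < f w} w"
          using k Suc elim(2) b0[of 0] f(2)[of w] by (auto simp: b_def indicator_def min_def intro!: ennreal_leI)
        also have "\<dots> \<le> (\<Sum>k. ennreal (b (Suc k)) * indicator {w \<in> space circle_measure. b k < f w} w)"
        proof -
          define T where "T k = ennreal (b (Suc k)) * indicator {w \<in> space circle_measure. b k < f w} w" for k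
          have "sum T {k'} \<le> suminf T" by (rule sum_le_suminf) auto
          moreover have "sum T {k'} = T k'" by simp
          ultimately show ?thesis unfolding T_def by argo
        qed
        finally show ?thesis .
      qed
    qed
  qed
  also have "\<dots> = (\<Sum>k. \<integral>\<^sup>+w. ennreal (b (Suc k)) * indicator {w \<in> space circle_measure. b k < f w} w \<partial>circle_measure)"
    by (rule nn_integral_suminf) measurable
  also have "\<dots> = (\<Sum>k. ennreal (b (Suc k)) * emeasure circle_measure {w \<in> space circle_measure. b k < f w})"
    by (intro suminf_cong nn_integral_cmult_indicator) measurable
  also have "\<dots> \<le> (\<Sum>k. ennreal (t * ((1/2) ^ k * R ((1/2) ^ Suc k * t))))"
  proof (rule suminf_le)
    fix k
    have "ennreal (b (Suc k)) * emeasure circle_measure {w \<in> space circle_measure. b k < f w}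
      \<le> ennreal (b (Suc k)) * ennreal ((1/2) ^ k * t)"
      unfolding circle.emeasure_eq_measure by (intro mult_left_mono ennreal_leI mb) auto
    also have "\<dots> = ennreal (b (Suc k) * ((1/2) ^ k * t))" using b0 by (rule ennreal_mult'[symmetric])
    also have "b (Suc k) * ((1/2) ^ k * t) = t * ((1/2) ^ k * R ((1/2) ^ Suc k * t))"
      by (simp add: b_def mult_ac)
    finally show "ennreal (b (Suc k)) * emeasure circle_measure {w \<in> space circle_measure. b k < f w}
      \<le> ennreal (t * ((1/2) ^ k * R ((1/2) ^ Suc k * t)))" .
  qed auto
  finally show ?thesis .
qed

text \<open>Lower semicontinuity: where \<open>|v|\<close> exceeds \<open>l\<close>, all but
  finitely many \<open>|u n|\<close> do so, hence up to a null set the superlevel set of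
  \<open>v\<close> lies in the increasing union of the sets \<open>B N\<close>.\<close>

lemma distr_fun_limit:
  assumes u: "\<And>n. u n \<in> L0" and lim: "AE z in circle_measure. (\<lambda>n. u n z) \<longlonglongrightarrow> v z" and v: "v \<in> L0"
    and le: "\<And>n. distr_fun (u n) l \<le> t"
  shows "distr_fun v l \<le> t"
proof -
  note [measurable] = u v
  define B where "B N = {z \<in> space circle_measure. \<forall>n\<ge>N. l < cmod (u n z)}" for N
  have B [measurable]: "B N \<in> sets circle_measure" for N unfolding B_def by measurable
  have "measure circle_measure (B N) \<le> t" for N
    by (rule order_trans[OF circle.finite_measure_mono le[of N, unfolded distr_fun_def]]) (auto simp: B_def)
  moreover have "(\<lambda>N. measure circle_measure (B N)) \<longlonglongrightarrow> measure circle_measure (\<Union>N. B N)"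
    by (rule circle.finite_Lim_measure_incseq) (use B in auto, auto simp: incseq_def B_def)
  ultimately have "measure circle_measure (\<Union>N. B N) \<le> t" by (intro LIMSEQ_le_const2) auto
  moreover have "distr_fun v l \<le> measure circle_measure (\<Union>N. B N)"
    unfolding distr_fun_def
  proof (rule circle.finite_measure_mono_AE)
    show "AE z in circle_measure. z \<in> {z \<in> space circle_measure. l < cmod (v z)} \<longrightarrow> z \<in> (\<Union>N. B N)"
      using lim
    proof eventually_elim
      case (elim z)
      show ?case
      proof
        assume z: "z \<in> {z \<in> space circle_measure. l < cmod (v z)}"
        have "(\<lambda>n. cmod (u n z)) \<longlonglongrightarrow> cmod (v z)" by (intro tendsto_intros elim)
        then have "eventually (\<lambda>n. l < cmod (u n z)) sequentially"
          using z by (intro order_tendstoD(1)) auto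
        then show "z \<in> (\<Union>N. B N)" using z by (auto simp: B_def eventually_sequentially)
      qed
    qed
  qed measurable
  ultimately show ?thesis by linarith
qed

section \<open>Domination in distribution\<close>

text \<open>The excess over \<open>K\<close> exceeds \<open>s\<close> where the modulus exceeds
  \<open>s + K\<close>; so its layer cake integral depends on the distribution function only, and
  monotonically.\<close>

lemma nn_integral_excess_mono:
  assumes u: "u \<in> L0" and w: "w \<in> L0" and d: "\<And>l. l \<ge> 0 \<Longrightarrow> distr_fun u l \<le> distr_fun w l" and K: "K \<ge> 0"
  shows "(\<integral>\<^sup>+z. ennreal (max 0 (cmod (u z) - K)) \<partial>circle_measure)
    \<le> (\<integral>\<^sup>+z. ennreal (max 0 (cmod (w z) - K)) \<partial>circle_measure)"
proof -
  note [measurable] = u w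
  have eq: "emeasure circle_measure {z \<in> space circle_measure. s < max 0 (cmod (x z) - K)} = ennreal (distr_fun x (s + K))"
    if "s \<ge> 0" for s x
  proof -
    have "{z \<in> space circle_measure. s < max 0 (cmod (x z) - K)} = {z \<in> space circle_measure. s + K < cmod (x z)}"
      using that by auto
    then show ?thesis by (simp only: circle.emeasure_eq_measure distr_fun_def)
  qed
  have "(\<integral>\<^sup>+z. ennreal (max 0 (cmod (u z) - K)) \<partial>circle_measure)
    = (\<integral>\<^sup>+s. emeasure circle_measure {z \<in> space circle_measure. s < max 0 (cmod (u z) - K)} * indicator {0..} s \<partial>lborel)"
    by (rule circle.nn_integral_layer_cake) measurable
  also have "\<dots> \<le> (\<integral>\<^sup>+s. emeasure circle_measure {z \<in> space circle_measure. s < max 0 (cmod (w z) - K)} * indicator {0..} s \<partial>lborel)"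
  proof (rule nn_integral_mono)
    fix s :: real
    show "emeasure circle_measure {z \<in> space circle_measure. s < max 0 (cmod (u z) - K)} * indicator {0..} s
      \<le> emeasure circle_measure {z \<in> space circle_measure. s < max 0 (cmod (w z) - K)} * indicator {0..} s"
      by (cases "s \<ge> 0") (use K in \<open>auto simp: eq indicator_def simp del: space_circle_measure intro!: ennreal_leI d\<close>)
  qed
  also have "\<dots> = (\<integral>\<^sup>+z. ennreal (max 0 (cmod (w z) - K)) \<partial>circle_measure)"
    by (rule circle.nn_integral_layer_cake[symmetric]) measurable
  finally show ?thesis .
qed

lemma excess_dominated:
  assumes u: "u \<in> L0" and w: "integrable circle_measure w"
    and d: "\<And>l. l \<ge> 0 \<Longrightarrow> distr_fun u l \<le> distr_fun w l" and K: "K \<ge> 0"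
  shows "integrable circle_measure u"
    and "(\<integral>z. max 0 (cmod (u z) - K) \<partial>circle_measure) \<le> (\<integral>z. max 0 (cmod (w z) - K) \<partial>circle_measure)"
proof -
  have wL: "w \<in> L0" using w by auto
  note [measurable] = u wL
  have "(\<integral>\<^sup>+z. ennreal (cmod (u z)) \<partial>circle_measure) \<le> (\<integral>\<^sup>+z. ennreal (cmod (w z)) \<partial>circle_measure)"
    using nn_integral_excess_mono[OF u wL d, of 0] by simp
  also have "\<dots> < \<infinity>" using w by (simp add: integrable_iff_bounded)
  finally show iu: "integrable circle_measure u" using u by (simp add: integrable_iff_bounded)
  have eq: "(\<integral>\<^sup>+z. ennreal (max 0 (cmod (x z) - K)) \<partial>circle_measure) = ennreal (\<integral>z. max 0 (cmod (x z) - K) \<partial>circle_measure)"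
    if "integrable circle_measure x" for x
    by (rule nn_integral_eq_integral) (use that in auto)
  have "ennreal (\<integral>z. max 0 (cmod (u z) - K) \<partial>circle_measure) \<le> ennreal (\<integral>z. max 0 (cmod (w z) - K) \<partial>circle_measure)"
    using nn_integral_excess_mono[OF u wL d K] by (simp only: eq[OF iu] eq[OF w])
  moreover have "0 \<le> (\<integral>z. max 0 (cmod (w z) - K) \<partial>circle_measure)" by simp
  ultimately show "(\<integral>z. max 0 (cmod (u z) - K) \<partial>circle_measure) \<le> (\<integral>z. max 0 (cmod (w z) - K) \<partial>circle_measure)"
    by (simp only: ennreal_le_iff)
qed

text \<open>The radial retraction onto the disc of radius \<open>K\<close>. At \<open>x = 0\<close>
  the quotient is \<open>0\<close> by the convention for division, and the factor \<open>x\<close>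
  makes the value right.\<close>

definition truncate :: "real \<Rightarrow> complex \<Rightarrow> complex" where
  "truncate K x = of_real (min 1 (K / cmod x)) * x"

lemma truncate_bounds:
  assumes "K > 0"
  shows "cmod (truncate K x) \<le> K" "cmod (x - truncate K x) = max 0 (cmod x - K)"
proof -
  have p: "x \<noteq> 0 \<Longrightarrow> 0 \<le> min 1 (K / cmod x)" using assms by simp
  show "cmod (truncate K x) \<le> K"
  proof (cases "x = 0")
    case False
    then have "cmod (truncate K x) = min 1 (K / cmod x) * cmod x" using p by (simp add: truncate_def norm_mult)
    also have "\<dots> \<le> K / cmod x * cmod x" by (intro mult_right_mono) auto
    finally show ?thesis using False by simp
  qed (use assms in \<open>simp add: truncate_def\<close>)
  show "cmod (x - truncate K x) = max 0 (cmod x - K)"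
  proof (cases "x = 0")
    case False
    have "x - truncate K x = of_real (1 - min 1 (K / cmod x)) * x"
      by (simp add: truncate_def ring_distribs)
    then have "cmod (x - truncate K x) = \<bar>1 - min 1 (K / cmod x)\<bar> * cmod x"
      by (simp only: norm_mult norm_of_real)
    also have "\<dots> = max 0 (cmod x - K)"
      using False assms by (auto simp: min_def max_def field_simps)
    finally show ?thesis .
  qed (use assms in \<open>simp add: truncate_def\<close>)
qed

lemma tendsto_truncate: "K > 0 \<Longrightarrow> (x \<longlongrightarrow> l) F \<Longrightarrow> ((\<lambda>n. truncate K (x n)) \<longlongrightarrow> truncate K l) F"
proof -
  assume K: "K > 0" and x: "(x \<longlongrightarrow> l) F"
  have eq: "truncate K y = of_real (K / max K (cmod y)) * y" for y
  proof (cases "y = 0")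
    case False
    then have "min 1 (K / cmod y) = K / max K (cmod y)"
      using K by (auto simp: min_def max_def field_simps)
    then show ?thesis by (simp only: truncate_def)
  qed (simp add: truncate_def)
  have "((\<lambda>n. of_real (K / max K (cmod (x n))) * x n) \<longlongrightarrow> of_real (K / max K (cmod l)) * l) F"
    using K by (intro tendsto_intros x) auto
  then show ?thesis by (simp only: eq)
qed

lemma measurable_truncate [measurable]: "truncate K \<in> borel_measurable borel"
  unfolding truncate_def by measurable

text \<open>A form of Vitali's convergence theorem. No pointwise dominating function is available,
  since only rearrangements are estimated; but domination in distribution makes the excess over a
  large level uniformly small, and the truncated functions converge by dominated
  convergence.\<close>

lemma tendsto_L1_dominated_distribution:
  assumes u: "\<And>n. u n \<in> L0" and v: "v \<in> L0" and lim: "AE z in circle_measure. (\<lambda>n. u n z) \<longlonglongrightarrow> v z"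
    and w: "integrable circle_measure w"
    and d: "\<And>n l. l \<ge> 0 \<Longrightarrow> distr_fun (u n) l \<le> distr_fun w l"
  shows "integrable circle_measure v" "(\<lambda>n. \<integral>z. cmod (u n z - v z) \<partial>circle_measure) \<longlonglongrightarrow> 0"
proof -
  note [measurable] = u v
  have dv: "distr_fun v l \<le> distr_fun w l" if "l \<ge> 0" for l
    by (rule distr_fun_limit[OF u lim v d[OF that]])
  show iv: "integrable circle_measure v" by (rule excess_dominated(1)[OF v w dv, of 0]) auto
  have iu: "integrable circle_measure (u n)" for n by (rule excess_dominated(1)[OF u w d, of 0]) auto
  define \<delta> where "\<delta> K = (\<integral>z. max 0 (cmod (w z) - real (Suc K)) \<partial>circle_measure)" for K
  have "\<delta> \<longlonglongrightarrow> (\<integral>z. 0 \<partial>circle_measure)"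
    unfolding \<delta>_def
  proof (rule integral_dominated_convergence[where w = "\<lambda>z. cmod (w z)"])
    show "AE z in circle_measure. (\<lambda>K. max 0 (cmod (w z) - real (Suc K))) \<longlonglongrightarrow> 0"
    proof (rule AE_I2)
      fix z
      obtain N where N: "cmod (w z) < real N" using reals_Archimedean2 by blast
      have "eventually (\<lambda>K. max 0 (cmod (w z) - real (Suc K)) = 0) sequentially"
        using eventually_ge_at_top[of N] by eventually_elim (use N in auto)
      then show "(\<lambda>K. max 0 (cmod (w z) - real (Suc K))) \<longlonglongrightarrow> 0" by (rule tendsto_eventually)
    qed
  qed (use w in auto)
  then have \<delta>0: "\<delta> \<longlonglongrightarrow> 0" by simp
  show "(\<lambda>n. \<integral>z. cmod (u n z - v z) \<partial>circle_measure) \<longlonglongrightarrow> 0"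
  proof (rule LIMSEQ_I)
    fix e :: real assume e: "e > 0"
    then have "eventually (\<lambda>K. \<delta> K < e / 4) sequentially" by (intro order_tendstoD(2)[OF \<delta>0]) simp
    then obtain K where K: "\<delta> K < e / 4" by (auto simp: eventually_sequentially)
    define T where "T = truncate (real (Suc K))"
    have Kpos: "real (Suc K) > 0" by simp
    have [measurable]: "T \<in> borel_measurable borel" by (simp add: T_def)
    have "(\<lambda>n. \<integral>z. cmod (T (u n z) - T (v z)) \<partial>circle_measure) \<longlonglongrightarrow> (\<integral>z. 0 \<partial>circle_measure)"
    proof (rule integral_dominated_convergence[where w = "\<lambda>z. 2 * real (Suc K)"])
      show "AE z in circle_measure. (\<lambda>n. cmod (T (u n z) - T (v z))) \<longlonglongrightarrow> 0"
        using lim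
      proof eventually_elim
        case (elim z)
        have "(\<lambda>n. cmod (T (u n z) - T (v z))) \<longlonglongrightarrow> cmod (T (v z) - T (v z))"
          unfolding T_def by (intro tendsto_intros tendsto_truncate elim) simp
        then show ?case by simp
      qed
      show "AE z in circle_measure. norm (cmod (T (u n z) - T (v z))) \<le> 2 * real (Suc K)" for n
      proof (rule AE_I2)
        fix z
        have "cmod (T (u n z)) \<le> real (Suc K)" "cmod (T (v z)) \<le> real (Suc K)"
          unfolding T_def by (rule truncate_bounds(1)[OF Kpos])+
        then show "norm (cmod (T (u n z) - T (v z))) \<le> 2 * real (Suc K)"
          using norm_triangle_ineq4[of "T (u n z)" "T (v z)"] by simp
      qed
    qed auto
    then have "(\<lambda>n. \<integral>z. cmod (T (u n z) - T (v z)) \<partial>circle_measure) \<longlonglongrightarrow> 0" by simp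
    then have "eventually (\<lambda>n. (\<integral>z. cmod (T (u n z) - T (v z)) \<partial>circle_measure) < e / 2) sequentially"
      by (rule order_tendstoD(2)) (use e in simp)
    then obtain N where N: "\<And>n. n \<ge> N \<Longrightarrow> (\<integral>z. cmod (T (u n z) - T (v z)) \<partial>circle_measure) < e / 2"
      by (auto simp: eventually_sequentially)
    have iT: "integrable circle_measure (\<lambda>z. T (x z))" if "x \<in> L0" for x
    proof (rule integrable_circle_bounded)
      show "(\<lambda>z. T (x z)) \<in> L0" using that by measurable
      show "cmod (T (x z)) \<le> real (Suc K)" for z unfolding T_def by (rule truncate_bounds(1)[OF Kpos])
    qed
    show "\<exists>no. \<forall>n\<ge>no. norm ((\<integral>z. cmod (u n z - v z) \<partial>circle_measure) - 0) < e"
    proof (intro exI[of _ N] allI impI)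
      fix n assume n: "n \<ge> N"
      have e1: "cmod (x - T x) = max 0 (cmod x - real (Suc K))" for x
        unfolding T_def by (rule truncate_bounds(2)[OF Kpos])
      have ix: "integrable circle_measure (\<lambda>z. max 0 (cmod (x z) - real (Suc K)))" if "integrable circle_measure x" for x
        using that by simp
      have pt: "cmod (u n z - v z) \<le> max 0 (cmod (u n z) - real (Suc K)) + cmod (T (u n z) - T (v z)) + max 0 (cmod (v z) - real (Suc K))" for z
      proof -
        have "u n z - v z = (u n z - T (u n z)) + (T (u n z) - T (v z)) - (v z - T (v z))" by simp
        then have "cmod (u n z - v z) \<le> cmod (u n z - T (u n z)) + cmod (T (u n z) - T (v z)) + cmod (v z - T (v z))"
          by (metis norm_triangle_le_diff norm_triangle_ineq add_right_mono order_trans norm_triangle_ineq4)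
        then show ?thesis by (simp only: e1)
      qed
      have "(\<integral>z. cmod (u n z - v z) \<partial>circle_measure)
        \<le> (\<integral>z. max 0 (cmod (u n z) - real (Suc K)) + cmod (T (u n z) - T (v z)) + max 0 (cmod (v z) - real (Suc K)) \<partial>circle_measure)"
        by (rule integral_mono)
           (use iu iv iT u v pt in \<open>auto intro!: Bochner_Integration.integrable_add Bochner_Integration.integrable_diff integrable_norm ix\<close>)
      also have "\<dots> = (\<integral>z. max 0 (cmod (u n z) - real (Suc K)) \<partial>circle_measure)
          + (\<integral>z. cmod (T (u n z) - T (v z)) \<partial>circle_measure)
          + (\<integral>z. max 0 (cmod (v z) - real (Suc K)) \<partial>circle_measure)"
        using ix[OF iu[of n]] ix[OF iv] iT[OF u[of n]] iT[OF v]
        by (subst Bochner_Integration.integral_add; (subst Bochner_Integration.integral_add)?)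
           (auto intro!: Bochner_Integration.integrable_add Bochner_Integration.integrable_diff integrable_norm)
      also have "\<dots> < \<delta> K + e / 2 + \<delta> K"
      proof -
        have "(\<integral>z. max 0 (cmod (u n z) - real (Suc K)) \<partial>circle_measure) \<le> \<delta> K"
          unfolding \<delta>_def by (rule excess_dominated(2)[OF u w d]) auto
        moreover have "(\<integral>z. max 0 (cmod (v z) - real (Suc K)) \<partial>circle_measure) \<le> \<delta> K"
          unfolding \<delta>_def by (rule excess_dominated(2)[OF v w dv]) auto
        ultimately show ?thesis using N[OF n] by linarith
      qed
      also have "\<dots> \<le> e" using K by linarith
      finally show "norm ((\<integral>z. cmod (u n z - v z) \<partial>circle_measure) - 0) < e" by simp
    qed
  qed
qed

section \<open>Operator norms and elementary properties of function spaces\<close>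

text \<open>Homogeneity is only required almost everywhere because \<^const>\<open>conjugate_function\<close> is
  homogeneous only where the radial limits exist.\<close>
lemma op_norm_apply:
  assumes X: "banach_function_space X NX" and Y: "banach_function_space Y NY"
    and D: "D \<subseteq> X" "D' \<subseteq> Y"
    and sc: "\<And>f c. f \<in> D \<Longrightarrow> c > 0 \<Longrightarrow> (\<lambda>z. complex_of_real c * f z) \<in> D"
    and hom: "\<And>f c. f \<in> D \<Longrightarrow> c > 0 \<Longrightarrow>
      AE z in circle_measure. T (\<lambda>z. complex_of_real c * f z) z = complex_of_real c * T f z"
    and meas: "\<And>f. f \<in> D \<Longrightarrow> T f \<in> L0"
    and fin: "op_norm D NX D' NY T < \<infinity>" and f: "f \<in> D"
  shows "T f \<in> Y" "NY (T f) \<le> enn2real (op_norm D NX D' NY T) * NX f"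
proof -
  interpret X: banach_function_space X NX by fact
  interpret Y: banach_function_space Y NY by fact
  define E where "E = enn2real (op_norm D NX D' NY T)"
  have E: "op_norm D NX D' NY T = ennreal E" using fin by (simp add: E_def)
  have E0: "0 \<le> E" by (simp add: E_def)
  have unit: "T g \<in> Y \<and> NY (T g) \<le> E" if "g \<in> D" "NX g \<le> 1" for g
  proof -
    \<comment> \<open>\<open>op_norm\<close> counts an image outside \<open>D'\<close> as
      \<open>\<infinity>\<close>, so its finiteness also yields membership.\<close>
    have le: "(if T g \<in> D' then ennreal (NY (T g)) else \<infinity>) \<le> ennreal E"
      unfolding E[symmetric] op_norm_def by (rule SUP_upper) (use that in auto)
    then have "T g \<in> D'" by (auto split: if_splits simp: top_unique)
    then show ?thesis using le D E0 by (auto simp: ennreal_le_iff)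
  qed
  \<comment> \<open>Normalizing by \<open>NX f + e\<close> instead of \<open>NX f\<close> includes
    the case \<open>NX f = 0\<close>.\<close>
  have step: "T f \<in> Y \<and> NY (T f) \<le> E * (NX f + e)" if e: "e > 0" for e
  proof -
    define c where "c = NX f + e"
    have fX: "f \<in> X" using f D by auto
    have c: "c > 0" using X.norm_nonneg[OF fX] e by (simp add: c_def)
    define g where "g = (\<lambda>z. complex_of_real (1 / c) * f z)"
    have gD: "g \<in> D" unfolding g_def by (rule sc[OF f]) (use c in simp)
    have "NX g = cmod (complex_of_real (1 / c)) * NX f" unfolding g_def by (rule X.norm_scale[OF fX])
    also have "\<dots> = NX f / c" using c by (simp add: norm_divide)
    also have "\<dots> \<le> 1" using c e by (simp add: c_def)
    finally have g: "T g \<in> Y" "NY (T g) \<le> E" using unit[OF gD] by auto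
    have "AE z in circle_measure. T g z = complex_of_real (1 / c) * T f z"
      unfolding g_def by (rule hom[OF f]) (use c in simp)
    then have ae: "AE z in circle_measure. cmod (T f z) \<le> cmod (complex_of_real c * T g z)"
      by eventually_elim (use c in \<open>simp add: norm_mult norm_divide\<close>)
    have "T f \<in> Y \<and> NY (T f) \<le> NY (\<lambda>z. complex_of_real c * T g z)"
      by (rule Y.ideal[OF Y.scale_closed[OF g(1)] meas[OF f] ae])
    also have "NY (\<lambda>z. complex_of_real c * T g z) = c * NY (T g)"
      using Y.norm_scale[OF g(1), of "complex_of_real c"] c by simp
    finally have "T f \<in> Y" "NY (T f) \<le> c * NY (T g)" by auto
    moreover have "c * NY (T g) \<le> c * E" using g(2) c by (intro mult_left_mono) auto
    ultimately show ?thesis by (simp add: c_def mult.commute)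
  qed
  show "T f \<in> Y" using step[of 1] by simp
  show "NY (T f) \<le> enn2real (op_norm D NX D' NY T) * NX f"
  proof (rule field_le_epsilon)
    fix e :: real assume e: "e > 0"
    have "NY (T f) \<le> E * (NX f + e / (E + 1))" using step[of "e / (E + 1)"] e E0 by simp
    also have "\<dots> = E * NX f + E / (E + 1) * e" by (simp add: ring_distribs)
    also have "E / (E + 1) * e \<le> 1 * e" using e E0 by (intro mult_right_mono) auto
    finally show "NY (T f) \<le> enn2real (op_norm D NX D' NY T) * NX f + e" by (simp add: E_def)
  qed
qed

context banach_function_space
begin

lemma mem_L0: "f \<in> X \<Longrightarrow> f \<in> L0"
  using subset_L0 by auto

lemma ideal_norm: "f \<in> X \<Longrightarrow> g \<in> L0 \<Longrightarrow> AE z in circle_measure. cmod (g z) \<le> cmod (f z) \<Longrightarrow> N g \<le> N f"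
  using ideal by auto

lemma const_mem: "(\<lambda>z. c) \<in> X"
  by (rule Linfty_subset[of _ "cmod c"]) auto

lemma norm_const: "N (\<lambda>z. c) = cmod c * N (\<lambda>z. 1)"
  using norm_scale[OF const_mem[of 1], of c] by simp

lemma norm_one_pos: "0 < N (\<lambda>z. 1)"
proof -
  have "ae_filter circle_measure \<noteq> bot"
    using emeasure_circle_UNIV by (simp only: ae_filter_eq_bot_iff) simp
  then have "\<not> (AE z in circle_measure. (1::complex) = 0)"
    by (simp add: trivial_limit_def)
  then have "N (\<lambda>z. 1) \<noteq> 0" using norm_eq_0_iff[OF const_mem[of 1]] by blast
  then show ?thesis using norm_nonneg[OF const_mem[of 1]] by simp
qed

lemma sum_mem:
  assumes "finite I" "\<And>i. i \<in> I \<Longrightarrow> f i \<in> X"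
  shows "(\<lambda>z. \<Sum>i\<in>I. f i z) \<in> X \<and> N (\<lambda>z. \<Sum>i\<in>I. f i z) \<le> (\<Sum>i\<in>I. N (f i))"
  using assms
proof (induction I rule: finite_induct)
  case empty
  then show ?case using const_mem[of 0] norm_const[of 0] by simp
next
  case (insert i I)
  then have 1: "f i \<in> X" "(\<lambda>z. \<Sum>i\<in>I. f i z) \<in> X" "N (\<lambda>z. \<Sum>i\<in>I. f i z) \<le> (\<Sum>i\<in>I. N (f i))" by auto
  then show ?case
    using add_closed[OF 1(1,2)] norm_triangle[OF 1(1,2)] insert(1,2) by simp
qed

end

section \<open>Boyd indices\<close>

lemma Arg2pi_cis: "0 \<le> t \<Longrightarrow> t < 2*pi \<Longrightarrow> Arg2pi (cis t) = t"
  by (rule Arg2pi_unique[of 1]) (auto simp: cis_conv_exp)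

text \<open>The cut-off in the dilation agrees with the right-hand side because \<open>rearr\<close>
  vanishes from \<open>1\<close> on.\<close>

lemma dilation_rearr:
  assumes f: "f \<in> L0" and s: "s > 0"
  shows "dilation s (\<lambda>z. complex_of_real (rearr f (circle_angle z))) z = complex_of_real (rearr f (s * circle_angle z))"
proof (cases "Arg2pi z * s < 2 * pi")
  case True
  then have "Arg2pi (cis (Arg2pi z * s)) = Arg2pi z * s"
    using s Arg2pi_ge_0[of z] by (intro Arg2pi_cis) auto
  then show ?thesis
    using True s Arg2pi_ge_0[of z] by (simp add: dilation_def circle_angle_def mult.commute)
next
  case False
  then have "1 \<le> s * circle_angle z" by (simp add: circle_angle_def pos_le_divide_eq mult.commute)
  then show ?thesis using False rearr_eq_0[OF f] by (simp add: dilation_def)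
qed

lemma measurable_dilation:
  assumes [measurable]: "f \<in> L0"
  shows "dilation s f \<in> L0"
proof -
  have "Arg2pi z = 2 * pi * circle_angle z" for z by (simp add: circle_angle_def)
  then show ?thesis unfolding dilation_def by (simp only:) measurable
qed

lemma dilation_scale: "dilation s (\<lambda>z. c * f z) z = c * dilation s f z"
  by (simp add: dilation_def)

text \<open>For \<open>s < 1\<close> the logarithm is negative, so a lower bound of the quotient is
  an upper bound of the norm. A positive quotient also rules out the norms \<open>0\<close> and
  \<open>\<infinity>\<close>: \<open>enn2real\<close> sends both to \<open>0\<close>, and
  \<open>ln 0\<close> is \<open>0\<close>.\<close>

lemma lower_boyd_bound:
  assumes "has_lower_boyd_index X N \<alpha>" "\<alpha> > 0"
  obtains s0 where "0 < s0"
    "\<And>s. 0 < s \<Longrightarrow> s < s0 \<Longrightarrow> op_norm X N X N (dilation (1 / s)) < \<infinity>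
      \<and> enn2real (op_norm X N X N (dilation (1 / s))) \<le> s powr (\<alpha> / 2)"
proof -
  have "eventually (\<lambda>s. \<alpha> / 2 < boyd_quotient X N s) (at_right 0)"
    using assms unfolding has_lower_boyd_index_def by (intro order_tendstoD(1)) auto
  then obtain b where b: "b > 0" "\<And>s. 0 < s \<Longrightarrow> s < b \<Longrightarrow> \<alpha> / 2 < boyd_quotient X N s"
    unfolding eventually_at_right_field by blast
  show ?thesis
  proof (rule that[of "min b 1"])
    fix s :: real assume s: "0 < s" "s < min b 1"
    define E where "E = enn2real (op_norm X N X N (dilation (1 / s)))"
    have q: "\<alpha> / 2 < ln E / ln s" using b(2)[of s] s by (simp add: boyd_quotient_def E_def)
    have "E \<noteq> 0"
    proof
      assume "E = 0"
      then show False using q assms(2) by simp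
    qed
    moreover have "0 \<le> E" by (simp add: E_def)
    ultimately have E: "E > 0" by simp
    have "ln E < \<alpha> / 2 * ln s" using q s by (simp add: neg_less_divide_eq)
    then have "exp (ln E) < exp (\<alpha> / 2 * ln s)" by simp
    then have "E \<le> s powr (\<alpha> / 2)" using E s by (simp add: powr_def)
    moreover have "op_norm X N X N (dilation (1 / s)) \<noteq> \<infinity>" using E by (auto simp: E_def)
    ultimately show "op_norm X N X N (dilation (1 / s)) < \<infinity>
      \<and> enn2real (op_norm X N X N (dilation (1 / s))) \<le> s powr (\<alpha> / 2)"
      by (auto simp: E_def top.not_eq_extremum)
  qed (use b in simp)
qed

text \<open>The exponent is the midpoint of \<open>\<beta>\<close> and \<open>1\<close>: being below
  \<open>1\<close> it leaves room for the weights \<open>(1/2)^k\<close> of the majorant. Positivity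
  of the quotient, from \<open>\<beta> > 0\<close>, again excludes the default values of
  \<open>enn2real\<close> and \<open>ln\<close>.\<close>

lemma upper_boyd_bound:
  assumes "has_upper_boyd_index X N \<beta>" "0 < \<beta>" "\<beta> < 1"
  obtains s1 where
    "\<And>s. s1 < s \<Longrightarrow> op_norm X N X N (dilation (1 / s)) < \<infinity>
      \<and> enn2real (op_norm X N X N (dilation (1 / s))) \<le> s powr ((1 + \<beta>) / 2)"
proof -
  have T: "(boyd_quotient X N \<longlongrightarrow> \<beta>) at_top" using assms(1) by (simp add: has_upper_boyd_index_def)
  have lt: "\<beta> < (1 + \<beta>) / 2" using assms(3) by simp
  have "eventually (\<lambda>s. 0 < boyd_quotient X N s) at_top"
    "eventually (\<lambda>s. boyd_quotient X N s < (1 + \<beta>) / 2) at_top"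
    using order_tendstoD(1)[OF T assms(2)] order_tendstoD(2)[OF T lt] by blast+
  then have "eventually (\<lambda>s. 0 < boyd_quotient X N s \<and> boyd_quotient X N s < (1 + \<beta>) / 2) at_top"
    by (rule eventually_conj)
  then obtain b where b: "\<And>s. b < s \<Longrightarrow> 0 < boyd_quotient X N s \<and> boyd_quotient X N s < (1 + \<beta>) / 2"
    unfolding eventually_at_top_dense by blast
  show ?thesis
  proof (rule that[of "max b 1"])
    fix s :: real assume s: "max b 1 < s"
    define E where "E = enn2real (op_norm X N X N (dilation (1 / s)))"
    have q: "0 < ln E / ln s" "ln E / ln s < (1 + \<beta>) / 2"
      using b[of s] s by (auto simp: boyd_quotient_def E_def)
    have "E \<noteq> 0" using q(1) by auto
    moreover have "0 \<le> E" by (simp add: E_def)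
    ultimately have E: "E > 0" by simp
    have "ln E < (1 + \<beta>) / 2 * ln s" using q(2) s by (subst (asm) pos_divide_less_eq) auto
    then have "exp (ln E) < exp ((1 + \<beta>) / 2 * ln s)" by (simp only: exp_less_mono)
    then have "E \<le> s powr ((1 + \<beta>) / 2)" using E s by (simp add: powr_def)
    moreover have "op_norm X N X N (dilation (1 / s)) \<noteq> \<infinity>" using E by (auto simp: E_def)
    ultimately show "op_norm X N X N (dilation (1 / s)) < \<infinity>
      \<and> enn2real (op_norm X N X N (dilation (1 / s))) \<le> s powr ((1 + \<beta>) / 2)"
      by (auto simp: E_def top.not_eq_extremum)
  qed
qed

text \<open>The factors \<open>4\<close> and \<open>6\<close> are those of
  \<open>rearr_herglotz_le\<close>; the first summand is what \<open>nn_integral_above_rearr\<close>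
  makes of the integral there.\<close>

definition rearr_majorant_term :: "(complex \<Rightarrow> complex) \<Rightarrow> nat \<Rightarrow> real \<Rightarrow> real" where
  "rearr_majorant_term f k t = 4 * ((1/2)^k * rearr f ((1/2)^Suc k * t)) + 6 * rearr f (2^k * t)"

text \<open>A discrete form of the Calderon operator applied to \<open>f\<^sup>*\<close>.\<close>
definition rearr_majorant :: "(complex \<Rightarrow> complex) \<Rightarrow> real \<Rightarrow> real" where
  "rearr_majorant f t = (\<Sum>k. rearr_majorant_term f k t)"

lemma rearr_majorant_term_nonneg: "f \<in> L0 \<Longrightarrow> 0 \<le> rearr_majorant_term f k t"
  by (simp add: rearr_majorant_term_def rearr_nonneg)

context ri_space
begin

lemma rearr_mem:
  assumes "f \<in> X"
  shows "(\<lambda>z. complex_of_real (rearr f (circle_angle z))) \<in> X"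
    "N (\<lambda>z. complex_of_real (rearr f (circle_angle z))) = N f"
proof -
  have f: "f \<in> L0" using assms mem_L0 by blast
  have [measurable]: "(\<lambda>z. rearr f (circle_angle z)) \<in> borel_measurable circle_measure"
    using measurable_rearr_angle[OF f, of 1] by simp
  have "(\<lambda>z. complex_of_real (rearr f (circle_angle z))) \<in> L0" by measurable
  moreover have "equimeasurable f (\<lambda>z. complex_of_real (rearr f (circle_angle z)))"
    unfolding equimeasurable_iff using distr_fun_rearr_angle[OF f] by simp
  ultimately have "(\<lambda>z. complex_of_real (rearr f (circle_angle z))) \<in> X
      \<and> N f = N (\<lambda>z. complex_of_real (rearr f (circle_angle z)))"
    by (rule rearrangement_invariant[OF assms])
  then show "(\<lambda>z. complex_of_real (rearr f (circle_angle z))) \<in> X"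
    "N (\<lambda>z. complex_of_real (rearr f (circle_angle z))) = N f"
    by auto
qed

lemma mem_if_rearr_le:
  assumes v: "v \<in> L0" and w: "w \<in> X"
    and le: "AE z in circle_measure. rearr v (circle_angle z) \<le> cmod (w z)"
  shows "v \<in> X \<and> N v \<le> N w"
proof -
  have [measurable]: "(\<lambda>z. rearr v (circle_angle z)) \<in> borel_measurable circle_measure"
    using measurable_rearr_angle[OF v, of 1] by simp
  have m: "(\<lambda>z. complex_of_real (rearr v (circle_angle z))) \<in> L0" by measurable
  have "AE z in circle_measure. cmod (complex_of_real (rearr v (circle_angle z))) \<le> cmod (w z)"
    using le by eventually_elim (simp add: rearr_nonneg[OF v])
  then have 1: "(\<lambda>z. complex_of_real (rearr v (circle_angle z))) \<in> X"
    "N (\<lambda>z. complex_of_real (rearr v (circle_angle z))) \<le> N w"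
    using ideal[OF w m] by auto
  have "equimeasurable (\<lambda>z. complex_of_real (rearr v (circle_angle z))) v"
    unfolding equimeasurable_iff using distr_fun_rearr_angle[OF v] by simp
  then show ?thesis using rearrangement_invariant[OF 1(1) v] 1(2) by auto
qed

lemma dilated_rearr_bound:
  assumes fin: "op_norm X N X N (dilation s) < \<infinity>" and s: "s > 0" and f: "f \<in> X"
  shows "(\<lambda>z. complex_of_real (rearr f (s * circle_angle z))) \<in> X"
    "N (\<lambda>z. complex_of_real (rearr f (s * circle_angle z))) \<le> enn2real (op_norm X N X N (dilation s)) * N f"
proof -
  have bfs: "banach_function_space X N" by (rule banach_function_space_axioms)
  have eq: "dilation s (\<lambda>z. complex_of_real (rearr f (circle_angle z)))
      = (\<lambda>z. complex_of_real (rearr f (s * circle_angle z)))"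
    using dilation_rearr[OF mem_L0[OF f] s] by auto
  have "dilation s (\<lambda>z. complex_of_real (rearr f (circle_angle z))) \<in> X"
    by (rule op_norm_apply(1)[OF bfs bfs order_refl order_refl scale_closed, where T = "dilation s"
          and f = "\<lambda>z. complex_of_real (rearr f (circle_angle z))"])
       (use fin in \<open>auto simp: dilation_scale measurable_dilation mem_L0 rearr_mem f\<close>)
  then show "(\<lambda>z. complex_of_real (rearr f (s * circle_angle z))) \<in> X"
    by (simp only: eq)
  have "N (dilation s (\<lambda>z. complex_of_real (rearr f (circle_angle z))))
      \<le> enn2real (op_norm X N X N (dilation s)) * N (\<lambda>z. complex_of_real (rearr f (circle_angle z)))"
    by (rule op_norm_apply(2)[OF bfs bfs order_refl order_refl scale_closed, where T = "dilation s"
          and f = "\<lambda>z. complex_of_real (rearr f (circle_angle z))"])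
       (use fin in \<open>auto simp: dilation_scale measurable_dilation mem_L0 rearr_mem f\<close>)
  then show "N (\<lambda>z. complex_of_real (rearr f (s * circle_angle z))) \<le> enn2real (op_norm X N X N (dilation s)) * N f"
    by (simp only: eq rearr_mem(2)[OF f])
qed

lemma rearr_dilate_mono:
  assumes f: "f \<in> X" and s: "0 < s" "s \<le> s'" and mem: "(\<lambda>z. complex_of_real (rearr f (s * circle_angle z))) \<in> X"
  shows "(\<lambda>z. complex_of_real (rearr f (s' * circle_angle z))) \<in> X"
    "N (\<lambda>z. complex_of_real (rearr f (s' * circle_angle z))) \<le> N (\<lambda>z. complex_of_real (rearr f (s * circle_angle z)))"
proof -
  have fL: "f \<in> L0" using mem_L0[OF f] .
  have [measurable]: "(\<lambda>z. rearr f (s' * circle_angle z)) \<in> borel_measurable circle_measure"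
    by (rule measurable_rearr_angle[OF fL]) (use s in simp)
  have m: "(\<lambda>z. complex_of_real (rearr f (s' * circle_angle z))) \<in> L0" by measurable
  have "AE z in circle_measure. cmod (complex_of_real (rearr f (s' * circle_angle z)))
      \<le> cmod (complex_of_real (rearr f (s * circle_angle z)))"
    using AE_circle_angle_pos
  proof eventually_elim
    case (elim z)
    have "rearr f (s' * circle_angle z) \<le> rearr f (s * circle_angle z)"
      by (rule rearr_antimono[OF fL]) (use s elim in \<open>auto intro: mult_right_mono\<close>)
    then show ?case using rearr_nonneg[OF fL] by simp
  qed
  then show "(\<lambda>z. complex_of_real (rearr f (s' * circle_angle z))) \<in> X"
    "N (\<lambda>z. complex_of_real (rearr f (s' * circle_angle z))) \<le> N (\<lambda>z. complex_of_real (rearr f (s * circle_angle z)))"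
    using ideal[OF mem m] by auto
qed

text \<open>The indices control the dilations only for extreme scales, with rates
  \<open>q = (1/2) powr (\<alpha> / 2)\<close> and \<open>p = 2 powr ((1 + \<beta>) / 2)\<close>.
  For the finitely many other dyadic scales, monotonicity of \<open>rearr f\<close> allows a
  comparison with the scale \<open>1\<close>, respectively \<open>(1/2)^n\<close>, and
  \<open>B\<close> absorbs the loss.\<close>

lemma boyd_dilation_bounds:
  assumes "nontrivial_boyd_indices X N"
  obtains q p B :: real where "0 < q" "q < 1" "0 < p" "p < 2" "0 < B"
    "\<And>f k. f \<in> X \<Longrightarrow> (\<lambda>z. complex_of_real (rearr f (2^k * circle_angle z))) \<in> X
      \<and> N (\<lambda>z. complex_of_real (rearr f (2^k * circle_angle z))) \<le> B * q^k * N f"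
    "\<And>f k. f \<in> X \<Longrightarrow> (\<lambda>z. complex_of_real (rearr f ((1/2)^k * circle_angle z))) \<in> X
      \<and> N (\<lambda>z. complex_of_real (rearr f ((1/2)^k * circle_angle z))) \<le> B * p^k * N f"
proof -
  obtain \<alpha> \<beta> where ab: "0 < \<alpha>" "\<alpha> < 1" "0 < \<beta>" "\<beta> < 1" "has_lower_boyd_index X N \<alpha>" "has_upper_boyd_index X N \<beta>"
    using assms by (auto simp: nontrivial_boyd_indices_def)
  obtain s0 where s0: "0 < s0"
    "\<And>s. 0 < s \<Longrightarrow> s < s0 \<Longrightarrow> op_norm X N X N (dilation (1 / s)) < \<infinity>
      \<and> enn2real (op_norm X N X N (dilation (1 / s))) \<le> s powr (\<alpha> / 2)"
    using lower_boyd_bound[OF ab(5,1)] by blast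
  obtain s1 where s1:
    "\<And>s. s1 < s \<Longrightarrow> op_norm X N X N (dilation (1 / s)) < \<infinity>
      \<and> enn2real (op_norm X N X N (dilation (1 / s))) \<le> s powr ((1 + \<beta>) / 2)"
    using upper_boyd_bound[OF ab(6,3,4)] by blast
  define q where "q = (1/2) powr (\<alpha> / 2)"
  define p where "p = 2 powr ((1 + \<beta>) / 2)"
  have q: "0 < q" "q < 1"
  proof -
    have "ln (1/2::real) < 0" by (rule ln_less_zero) auto
    then have "exp (\<alpha> / 2 * ln (1/2)) < exp 0" using ab(1) by (subst exp_less_cancel_iff) (simp add: mult_pos_neg)
    then show "q < 1" by (simp add: q_def powr_def)
  qed (simp add: q_def)
  have p: "1 \<le> p" "p < 2"
  proof -
    show "1 \<le> p" unfolding p_def using ab by (intro ge_one_powr_ge_zero) auto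
    have "p < 2 powr 1" unfolding p_def using ab by (intro powr_less_mono) auto
    then show "p < 2" by simp
  qed
  obtain m where m: "(1/2)^m < s0" using real_arch_pow_inv[OF s0(1), of "1/2"] by auto
  obtain n where n: "s1 < 2^n" using real_arch_pow[of 2 s1] by auto
  define B where "B = max (1 / q^m) (p^n)"
  have B: "1 / q^m \<le> B" "p^n \<le> B" by (auto simp: B_def)
  have q1: "1 \<le> 1 / q^m" using q by (simp add: power_le_one)
  have B0: "1 \<le> B" using B(1) q1 by linarith
  have A: "(\<lambda>z. complex_of_real (rearr f (2^k * circle_angle z))) \<in> X
      \<and> N (\<lambda>z. complex_of_real (rearr f (2^k * circle_angle z))) \<le> B * q^k * N f" if f: "f \<in> X" for f k
  proof -
    have Nf: "0 \<le> N f" using norm_nonneg[OF f] .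
    show ?thesis
    proof (cases "m \<le> k")
      case True
      have "(1/2::real)^k \<le> (1/2)^m" using True by (intro power_decreasing) auto
      then have s: "0 < (1/2::real)^k" "(1/2)^k < s0" using m by (simp, linarith)
      have e: "1 / (1/2::real)^k = 2^k" by (simp add: power_divide)
      have fin: "op_norm X N X N (dilation (2^k)) < \<infinity>" "enn2real (op_norm X N X N (dilation (2^k))) \<le> ((1/2)^k) powr (\<alpha> / 2)"
        using s0(2)[OF s] unfolding e by auto
      have "((1/2::real)^k) powr (\<alpha> / 2) = q^k"
        by (simp add: q_def powr_power powr_powr powr_realpow[symmetric] mult.commute)
      then have "enn2real (op_norm X N X N (dilation (2^k))) * N f \<le> 1 * q^k * N f"
        using fin(2) Nf by (simp add: mult_right_mono)
      also have "\<dots> \<le> B * q^k * N f" using B0 q Nf by (intro mult_right_mono) auto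
      finally show ?thesis using dilated_rearr_bound[OF fin(1) _ f] by auto
    next
      case False
      have r1: "(\<lambda>z. complex_of_real (rearr f (1 * circle_angle z))) \<in> X" "N (\<lambda>z. complex_of_real (rearr f (1 * circle_angle z))) = N f"
        using rearr_mem[OF f] by auto
      have "1 \<le> 1 / q^m * q^k" using False q by (simp add: field_simps)
      also have "\<dots> \<le> B * q^k" using B(1) q by (intro mult_right_mono) auto
      finally have "1 * N f \<le> B * q^k * N f" using Nf by (rule mult_right_mono)
      moreover have "(1::real) \<le> 2^k" by simp
      ultimately show ?thesis using rearr_dilate_mono[OF f _ _ r1(1), of "2^k"] r1(2) by auto
    qed
  qed
  have C: "(\<lambda>z. complex_of_real (rearr f ((1/2)^k * circle_angle z))) \<in> X
      \<and> N (\<lambda>z. complex_of_real (rearr f ((1/2)^k * circle_angle z))) \<le> B * p^k * N f" if f: "f \<in> X" for f k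
  proof -
    have Nf: "0 \<le> N f" using norm_nonneg[OF f] .
    have main: "(\<lambda>z. complex_of_real (rearr f ((1/2)^k * circle_angle z))) \<in> X
      \<and> N (\<lambda>z. complex_of_real (rearr f ((1/2)^k * circle_angle z))) \<le> p^k * N f" if k: "n \<le> k" for k
    proof -
      have "(2::real)^n \<le> 2^k" using k by (intro power_increasing) auto
      then have s: "s1 < 2^k" using n by linarith
      have e: "1 / (2::real)^k = (1/2)^k" by (simp add: power_divide)
      have fin: "op_norm X N X N (dilation ((1/2)^k)) < \<infinity>" "enn2real (op_norm X N X N (dilation ((1/2)^k))) \<le> (2^k) powr ((1 + \<beta>) / 2)"
        using s1[OF s] unfolding e by auto
      have "((2::real)^k) powr ((1 + \<beta>) / 2) = p^k"
        by (simp add: p_def powr_power powr_powr powr_realpow[symmetric] mult.commute)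
      then have "enn2real (op_norm X N X N (dilation ((1/2)^k))) * N f \<le> p^k * N f"
        using fin(2) Nf by (simp add: mult_right_mono)
      then show ?thesis using dilated_rearr_bound[OF fin(1) _ f] by auto
    qed
    show ?thesis
    proof (cases "n \<le> k")
      case True
      have "p^k * N f \<le> B * p^k * N f" using B0 p Nf by (intro mult_right_mono) auto
      then show ?thesis using main[OF True] by auto
    next
      case False
      have le: "(1/2::real)^n \<le> (1/2)^k" using False by (intro power_decreasing) auto
      have "p^n * 1 \<le> B * p^k" using B(2) B0 p by (intro mult_mono) auto
      then have "p^n * N f \<le> B * p^k * N f" using Nf by (intro mult_right_mono) auto
      then show ?thesis
        using rearr_dilate_mono[OF f _ le] main[of n] by auto
    qed
  qed
  show ?thesis by (rule that[of q p B]) (use q p B0 A C in auto)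
qed

text \<open>As \<open>circle_angle\<close> stays below \<open>1\<close>, the dilated rearrangement
  dominates the constant \<open>rearr f ((1/2)^k)\<close>. Thus norm bounds for dilations become
  bounds for the growth of \<open>rearr f\<close> at \<open>0\<close>.\<close>

lemma rearr_pointwise_bound:
  assumes "(\<lambda>z. complex_of_real (rearr f ((1/2)^k * circle_angle z))) \<in> X" and f: "f \<in> X"
  shows "rearr f ((1/2)^k) * N (\<lambda>z. 1) \<le> N (\<lambda>z. complex_of_real (rearr f ((1/2)^k * circle_angle z)))"
proof -
  have fL: "f \<in> L0" using mem_L0[OF f] .
  have "AE z in circle_measure. cmod (complex_of_real (rearr f ((1/2)^k)))
      \<le> cmod (complex_of_real (rearr f ((1/2)^k * circle_angle z)))"
    using AE_circle_angle_pos
  proof eventually_elim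
    case (elim z)
    have "(1/2::real)^k * circle_angle z \<le> (1/2)^k * 1"
      using circle_angle_bounds[of z] by (intro mult_left_mono) auto
    then have "rearr f ((1/2)^k) \<le> rearr f ((1/2)^k * circle_angle z)"
      by (intro rearr_antimono[OF fL]) (use elim in auto)
    then show ?case using rearr_nonneg[OF fL] by simp
  qed
  then have "N (\<lambda>z. complex_of_real (rearr f ((1/2)^k))) \<le> N (\<lambda>z. complex_of_real (rearr f ((1/2)^k * circle_angle z)))"
    by (intro ideal_norm[OF assms(1)]) auto
  then show ?thesis using norm_const[of "complex_of_real (rearr f ((1/2)^k))"] rearr_nonneg[OF fL] by simp
qed

text \<open>By the pointwise bound \<open>rearr f\<close> grows at most like \<open>p^k\<close> at
  \<open>(1/2)^k\<close>; since \<open>p < 2\<close>, the weights \<open>(1/2)^k\<close> make the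
  first series and the integral of \<open>cmod (f z)\<close> finite. The second series has finitely
  many nonzero terms for each \<open>t\<close>, and its terms have norms of order
  \<open>q^k\<close>. The partial sums of the majorant increase with bounded norms, so the Fatou
  property puts the majorant itself into \<open>X\<close>.\<close>

lemma boyd_consequences:
  assumes boyd: "nontrivial_boyd_indices X N" and fatou: "fatou_property X N"
  obtains C where "0 \<le> C"
    "\<And>f. f \<in> X \<Longrightarrow> integrable circle_measure f"
    "\<And>f. f \<in> X \<Longrightarrow> (\<integral>z. cmod (f z) \<partial>circle_measure) \<le> C * N f"
    "\<And>f t. f \<in> X \<Longrightarrow> summable (\<lambda>k. (1/2)^k * rearr f ((1/2)^Suc k * t))"
    "\<And>f t. f \<in> X \<Longrightarrow> summable (\<lambda>k. rearr f (2^k * t))"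
    "\<And>f. f \<in> X \<Longrightarrow> (\<lambda>z. complex_of_real (rearr_majorant f (circle_angle z))) \<in> X"
    "\<And>f. f \<in> X \<Longrightarrow> N (\<lambda>z. complex_of_real (rearr_majorant f (circle_angle z))) \<le> C * N f"
proof -
  obtain q p B :: real where q: "0 < q" "q < 1" and p: "0 < p" "p < 2" and B: "0 < B"
    and A: "\<And>f k. f \<in> X \<Longrightarrow> (\<lambda>z. complex_of_real (rearr f (2^k * circle_angle z))) \<in> X
      \<and> N (\<lambda>z. complex_of_real (rearr f (2^k * circle_angle z))) \<le> B * q^k * N f"
    and D: "\<And>f k. f \<in> X \<Longrightarrow> (\<lambda>z. complex_of_real (rearr f ((1/2)^k * circle_angle z))) \<in> X
      \<and> N (\<lambda>z. complex_of_real (rearr f ((1/2)^k * circle_angle z))) \<le> B * p^k * N f"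
    using boyd_dilation_bounds[OF boyd] by metis
  define N1 where "N1 = N (\<lambda>z. 1)"
  have N1: "N1 > 0" unfolding N1_def by (rule norm_one_pos)
  have pw: "rearr f ((1/2)^k) \<le> B / N1 * N f * p^k" if f: "f \<in> X" for f k
  proof -
    have "rearr f ((1/2)^k) * N1 \<le> B * p^k * N f"
      using rearr_pointwise_bound[OF conjunct1[OF D[OF f]] f, of k] D[OF f, of k] by (auto simp: N1_def)
    then show ?thesis using N1 by (simp add: pos_le_divide_eq mult_ac)
  qed
  have p2: "summable (\<lambda>k. (p/2)^k)" using p by (intro summable_geometric) auto
  have sum1: "summable (\<lambda>k. (1/2)^k * rearr f ((1/2)^Suc k * t))" if f: "f \<in> X" for f t
  proof (cases "t > 0")
    case True
    have fL: "f \<in> L0" using mem_L0[OF f] .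
    obtain n where n: "(1/2)^n < t" using real_arch_pow_inv[OF True, of "1/2"] by auto
    show ?thesis
    proof (rule summable_comparison_test'[OF summable_mult[OF p2, of "B / N1 * N f * p^Suc n"]])
      fix k
      have "(1/2)^(k + Suc n) \<le> (1/2)^Suc k * t"
        using n by (simp add: power_add mult_left_mono)
      then have "rearr f ((1/2)^Suc k * t) \<le> rearr f ((1/2)^(k + Suc n))"
        by (intro rearr_antimono[OF fL]) auto
      also have "\<dots> \<le> B / N1 * N f * p^(k + Suc n)" by (rule pw[OF f])
      finally have "(1/2)^k * rearr f ((1/2)^Suc k * t) \<le> (1/2)^k * (B / N1 * N f * p^(k + Suc n))"
        by (intro mult_left_mono) auto
      also have "\<dots> = B / N1 * N f * p^Suc n * (p/2)^k"
        by (simp add: power_add power_divide mult_ac)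
      finally show "norm ((1/2)^k * rearr f ((1/2)^Suc k * t)) \<le> B / N1 * N f * p^Suc n * (p/2)^k"
        using rearr_nonneg[OF fL] by simp
    qed
  next
    case False
    then have "rearr f ((1/2)^Suc k * t) = 0" for k by (simp add: rearr_def mult_nonneg_nonpos)
    then show ?thesis by simp
  qed
  have sum2: "summable (\<lambda>k. rearr f (2^k * t))" if f: "f \<in> X" for f t
  proof (cases "t > 0")
    case True
    have fL: "f \<in> L0" using mem_L0[OF f] .
    obtain J where J: "1 / t < 2^J" using real_arch_pow[of 2 "1 / t"] by auto
    show ?thesis
    proof (rule summable_finite[of "{..<J}"])
      fix k assume "k \<notin> {..<J}"
      then have "(2::real)^J \<le> 2^k" by (intro power_increasing) auto
      then have "1 / t \<le> 2^k" using J by linarith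
      then have "1 \<le> 2^k * t" using True by (simp add: pos_divide_le_eq)
      then show "rearr f (2^k * t) = 0" by (rule rearr_eq_0[OF fL])
    qed simp
  next
    case False
    then have "rearr f (2^k * t) = 0" for k by (simp add: rearr_def mult_nonneg_nonpos)
    then show ?thesis by simp
  qed
  define C1 where "C1 = B / N1 * p * (\<Sum>k. (p/2)^k)"
  have C10: "0 \<le> C1" unfolding C1_def using B N1 p by (intro mult_nonneg_nonneg suminf_nonneg[OF p2]) auto
  have int: "integrable circle_measure f \<and> (\<integral>z. cmod (f z) \<partial>circle_measure) \<le> C1 * N f" if f: "f \<in> X" for f
  proof -
    have fL: "f \<in> L0" using mem_L0[OF f] .
    note [measurable] = fL
    have R: "rearr (\<lambda>w. complex_of_real (cmod (f w))) = rearr f"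
      by (simp add: fun_eq_iff rearr_def distr_fun_def)
    \<comment> \<open>At \<open>t = 1\<close> the level \<open>rearr f 1\<close> is
      \<open>0\<close>, so the excess above it is the whole function.\<close>
    have "(\<integral>\<^sup>+w. ennreal (cmod (f w) - min (cmod (f w)) (rearr f 1)) \<partial>circle_measure)
        \<le> (\<Sum>k. ennreal (1 * ((1/2)^k * rearr f ((1/2)^Suc k * 1))))"
      using nn_integral_above_rearr[of "\<lambda>w. cmod (f w)" 1] unfolding R by simp
    also have "rearr f 1 = 0" by (rule rearr_eq_0[OF fL]) simp
    also have "(\<Sum>k. ennreal (1 * ((1/2)^k * rearr f ((1/2)^Suc k * 1)))) \<le> (\<Sum>k. ennreal (B / N1 * N f * p * (p/2)^k))"
    proof (rule suminf_le)
      fix k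
      have "(1/2)^k * rearr f ((1/2)^Suc k) \<le> (1/2)^k * (B / N1 * N f * p^Suc k)"
        by (intro mult_left_mono pw[OF f]) auto
      also have "\<dots> = B / N1 * N f * p * (p/2)^k" by (simp add: power_divide mult_ac)
      finally show "ennreal (1 * ((1/2)^k * rearr f ((1/2)^Suc k * 1))) \<le> ennreal (B / N1 * N f * p * (p/2)^k)"
        by (simp add: ennreal_leI)
    qed auto
    also have "\<dots> = ennreal (\<Sum>k. B / N1 * N f * p * (p/2)^k)"
      by (rule suminf_ennreal2) (use B N1 p p2 norm_nonneg[OF f] in \<open>auto intro!: summable_mult\<close>)
    also have "(\<Sum>k. B / N1 * N f * p * (p/2)^k) = C1 * N f"
      using suminf_mult[OF p2, of "B / N1 * N f * p"] by (simp add: C1_def mult_ac)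
    finally have le: "(\<integral>\<^sup>+w. ennreal (cmod (f w)) \<partial>circle_measure) \<le> ennreal (C1 * N f)"
      by (simp add: min_absorb2)
    then have i: "integrable circle_measure f"
      using fL by (auto simp: integrable_iff_bounded intro: le_less_trans)
    have "(\<integral>\<^sup>+w. ennreal (cmod (f w)) \<partial>circle_measure) = ennreal (\<integral>w. cmod (f w) \<partial>circle_measure)"
      by (rule nn_integral_eq_integral) (use i in auto)
    then have "(\<integral>w. cmod (f w) \<partial>circle_measure) \<le> C1 * N f"
      using le C10 norm_nonneg[OF f] by (simp add: ennreal_le_iff)
    then show ?thesis using i by blast
  qed
  define c where "c k = B * (4 * ((1/2)^k * p^Suc k) + 6 * q^k)" for k :: nat
  have sc: "summable c"
  proof -
    have "summable (\<lambda>k. B * (4 * p * (p/2)^k + 6 * q^k))"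
      using q by (intro summable_mult summable_add p2 summable_geometric) auto
    then show ?thesis unfolding c_def by (simp add: power_divide mult_ac)
  qed
  have c0: "0 \<le> c k" for k using B q p by (simp add: c_def)
  define C2 where "C2 = suminf c"
  have C20: "0 \<le> C2" unfolding C2_def by (rule suminf_nonneg[OF sc c0])
  have maj: "(\<lambda>z. complex_of_real (rearr_majorant f (circle_angle z))) \<in> X
    \<and> N (\<lambda>z. complex_of_real (rearr_majorant f (circle_angle z))) \<le> C2 * N f" if f: "f \<in> X" for f
  proof -
    have fL: "f \<in> L0" using mem_L0[OF f] .
    have Nf: "0 \<le> N f" using norm_nonneg[OF f] .
    define a where "a k z = rearr_majorant_term f k (circle_angle z)" for k z
    have a0: "0 \<le> a k z" for k z unfolding a_def by (rule rearr_majorant_term_nonneg[OF fL])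
    have am [measurable]: "a k \<in> borel_measurable circle_measure" for k
    proof -
      have [measurable]: "(\<lambda>z. rearr f ((1/2)^Suc k * circle_angle z)) \<in> borel_measurable circle_measure"
        "(\<lambda>z. rearr f (2^k * circle_angle z)) \<in> borel_measurable circle_measure"
        by (rule measurable_rearr_angle[OF fL], simp)+
      have "a k = (\<lambda>z. 4 * ((1/2)^k * rearr f ((1/2)^Suc k * circle_angle z)) + 6 * rearr f (2^k * circle_angle z))"
        by (simp add: a_def rearr_majorant_term_def fun_eq_iff)
      then show ?thesis by (simp only:) measurable
    qed
    have as: "summable (\<lambda>k. a k z)" for z
      unfolding a_def rearr_majorant_term_def by (intro summable_add summable_mult sum1[OF f] sum2[OF f])
    have aX: "(\<lambda>z. complex_of_real (a k z)) \<in> X \<and> N (\<lambda>z. complex_of_real (a k z)) \<le> c k * N f" for k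
    proof -
      define u where "u = (\<lambda>z. complex_of_real (4 * (1/2)^k) * complex_of_real (rearr f ((1/2)^Suc k * circle_angle z)))"
      define v where "v = (\<lambda>z. complex_of_real 6 * complex_of_real (rearr f (2^k * circle_angle z)))"
      note D' = D[OF f, of "Suc k"] and A' = A[OF f, of k]
      have u: "u \<in> X" unfolding u_def using D' by (intro scale_closed) auto
      have v: "v \<in> X" unfolding v_def using A' by (intro scale_closed) auto
      have "N u = cmod (complex_of_real (4 * (1/2)^k)) * N (\<lambda>z. complex_of_real (rearr f ((1/2)^Suc k * circle_angle z)))"
        unfolding u_def using D' by (intro norm_scale) auto
      also have "\<dots> \<le> 4 * (1/2)^k * (B * p^Suc k * N f)"
        unfolding norm_of_real using D' by (intro mult_mono norm_nonneg) auto
      finally have Nu: "N u \<le> 4 * (1/2)^k * (B * p^Suc k * N f)" .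
      have "N v = cmod (complex_of_real 6) * N (\<lambda>z. complex_of_real (rearr f (2^k * circle_angle z)))"
        unfolding v_def using A' by (intro norm_scale) auto
      also have "\<dots> \<le> 6 * (B * q^k * N f)"
        unfolding norm_of_real using A' by (intro mult_mono norm_nonneg) auto
      finally have Nv: "N v \<le> 6 * (B * q^k * N f)" .
      have eq: "(\<lambda>z. complex_of_real (a k z)) = (\<lambda>z. u z + v z)"
        by (simp add: a_def rearr_majorant_term_def u_def v_def fun_eq_iff)
      have "N (\<lambda>z. u z + v z) \<le> 4 * (1/2)^k * (B * p^Suc k * N f) + 6 * (B * q^k * N f)"
        using norm_triangle[OF u v] Nu Nv by linarith
      also have "\<dots> = c k * N f" by (simp add: c_def algebra_simps)
      finally show ?thesis unfolding eq using add_closed[OF u v] by blast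
    qed
    define F where "F n z = (\<Sum>k<n. a k z)" for n z
    have FX: "(\<lambda>z. complex_of_real (F n z)) \<in> X" and FN: "N (\<lambda>z. complex_of_real (F n z)) \<le> C2 * N f" for n
    proof -
      have s: "(\<lambda>z. \<Sum>k<n. complex_of_real (a k z)) \<in> X \<and> N (\<lambda>z. \<Sum>k<n. complex_of_real (a k z)) \<le> (\<Sum>k<n. N (\<lambda>z. complex_of_real (a k z)))"
        by (rule sum_mem) (use aX in auto)
      then show "(\<lambda>z. complex_of_real (F n z)) \<in> X" by (simp add: F_def)
      have "(\<Sum>k<n. N (\<lambda>z. complex_of_real (a k z))) \<le> (\<Sum>k<n. c k * N f)"
        by (rule sum_mono) (use aX in auto)
      also have "\<dots> = (\<Sum>k<n. c k) * N f" by (rule sum_distrib_right[symmetric])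
      also have "\<dots> \<le> C2 * N f" unfolding C2_def using Nf c0 by (intro mult_right_mono sum_le_suminf sc) auto
      finally show "N (\<lambda>z. complex_of_real (F n z)) \<le> C2 * N f" using s by (simp add: F_def)
    qed
    define h where "h z = rearr_majorant f (circle_angle z)" for z
    have lim: "(\<lambda>n. F n z) \<longlonglongrightarrow> h z" for z
      unfolding F_def h_def rearr_majorant_def using summable_LIMSEQ[OF as[of z]] by (simp add: a_def)
    have [measurable]: "F n \<in> borel_measurable circle_measure" for n unfolding F_def by measurable
    have [measurable]: "h \<in> borel_measurable circle_measure"
      by (rule borel_measurable_LIMSEQ_metric[where f = F]) (use lim in auto)
    have hL: "(\<lambda>z. complex_of_real (h z)) \<in> L0" by measurable
    have inc: "nonneg_increasing_to F h"
      unfolding nonneg_increasing_to_def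
    proof (rule AE_I2, intro conjI allI)
      fix z n
      show "0 \<le> F n z" unfolding F_def by (intro sum_nonneg a0)
      show "incseq (\<lambda>n. F n z)" by (rule incseq_SucI) (simp add: F_def a0)
      show "(\<lambda>n. F n z) \<longlonglongrightarrow> h z" by (rule lim)
    qed
    have bdd: "bdd_above (range (\<lambda>n. N (\<lambda>z. complex_of_real (F n z))))"
      by (rule bdd_aboveI[of _ "C2 * N f"]) (use FN in auto)
    have "(\<lambda>z. complex_of_real (h z)) \<in> X \<and> N (\<lambda>z. complex_of_real (h z)) = (SUP n. N (\<lambda>z. complex_of_real (F n z)))"
      using fatou FX hL inc bdd unfolding fatou_property_def by blast
    moreover have "(SUP n. N (\<lambda>z. complex_of_real (F n z))) \<le> C2 * N f"
      by (rule cSUP_least) (use FN in auto)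
    ultimately show ?thesis by (simp add: h_def)
  qed
  show ?thesis
  proof (rule that[of "max C1 C2"])
    show "0 \<le> max C1 C2" using C10 by simp
    fix f assume f: "f \<in> X"
    have Nf: "0 \<le> N f" using norm_nonneg[OF f] .
    have "C1 * N f \<le> max C1 C2 * N f" "C2 * N f \<le> max C1 C2 * N f"
      using Nf by (auto intro!: mult_right_mono)
    then show "(\<integral>z. cmod (f z) \<partial>circle_measure) \<le> max C1 C2 * N f"
      "N (\<lambda>z. complex_of_real (rearr_majorant f (circle_angle z))) \<le> max C1 C2 * N f"
      using int[OF f] maj[OF f] by linarith+
  qed (use int maj sum1 sum2 in auto)
qed

end

section \<open>Boundedness of the Riesz projection\<close>

text \<open>Starts at \<open>1/2\<close> because \<open>integral_moment_zero\<close> cancels a power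
  of the radius.\<close>

definition radius_seq :: "nat \<Rightarrow> real" where
  "radius_seq n = 1 - 1 / (real n + 2)"

lemma radius_seq_bounds: "0 < radius_seq n" "radius_seq n < 1"
  by (auto simp: radius_seq_def field_simps)

lemma filterlim_radius_seq: "filterlim radius_seq (at_left 1) sequentially"
  unfolding filterlim_at
proof
  show "eventually (\<lambda>n. radius_seq n \<in> {..<1} \<and> radius_seq n \<noteq> 1) sequentially"
    using radius_seq_bounds(2) by (intro always_eventually allI) (auto simp: less_imp_neq)
  have "(\<lambda>n. 1 / real (Suc (Suc n))) \<longlonglongrightarrow> 0"
    by (intro LIMSEQ_Suc lim_1_over_n)
  then have "(\<lambda>n. 1 - 1 / real (Suc (Suc n))) \<longlonglongrightarrow> 1 - 0" by (intro tendsto_intros)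
  moreover have "(\<lambda>n. 1 - 1 / real (Suc (Suc n))) = radius_seq"
    by (simp add: radius_seq_def fun_eq_iff add.commute)
  ultimately show "radius_seq \<longlonglongrightarrow> 1" by simp
qed

lemma integrable_mult_power:
  assumes "integrable circle_measure h"
  shows "integrable circle_measure (\<lambda>z. h z * z ^ m)"
proof (rule integrable_mult_bounded[OF assms])
  show "(\<lambda>w. w ^ m) \<in> L0" by (intro continuous_imp_measurable_circle continuous_intros)
  show "cmod (w ^ m) \<le> 1" if "cmod w = 1" for w using that by (simp add: norm_power)
qed

text \<open>The mean value property of \<open>F \<zeta> * \<zeta> ^ m\<close>, which vanishes at the
  origin. On the circle the moments with \<open>m > 0\<close> are the Fourier coefficients of
  negative index.\<close>

lemma integral_moment_zero:
  assumes F: "F holomorphic_on ball 0 1" and m: "m > 0" and r: "0 < r" "r < 1"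
  shows "(\<integral>z. F (of_real r * z) * z ^ m \<partial>circle_measure) = 0"
proof -
  have "(\<lambda>\<zeta>. F \<zeta> * \<zeta> ^ m) holomorphic_on ball 0 1" by (intro holomorphic_intros F)
  then have "(\<integral>z. F (of_real r * z) * (of_real r * z) ^ m \<partial>circle_measure) = F 0 * 0 ^ m"
    using r by (intro mean_value_radius) auto
  also have "\<dots> = 0" using m by (simp add: zero_power)
  also have "(\<integral>z. F (of_real r * z) * (of_real r * z) ^ m \<partial>circle_measure)
      = (\<integral>z. of_real r ^ m * (F (of_real r * z) * z ^ m) \<partial>circle_measure)"
    by (simp add: power_mult_distrib mult_ac)
  also have "\<dots> = of_real r ^ m * (\<integral>z. F (of_real r * z) * z ^ m \<partial>circle_measure)"
    by (rule integral_mult_right_zero)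
  finally show ?thesis using r by simp
qed

lemma cnj_powi_neg:
  assumes "cmod z = 1" "n < 0"
  shows "cnj (z powi n) = z ^ nat (- n)"
proof -
  have "cnj (inverse z) = z" using cnj_eq_inverse[OF assms(1)] by (metis complex_cnj_cnj)
  then show ?thesis using assms(2) by (simp add: power_int_def)
qed

lemma fourier_coeff_neg:
  assumes "n < 0"
  shows "fourier_coeff f n = (\<integral>z. f z * z ^ nat (- n) \<partial>circle_measure)"
  unfolding fourier_coeff_def pairing_def
  by (rule Bochner_Integration.integral_cong) (use assms in \<open>auto simp: cnj_powi_neg simp del: complex_cnj_power_int\<close>)

section \<open>Reduction to nonnegative functions and the weak type of the Riesz projection\<close>

text \<open>The basic estimates are for nonnegative functions and are applied to these four. They
  are indexed by numbers to be summed; every index from \<open>3\<close> on denotes the same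
  part.\<close>

definition part :: "nat \<Rightarrow> complex \<Rightarrow> real" where
  "part i x = (if i = 0 then max (Re x) 0 else if i = 1 then max (- Re x) 0
     else if i = 2 then max (Im x) 0 else max (- Im x) 0)"

lemma part_nonneg: "0 \<le> part i x"
  by (auto simp: part_def)

lemma part_le: "part i x \<le> cmod x"
  using abs_Re_le_cmod[of x] abs_Im_le_cmod[of x] by (auto simp: part_def)

definition part_unit :: "nat \<Rightarrow> complex" where
  "part_unit i = \<i> ^ (if i = 0 then 0 else if i = 1 then 2 else if i = 2 then 1 else 3)"

lemma norm_part_unit [simp]: "cmod (part_unit i) = 1"
  by (simp add: part_unit_def norm_power)

lemma part_decomp: "x = (\<Sum>i<4. part_unit i * complex_of_real (part i x))"
proof -
  have e: "(\<Sum>i<4. g i) = g 0 + g 1 + g 2 + g 3" for g :: "nat \<Rightarrow> complex"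
    by (simp add: eval_nat_numeral)
  have i3: "\<i> ^ 3 = - \<i>" by (simp add: power3_eq_cube)
  show ?thesis unfolding e by (simp add: part_unit_def part_def i3 complex_eq_iff max_def)
qed

lemma measurable_part [measurable]: "part i \<in> borel_measurable borel"
  unfolding part_def by measurable

lemma integrable_part: "integrable circle_measure f \<Longrightarrow> integrable circle_measure (\<lambda>z. part i (f z))"
  by (rule Bochner_Integration.integrable_bound[of _ "\<lambda>z. cmod (f z)"])
     (use part_le part_nonneg in \<open>auto intro!: measurable_compose[OF _ measurable_part]\<close>)

lemma herglotz_parts:
  assumes f: "integrable circle_measure f" and \<zeta>: "cmod \<zeta> < 1"
  shows "herglotz f \<zeta> = (\<Sum>i<4. part_unit i * herglotz (\<lambda>w. complex_of_real (part i (f w))) \<zeta>)"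
proof -
  have "herglotz f \<zeta> = herglotz (\<lambda>w. \<Sum>i<4. part_unit i * complex_of_real (part i (f w))) \<zeta>"
    by (subst part_decomp[of "f _", symmetric]) (rule refl)
  also have "\<dots> = (\<Sum>i<4. herglotz (\<lambda>w. part_unit i * complex_of_real (part i (f w))) \<zeta>)"
    by (rule herglotz_sum) (use integrable_part[OF f] \<zeta> in auto)
  finally show ?thesis by (simp only: herglotz_cmult)
qed

text \<open>Each of the four parts is tested at the level \<open>l / 4\<close> with the constant
  \<open>2\<close>, which makes \<open>4 * 2 * 4 = 32\<close>.\<close>

lemma weak_type_herglotz_complex:
  assumes f: "integrable circle_measure f" and r: "0 \<le> r" "r < 1" and l: "l > 0"
  shows "distr_fun (\<lambda>z. herglotz f (of_real r * z)) l \<le> 32 * (\<integral>w. cmod (f w) \<partial>circle_measure) / l"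
proof -
  define u where "u i z = herglotz (\<lambda>w. complex_of_real (part i (f w))) (of_real r * z)" for i z
  have um: "u i \<in> L0" for i
    unfolding u_def by (rule measurable_herglotz_radius) (use integrable_part[OF f] r in auto)
  note [measurable] = um
  have sl [simp]: "(\<Union>i<4. {z \<in> space circle_measure. l / 4 < cmod (u i z)}) \<in> sets circle_measure"
    by measurable
  have sl' [measurable]: "{z \<in> space circle_measure. l / 4 < cmod (u i z)} \<in> sets circle_measure" for i
    by measurable
  have "distr_fun (\<lambda>z. herglotz f (of_real r * z)) l
    \<le> measure circle_measure (\<Union>i<4. {z \<in> space circle_measure. l / 4 < cmod (u i z)})"
    unfolding distr_fun_def
  proof (rule circle.finite_measure_mono)
    show "{z \<in> space circle_measure. l < cmod (herglotz f (of_real r * z))}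
      \<subseteq> (\<Union>i<4. {z \<in> space circle_measure. l / 4 < cmod (u i z)})"
    proof
      fix z assume z: "z \<in> {z \<in> space circle_measure. l < cmod (herglotz f (of_real r * z))}"
      show "z \<in> (\<Union>i<4. {z \<in> space circle_measure. l / 4 < cmod (u i z)})"
      proof (rule ccontr)
        assume "\<not> ?thesis"
        then have n: "cmod (u i z) \<le> l / 4" if "i < 4" for i using z that by force
        have "cmod (herglotz f (of_real r * z)) = cmod (\<Sum>i<4. part_unit i * u i z)"
          unfolding u_def using z cmod_radius_less[OF _ r] by (subst herglotz_parts[OF f]) auto
        also have "\<dots> \<le> (\<Sum>i<(4::nat). l / 4)"
          by (rule sum_norm_le) (use n in \<open>simp add: norm_mult\<close>)
        finally show False using z by simp
      qed
    qed
  qed (rule sl)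
  also have "\<dots> \<le> (\<Sum>i<4. distr_fun (u i) (l / 4))"
    unfolding distr_fun_def
    by (rule circle.finite_measure_subadditive_finite) (use sl' in blast)+
  also have "\<dots> \<le> (\<Sum>i<(4::nat). 8 * (\<integral>w. cmod (f w) \<partial>circle_measure) / l)"
  proof (rule sum_mono)
    fix i :: nat
    have "distr_fun (u i) (l / 4) \<le> 2 * (\<integral>w. part i (f w) \<partial>circle_measure) / (l / 4)"
      unfolding u_def by (rule weak_type_herglotz[OF integrable_part[OF f] part_nonneg r]) (use l in simp)
    also have "\<dots> \<le> 2 * (\<integral>w. cmod (f w) \<partial>circle_measure) / (l / 4)"
      using l integrable_part[OF f] f part_le by (intro divide_right_mono mult_left_mono integral_mono) auto
    also have "\<dots> = 8 * (\<integral>w. cmod (f w) \<partial>circle_measure) / l" by simp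
    finally show "distr_fun (u i) (l / 4) \<le> 8 * (\<integral>w. cmod (f w) \<partial>circle_measure) / l" .
  qed
  also have "\<dots> = 32 * (\<integral>w. cmod (f w) \<partial>circle_measure) / l" by simp
  finally show ?thesis .
qed

lemma norm_fourier_coeff_0: "cmod (fourier_coeff f 0) \<le> (\<integral>w. cmod (f w) \<partial>circle_measure)"
  unfolding fourier_coeff_0 by (rule integral_norm_bound)

lemma weak_type_riesz:
  assumes f: "integrable circle_measure f" and l: "l > 0"
  shows "distr_fun (riesz_projection f) l \<le> 32 * (\<integral>w. cmod (f w) \<partial>circle_measure) / l"
proof (rule distr_fun_limit)
  define u where "u n z = (herglotz f (of_real (radius_seq n) * z) + fourier_coeff f 0) / 2" for n z
  have r: "0 \<le> radius_seq n" "radius_seq n < 1" for n using radius_seq_bounds[of n] by auto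
  have hm [measurable]: "(\<lambda>z. herglotz f (of_real (radius_seq n) * z)) \<in> L0" for n
    by (rule measurable_herglotz_radius[OF f r])
  show "u n \<in> L0" for n unfolding u_def by measurable
  show "AE z in circle_measure. (\<lambda>n. u n z) \<longlonglongrightarrow> riesz_projection f z"
    using riesz_projection_radial_limit[OF f]
    by eventually_elim (unfold u_def, rule filterlim_compose[OF _ filterlim_radius_seq])
  show "riesz_projection f \<in> L0" by (rule measurable_riesz_projection[OF f])
  fix n
  show "distr_fun (u n) l \<le> 32 * (\<integral>w. cmod (f w) \<partial>circle_measure) / l"
  \<comment> \<open>\<open>u n\<close> is the mean of the transform and the constant
    \<open>fourier_coeff f 0\<close>. If the constant is below \<open>l\<close>, the transform
    exceeds \<open>l\<close> wherever \<open>u n\<close> does; otherwise the right-hand side is at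
    least \<open>1\<close> and nothing has to be estimated.\<close>
  proof (cases "l \<le> cmod (fourier_coeff f 0)")
    case True
    then have "l \<le> (\<integral>w. cmod (f w) \<partial>circle_measure)" using norm_fourier_coeff_0[of f] by linarith
    then have "1 \<le> 32 * (\<integral>w. cmod (f w) \<partial>circle_measure) / l" using l by (simp add: pos_le_divide_eq)
    then show ?thesis using distr_fun_bounds(2)[of "u n" l] by linarith
  next
    case False
    have "distr_fun (u n) l \<le> distr_fun (\<lambda>z. herglotz f (of_real (radius_seq n) * z)) l"
      unfolding distr_fun_def
    proof (rule circle.finite_measure_mono)
      show "{z \<in> space circle_measure. l < cmod (u n z)}
        \<subseteq> {z \<in> space circle_measure. l < cmod (herglotz f (of_real (radius_seq n) * z))}"
      proof
        fix z assume z: "z \<in> {z \<in> space circle_measure. l < cmod (u n z)}"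
        have "cmod (u n z) \<le> (cmod (herglotz f (of_real (radius_seq n) * z)) + cmod (fourier_coeff f 0)) / 2"
          unfolding u_def by (simp add: norm_divide norm_triangle_ineq)
        then show "z \<in> {z \<in> space circle_measure. l < cmod (herglotz f (of_real (radius_seq n) * z))}"
          using z False by auto
      qed
    qed measurable
    then show ?thesis using weak_type_herglotz_complex[OF f r l, of n] by linarith
  qed
qed

section \<open>Linearity of the Riesz projection and its action on shifted functions\<close>

text \<open>Linearity is inherited from the Herglotz transform in the disc through this uniqueness
  of radial limits, and therefore holds only almost everywhere.\<close>

lemma riesz_projection_unique:
  assumes f: "integrable circle_measure f"
    and lim: "AE z in circle_measure. ((\<lambda>r. (herglotz f (of_real r * z) + fourier_coeff f 0) / 2) \<longlongrightarrow> g z) (at_left 1)"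
  shows "AE z in circle_measure. riesz_projection f z = g z"
  using riesz_projection_radial_limit[OF f] lim
  by eventually_elim (rule tendsto_unique[OF trivial_limit_at_left_real])

lemma riesz_projection_add:
  assumes f: "integrable circle_measure f" and g: "integrable circle_measure g"
  shows "AE z in circle_measure. riesz_projection (\<lambda>w. f w + g w) z = riesz_projection f z + riesz_projection g z"
proof (rule riesz_projection_unique)
  have c: "fourier_coeff (\<lambda>w. f w + g w) 0 = fourier_coeff f 0 + fourier_coeff g 0"
    unfolding fourier_coeff_0 by (rule Bochner_Integration.integral_add[OF f g])
  show "AE z in circle_measure. ((\<lambda>r. (herglotz (\<lambda>w. f w + g w) (of_real r * z) + fourier_coeff (\<lambda>w. f w + g w) 0) / 2)
      \<longlongrightarrow> riesz_projection f z + riesz_projection g z) (at_left 1)"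
    using riesz_projection_radial_limit[OF f] riesz_projection_radial_limit[OF g] AE_space
  proof eventually_elim
    case (elim z)
    have ev: "eventually (\<lambda>r. (herglotz (\<lambda>w. f w + g w) (of_real r * z) + fourier_coeff (\<lambda>w. f w + g w) 0) / 2
      = (herglotz f (of_real r * z) + fourier_coeff f 0) / 2 + (herglotz g (of_real r * z) + fourier_coeff g 0) / 2) (at_left 1)"
      using eventually_at_left_1
    proof eventually_elim
      case r: (elim r)
      have "cmod (complex_of_real r * z) < 1" using r elim(3) cmod_radius_less[of z r] by auto
      then show ?case unfolding c using herglotz_add[OF f g] by (simp add: field_simps)
    qed
    show ?case using tendsto_add[OF elim(1,2)] tendsto_cong[OF ev] by blast
  qed
qed (use f g in simp)

lemma riesz_projection_cmult:
  assumes f: "integrable circle_measure f"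
  shows "AE z in circle_measure. riesz_projection (\<lambda>w. c * f w) z = c * riesz_projection f z"
proof (rule riesz_projection_unique)
  have c: "fourier_coeff (\<lambda>w. c * f w) 0 = c * fourier_coeff f 0"
    unfolding fourier_coeff_0 by (rule integral_mult_right_zero)
  show "AE z in circle_measure. ((\<lambda>r. (herglotz (\<lambda>w. c * f w) (of_real r * z) + fourier_coeff (\<lambda>w. c * f w) 0) / 2)
      \<longlongrightarrow> c * riesz_projection f z) (at_left 1)"
    using riesz_projection_radial_limit[OF f]
  proof eventually_elim
    case (elim z)
    have "((\<lambda>r. c * ((herglotz f (of_real r * z) + fourier_coeff f 0) / 2)) \<longlongrightarrow> c * riesz_projection f z) (at_left 1)"
      by (intro tendsto_intros elim)
    then show ?case by (simp add: c herglotz_cmult ring_distribs)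
  qed
qed (use f in simp)

lemma riesz_projection_cong:
  assumes eq: "\<And>w. cmod w = 1 \<Longrightarrow> f w = g w" and z: "cmod z = 1"
  shows "riesz_projection f z = riesz_projection g z"
proof -
  have "conjugate_poisson f = conjugate_poisson g"
    unfolding conjugate_poisson_def fun_eq_iff
    by (intro allI Bochner_Integration.integral_cong) (use eq in auto)
  moreover have "fourier_coeff f 0 = fourier_coeff g 0"
    unfolding fourier_coeff_0 by (rule Bochner_Integration.integral_cong) (use eq in auto)
  ultimately show ?thesis using eq[OF z] by (simp add: riesz_projection_def conjugate_function_eq)
qed

lemma riesz_projection_monomial:
  "AE z in circle_measure. riesz_projection (\<lambda>w. c * w ^ m) z = c * z ^ m"
proof -
  have i: "integrable circle_measure (\<lambda>w. w ^ m)"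
    by (intro integrable_circle_continuous continuous_intros)
  have f0: "fourier_coeff (\<lambda>w. w ^ m) 0 = 0 ^ m"
    unfolding fourier_coeff_0 by (rule mean_value_circle[where S = UNIV]) (auto intro!: holomorphic_intros)
  have "AE z in circle_measure. riesz_projection (\<lambda>w. w ^ m) z = z ^ m"
  proof (rule riesz_projection_unique[OF i], rule AE_I2)
    fix z :: complex assume "z \<in> space circle_measure"
    then have z: "cmod z = 1" by simp
    have "((\<lambda>r. (of_real r * z) ^ m) \<longlongrightarrow> z ^ m) (at_left 1)"
      by (intro tendsto_intros filterlim_radius)
    moreover have "eventually (\<lambda>r. (herglotz (\<lambda>w. w ^ m) (of_real r * z) + fourier_coeff (\<lambda>w. w ^ m) 0) / 2 = (of_real r * z) ^ m) (at_left 1)"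
      using eventually_at_left_1
    proof eventually_elim
      case (elim r)
      then have "cmod (complex_of_real r * z) < 1" using cmod_radius_less[OF z] by auto
      then show ?case by (simp only: herglotz_monomial_nonneg f0) simp
    qed
    ultimately show "((\<lambda>r. (herglotz (\<lambda>w. w ^ m) (of_real r * z) + fourier_coeff (\<lambda>w. w ^ m) 0) / 2) \<longlongrightarrow> z ^ m) (at_left 1)"
      by (simp add: tendsto_cong)
  qed
  then show ?thesis using riesz_projection_cmult[OF i, of c] by eventually_elim simp
qed

text \<open>Once \<open>n\<close> exceeds the negative frequencies of \<open>p\<close>, the product
  is a polynomial on the circle, and the projection fixes polynomials.\<close>

lemma riesz_projection_shifted_trig_poly:
  assumes "trig_poly p"
  shows "\<exists>M. \<forall>n\<ge>M. AE z in circle_measure. riesz_projection (\<lambda>w. w ^ n * p w) z = z ^ n * p z"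
  using assms
proof (induction rule: trig_poly.induct)
  case (monomial c k)
  show ?case
  proof (intro exI[of _ "nat (- k)"] allI impI)
    fix n assume n: "n \<ge> nat (- k)"
    define m where "m = nat (int n + k)"
    have eq: "w ^ n * (c * w powi k) = c * w ^ m" if "cmod w = 1" for w :: complex
    proof -
      have "w \<noteq> 0" using that by auto
      then have "w powi (int n + k) = w ^ n * w powi k" by (simp add: power_int_add)
      moreover have "w powi (int n + k) = w ^ m" using n by (simp add: m_def power_int_def)
      ultimately show ?thesis by simp
    qed
    show "AE z in circle_measure. riesz_projection (\<lambda>w. w ^ n * (c * w powi k)) z = z ^ n * (c * z powi k)"
      using riesz_projection_monomial[of c m] AE_space
    proof eventually_elim
      case (elim z)
      then have z: "cmod z = 1" by simp
      have "riesz_projection (\<lambda>w. w ^ n * (c * w powi k)) z = riesz_projection (\<lambda>w. c * w ^ m) z"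
        by (rule riesz_projection_cong[OF _ z]) (rule eq)
      then show ?case by (simp only: elim(1) eq[OF z])
    qed
  qed
next
  case (add p q)
  then obtain M1 M2 where M: "\<forall>n\<ge>M1. AE z in circle_measure. riesz_projection (\<lambda>w. w ^ n * p w) z = z ^ n * p z"
    "\<forall>n\<ge>M2. AE z in circle_measure. riesz_projection (\<lambda>w. w ^ n * q w) z = z ^ n * q z" by blast
  show ?case
  proof (intro exI[of _ "max M1 M2"] allI impI)
    fix n assume n: "n \<ge> max M1 M2"
    have i: "integrable circle_measure (\<lambda>w. w ^ n * p w)" "integrable circle_measure (\<lambda>w. w ^ n * q w)"
      by (intro integrable_circle_continuous continuous_on_mult continuous_on_power continuous_on_id
          continuous_on_trig_poly add(1,2))+
    have "AE z in circle_measure. riesz_projection (\<lambda>w. w ^ n * p w) z = z ^ n * p z"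
      "AE z in circle_measure. riesz_projection (\<lambda>w. w ^ n * q w) z = z ^ n * q z" using M n by auto
    then show "AE z in circle_measure. riesz_projection (\<lambda>w. w ^ n * (p w + q w)) z = z ^ n * (p z + q z)"
      unfolding distrib_left using riesz_projection_add[OF i] by eventually_elim simp
  qed
qed

lemma trig_poly_dense_complex:
  assumes g: "integrable circle_measure g" and e: "e > 0"
  obtains p where "trig_poly p" "integrable circle_measure p" "(\<integral>w. cmod (g w - p w) \<partial>circle_measure) < e"
proof -
  have i: "integrable circle_measure (\<lambda>w. Re (g w))" "integrable circle_measure (\<lambda>w. Im (g w))" using g by auto
  have e2: "e/2 > 0" using e by simp
  obtain q1 where q1: "real_trig_poly q1" "integrable circle_measure q1" "(\<integral>w. \<bar>Re (g w) - q1 w\<bar> \<partial>circle_measure) < e/2"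
    by (rule trig_poly_dense[OF i(1) e2])
  obtain q2 where q2: "real_trig_poly q2" "integrable circle_measure q2" "(\<integral>w. \<bar>Im (g w) - q2 w\<bar> \<partial>circle_measure) < e/2"
    by (rule trig_poly_dense[OF i(2) e2])
  obtain p1 p2 where p1: "trig_poly p1" "\<forall>z\<in>sphere 0 1. complex_of_real (q1 z) = p1 z"
    and p2: "trig_poly p2" "\<forall>z\<in>sphere 0 1. complex_of_real (q2 z) = p2 z"
    using q1 q2 by (auto simp: real_trig_poly_def)
  obtain s where s: "trig_poly s" "\<forall>z\<in>sphere 0 1. s z = \<i> * z powi 0 * p2 z"
    using trig_poly_mult_monomial[OF p2(1), of \<i> 0] by blast
  have sp: "trig_poly (\<lambda>z. p1 z + s z)" by (rule trig_poly.add[OF p1(1) s(1)])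
  have ip: "integrable circle_measure (\<lambda>z. p1 z + s z)"
    by (rule integrable_circle_continuous[OF continuous_on_trig_poly[OF sp]])
  have "(\<integral>w. cmod (g w - (p1 w + s w)) \<partial>circle_measure) \<le> (\<integral>w. \<bar>Re (g w) - q1 w\<bar> + \<bar>Im (g w) - q2 w\<bar> \<partial>circle_measure)"
  proof (rule integral_mono)
    fix w assume "w \<in> space circle_measure"
    then have w: "w \<in> sphere 0 1" by simp
    have "p1 w = complex_of_real (q1 w)" "s w = \<i> * complex_of_real (q2 w)" using p1 p2 s w by auto
    then have "g w - (p1 w + s w) = Complex (Re (g w) - q1 w) (Im (g w) - q2 w)" by (simp add: complex_eq_iff)
    then show "cmod (g w - (p1 w + s w)) \<le> \<bar>Re (g w) - q1 w\<bar> + \<bar>Im (g w) - q2 w\<bar>"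
      using cmod_le[of "g w - (p1 w + s w)"] by simp
  qed (use g ip q1 q2 in auto)
  also have "\<dots> = (\<integral>w. \<bar>Re (g w) - q1 w\<bar> \<partial>circle_measure) + (\<integral>w. \<bar>Im (g w) - q2 w\<bar> \<partial>circle_measure)"
    by (rule Bochner_Integration.integral_add) (use g q1 q2 in auto)
  finally show ?thesis using that[OF sp ip] q1(3) q2(3) by linarith
qed

lemma distr_fun_markov:
  assumes "integrable circle_measure f" "l > 0"
  shows "distr_fun f l \<le> (\<integral>w. cmod (f w) \<partial>circle_measure) / l"
proof -
  have [measurable]: "f \<in> L0" using assms by auto
  have "distr_fun f l \<le> measure circle_measure {z \<in> space circle_measure. l \<le> cmod (f z)}"
    unfolding distr_fun_def by (rule circle.finite_measure_mono) (auto simp del: space_circle_measure)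
  also have "\<dots> \<le> (\<integral>w. cmod (f w) \<partial>circle_measure) / l"
    by (rule integral_Markov_inequality_measure[where A = "{}", simplified]) (use assms in auto)
  finally show ?thesis .
qed

text \<open>The operators \<open>g \<mapsto> \<chi>\<^sub>-\<^sub>n P(\<chi>\<^sub>n g)\<close> are uniformly of weak type (1,1) and eventually the
  identity on trigonometric polynomials.\<close>
lemma shifted_riesz_subsequence:
  assumes g: "integrable circle_measure g"
  obtains s :: "nat \<Rightarrow> nat" where
    "AE z in circle_measure. (\<lambda>n. cnj z ^ s n * riesz_projection (\<lambda>w. w ^ s n * g w) z) \<longlonglongrightarrow> g z"
proof -
  define d where "d n z = cnj z ^ n * riesz_projection (\<lambda>w. w ^ n * g w) z - g z" for n z
  have ish: "integrable circle_measure (\<lambda>w. w ^ n * h w)" if "integrable circle_measure h" for n h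
    using integrable_mult_power[OF that, of n] by (simp add: mult.commute)
  have Lsh: "(\<integral>w. cmod (w ^ n * h w) \<partial>circle_measure) = (\<integral>w. cmod (h w) \<partial>circle_measure)" for n h
    by (rule Bochner_Integration.integral_cong) (auto simp: norm_mult norm_power)
  have dm [measurable]: "d n \<in> L0" for n
  proof -
    have [measurable]: "riesz_projection (\<lambda>w. w ^ n * g w) \<in> L0"
      by (rule measurable_riesz_projection[OF ish[OF g]])
    have [measurable]: "g \<in> L0" using g by auto
    have [measurable]: "(\<lambda>z. cnj z ^ n) \<in> L0" by (intro continuous_imp_measurable_circle continuous_intros)
    show ?thesis unfolding d_def by measurable
  qed
  have small: "eventually (\<lambda>n. distr_fun (d n) l < e) sequentially" if l: "l > 0" and e: "e > 0" for l e
  proof -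
    \<comment> \<open>The remainder \<open>h\<close> enters through \<open>32 / (l/2)\<close> for
      its projection and \<open>1 / (l/2)\<close> for itself, together
      \<open>66 / l\<close>.\<close>
    define e' where "e' = e * l / 66"
    have e': "e' > 0" using e l by (simp add: e'_def)
    obtain p where p: "trig_poly p" "integrable circle_measure p" "(\<integral>w. cmod (g w - p w) \<partial>circle_measure) < e'"
      by (rule trig_poly_dense_complex[OF g e'])
    obtain M where M: "\<forall>n\<ge>M. AE z in circle_measure. riesz_projection (\<lambda>w. w ^ n * p w) z = z ^ n * p z"
      using riesz_projection_shifted_trig_poly[OF p(1)] by blast
    define h where "h w = g w - p w" for w
    have ih: "integrable circle_measure h" unfolding h_def using g p by simp
    define x where "x = (\<integral>w. cmod (h w) \<partial>circle_measure)"
    have [measurable]: "h \<in> L0" using ih by auto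
    show ?thesis
      unfolding eventually_sequentially
    proof (intro exI[of _ M] allI impI)
      fix n assume n: "n \<ge> M"
      define R where "R = riesz_projection (\<lambda>w. w ^ n * h w)"
      have [measurable]: "R \<in> L0" unfolding R_def by (rule measurable_riesz_projection[OF ish[OF ih]])
      have "AE z in circle_measure. riesz_projection (\<lambda>w. w ^ n * p w + w ^ n * h w) z
          = riesz_projection (\<lambda>w. w ^ n * p w) z + R z"
        unfolding R_def by (rule riesz_projection_add[OF ish[OF p(2)] ish[OF ih]])
      moreover have "(\<lambda>w. w ^ n * p w + w ^ n * h w) = (\<lambda>w. w ^ n * g w)"
        by (simp add: h_def fun_eq_iff right_diff_distrib)
      moreover have "AE z in circle_measure. riesz_projection (\<lambda>w. w ^ n * p w) z = z ^ n * p z" using M n by blast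
      ultimately have ae: "AE z in circle_measure. riesz_projection (\<lambda>w. w ^ n * g w) z = z ^ n * p z + R z"
        by auto
      have deq: "AE z in circle_measure. d n z = cnj z ^ n * R z - h z"
        using ae AE_space
      proof eventually_elim
        case (elim z)
        then have z: "cmod z = 1" by simp
        have "cnj z * z = 1" using cnj_eq_inverse[OF z] z by (metis left_inverse norm_zero zero_neq_one)
        then have "cnj z ^ n * z ^ n = 1" by (metis power_mult_distrib power_one)
        then have "cnj z ^ n * (z ^ n * p z) = p z" by (metis mult.assoc mult_1)
        then show ?case by (simp add: d_def elim(1) ring_distribs h_def)
      qed
      have "distr_fun (d n) l \<le> measure circle_measure
          ({z \<in> space circle_measure. l / 2 < cmod (R z)} \<union> {z \<in> space circle_measure. l / 2 < cmod (h z)})"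
        unfolding distr_fun_def
      proof (rule circle.finite_measure_mono_AE)
        show "AE z in circle_measure. z \<in> {z \<in> space circle_measure. l < cmod (d n z)} \<longrightarrow>
          z \<in> {z \<in> space circle_measure. l / 2 < cmod (R z)} \<union> {z \<in> space circle_measure. l / 2 < cmod (h z)}"
          using deq AE_space
        proof eventually_elim
          case (elim z)
          have "cmod (d n z) \<le> cmod (cnj z ^ n * R z) + cmod (h z)" unfolding elim(1) by (rule norm_triangle_ineq4)
          also have "cmod (cnj z ^ n * R z) = cmod (R z)" using elim(2) by (simp add: norm_mult norm_power)
          finally show ?case using elim(2) by auto
        qed
      qed measurable
      also have "\<dots> \<le> distr_fun R (l / 2) + distr_fun h (l / 2)"
        unfolding distr_fun_def by (rule measure_Un_le) measurable
      also have "distr_fun R (l / 2) \<le> 32 * x / (l / 2)"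
        unfolding R_def x_def using weak_type_riesz[OF ish[OF ih], of "l/2" n] l by (simp only: Lsh)
      also have "distr_fun h (l / 2) \<le> x / (l / 2)"
        unfolding x_def by (rule distr_fun_markov[OF ih]) (use l in simp)
      also have "32 * x / (l / 2) + x / (l / 2) = 66 * x / l" by (simp add: field_simps)
      also have "\<dots> < 66 * e' / l" using p(3) l by (intro divide_strict_right_mono) (auto simp: x_def h_def)
      also have "\<dots> = e" using l by (simp add: e'_def)
      finally show "distr_fun (d n) l < e" by simp
    qed
  qed
  \<comment> \<open>Capping at \<open>1\<close> turns convergence in measure into convergence of
    integrals, from which an almost everywhere convergent subsequence is extracted.\<close>
  define D where "D n z = min 1 (cmod (d n z))" for n z
  have Dm [measurable]: "D n \<in> borel_measurable circle_measure" for n unfolding D_def by measurable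
  have iD: "integrable circle_measure (D n)" for n
    by (rule integrable_circle_bounded[where B = 1]) (auto simp: D_def)
  have "(\<lambda>n. \<integral>z. norm (D n z) \<partial>circle_measure) \<longlonglongrightarrow> 0"
  proof (rule LIMSEQ_I)
    fix e :: real assume e: "e > 0"
    then have "eventually (\<lambda>n. distr_fun (d n) (e/2) < e/2) sequentially" by (intro small) auto
    then obtain M where M: "\<And>n. n \<ge> M \<Longrightarrow> distr_fun (d n) (e/2) < e/2" by (auto simp: eventually_sequentially)
    show "\<exists>no. \<forall>n\<ge>no. norm ((\<integral>z. norm (D n z) \<partial>circle_measure) - 0) < e"
    proof (intro exI[of _ M] allI impI)
      fix n assume n: "n \<ge> M"
      define A where "A = {z \<in> space circle_measure. e/2 < cmod (d n z)}"
      have A [measurable]: "A \<in> sets circle_measure" unfolding A_def by measurable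
      have iA: "integrable circle_measure (indicat_real A)"
        by (rule integrable_real_indicator[OF A]) (simp add: circle.emeasure_eq_measure)
      have "(\<integral>z. norm (D n z) \<partial>circle_measure) \<le> (\<integral>z. e/2 + indicator A z \<partial>circle_measure)"
      proof (rule integral_mono)
        show "integrable circle_measure (\<lambda>z. norm (D n z))" using iD by simp
        show "integrable circle_measure (\<lambda>z. e/2 + indicat_real A z)" using iA by simp
        show "norm (D n z) \<le> e/2 + indicator A z" if "z \<in> space circle_measure" for z
          using that e by (auto simp: D_def A_def indicator_def)
      qed
      also have "\<dots> = e/2 + (\<integral>z. indicator A z \<partial>circle_measure)"
        using iA by simp
      also have "(\<integral>z. indicator A z \<partial>circle_measure) = measure circle_measure A"
        using sets.sets_into_space[OF A] by (simp add: Int_absorb2)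
      also have "measure circle_measure A = distr_fun (d n) (e/2)" by (simp add: A_def distr_fun_def)
      also have "e/2 + \<dots> < e" using M[OF n] by linarith
      finally show "norm ((\<integral>z. norm (D n z) \<partial>circle_measure) - 0) < e" by simp
    qed
  qed
  then obtain s where s: "AE z in circle_measure. (\<lambda>n. D (s n) z) \<longlonglongrightarrow> 0"
    using tendsto_L1_AE_subseq[where u = D, OF iD] by blast
  show ?thesis
  proof (rule that[of s])
    show "AE z in circle_measure. (\<lambda>n. cnj z ^ s n * riesz_projection (\<lambda>w. w ^ s n * g w) z) \<longlonglongrightarrow> g z"
      using s
    proof eventually_elim
      case (elim z)
      have "eventually (\<lambda>n. D (s n) z < 1) sequentially" using elim by (rule order_tendstoD(2)) simp
      then have "eventually (\<lambda>n. cmod (d (s n) z) = D (s n) z) sequentially"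
        by eventually_elim (auto simp: D_def min_def split: if_splits)
      then have "(\<lambda>n. cmod (d (s n) z)) \<longlonglongrightarrow> 0" using elim by (simp add: tendsto_cong)
      then have "(\<lambda>n. d (s n) z) \<longlonglongrightarrow> 0" by (rule tendsto_norm_zero_cancel)
      then have "(\<lambda>n. d (s n) z + g z) \<longlonglongrightarrow> 0 + g z" by (intro tendsto_intros)
      then show ?case by (simp add: d_def)
    qed
  qed
qed

context ri_space
begin

lemma part_mem:
  assumes "f \<in> X"
  shows "(\<lambda>z. complex_of_real (part i (f z))) \<in> X" "N (\<lambda>z. complex_of_real (part i (f z))) \<le> N f"
proof -
  have [measurable]: "f \<in> L0" using assms mem_L0 by blast
  have m: "(\<lambda>z. complex_of_real (part i (f z))) \<in> L0" by measurable
  have "AE z in circle_measure. cmod (complex_of_real (part i (f z))) \<le> cmod (f z)"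
    using part_le part_nonneg by (intro AE_I2) simp
  then show "(\<lambda>z. complex_of_real (part i (f z))) \<in> X" "N (\<lambda>z. complex_of_real (part i (f z))) \<le> N f"
    using ideal[OF assms m] by auto
qed

text \<open>The bound of the rearrangements by the majorant is uniform in the radius and passes to
  the boundary function by \<open>distr_fun_limit\<close>. The same majorant, being integrable,
  turns the radial convergence into convergence in L1, under which the vanishing moments
  persist.\<close>

lemma herglotz_boundary_bound:
  assumes boyd: "nontrivial_boyd_indices X N" and fatou: "fatou_property X N"
  obtains C where "0 \<le> C" "\<And>f. f \<in> X \<Longrightarrow> integrable circle_measure f"
    "\<And>f. f \<in> X \<Longrightarrow> (\<integral>z. cmod (f z) \<partial>circle_measure) \<le> C * N f"
    "\<And>g v. (\<lambda>z. complex_of_real (g z)) \<in> X \<Longrightarrow> (\<And>w. 0 \<le> g w) \<Longrightarrow> v \<in> L0 \<Longrightarrow>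
      AE z in circle_measure. ((\<lambda>r. herglotz (\<lambda>w. complex_of_real (g w)) (of_real r * z)) \<longlongrightarrow> v z) (at_left 1) \<Longrightarrow>
      v \<in> X \<and> N v \<le> C * N (\<lambda>z. complex_of_real (g z)) \<and>
      (\<forall>m>0. (\<integral>z. v z * z ^ m \<partial>circle_measure) = 0)"
proof -
  obtain C where C: "0 \<le> C"
    and int: "\<And>f. f \<in> X \<Longrightarrow> integrable circle_measure f"
    and L1: "\<And>f. f \<in> X \<Longrightarrow> (\<integral>z. cmod (f z) \<partial>circle_measure) \<le> C * N f"
    and sum1: "\<And>f t. f \<in> X \<Longrightarrow> summable (\<lambda>k. (1/2)^k * rearr f ((1/2)^Suc k * t))"
    and sum2: "\<And>f t. f \<in> X \<Longrightarrow> summable (\<lambda>k. rearr f (2^k * t))"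
    and majX: "\<And>f. f \<in> X \<Longrightarrow> (\<lambda>z. complex_of_real (rearr_majorant f (circle_angle z))) \<in> X"
    and majN: "\<And>f. f \<in> X \<Longrightarrow> N (\<lambda>z. complex_of_real (rearr_majorant f (circle_angle z))) \<le> C * N f"
    using boyd_consequences[OF boyd fatou] by blast
  have main: "v \<in> X \<and> N v \<le> C * N (\<lambda>z. complex_of_real (g z)) \<and>
      (\<forall>m>0. (\<integral>z. v z * z ^ m \<partial>circle_measure) = 0)"
    if gX: "(\<lambda>z. complex_of_real (g z)) \<in> X" and g0: "\<And>w. 0 \<le> g w" and v: "v \<in> L0"
      and lim: "AE z in circle_measure. ((\<lambda>r. herglotz (\<lambda>w. complex_of_real (g w)) (of_real r * z)) \<longlongrightarrow> v z) (at_left 1)"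
    for g v
  proof -
    define f where "f = (\<lambda>z. complex_of_real (g z))"
    have fX: "f \<in> X" using gX by (simp add: f_def)
    have fL: "f \<in> L0" using mem_L0[OF fX] .
    have fi: "integrable circle_measure f" using int[OF fX] .
    have gi: "integrable circle_measure g"
      using fi unfolding f_def by (simp only: complex_of_real_integrable_eq)
    have gm: "g \<in> borel_measurable circle_measure" using gi by auto
    have st: "summable (\<lambda>k. rearr_majorant_term f k t)" for t
      unfolding rearr_majorant_term_def by (intro summable_add summable_mult sum1[OF fX] sum2[OF fX])
    have maj0: "0 \<le> rearr_majorant f t" for t
      unfolding rearr_majorant_def by (rule suminf_nonneg[OF st rearr_majorant_term_nonneg[OF fL]])
    define u where "u r z = herglotz f (of_real r * z)" for r and z :: complex
    have um: "u r \<in> L0" if "0 \<le> r" "r < 1" for r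
      unfolding u_def by (rule measurable_herglotz_radius[OF fi that])
    have key: "rearr (u r) t \<le> rearr_majorant f t" if r: "0 \<le> r" "r < 1" and t: "t > 0" for r t
    proof -
      obtain J where J: "1 / t < 2^J" using real_arch_pow[of 2 "1 / t"] by auto
      then have J1: "1 \<le> 2^J * t" using t by (simp add: pos_divide_less_eq)
      have 1: "rearr (u r) t \<le> 4 / t * (\<integral>w. g w - min (g w) (rearr f t) \<partial>circle_measure) + 6 * (\<Sum>j<J. rearr f (2^j * t))"
        unfolding u_def f_def by (rule rearr_herglotz_le[OF gi g0 t J1 r])
      define S where "S = (\<Sum>k. (1/2)^k * rearr f ((1/2)^Suc k * t))"
      have S0: "0 \<le> S" unfolding S_def by (rule suminf_nonneg[OF sum1[OF fX]]) (simp add: rearr_nonneg[OF fL])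
      have "ennreal (\<integral>w. g w - min (g w) (rearr f t) \<partial>circle_measure)
          = (\<integral>\<^sup>+w. ennreal (g w - min (g w) (rearr f t)) \<partial>circle_measure)"
        by (rule nn_integral_eq_integral[symmetric]) (use gi in auto)
      also have "\<dots> \<le> (\<Sum>k. ennreal (t * ((1/2) ^ k * rearr f ((1/2) ^ Suc k * t))))"
        unfolding f_def by (rule nn_integral_above_rearr[OF gm g0 t])
      also have "\<dots> = ennreal (\<Sum>k. t * ((1/2) ^ k * rearr f ((1/2) ^ Suc k * t)))"
        by (rule suminf_ennreal2[OF _ summable_mult[OF sum1[OF fX]]]) (use t rearr_nonneg[OF fL] in auto)
      also have "(\<Sum>k. t * ((1/2) ^ k * rearr f ((1/2) ^ Suc k * t))) = t * S"
        unfolding S_def by (rule suminf_mult[OF sum1[OF fX]])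
      finally have "(\<integral>w. g w - min (g w) (rearr f t) \<partial>circle_measure) \<le> t * S"
        using t S0 by (simp add: ennreal_le_iff)
      then have "4 / t * (\<integral>w. g w - min (g w) (rearr f t) \<partial>circle_measure) \<le> 4 / t * (t * S)"
        using t by (intro mult_left_mono) auto
      also have "\<dots> = 4 * S" using t by simp
      finally have 2: "4 / t * (\<integral>w. g w - min (g w) (rearr f t) \<partial>circle_measure) \<le> 4 * S" .
      have 3: "(\<Sum>j<J. rearr f (2^j * t)) \<le> (\<Sum>k. rearr f (2^k * t))"
        by (rule sum_le_suminf[OF sum2[OF fX]]) (auto simp: rearr_nonneg[OF fL])
      have "rearr_majorant f t = 4 * S + 6 * (\<Sum>k. rearr f (2^k * t))"
        using suminf_add[OF summable_mult[OF sum1[OF fX, of t], where c = 4] summable_mult[OF sum2[OF fX, of t], where c = 6]]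
        unfolding rearr_majorant_def rearr_majorant_term_def S_def
          suminf_mult[OF sum1[OF fX]] suminf_mult[OF sum2[OF fX]] by (rule sym)
      then show ?thesis using 1 2 3 by linarith
    qed
    define w where "w z = complex_of_real (rearr_majorant f (circle_angle z))" for z
    have wX: "w \<in> X" unfolding w_def by (rule majX[OF fX])
    have wN: "N w \<le> C * N f" unfolding w_def by (rule majN[OF fX])
    define U where "U n = u (radius_seq n)" for n
    have r: "0 \<le> radius_seq n" "radius_seq n < 1" for n using radius_seq_bounds[of n] by auto
    have UL: "U n \<in> L0" for n unfolding U_def by (rule um[OF r])
    have Ulim: "AE z in circle_measure. (\<lambda>n. U n z) \<longlonglongrightarrow> v z"
      using lim by eventually_elim (unfold U_def u_def f_def, rule filterlim_compose[OF _ filterlim_radius_seq])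
    have rv: "rearr v t \<le> rearr_majorant f t" if t: "t > 0" for t
    proof -
      have "distr_fun v (rearr_majorant f t) \<le> t"
      proof (rule distr_fun_limit[OF UL Ulim v])
        fix n
        show "distr_fun (U n) (rearr_majorant f t) \<le> t"
          using key[OF r t, of n] rearr_le_iff[OF UL t maj0] unfolding U_def by blast
      qed
      then show ?thesis using rearr_le_iff[OF v t maj0] by blast
    qed
    have "AE z in circle_measure. rearr v (circle_angle z) \<le> cmod (w z)"
      using AE_circle_angle_pos by eventually_elim (use rv maj0 in \<open>simp add: w_def\<close>)
    then have vX: "v \<in> X" "N v \<le> C * N f" using mem_if_rearr_le[OF v wX] wN by auto
    \<comment> \<open>\<open>U n\<close> itself need not lie below \<open>w\<close>; its
      rearrangement does, and it has the same distribution function.\<close>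
    have dom: "distr_fun (U n) l \<le> distr_fun w l" if l: "l \<ge> 0" for n l
    proof -
      have "distr_fun (U n) l = distr_fun (\<lambda>z. complex_of_real (rearr (U n) (circle_angle z))) l"
        by (rule distr_fun_rearr_angle[OF UL l, symmetric])
      also have "\<dots> \<le> distr_fun w l"
      proof (rule distr_fun_mono_AE[OF mem_L0[OF wX]])
        show "AE z in circle_measure. cmod (complex_of_real (rearr (U n) (circle_angle z))) \<le> cmod (w z)"
          using AE_circle_angle_pos
          by eventually_elim (use key[OF r] maj0 rearr_nonneg[OF UL] in \<open>simp add: w_def U_def\<close>)
      qed
      finally show ?thesis .
    qed
    note conv = tendsto_L1_dominated_distribution[OF UL v Ulim int[OF wX] dom]
    have iU: "integrable circle_measure (U n)" for n
      by (rule excess_dominated(1)[OF UL int[OF wX] dom, of 0]) auto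
    have "(\<integral>z. v z * z ^ m \<partial>circle_measure) = 0" if m: "m > 0" for m
    proof -
      note im = integrable_mult_power
      have U0: "(\<integral>z. U n z * z ^ m \<partial>circle_measure) = 0" for n
        unfolding U_def u_def by (rule integral_moment_zero[OF herglotz_holomorphic[OF fi] m radius_seq_bounds])
      have "cmod (\<integral>z. v z * z ^ m \<partial>circle_measure) \<le> (\<integral>z. cmod (U n z - v z) \<partial>circle_measure)" for n
      proof -
        have "(\<integral>z. v z * z ^ m \<partial>circle_measure) = (\<integral>z. v z * z ^ m \<partial>circle_measure) - (\<integral>z. U n z * z ^ m \<partial>circle_measure)"
          by (simp only: U0 diff_zero)
        also have "\<dots> = (\<integral>z. v z * z ^ m - U n z * z ^ m \<partial>circle_measure)"
          by (rule Bochner_Integration.integral_diff[symmetric]) (use im conv(1) iU in auto)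
        finally have "cmod (\<integral>z. v z * z ^ m \<partial>circle_measure) \<le> (\<integral>z. cmod (v z * z ^ m - U n z * z ^ m) \<partial>circle_measure)"
          by (simp only: integral_norm_bound)
        also have "\<dots> = (\<integral>z. cmod (U n z - v z) \<partial>circle_measure)"
        proof (rule Bochner_Integration.integral_cong)
          fix z assume "z \<in> space circle_measure"
          then have "cmod (z ^ m) = 1" by (simp add: norm_power)
          then show "cmod (v z * z ^ m - U n z * z ^ m) = cmod (U n z - v z)"
            by (simp only: left_diff_distrib[symmetric] norm_mult mult_1_right norm_minus_commute)
        qed simp
        finally show ?thesis .
      qed
      then have "cmod (\<integral>z. v z * z ^ m \<partial>circle_measure) \<le> 0"
        by (intro LIMSEQ_le_const[OF conv(2)]) auto
      then show ?thesis by simp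
    qed
    then show ?thesis using vX unfolding f_def by blast
  qed
  show ?thesis by (rule that[OF C int L1 main])
qed

theorem riesz_projection_bounded:
  assumes boyd: "nontrivial_boyd_indices X N" and fatou: "fatou_property X N"
  obtains C where "0 \<le> C" "\<And>f. f \<in> X \<Longrightarrow> integrable circle_measure f"
    "\<And>f. f \<in> X \<Longrightarrow> riesz_projection f \<in> hardy X"
    "\<And>f. f \<in> X \<Longrightarrow> N (riesz_projection f) \<le> C * N f"
proof -
  obtain C where C: "0 \<le> C" and int: "\<And>f. f \<in> X \<Longrightarrow> integrable circle_measure f"
    and L1: "\<And>f. f \<in> X \<Longrightarrow> (\<integral>z. cmod (f z) \<partial>circle_measure) \<le> C * N f"
    and bd: "\<And>g v. (\<lambda>z. complex_of_real (g z)) \<in> X \<Longrightarrow> (\<And>w. 0 \<le> g w) \<Longrightarrow> v \<in> L0 \<Longrightarrow>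
      AE z in circle_measure. ((\<lambda>r. herglotz (\<lambda>w. complex_of_real (g w)) (of_real r * z)) \<longlongrightarrow> v z) (at_left 1) \<Longrightarrow>
      v \<in> X \<and> N v \<le> C * N (\<lambda>z. complex_of_real (g z)) \<and>
      (\<forall>m>0. (\<integral>z. v z * z ^ m \<partial>circle_measure) = 0)"
    using herglotz_boundary_bound[OF boyd fatou] by blast
  \<comment> \<open>One \<open>C\<close> for each of the four parts, and one for the constant
    \<open>fourier_coeff f 0\<close>, which the L1 bound controls.\<close>
  define K where "K = 4 * C + C * N (\<lambda>z. 1)"
  have K: "0 \<le> K" unfolding K_def using C norm_one_pos by simp
  have main: "riesz_projection f \<in> hardy X \<and> N (riesz_projection f) \<le> K * N f" if f: "f \<in> X" for f
  proof -
    have Nf: "0 \<le> N f" using norm_nonneg[OF f] .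
    have fi: "integrable circle_measure f" by (rule int[OF f])
    define g where "g i z = part i (f z)" for i z
    define v where "v i z = complex_of_real (g i z) + \<i> * conjugate_function (\<lambda>w. complex_of_real (g i w)) z" for i z
    have gX: "(\<lambda>z. complex_of_real (g i z)) \<in> X" "N (\<lambda>z. complex_of_real (g i z)) \<le> N f" for i
      unfolding g_def using part_mem[OF f] by auto
    have gi: "integrable circle_measure (\<lambda>z. complex_of_real (g i z))" for i by (rule int[OF gX(1)])
    have vL: "v i \<in> L0" for i
    proof -
      have [measurable]: "conjugate_function (\<lambda>w. complex_of_real (g i w)) \<in> L0"
        by (rule measurable_conjugate_function[OF gi])
      have [measurable]: "(\<lambda>z. complex_of_real (g i z)) \<in> L0"
        by (rule borel_measurable_integrable[OF gi])
      show ?thesis unfolding v_def by measurable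
    qed
    have vlim: "AE z in circle_measure. ((\<lambda>r. herglotz (\<lambda>w. complex_of_real (g i w)) (of_real r * z)) \<longlongrightarrow> v i z) (at_left 1)" for i
      unfolding v_def by (rule herglotz_radial_limit[OF gi])
    have g0: "0 \<le> g i w" for i w by (simp add: g_def part_nonneg)
    have v: "v i \<in> X" "N (v i) \<le> C * N f" "\<And>m. m > 0 \<Longrightarrow> (\<integral>z. v i z * z ^ m \<partial>circle_measure) = 0" for i
    proof -
      have "C * N (\<lambda>z. complex_of_real (g i z)) \<le> C * N f" using C gX(2) by (intro mult_left_mono) auto
      then show "v i \<in> X" "N (v i) \<le> C * N f" "\<And>m. m > 0 \<Longrightarrow> (\<integral>z. v i z * z ^ m \<partial>circle_measure) = 0"
        using bd[OF gX(1) g0 vL vlim, of i] by auto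
    qed
    define c where "c = fourier_coeff f 0"
    define R where "R z = (\<Sum>i<4. part_unit i / 2 * v i z) + c / 2" for z
    have Rae: "AE z in circle_measure. riesz_projection f z = R z"
    proof (rule riesz_projection_unique[OF fi])
      have "AE z in circle_measure. \<forall>i<4. ((\<lambda>r. herglotz (\<lambda>w. complex_of_real (g i w)) (of_real r * z)) \<longlongrightarrow> v i z) (at_left 1)"
        using vlim by (intro AE_all_countable[THEN iffD2] allI) auto
      then show "AE z in circle_measure. ((\<lambda>r. (herglotz f (of_real r * z) + fourier_coeff f 0) / 2) \<longlongrightarrow> R z) (at_left 1)"
        using AE_space
      proof eventually_elim
        case (elim z)
        have "((\<lambda>r. (\<Sum>i<4. part_unit i / 2 * herglotz (\<lambda>w. complex_of_real (g i w)) (of_real r * z)) + c / 2) \<longlongrightarrow> R z) (at_left 1)"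
          unfolding R_def using elim(1) by (intro tendsto_intros) auto
        moreover have ev: "eventually (\<lambda>r. (herglotz f (of_real r * z) + fourier_coeff f 0) / 2
          = (\<Sum>i<4. part_unit i / 2 * herglotz (\<lambda>w. complex_of_real (g i w)) (of_real r * z)) + c / 2) (at_left 1)"
          using eventually_at_left_1
        proof eventually_elim
          case r: (elim r)
          have "cmod (complex_of_real r * z) < 1" using r elim(2) cmod_radius_less[of z r] by auto
          then show ?case
            by (simp only: herglotz_parts[OF fi] g_def c_def add_divide_distrib sum_divide_distrib) simp
        qed
        ultimately show ?case using tendsto_cong[OF ev] by blast
      qed
    qed
    have vs: "(\<lambda>z. part_unit i / 2 * v i z) \<in> X" "N (\<lambda>z. part_unit i / 2 * v i z) \<le> C * N f" for i
    proof -
      show "(\<lambda>z. part_unit i / 2 * v i z) \<in> X" by (rule scale_closed[OF v(1)])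
      have "N (\<lambda>z. part_unit i / 2 * v i z) = 1 / 2 * N (v i)"
        using norm_scale[OF v(1), of "part_unit i / 2" i] by (simp add: norm_divide)
      then show "N (\<lambda>z. part_unit i / 2 * v i z) \<le> C * N f"
        using v(2)[of i] norm_nonneg[OF v(1), of i] by linarith
    qed
    have s: "(\<lambda>z. \<Sum>i<4. part_unit i / 2 * v i z) \<in> X
      \<and> N (\<lambda>z. \<Sum>i<4. part_unit i / 2 * v i z) \<le> (\<Sum>i<4. N (\<lambda>z. part_unit i / 2 * v i z))"
      by (rule sum_mem) (use vs in auto)
    have "(\<Sum>i<4. N (\<lambda>z. part_unit i / 2 * v i z)) \<le> (\<Sum>i<(4::nat). C * N f)" by (rule sum_mono) (rule vs)
    then have s4: "N (\<lambda>z. \<Sum>i<4. part_unit i / 2 * v i z) \<le> 4 * C * N f" using s by simp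
    have RX: "R \<in> X" unfolding R_def by (rule add_closed[OF conjunct1[OF s] const_mem])
    have "N R \<le> N (\<lambda>z. \<Sum>i<4. part_unit i / 2 * v i z) + N (\<lambda>z. c / 2)"
      unfolding R_def by (rule norm_triangle[OF conjunct1[OF s] const_mem])
    also have "N (\<lambda>z. c / 2) = cmod c / 2 * N (\<lambda>z. 1)" using norm_const[of "c / 2"] by (simp add: norm_divide)
    also have "\<dots> \<le> C * N f * N (\<lambda>z. 1)"
    proof (rule mult_right_mono)
      have "cmod c \<le> C * N f" using norm_fourier_coeff_0[of f] L1[OF f] by (simp add: c_def)
      then show "cmod c / 2 \<le> C * N f" using norm_ge_zero[of c] by linarith
    qed (use norm_one_pos in simp)
    finally have NR: "N R \<le> K * N f" using s4 by (simp add: K_def algebra_simps)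
    have Rm: "riesz_projection f \<in> L0" by (rule measurable_riesz_projection[OF fi])
    have "AE z in circle_measure. cmod (riesz_projection f z) \<le> cmod (R z)"
      using Rae by eventually_elim simp
    then have P: "riesz_projection f \<in> X" "N (riesz_projection f) \<le> N R"
      using ideal[OF RX Rm] by auto
    have "fourier_coeff (riesz_projection f) n = 0" if n: "n < 0" for n
    proof -
      define m where "m = nat (- n)"
      have m: "m > 0" using n by (simp add: m_def)
      note im = integrable_mult_power
      have z0: "(\<integral>z. z ^ m \<partial>circle_measure) = 0"
      proof -
        have "(\<integral>z. z ^ m \<partial>circle_measure) = 0 ^ m"
          by (rule mean_value_circle[where S = UNIV]) (auto intro!: holomorphic_intros)
        then show ?thesis using m by (simp only: zero_power)
      qed
      have zm: "integrable circle_measure (\<lambda>z. z ^ m)" by (intro integrable_circle_continuous continuous_intros)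
      have "fourier_coeff (riesz_projection f) n = (\<integral>z. riesz_projection f z * z ^ m \<partial>circle_measure)"
        unfolding m_def by (rule fourier_coeff_neg[OF n])
      also have "\<dots> = (\<integral>z. R z * z ^ m \<partial>circle_measure)"
      proof (rule integral_cong_AE)
        show "AE z in circle_measure. riesz_projection f z * z ^ m = R z * z ^ m"
          using Rae by eventually_elim simp
        show "(\<lambda>z. riesz_projection f z * z ^ m) \<in> L0" by (rule borel_measurable_integrable[OF im[OF int[OF P(1)]]])
        show "(\<lambda>z. R z * z ^ m) \<in> L0" by (rule borel_measurable_integrable[OF im[OF int[OF RX]]])
      qed
      also have "\<dots> = (\<integral>z. (\<Sum>i<4. part_unit i / 2 * (v i z * z ^ m)) + c / 2 * z ^ m \<partial>circle_measure)"
        by (simp add: R_def distrib_right sum_distrib_right mult.assoc)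
      also have "\<dots> = (\<Sum>i<4. part_unit i / 2 * (\<integral>z. v i z * z ^ m \<partial>circle_measure)) + c / 2 * (\<integral>z. z ^ m \<partial>circle_measure)"
      proof -
        have "(\<integral>z. (\<Sum>i<4. part_unit i / 2 * (v i z * z ^ m)) + c / 2 * z ^ m \<partial>circle_measure)
          = (\<integral>z. (\<Sum>i<4. part_unit i / 2 * (v i z * z ^ m)) \<partial>circle_measure) + (\<integral>z. c / 2 * z ^ m \<partial>circle_measure)"
          by (rule Bochner_Integration.integral_add)
             (use zm im[OF int[OF v(1)]] in \<open>auto intro!: Bochner_Integration.integrable_sum\<close>)
        also have "(\<integral>z. (\<Sum>i<4. part_unit i / 2 * (v i z * z ^ m)) \<partial>circle_measure)
          = (\<Sum>i<4. (\<integral>z. part_unit i / 2 * (v i z * z ^ m) \<partial>circle_measure))"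
          by (rule Bochner_Integration.integral_sum) (use im[OF int[OF v(1)]] in auto)
        finally show ?thesis by (simp only: integral_mult_right_zero)
      qed
      also have "\<dots> = 0" using v(3)[OF m] z0 by simp
      finally show ?thesis .
    qed
    then show ?thesis using P NR by (simp add: hardy_def)
  qed
  show ?thesis by (rule that[of K]) (use K int main in auto)
qed

end

section \<open>Toeplitz operators and multipliers\<close>

text \<open>The Fatou property speaks of increasing sequences only. It is applied to the infima of
  the tails of \<open>cmod (u n z)\<close>, which increase to \<open>cmod (g z)\<close> and lie
  below the single functions \<open>cmod (u n z)\<close>.\<close>

lemma fatou_liminf:
  assumes Y: "banach_function_space Y NY" and fatou: "fatou_property Y NY"
    and u: "\<And>n. u n \<in> Y" "\<And>n. NY (u n) \<le> C"
    and lim: "AE z in circle_measure. (\<lambda>n. u n z) \<longlonglongrightarrow> g z" and g: "g \<in> L0"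
  shows "g \<in> Y \<and> NY g \<le> C"
proof -
  interpret Y: banach_function_space Y NY by fact
  note [measurable] = Y.mem_L0[OF u(1)] g
  define F where "F n z = (INF k\<in>{n..}. cmod (u k z))" for n z
  have bdd: "bdd_below ((\<lambda>k. cmod (u k z)) ` A)" for z A by (rule bdd_belowI[of _ 0]) auto
  have Fm [measurable]: "F n \<in> borel_measurable circle_measure" for n
    unfolding F_def by (rule borel_measurable_cINF_real) (auto intro: countable_subset)
  have F0: "0 \<le> F n z" for n z unfolding F_def by (rule cINF_greatest) auto
  have Fle: "F n z \<le> cmod (u n z)" for n z unfolding F_def by (rule cINF_lower[OF bdd]) auto
  have FY: "(\<lambda>z. complex_of_real (F n z)) \<in> Y" "NY (\<lambda>z. complex_of_real (F n z)) \<le> C" for n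
  proof -
    have "AE z in circle_measure. cmod (complex_of_real (F n z)) \<le> cmod (u n z)"
      using F0 Fle by (intro AE_I2) simp
    then have "(\<lambda>z. complex_of_real (F n z)) \<in> Y \<and> NY (\<lambda>z. complex_of_real (F n z)) \<le> NY (u n)"
      by (intro Y.ideal[OF u(1)]) measurable
    then show "(\<lambda>z. complex_of_real (F n z)) \<in> Y" "NY (\<lambda>z. complex_of_real (F n z)) \<le> C"
      using u(2)[of n] by auto
  qed
  define h where "h z = cmod (g z)" for z
  have inc: "nonneg_increasing_to F h"
    unfolding nonneg_increasing_to_def
    using lim
  proof eventually_elim
    case (elim z)
    have c: "(\<lambda>n. cmod (u n z)) \<longlonglongrightarrow> h z" unfolding h_def by (intro tendsto_intros elim)
    have mono: "incseq (\<lambda>n. F n z)"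
      unfolding F_def by (intro incseq_SucI cINF_superset_mono bdd) auto
    have "(\<lambda>n. F n z) \<longlonglongrightarrow> h z"
    proof (rule LIMSEQ_I)
      fix e :: real assume e: "e > 0"
      then have "eventually (\<lambda>n. dist (cmod (u n z)) (h z) < e / 2) sequentially"
        by (intro tendstoD[OF c]) simp
      then obtain M where M: "\<And>n. n \<ge> M \<Longrightarrow> \<bar>cmod (u n z) - h z\<bar> < e / 2"
        by (auto simp: eventually_sequentially dist_real_def)
      have "norm (F n z - h z) < e" if n: "n \<ge> M" for n
      proof -
        have "h z - e / 2 \<le> F n z"
          unfolding F_def
        proof (rule cINF_greatest)
          fix k assume "k \<in> {n..}"
          then have "\<bar>cmod (u k z) - h z\<bar> < e / 2" by (intro M) (use n in auto)
          then show "h z - e / 2 \<le> cmod (u k z)" by linarith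
        qed simp
        moreover have "F n z < h z + e / 2" using Fle[of n z] M[OF n] by linarith
        ultimately show ?thesis using e by (simp add: abs_less_iff)
      qed
      then show "\<exists>no. \<forall>n\<ge>no. norm (F n z - h z) < e" by blast
    qed
    then show ?case using F0 mono by blast
  qed
  have hL: "(\<lambda>z. complex_of_real (h z)) \<in> L0" unfolding h_def by measurable
  have bd: "bdd_above (range (\<lambda>n. NY (\<lambda>z. complex_of_real (F n z))))"
    by (rule bdd_aboveI[of _ C]) (use FY(2) in auto)
  have "(\<lambda>z. complex_of_real (h z)) \<in> Y \<and> NY (\<lambda>z. complex_of_real (h z)) = (SUP n. NY (\<lambda>z. complex_of_real (F n z)))"
    using fatou FY(1) hL inc bd unfolding fatou_property_def by blast
  moreover have "(SUP n. NY (\<lambda>z. complex_of_real (F n z))) \<le> C"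
    by (rule cSUP_least) (use FY(2) in auto)
  ultimately have h: "(\<lambda>z. complex_of_real (h z)) \<in> Y" "NY (\<lambda>z. complex_of_real (h z)) \<le> C" by auto
  have "AE z in circle_measure. cmod (g z) \<le> cmod (complex_of_real (h z))"
    by (intro AE_I2) (simp add: h_def)
  then show ?thesis using Y.ideal[OF h(1) g] h(2) by auto
qed

text \<open>\<open>h\<close> is the boundary function of \<open>exp\<close> of the Herglotz
  transform of \<open>u\<close>. The bound on \<open>u\<close> keeps this holomorphic function below
  \<open>exp B\<close> in the disc, so its vanishing moments pass to the boundary by dominated
  convergence.\<close>

lemma outer_function:
  fixes u :: "complex \<Rightarrow> real"
  assumes u: "u \<in> borel_measurable circle_measure" "\<And>z. \<bar>u z\<bar> \<le> B"
  obtains h where "h \<in> L0" "AE z in circle_measure. cmod (h z) = exp (u z)"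
    "\<And>m. m > 0 \<Longrightarrow> (\<integral>z. h z * z ^ m \<partial>circle_measure) = 0"
proof -
  have iu: "integrable circle_measure u"
    by (rule integrable_circle_bounded[OF u(1)]) (use u(2) in simp)
  define U where "U = (\<lambda>z. complex_of_real (u z))"
  have iU: "integrable circle_measure U" unfolding U_def using iu by simp
  define h where "h z = exp (U z + \<i> * conjugate_function U z)" for z
  have [measurable]: "conjugate_function U \<in> L0" "U \<in> L0"
    by (rule measurable_conjugate_function[OF iU], rule borel_measurable_integrable[OF iU])
  have hL [measurable]: "h \<in> L0" unfolding h_def by measurable
  define H where "H n z = exp (herglotz U (of_real (radius_seq n) * z))" for n z
  have r: "0 \<le> radius_seq n" "radius_seq n < 1" for n using radius_seq_bounds[of n] by auto
  have HL [measurable]: "H n \<in> L0" for n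
  proof -
    have [measurable]: "(\<lambda>z. herglotz U (of_real (radius_seq n) * z)) \<in> L0"
      by (rule measurable_herglotz_radius[OF iU r])
    show ?thesis unfolding H_def by measurable
  qed
  have Hlim: "AE z in circle_measure. (\<lambda>n. H n z) \<longlonglongrightarrow> h z"
    using herglotz_radial_limit[OF iU]
  proof eventually_elim
    case (elim z)
    show ?case unfolding H_def h_def
      by (intro tendsto_exp filterlim_compose[OF elim filterlim_radius_seq])
  qed
  have Hb: "cmod (H n z) \<le> exp B" if "cmod z = 1" for n z
  proof -
    have "Re (herglotz U (of_real (radius_seq n) * z)) \<le> B"
      unfolding U_def
      by (rule Re_herglotz_bounds(2)[OF iu cmod_radius_less[OF that r], of "- B"]) (use u(2) in \<open>auto simp: abs_le_iff minus_le_iff\<close>)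
    then show ?thesis by (simp add: H_def)
  qed
  have mod: "AE z in circle_measure. cmod (h z) = exp (u z)"
    using herglotz_radial_limit[OF iU] herglotz_radial_limit_real[OF iu]
  proof eventually_elim
    case (elim z)
    then obtain L where L: "((\<lambda>r. herglotz U (of_real r * z)) \<longlongrightarrow> L) (at_left 1)" "Re L = u z"
      unfolding U_def by blast
    then have "U z + \<i> * conjugate_function U z = L"
      using tendsto_unique[OF trivial_limit_at_left_real elim(1)] by blast
    then show ?case using L(2) by (simp add: h_def)
  qed
  have "(\<integral>z. h z * z ^ m \<partial>circle_measure) = 0" if m: "m > 0" for m
  proof -
    have zm [measurable]: "(\<lambda>w. w ^ m) \<in> L0" by (intro continuous_imp_measurable_circle continuous_intros)
    have "(\<lambda>n. \<integral>z. H n z * z ^ m \<partial>circle_measure) \<longlonglongrightarrow> (\<integral>z. h z * z ^ m \<partial>circle_measure)"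
    proof (rule integral_dominated_convergence[where w = "\<lambda>_. exp B"])
      show "AE z in circle_measure. (\<lambda>n. H n z * z ^ m) \<longlonglongrightarrow> h z * z ^ m"
        using Hlim by eventually_elim (intro tendsto_intros)
      show "AE z in circle_measure. norm (H n z * z ^ m) \<le> exp B" for n
        by (rule AE_I2) (use Hb in \<open>simp add: norm_mult norm_power\<close>)
    qed (use zm in \<open>auto intro!: borel_measurable_times\<close>)
    moreover have "(\<integral>z. H n z * z ^ m \<partial>circle_measure) = 0" for n
      unfolding H_def
      by (rule integral_moment_zero[where F = "\<lambda>\<zeta>. exp (herglotz U \<zeta>)", OF _ m radius_seq_bounds])
         (intro holomorphic_intros herglotz_holomorphic[OF iU])
    ultimately show ?thesis using LIMSEQ_unique[of "\<lambda>n. 0"] by auto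
  qed
  then show ?thesis by (rule that[OF hL mod])
qed

section \<open>The Koethe dual and multiplier norms\<close>

text \<open>Constants belong to \<open>X\<close>, so the defining supremum of the dual can be tested
  at the constant \<open>1 / NX (\<lambda>z. 1)\<close>.\<close>

lemma kothe_dual_integrable:
  assumes X: "banach_function_space X NX" and a: "a \<in> kothe_dual X NX"
  shows "integrable circle_measure a"
proof -
  interpret X: banach_function_space X NX by fact
  define c where "c = complex_of_real (1 / NX (\<lambda>z. 1))"
  have N1: "NX (\<lambda>z. 1) > 0" by (rule X.norm_one_pos)
  have aL: "a \<in> L0" using a by (simp add: kothe_dual_def)
  have "NX (\<lambda>z. c) \<le> 1" using X.norm_const[of c] N1 by (simp add: c_def norm_divide)
  then have "(\<integral>\<^sup>+ z. ennreal (cmod (c * a z)) \<partial>circle_measure) \<le>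
      (SUP f\<in>{f \<in> X. NX f \<le> 1}. \<integral>\<^sup>+ z. ennreal (cmod (f z * a z)) \<partial>circle_measure)"
    using X.const_mem[of c] by (intro SUP_upper2[of "\<lambda>z. c"]) auto
  also have "\<dots> < \<infinity>" using a by (simp add: kothe_dual_def)
  finally have i: "integrable circle_measure (\<lambda>z. c * a z)"
    using aL by (simp add: integrable_iff_bounded)
  have c0: "c \<noteq> 0" using N1 by (simp add: c_def)
  have "integrable circle_measure (\<lambda>z. (1 / c) * (c * a z))"
    by (rule Bochner_Integration.integrable_mult_right[OF i])
  also have "(\<lambda>z. (1 / c) * (c * a z)) = a" using c0 by (simp add: fun_eq_iff)
  finally show ?thesis .
qed

lemma multiplier_norm_eq_op_norm:
  assumes "a \<in> multipliers X Y"
  shows "multiplier_norm X NX NY a = op_norm X NX Y NY (\<lambda>f z. a z * f z)"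
  unfolding multiplier_norm_def op_norm_def
  by (rule SUP_cong) (use assms in \<open>auto simp: multipliers_def\<close>)

text \<open>If the multiplier were unbounded on the unit ball, a series of unit vectors with weights
  \<open>2\<^sup>-\<^sup>k\<close> would be mapped outside \<open>Y\<close>.\<close>
lemma multiplier_norm_finite:
  assumes X: "banach_function_space X NX" and Y: "banach_function_space Y NY"
    and a: "a \<in> multipliers X Y"
  shows "multiplier_norm X NX NY a < \<infinity>"
proof (rule ccontr)
  interpret X: banach_function_space X NX by fact
  interpret Y: banach_function_space Y NY by fact
  have aL [measurable]: "a \<in> L0" and aY: "\<And>g. g \<in> X \<Longrightarrow> (\<lambda>z. a z * g z) \<in> Y"
    using a by (auto simp: multipliers_def)
  assume "\<not> ?thesis"
  then have top: "multiplier_norm X NX NY a = \<infinity>" by (simp add: not_less top_unique)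
  \<comment> \<open>The weight \<open>(1/2)^n\<close> that makes the series converge still leaves a
    norm above \<open>2^n\<close>.\<close>
  have "\<exists>g. g \<in> X \<and> NX g \<le> 1 \<and> 4 ^ n < NY (\<lambda>z. a z * g z)" for n :: nat
  proof -
    have "ennreal (4 ^ n) < multiplier_norm X NX NY a" unfolding top by simp
    then obtain g where g: "g \<in> X" "NX g \<le> 1" "ennreal (4 ^ n) < ennreal (NY (\<lambda>z. a z * g z))"
      unfolding multiplier_norm_def less_SUP_iff by blast
    then have "4 ^ n < NY (\<lambda>z. a z * g z)" by (simp add: ennreal_less_iff)
    then show ?thesis using g by blast
  qed
  then obtain g where g: "\<And>n. g n \<in> X" "\<And>n. NX (g n) \<le> 1" "\<And>n::nat. 4 ^ n < NY (\<lambda>z. a z * g n z)"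
    by metis
  have gL [measurable]: "g n \<in> L0" for n using X.mem_L0[OF g(1)] .
  define b where "b k z = (1/2)^k * cmod (g k z)" for k z
  have b0: "0 \<le> b k z" for k z by (simp add: b_def)
  have [measurable]: "b k \<in> borel_measurable circle_measure" for k unfolding b_def by measurable
  have bX: "(\<lambda>z. complex_of_real (b k z)) \<in> X" and bN: "NX (\<lambda>z. complex_of_real (b k z)) \<le> (1/2)^k" for k
  proof -
    have s: "(\<lambda>z. complex_of_real ((1/2)^k) * g k z) \<in> X" by (rule X.scale_closed[OF g(1)])
    have m: "(\<lambda>z. complex_of_real (b k z)) \<in> L0" by measurable
    have "AE z in circle_measure. cmod (complex_of_real (b k z)) \<le> cmod (complex_of_real ((1/2)^k) * g k z)"
      by (rule AE_I2) (simp add: b_def norm_mult norm_power norm_divide)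
    then have 1: "(\<lambda>z. complex_of_real (b k z)) \<in> X"
      "NX (\<lambda>z. complex_of_real (b k z)) \<le> NX (\<lambda>z. complex_of_real ((1/2)^k) * g k z)"
      using X.ideal[OF s m] by auto
    then show "(\<lambda>z. complex_of_real (b k z)) \<in> X" by blast
    have "NX (\<lambda>z. complex_of_real ((1/2)^k) * g k z) = (1/2)^k * NX (g k)"
      using X.norm_scale[OF g(1), of "complex_of_real ((1/2)^k)" k] by (simp add: norm_power norm_divide)
    also have "\<dots> \<le> (1/2)^k * 1" by (intro mult_left_mono g(2)) simp
    finally show "NX (\<lambda>z. complex_of_real (b k z)) \<le> (1/2)^k" using 1(2) by simp
  qed
  define F where "F n z = (\<Sum>k<n. complex_of_real (b k z))" for n z
  have FX: "F n \<in> X" for n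
    unfolding F_def by (rule conjunct1[OF X.sum_mem]) (use bX in auto)
  have diffle: "NX (\<lambda>z. F i z - F j z) \<le> 2 * (1/2)^j" if "j \<le> i" for i j
  proof -
    have eq: "(\<lambda>z. F i z - F j z) = (\<lambda>z. \<Sum>k\<in>{j..<i}. complex_of_real (b k z))"
      unfolding F_def fun_eq_iff using that
      by (metis add_diff_cancel_left' atLeast0LessThan bot_nat_0.extremum sum.atLeastLessThan_concat)
    have "NX (\<lambda>z. F i z - F j z) \<le> (\<Sum>k\<in>{j..<i}. NX (\<lambda>z. complex_of_real (b k z)))"
      unfolding eq by (rule conjunct2[OF X.sum_mem]) (use bX in auto)
    also have "\<dots> \<le> (\<Sum>k\<in>{j..<i}. (1/2)^k)" by (rule sum_mono) (rule bN)
    also have "\<dots> = 2 * (1/2)^j - 2 * (1/2)^i"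
      using that by (induction i rule: dec_induct) auto
    also have "\<dots> \<le> 2 * (1/2)^j" by simp
    finally show ?thesis .
  qed
  have sym: "NX (\<lambda>z. F i z - F j z) = NX (\<lambda>z. F j z - F i z)" for i j
  proof -
    have d: "(\<lambda>z. F j z - F i z) \<in> X"
      using X.add_closed[OF FX X.scale_closed[OF FX, of "-1"], of j i] by simp
    show ?thesis using X.norm_scale[OF d, of "-1"] by simp
  qed
  \<comment> \<open>The completeness axiom only concerns real-valued sequences.\<close>
  have F_real: "F n z = complex_of_real (\<Sum>k<n. b k z)" for n z by (simp add: F_def)
  have "\<exists>f\<in>X. (\<lambda>n. NX (\<lambda>z. F n z - f z)) \<longlonglongrightarrow> 0"
    unfolding F_real
  proof (rule X.complete, unfold F_real[symmetric])
    show "(\<lambda>z. F n z) \<in> X" for n by (rule FX)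
    fix e :: real assume e: "e > 0"
    obtain M where M: "(1/2)^M < e / 2" using real_arch_pow_inv[of "e/2" "1/2"] e by auto
    have "NX (\<lambda>z. F i z - F j z) < e" if "i \<ge> M" "j \<ge> M" for i j
    proof -
      have main: "NX (\<lambda>z. F i z - F j z) < e" if "j \<le> i" "j \<ge> M" for i j
      proof -
        have "(1/2::real)^j \<le> (1/2)^M" using that by (intro power_decreasing) auto
        then show ?thesis using diffle[OF that(1)] M by linarith
      qed
      then show ?thesis using sym that by (metis nle_le)
    qed
    then show "\<exists>M. \<forall>i\<ge>M. \<forall>j\<ge>M. NX (\<lambda>z. F i z - F j z) < e" by blast
  qed
  then obtain f where f: "f \<in> X" "(\<lambda>n. NX (\<lambda>z. F n z - f z)) \<longlonglongrightarrow> 0" by blast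
  have fL [measurable]: "f \<in> L0" using X.mem_L0[OF f(1)] .
  \<comment> \<open>Norm convergence alone yields this: for \<open>n > k\<close> the positive part
    of \<open>b k - |f|\<close> is at most \<open>|F n - f|\<close>, so its norm is
    \<open>0\<close>.\<close>
  have dom: "AE z in circle_measure. b k z \<le> cmod (f z)" for k
  proof -
    define v where "v z = max 0 (b k z - cmod (f z))" for z
    have [measurable]: "v \<in> borel_measurable circle_measure" unfolding v_def by measurable
    have vL: "(\<lambda>z. complex_of_real (v z)) \<in> L0" by measurable
    have vle: "cmod (complex_of_real (v z)) \<le> cmod (F n z - f z)" if n: "n > k" for n z
    proof -
      have "b k z \<le> (\<Sum>j<n. b j z)" using n b0 by (intro member_le_sum) auto
      also have "\<dots> = cmod (F n z)"
        unfolding F_real norm_of_real by (rule abs_of_nonneg[symmetric], rule sum_nonneg, rule b0)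
      also have "\<dots> \<le> cmod (F n z - f z) + cmod (f z)" using norm_triangle_ineq[of "F n z - f z" "f z"] by simp
      finally show ?thesis by (simp add: v_def)
    qed
    have dX: "(\<lambda>z. F n z - f z) \<in> X" for n
      using X.add_closed[OF FX X.scale_closed[OF f(1), of "-1"], of n] by simp
    have v: "(\<lambda>z. complex_of_real (v z)) \<in> X" "NX (\<lambda>z. complex_of_real (v z)) \<le> NX (\<lambda>z. F n z - f z)" if "n > k" for n
      using X.ideal[OF dX[of n] vL] vle[OF that] by auto
    have "NX (\<lambda>z. complex_of_real (v z)) \<le> 0"
      by (rule LIMSEQ_le_const[OF f(2)]) (use v(2) in \<open>auto intro!: exI[of _ "Suc k"]\<close>)
    then have "NX (\<lambda>z. complex_of_real (v z)) = 0" using X.norm_nonneg[OF v(1)[of "Suc k"]] by simp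
    then have "AE z in circle_measure. complex_of_real (v z) = 0"
      using X.norm_eq_0_iff[OF v(1)[of "Suc k"]] by simp
    then show ?thesis by eventually_elim (simp add: v_def max_def split: if_splits)
  qed
  define y where "y = NY (\<lambda>z. a z * f z)"
  have "2 ^ k < y" for k :: nat
  proof -
    have ae: "AE z in circle_measure. cmod (a z * g k z) \<le> cmod (complex_of_real (2^k) * (a z * f z))"
      using dom[of k]
    proof eventually_elim
      case (elim z)
      have "cmod (g k z) \<le> 2^k * cmod (f z)" using elim by (simp add: b_def power_divide field_simps)
      then have "cmod (a z) * cmod (g k z) \<le> cmod (a z) * (2^k * cmod (f z))" by (intro mult_left_mono) auto
      then show ?case by (simp add: norm_mult norm_power mult_ac)
    qed
    have "NY (\<lambda>z. a z * g k z) \<le> NY (\<lambda>z. complex_of_real (2^k) * (a z * f z))"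
      by (rule Y.ideal_norm[OF Y.scale_closed[OF aY[OF f(1)]] _ ae]) measurable
    also have "\<dots> = 2^k * y" unfolding y_def using Y.norm_scale[OF aY[OF f(1)], of "complex_of_real (2^k)"] by (simp add: norm_power)
    finally have "4 ^ k < 2^k * y" using g(3)[of k] by linarith
    moreover have "(4::real)^k = 2^k * 2^k" by (simp add: power_mult_distrib[symmetric])
    ultimately show ?thesis by simp
  qed
  moreover obtain n where "y < 2^n" using real_arch_pow[of 2 y] by auto
  ultimately show False by (metis less_asym)
qed

text \<open>The lower estimate, first for outer functions, whose products with \<open>\<chi>\<^sub>n\<close> are again analytic
  and have the same norm.\<close>
lemma multiplier_bound_of_toeplitz_bound:
  assumes X: "banach_function_space X NX" and Y: "banach_function_space Y NY" and fatou: "fatou_property Y NY"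
    and a: "integrable circle_measure a"
    and T: "\<And>f. f \<in> hardy X \<Longrightarrow> toeplitz a f \<in> Y" "\<And>f. f \<in> hardy X \<Longrightarrow> NY (toeplitz a f) \<le> C * NX f"
    and C: "C \<ge> 0" and f: "f \<in> X"
  shows "(\<lambda>z. a z * f z) \<in> Y \<and> NY (\<lambda>z. a z * f z) \<le> C * NX f"
proof -
  interpret X: banach_function_space X NX by fact
  interpret Y: banach_function_space Y NY by fact
  have aL [measurable]: "a \<in> L0" by (rule borel_measurable_integrable[OF a])
  have fL [measurable]: "f \<in> L0" using X.mem_L0[OF f] .
  have zL [measurable]: "(\<lambda>w. w ^ m) \<in> L0" "(\<lambda>w. cnj w ^ m) \<in> L0" for m
    by (intro continuous_imp_measurable_circle continuous_intros)+
  have outer: "(\<lambda>z. a z * h z) \<in> Y \<and> NY (\<lambda>z. a z * h z) \<le> C * NX h"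
    if h: "h \<in> L0" "AE z in circle_measure. cmod (h z) \<le> B"
      "\<And>m. m > 0 \<Longrightarrow> (\<integral>z. h z * z ^ m \<partial>circle_measure) = 0" for h B
  proof -
    note [measurable] = h(1)
    have hX: "h \<in> X" by (rule X.Linfty_subset[OF h(1,2)])
    have shX: "(\<lambda>z. z ^ n * h z) \<in> hardy X" and shN: "NX (\<lambda>z. z ^ n * h z) \<le> NX h" for n
    proof -
      have m: "(\<lambda>z. z ^ n * h z) \<in> L0" by measurable
      have "AE z in circle_measure. cmod (z ^ n * h z) \<le> cmod (h z)"
        by (rule AE_I2) (simp add: norm_mult norm_power)
      then have 1: "(\<lambda>z. z ^ n * h z) \<in> X" "NX (\<lambda>z. z ^ n * h z) \<le> NX h"
        using X.ideal[OF hX m] by auto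
      then show "NX (\<lambda>z. z ^ n * h z) \<le> NX h" by blast
      have "fourier_coeff (\<lambda>z. z ^ n * h z) k = 0" if k: "k < 0" for k
      proof -
        \<comment> \<open>Multiplication by \<open>z ^ n\<close> only raises the exponent of the
          moment, which therefore stays positive.\<close>
        have "fourier_coeff (\<lambda>z. z ^ n * h z) k = (\<integral>z. h z * z ^ (n + nat (- k)) \<partial>circle_measure)"
          unfolding fourier_coeff_neg[OF k] by (simp add: power_add mult_ac)
        also have "\<dots> = 0" by (rule h(3)) (use k in simp)
        finally show ?thesis .
      qed
      then show "(\<lambda>z. z ^ n * h z) \<in> hardy X" using 1 by (simp add: hardy_def)
    qed
    have iah: "integrable circle_measure (\<lambda>z. a z * h z)"
    proof (rule Bochner_Integration.integrable_bound)
      show "integrable circle_measure (\<lambda>z. of_real B * a z)" using a by simp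
      show "AE z in circle_measure. norm (a z * h z) \<le> norm (of_real B * a z)"
        using h(2)
      proof eventually_elim
        case (elim z)
        then have "cmod (h z) \<le> \<bar>B\<bar>" by linarith
        then have "cmod (a z) * cmod (h z) \<le> cmod (a z) * \<bar>B\<bar>" by (intro mult_left_mono) auto
        then show ?case by (simp add: norm_mult mult.commute)
      qed
    qed measurable
    obtain s :: "nat \<Rightarrow> nat" where s: "AE z in circle_measure. (\<lambda>n. cnj z ^ s n * riesz_projection (\<lambda>w. w ^ s n * (a w * h w)) z) \<longlonglongrightarrow> a z * h z"
      using shifted_riesz_subsequence[OF iah] by blast
    define u where "u n z = cnj z ^ s n * toeplitz a (\<lambda>w. w ^ s n * h w) z" for n z
    have teq: "toeplitz a (\<lambda>w. w ^ n * h w) = riesz_projection (\<lambda>w. w ^ n * (a w * h w))" for n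
      unfolding toeplitz_def by (simp add: mult_ac)
    have uY: "u n \<in> Y \<and> NY (u n) \<le> C * NX h" for n
    proof -
      have t: "toeplitz a (\<lambda>w. w ^ s n * h w) \<in> Y" by (rule T(1)[OF shX])
      have [measurable]: "toeplitz a (\<lambda>w. w ^ s n * h w) \<in> L0" by (rule Y.mem_L0[OF t])
      have m: "u n \<in> L0" unfolding u_def by measurable
      have "AE z in circle_measure. cmod (u n z) \<le> cmod (toeplitz a (\<lambda>w. w ^ s n * h w) z)"
        by (rule AE_I2) (simp add: u_def norm_mult norm_power)
      then have "u n \<in> Y \<and> NY (u n) \<le> NY (toeplitz a (\<lambda>w. w ^ s n * h w))"
        by (rule Y.ideal[OF t m])
      moreover have "NY (toeplitz a (\<lambda>w. w ^ s n * h w)) \<le> C * NX (\<lambda>w. w ^ s n * h w)" by (rule T(2)[OF shX])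
      moreover have "C * NX (\<lambda>w. w ^ s n * h w) \<le> C * NX h" by (rule mult_left_mono[OF shN C])
      ultimately show ?thesis by linarith
    qed
    show ?thesis
    proof (rule fatou_liminf[OF Y fatou])
      show "u n \<in> Y" "NY (u n) \<le> C * NX h" for n using uY by auto
      show "AE z in circle_measure. (\<lambda>n. u n z) \<longlonglongrightarrow> a z * h z"
        using s by (simp add: u_def teq)
    qed measurable
  qed
  define g where "g k z = min (cmod (f z)) (real k)" for k z
  have [measurable]: "g k \<in> borel_measurable circle_measure" for k unfolding g_def by measurable
  have gX: "(\<lambda>z. complex_of_real (g k z)) \<in> X" "NX (\<lambda>z. complex_of_real (g k z)) \<le> NX f" for k
  proof -
    have m: "(\<lambda>z. complex_of_real (g k z)) \<in> L0" by measurable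
    have "AE z in circle_measure. cmod (complex_of_real (g k z)) \<le> cmod (f z)"
      by (rule AE_I2) (simp add: g_def)
    then show "(\<lambda>z. complex_of_real (g k z)) \<in> X" "NX (\<lambda>z. complex_of_real (g k z)) \<le> NX f"
      using X.ideal[OF f m] by auto
  qed
  have trunc: "(\<lambda>z. a z * complex_of_real (g k z)) \<in> Y \<and> NY (\<lambda>z. a z * complex_of_real (g k z)) \<le> C * (NX f + e * NX (\<lambda>z. 1))"
    if e: "e > 0" for k e
  proof -
    \<comment> \<open>Lying between \<open>e\<close> and \<open>max (real k) e\<close>,
      \<open>v\<close> has a bounded logarithm, as \<open>outer_function\<close> requires. The price
      is at most the norm of the constant \<open>e\<close>, which disappears when \<open>e\<close>
      tends to \<open>0\<close>.\<close>
    define v where "v z = max (g k z) e" for z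
    have v: "e \<le> v z" "v z \<le> max (real k) e" "g k z \<le> v z" "v z \<le> g k z + e" for z
      using e by (auto simp: v_def g_def)
    have v0: "v z > 0" for z using v(1)[of z] e by linarith
    have [measurable]: "v \<in> borel_measurable circle_measure" unfolding v_def by measurable
    define B where "B = max \<bar>ln e\<bar> \<bar>ln (max (real k) e)\<bar>"
    have lnB: "\<bar>ln (v z)\<bar> \<le> B" for z
    proof -
      have "ln e \<le> ln (v z)" "ln (v z) \<le> ln (max (real k) e)" using v[of z] e v0[of z] by (auto simp: ln_le_cancel_iff)
      then show ?thesis by (auto simp: B_def)
    qed
    have lm: "(\<lambda>z. ln (v z)) \<in> borel_measurable circle_measure" by measurable
    obtain h where h: "h \<in> L0" "AE z in circle_measure. cmod (h z) = exp (ln (v z))"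
      "\<And>m. m > 0 \<Longrightarrow> (\<integral>z. h z * z ^ m \<partial>circle_measure) = 0"
      using outer_function[OF lm lnB] by blast
    have hv: "AE z in circle_measure. cmod (h z) = v z" using h(2) by eventually_elim (simp add: v0)
    have hB: "AE z in circle_measure. cmod (h z) \<le> max (real k) e" using hv by eventually_elim (use v(2) in simp)
    have ah: "(\<lambda>z. a z * h z) \<in> Y" "NY (\<lambda>z. a z * h z) \<le> C * NX h" using outer[OF h(1) hB h(3)] by auto
    have sX: "(\<lambda>z. complex_of_real (g k z) + complex_of_real e) \<in> X" by (rule X.add_closed[OF gX(1) X.const_mem])
    have "NX h \<le> NX (\<lambda>z. complex_of_real (g k z) + complex_of_real e)"
    proof (rule X.ideal_norm[OF sX h(1)])
      show "AE z in circle_measure. cmod (h z) \<le> cmod (complex_of_real (g k z) + complex_of_real e)"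
        using hv
      proof eventually_elim
        case (elim z)
        have "0 \<le> g k z" by (simp add: g_def)
        then have "cmod (complex_of_real (g k z) + complex_of_real e) = g k z + e"
          using e by (simp only: of_real_add[symmetric] norm_of_real)
        then show ?case using elim v(4)[of z] by simp
      qed
    qed
    also have "\<dots> \<le> NX (\<lambda>z. complex_of_real (g k z)) + NX (\<lambda>z. complex_of_real e)"
      by (rule X.norm_triangle[OF gX(1) X.const_mem])
    also have "\<dots> \<le> NX f + e * NX (\<lambda>z. 1)"
      using gX(2)[of k] X.norm_const[of "complex_of_real e"] e by simp
    finally have Nh: "C * NX h \<le> C * (NX f + e * NX (\<lambda>z. 1))" using C by (intro mult_left_mono)
    have m: "(\<lambda>z. a z * complex_of_real (g k z)) \<in> L0" by measurable
    have "AE z in circle_measure. cmod (a z * complex_of_real (g k z)) \<le> cmod (a z * h z)"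
      using hv
    proof eventually_elim
      case (elim z)
      have "\<bar>g k z\<bar> \<le> cmod (h z)" using elim v(3)[of z] by (simp add: g_def)
      then show ?case by (simp add: norm_mult mult_left_mono)
    qed
    then show ?thesis using Y.ideal[OF ah(1) m] ah(2) Nh by auto
  qed
  show ?thesis
  proof (rule fatou_liminf[OF Y fatou])
    \<comment> \<open>The truncations forget the argument of \<open>f\<close>; the factor
      \<open>sgn (f z)\<close>, of modulus at most \<open>1\<close>, restores pointwise convergence
      to \<open>a z * f z\<close> without increasing the norm.\<close>
    show "(\<lambda>z. a z * complex_of_real (g k z) * sgn (f z)) \<in> Y"
      "NY (\<lambda>z. a z * complex_of_real (g k z) * sgn (f z)) \<le> C * NX f" for k
    proof -
      have t: "(\<lambda>z. a z * complex_of_real (g k z)) \<in> Y" using trunc[of 1 k] by simp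
      have le: "NY (\<lambda>z. a z * complex_of_real (g k z)) \<le> C * NX f"
      proof (rule field_le_epsilon)
        fix e :: real assume e: "e > 0"
        \<comment> \<open>The summand \<open>1\<close> keeps the denominator positive when
          \<open>C = 0\<close>.\<close>
        define d where "d = e / (C * NX (\<lambda>z. 1) + 1)"
        have p: "0 < C * NX (\<lambda>z. 1) + 1" using C X.norm_one_pos by (simp add: add_nonneg_pos)
        have d: "d > 0" using e p by (simp add: d_def)
        have "C * NX (\<lambda>z. 1) * d \<le> (C * NX (\<lambda>z. 1) + 1) * d" using d by (intro mult_right_mono) auto
        also have "\<dots> = e" using p by (simp add: d_def)
        finally show "NY (\<lambda>z. a z * complex_of_real (g k z)) \<le> C * NX f + e"
          using trunc[OF d, of k] by (simp add: algebra_simps)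
      qed
      have [measurable]: "(\<lambda>z. sgn (f z)) \<in> L0" by measurable
      have m: "(\<lambda>z. a z * complex_of_real (g k z) * sgn (f z)) \<in> L0" by measurable
      have "AE z in circle_measure. cmod (a z * complex_of_real (g k z) * sgn (f z)) \<le> cmod (a z * complex_of_real (g k z))"
        by (rule AE_I2) (simp add: norm_mult norm_sgn)
      then show "(\<lambda>z. a z * complex_of_real (g k z) * sgn (f z)) \<in> Y"
        "NY (\<lambda>z. a z * complex_of_real (g k z) * sgn (f z)) \<le> C * NX f"
        using Y.ideal[OF t m] le by auto
    qed
    show "AE z in circle_measure. (\<lambda>k. a z * complex_of_real (g k z) * sgn (f z)) \<longlonglongrightarrow> a z * f z"
    proof (rule AE_I2)
      fix z
      obtain M where M: "cmod (f z) < real M" using reals_Archimedean2 by blast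
      have "eventually (\<lambda>k. a z * complex_of_real (g k z) * sgn (f z) = a z * f z) sequentially"
        using eventually_ge_at_top[of M]
      proof eventually_elim
        case (elim k)
        then have "g k z = cmod (f z)" using M by (simp add: g_def)
        then show ?case by (cases "f z = 0") (simp_all add: sgn_eq)
      qed
      then show "(\<lambda>k. a z * complex_of_real (g k z) * sgn (f z)) \<longlonglongrightarrow> a z * f z" by (rule tendsto_eventually)
    qed
  qed measurable
qed

theorem theorem4p3:
  fixes X Y :: "(complex \<Rightarrow> complex) set"
    and NX NY :: "(complex \<Rightarrow> complex) \<Rightarrow> real"
    and a :: "complex \<Rightarrow> complex"
  assumes "ri_space X NX"
    and "ri_space Y NY"
    and "X \<subseteq> Y"
    and "nontrivial_boyd_indices Y NY"
    and "fatou_property Y NY"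
    and "a \<in> kothe_dual X NX"
  shows "(bounded_operator (hardy X) NX (hardy Y) NY (toeplitz a) \<longleftrightarrow> a \<in> multipliers X Y) \<and>
    (a \<in> multipliers X Y \<longrightarrow>
       multiplier_norm X NX NY a \<le> op_norm (hardy X) NX (hardy Y) NY (toeplitz a) \<and>
       op_norm (hardy X) NX (hardy Y) NY (toeplitz a)
         \<le> op_norm Y NY Y NY riesz_projection * multiplier_norm X NX NY a)"
proof -
  interpret X: ri_space X NX by fact
  interpret Y: ri_space Y NY by fact
  note bX = X.banach_function_space_axioms and bY = Y.banach_function_space_axioms
  have aL: "a \<in> L0" using assms(6) by (simp add: kothe_dual_def)
  have ai: "integrable circle_measure a" by (rule kothe_dual_integrable[OF bX assms(6)])
  have hX: "f \<in> X" if "f \<in> hardy X" for f using that by (simp add: hardy_def)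
  have hY: "hardy Y \<subseteq> Y" by (auto simp: hardy_def)
  have converse: "(\<lambda>z. a z * f z) \<in> Y \<and> NY (\<lambda>z. a z * f z) \<le> C * NX f"
    if "\<And>f. f \<in> hardy X \<Longrightarrow> toeplitz a f \<in> Y" "\<And>f. f \<in> hardy X \<Longrightarrow> NY (toeplitz a f) \<le> C * NX f" "C \<ge> 0" "f \<in> X"
    for C f
    by (rule multiplier_bound_of_toeplitz_bound[OF bX bY assms(5) ai that])
  obtain P where P: "0 \<le> P" and Yint: "\<And>f. f \<in> Y \<Longrightarrow> integrable circle_measure f"
    and Ph: "\<And>f. f \<in> Y \<Longrightarrow> riesz_projection f \<in> hardy Y"
    and Pb: "\<And>f. f \<in> Y \<Longrightarrow> NY (riesz_projection f) \<le> P * NY f"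
    using Y.riesz_projection_bounded[OF assms(4,5)] by blast
  have imp1: "a \<in> multipliers X Y" if b: "bounded_operator (hardy X) NX (hardy Y) NY (toeplitz a)"
  proof -
    obtain C where C: "\<And>f. f \<in> hardy X \<Longrightarrow> toeplitz a f \<in> hardy Y" "\<And>f. f \<in> hardy X \<Longrightarrow> NY (toeplitz a f) \<le> C * NX f"
      using b by (auto simp: bounded_operator_def)
    have "(\<lambda>z. a z * f z) \<in> Y" if f: "f \<in> X" for f
    proof -
      \<comment> \<open>The constant in \<open>bounded_operator\<close> may be negative, whereas
        \<open>converse\<close> asks for a nonnegative one.\<close>
      have "NY (toeplitz a f) \<le> max C 0 * NX f" if "f \<in> hardy X" for f
      proof -
        have "C * NX f \<le> max C 0 * NX f" using X.norm_nonneg[OF hX[OF that]] by (intro mult_right_mono) auto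
        then show ?thesis using C(2)[OF that] by linarith
      qed
      then show ?thesis using converse[of "max C 0" f] C(1) hY f by auto
    qed
    then show ?thesis using aL by (simp add: multipliers_def)
  qed
  have rest: "bounded_operator (hardy X) NX (hardy Y) NY (toeplitz a) \<and>
      multiplier_norm X NX NY a \<le> op_norm (hardy X) NX (hardy Y) NY (toeplitz a) \<and>
      op_norm (hardy X) NX (hardy Y) NY (toeplitz a) \<le> op_norm Y NY Y NY riesz_projection * multiplier_norm X NX NY a"
    if am: "a \<in> multipliers X Y"
  proof -
    have aY: "(\<lambda>z. a z * f z) \<in> Y" if "f \<in> X" for f using am that by (simp add: multipliers_def)
    define K where "K = enn2real (multiplier_norm X NX NY a)"
    have fin: "multiplier_norm X NX NY a < \<infinity>" by (rule multiplier_norm_finite[OF bX bY am])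
    have K0: "0 \<le> K" by (simp add: K_def)
    have Kb: "NY (\<lambda>z. a z * f z) \<le> K * NX f" if f: "f \<in> X" for f
      unfolding K_def multiplier_norm_eq_op_norm[OF am]
    proof (rule op_norm_apply(2)[OF bX bY order_refl order_refl, where T = "\<lambda>f z. a z * f z" and f = f])
      show "(\<lambda>z. complex_of_real c * f z) \<in> X" if "f \<in> X" for f c using that by (rule X.scale_closed)
      show "(\<lambda>z. a z * f z) \<in> L0" if "f \<in> X" for f using Y.mem_L0[OF aY[OF that]] .
      show "op_norm X NX Y NY (\<lambda>f z. a z * f z) < \<infinity>" using fin by (simp only: multiplier_norm_eq_op_norm[OF am])
    qed (use f in \<open>auto simp: mult_ac\<close>)
    have Th: "toeplitz a f \<in> hardy Y" if "f \<in> hardy X" for f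
      unfolding toeplitz_def by (rule Ph[OF aY[OF hX[OF that]]])
    have Tb: "NY (toeplitz a f) \<le> P * K * NX f" if f: "f \<in> hardy X" for f
    proof -
      have "NY (toeplitz a f) \<le> P * NY (\<lambda>z. a z * f z)"
        unfolding toeplitz_def by (rule Pb[OF aY[OF hX[OF f]]])
      also have "\<dots> \<le> P * (K * NX f)" by (rule mult_left_mono[OF Kb[OF hX[OF f]] P])
      finally show ?thesis by (simp add: mult.assoc)
    qed
    have bdd: "bounded_operator (hardy X) NX (hardy Y) NY (toeplitz a)"
      unfolding bounded_operator_def using Th Tb by blast
    define T where "T = op_norm (hardy X) NX (hardy Y) NY (toeplitz a)"
    \<comment> \<open>The crude bound \<open>P * K\<close> serves only to make \<open>T\<close>
      finite; \<open>op_norm_apply\<close> then gives the inequality with the constant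
      \<open>T\<close> itself, and as \<open>converse\<close> loses nothing, the lower estimate has
      the factor \<open>1\<close>.\<close>
    have Tfin: "T < \<infinity>"
    proof -
      have "T \<le> ennreal (P * K)"
        unfolding T_def op_norm_def
      proof (rule SUP_least)
        fix f assume "f \<in> {f \<in> hardy X. NX f \<le> 1}"
        then have f: "f \<in> hardy X" "NX f \<le> 1" by auto
        have "P * K * NX f \<le> P * K * 1" using P K0 f by (intro mult_left_mono) auto
        then have "NY (toeplitz a f) \<le> P * K" using Tb[OF f(1)] by linarith
        then show "(if toeplitz a f \<in> hardy Y then ennreal (NY (toeplitz a f)) else \<infinity>) \<le> ennreal (P * K)"
          using Th[OF f(1)] by (simp add: ennreal_leI)
      qed
      then show ?thesis by (simp add: le_less_trans)
    qed
    have Tsharp: "NY (toeplitz a f) \<le> enn2real T * NX f" if f: "f \<in> hardy X" for f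
      unfolding T_def
    proof (rule op_norm_apply(2)[OF bX bY _ hY, where T = "toeplitz a" and f = f])
      show "hardy X \<subseteq> X" by (auto simp: hardy_def)
      show "(\<lambda>z. complex_of_real c * f z) \<in> hardy X" if f: "f \<in> hardy X" for f c
      proof -
        have "fourier_coeff (\<lambda>z. complex_of_real c * f z) n = complex_of_real c * fourier_coeff f n" for n
          unfolding fourier_coeff_def pairing_def mult.assoc by (rule integral_mult_right_zero)
        then show ?thesis using f X.scale_closed by (simp add: hardy_def)
      qed
      show "AE z in circle_measure. toeplitz a (\<lambda>z. complex_of_real c * f z) z = complex_of_real c * toeplitz a f z"
        if f: "f \<in> hardy X" for f c
      proof -
        have "toeplitz a (\<lambda>z. complex_of_real c * f z) = riesz_projection (\<lambda>z. complex_of_real c * (a z * f z))"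
          unfolding toeplitz_def by (simp add: mult_ac)
        then show ?thesis
          using riesz_projection_cmult[OF Yint[OF aY[OF hX[OF f]]], of "complex_of_real c"] by (simp add: toeplitz_def)
      qed
      show "toeplitz a f \<in> L0" if "f \<in> hardy X" for f using Th[OF that] hY Y.mem_L0 by blast
      show "op_norm (hardy X) NX (hardy Y) NY (toeplitz a) < \<infinity>" using Tfin by (simp only: T_def)
    qed (rule f)
    have lower: "multiplier_norm X NX NY a \<le> T"
      unfolding multiplier_norm_def
    proof (rule SUP_least)
      fix f assume "f \<in> {f \<in> X. NX f \<le> 1}"
      then have f: "f \<in> X" "NX f \<le> 1" by auto
      have "NY (\<lambda>z. a z * f z) \<le> enn2real T * NX f"
        using converse[of "enn2real T" f] Th hY Tsharp f(1) by auto
      also have "\<dots> \<le> enn2real T * 1" using f by (intro mult_left_mono) auto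
      finally have "ennreal (NY (\<lambda>z. a z * f z)) \<le> ennreal (enn2real T)" by (simp add: ennreal_leI)
      also have "ennreal (enn2real T) = T" using Tfin by simp
      finally show "ennreal (NY (\<lambda>z. a z * f z)) \<le> T" .
    qed
    define R where "R = op_norm Y NY Y NY riesz_projection"
    have PY: "riesz_projection f \<in> Y" if "f \<in> Y" for f using Ph[OF that] hY by auto
    have Rfin: "R < \<infinity>"
    proof -
      have "R \<le> ennreal P"
        unfolding R_def op_norm_def
      proof (rule SUP_least)
        fix f assume "f \<in> {f \<in> Y. NY f \<le> 1}"
        then have f: "f \<in> Y" "NY f \<le> 1" by auto
        have "P * NY f \<le> P * 1" using P f by (intro mult_left_mono) auto
        then have "NY (riesz_projection f) \<le> P" using Pb[OF f(1)] by linarith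
        then show "(if riesz_projection f \<in> Y then ennreal (NY (riesz_projection f)) else \<infinity>) \<le> ennreal P"
          using PY[OF f(1)] by (simp add: ennreal_leI)
      qed
      then show ?thesis by (simp add: le_less_trans)
    qed
    have Rb: "NY (riesz_projection f) \<le> enn2real R * NY f" if f: "f \<in> Y" for f
      unfolding R_def
    proof (rule op_norm_apply(2)[OF bY bY order_refl order_refl, where T = riesz_projection and f = f])
      show "(\<lambda>z. complex_of_real c * f z) \<in> Y" if "f \<in> Y" for f c using that by (rule Y.scale_closed)
      show "AE z in circle_measure. riesz_projection (\<lambda>z. complex_of_real c * f z) z = complex_of_real c * riesz_projection f z"
        if "f \<in> Y" for f c by (rule riesz_projection_cmult[OF Yint[OF that]])
      show "riesz_projection f \<in> L0" if "f \<in> Y" for f by (rule Y.mem_L0[OF PY[OF that]])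
      show "op_norm Y NY Y NY riesz_projection < \<infinity>" using Rfin by (simp only: R_def)
    qed (rule f)
    have upper: "T \<le> R * multiplier_norm X NX NY a"
      unfolding T_def op_norm_def[of "hardy X"]
    proof (rule SUP_least)
      fix f assume "f \<in> {f \<in> hardy X. NX f \<le> 1}"
      then have f: "f \<in> hardy X" "NX f \<le> 1" by auto
      have "ennreal (NY (toeplitz a f)) \<le> ennreal (enn2real R * NY (\<lambda>z. a z * f z))"
        unfolding toeplitz_def by (intro ennreal_leI Rb aY hX f)
      also have "\<dots> = R * ennreal (NY (\<lambda>z. a z * f z))"
        using Rfin by (subst ennreal_mult') (auto simp: ennreal_enn2real)
      also have "\<dots> \<le> R * multiplier_norm X NX NY a"
        unfolding multiplier_norm_def using f hX by (intro mult_left_mono SUP_upper) auto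
      finally show "(if toeplitz a f \<in> hardy Y then ennreal (NY (toeplitz a f)) else \<infinity>) \<le> R * multiplier_norm X NX NY a"
        using Th[OF f(1)] by simp
    qed
    show ?thesis using bdd lower upper unfolding T_def R_def by blast
  qed
  show ?thesis using imp1 rest by blast
qed

end
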